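(* Let $d\in\mathbb{N}$, $d\ge 2$, let $\alpha>0$ be a fixed constant, and let $s>\frac d2$. Let $(v_0,\omega_0,b_0)\in(H^s(\mathbb{T}^d))^{d+2}$ be real-valued and such that $\operatorname{div}v_0=0$, $\min_{x\in\mathbb{T}^d}b_0(x)>0$ and $\min_{x\in\mathbb{T}^d}\omega_0(x)>0$. Let $T>0$ and, for $i=1,2$, let $$v^i\in C([0,T),H^s_{\operatorname{div}}(\mathbb{T}^d))\cap L^2(0,T;H^{s+1}_{\operatorname{div}}(\mathbb{T}^d))\cap W^{1,2}(0,T;H^{s-1}_{\operatorname{div}}(\mathbb{T}^d)),$$ $$(\omega^i,b^i)\in\left(C([0,T),H^s(\mathbb{T}^d))\cap L^2(0,T;H^{s+1}(\mathbb{T}^d))\cap W^{1,2}(0,T;H^{s-1}(\mathbb{T}^d))\right)^2$$ be two solutions of Kolmogorov's two-equation system in the weak sense with the same initial data $(v_0,\omega_0,b_0)$ (see context). Then $$v^1=v^2,\qquad \omega^1=\omega^2,\qquad b^1=b^2\qquad\text{for all }(t,x)\in[0,T]\times\mathbb{T}^d$$ (with values at $t=T$ understood through the continuous extension in time).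
   Context: $\mathbb{T}^d=[0,1)^d$ is the $d$-dimensional torus (functions are periodic). For $s\in\mathbb{R}$, $H^s(\mathbb{T}^d)=\{u\in\mathcal{D}'(\mathbb{T}^d):\|u\|_{H^s}^2=\sum_{k\in\mathbb{Z}^d}(1+4\pi^2|k|^2)^s|\hat u(k)|^2<\infty\}$, where $\hat u(k)=\int_{\mathbb{T}^d}u(x)e^{-2\pi i x\cdot k}dx$; $H^s_{\operatorname{div}}(\mathbb{T}^d)=\{u\in[H^s(\mathbb{T}^d)]^d:\operatorname{div}u=0\}$. For $s>d/2$ elements of $H^s(\mathbb{T}^d)$ are continuous. $(\cdot,\cdot)$ denotes the $L^2(\mathbb{T}^d)$ inner product, and $Dv=\frac12(\nabla v+(\nabla v)^T)$ is the symmetric gradient. The functions $(v,\omega,b)$ (velocity $v$, which is $\mathbb{R}^d$-valued, and scalar real-valued $\omega,b$) solve Kolmogorov's two-equation system on $(0,T)$ in the weak sense if $\operatorname{div}v=0$ and, for almost all $t\in(0,T)$, $$(\partial_t v,w)+(v\cdot\nabla v,w)+\left(\tfrac b\omega Dv,Dw\right)=0\quad\forall w\in H^1_{\operatorname{div}}(\mathbb{T}^d),$$ $$(\partial_t\omega,z)+(v\cdot\nabla\omega,z)+\left(\tfrac b\omega\nabla\omega,\nabla z\right)=-\alpha(\omega^2,z)\quad\forall z\in H^1(\mathbb{T}^d),$$ $$(\partial_t b,q)+(v\cdot\nabla b,q)+\left(\tfrac b\omega\nabla b,\nabla q\right)=-(b\omega,q)+\left(\tfrac b\omega|Dv|^2,q\right)\quad\forall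 q\in H^1(\mathbb{T}^d),$$ and it has initial data $(v_0,\omega_0,b_0)$ if $v(0,x)=v_0(x)$, $\omega(0,x)=\omega_0(x)$, $b(0,x)=b_0(x)$. *)

theory Defs
  imports "HOL-Analysis.Analysis"
begin

section \<open>Functions on the torus\<close>

text \<open>
  A function on the \<open>d\<close>-dimensional torus is a function on \<open>real^'n\<close> with \<open>d = CARD('n)\<close> that is
  1-periodic in every coordinate; integrals are taken over the fundamental cell.
\<close>

definition torus :: "(real^'n) set" where
  "torus = {x. \<forall>i. 0 \<le> x $ i \<and> x $ i < 1}"

definition periodic :: "(real^'n \<Rightarrow> 'b) \<Rightarrow> bool" where
  "periodic u \<longleftrightarrow> (\<forall>x i. u (x + axis i 1) = u x)"

definition L2_torus :: "(real^'n \<Rightarrow> real) set" where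
  "L2_torus = {u. periodic u \<and> u \<in> borel_measurable (lebesgue_on torus)
                  \<and> integrable (lebesgue_on torus) (\<lambda>x. (u x)\<^sup>2)}"

text \<open>On matrices (\<open>real^'n^'n\<close>) the inner product \<open>\<bullet>\<close> and the norm are the Frobenius ones.\<close>

definition l2_inner :: "(real^'n \<Rightarrow> 'b::real_inner) \<Rightarrow> (real^'n \<Rightarrow> 'b) \<Rightarrow> real" where
  "l2_inner f g = (LINT x|lebesgue_on torus. f x \<bullet> g x)"

definition fourier_coeff :: "(real^'n \<Rightarrow> real) \<Rightarrow> int^'n \<Rightarrow> complex" where
  "fourier_coeff u k = (LINT x|lebesgue_on torus.
     complex_of_real (u x) * exp (- 2 * complex_of_real pi * \<i> * complex_of_real (\<Sum>j\<in>UNIV. x $ j * of_int (k $ j))))"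

subsection \<open>Sobolev spaces\<close>

definition sobolev_term :: "real \<Rightarrow> (real^'n \<Rightarrow> real) \<Rightarrow> int^'n \<Rightarrow> real" where
  "sobolev_term s u k =
     (1 + 4 * pi\<^sup>2 * (\<Sum>j\<in>UNIV. (of_int (k $ j))\<^sup>2)) powr s * (cmod (fourier_coeff u k))\<^sup>2"

definition sobolev_norm :: "real \<Rightarrow> (real^'n \<Rightarrow> real) \<Rightarrow> real" where
  "sobolev_norm s u = sqrt (\<Sum>\<^sub>\<infinity>k. sobolev_term s u k)"

text \<open>
  The real-valued part of \<open>H\<^sup>s\<close>, to be used for \<open>s \<ge> 0\<close> only: then every distribution with finite
  \<open>H\<^sup>s\<close> norm is a square-integrable function. Elements are representatives of classes modulo
  null sets; if \<open>s > d/2\<close> every class contains exactly one continuous function, and the last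
  conjunct selects it, so that pointwise values are meaningful.
\<close>

definition sobolev :: "real \<Rightarrow> (real^'n \<Rightarrow> real) set" where
  "sobolev s = {u. u \<in> L2_torus \<and> sobolev_term s u summable_on UNIV
                   \<and> (s > real CARD('n) / 2 \<longrightarrow> continuous_on UNIV u)}"

definition sobolev_vec :: "real \<Rightarrow> (real^'n \<Rightarrow> real^'n) set" where
  "sobolev_vec s = {v. \<forall>i. (\<lambda>x. v x $ i) \<in> sobolev s}"

definition sobolev_vec_norm :: "real \<Rightarrow> (real^'n \<Rightarrow> real^'n) \<Rightarrow> real" where
  "sobolev_vec_norm s v = sqrt (\<Sum>i\<in>UNIV. (sobolev_norm s (\<lambda>x. v x $ i))\<^sup>2)"

subsection \<open>Weak derivatives in space\<close>

definition classical_partial :: "'n \<Rightarrow> (real^'n \<Rightarrow> real) \<Rightarrow> real^'n \<Rightarrow> real" where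
  "classical_partial i f x = frechet_derivative f (at x) (axis i 1)"

text \<open>Test functions are smooth and periodic: all iterated partial derivatives are differentiable.\<close>

definition test_function :: "(real^'n \<Rightarrow> real) \<Rightarrow> bool" where
  "test_function \<phi> \<longleftrightarrow> periodic \<phi> \<and> (\<forall>is x. fold classical_partial is \<phi> differentiable (at x))"

definition is_weak_partial :: "'n \<Rightarrow> (real^'n \<Rightarrow> real) \<Rightarrow> (real^'n \<Rightarrow> real) \<Rightarrow> bool" where
  "is_weak_partial i u g \<longleftrightarrow> g \<in> L2_torus \<and>
     (\<forall>\<phi>. test_function \<phi> \<longrightarrow> l2_inner u (classical_partial i \<phi>) = - l2_inner g \<phi>)"

text \<open>
  A weak partial derivative is unique up to null sets, hence the choice below does not affect any
  integral. It exists for every \<open>u\<close> in \<open>H\<^sup>1\<close>.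
\<close>

definition weak_partial :: "'n \<Rightarrow> (real^'n \<Rightarrow> real) \<Rightarrow> real^'n \<Rightarrow> real" where
  "weak_partial i u = (SOME g. is_weak_partial i u g)"

definition grad :: "(real^'n \<Rightarrow> real) \<Rightarrow> real^'n \<Rightarrow> real^'n" where
  "grad u x = (\<chi> i. weak_partial i u x)"

definition sym_grad :: "(real^'n \<Rightarrow> real^'n) \<Rightarrow> real^'n \<Rightarrow> real^'n^'n" where
  "sym_grad v x = (\<chi> i j. (weak_partial j (\<lambda>y. v y $ i) x + weak_partial i (\<lambda>y. v y $ j) x) / 2)"

definition convect :: "(real^'n \<Rightarrow> real^'n) \<Rightarrow> (real^'n \<Rightarrow> real) \<Rightarrow> real^'n \<Rightarrow> real" where
  "convect v u x = v x \<bullet> grad u x"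

text \<open>The divergence vanishes in the sense of distributions.\<close>

definition div_free :: "(real^'n \<Rightarrow> real^'n) \<Rightarrow> bool" where
  "div_free v \<longleftrightarrow>
     (\<forall>\<phi>. test_function \<phi> \<longrightarrow> l2_inner v (\<lambda>x. \<chi> i. classical_partial i \<phi> x) = 0)"

definition sobolev_div :: "real \<Rightarrow> (real^'n \<Rightarrow> real^'n) set" where
  "sobolev_div s = {v \<in> sobolev_vec s. div_free v}"

section \<open>Functions of time with values in a function space\<close>

text \<open>
  In this section \<open>X\<close> is a set of functions and \<open>N\<close> a seminorm on it, such as \<open>sobolev s\<close> with
  \<open>sobolev_norm s\<close>, or \<open>sobolev_div s\<close> with \<open>sobolev_vec_norm s\<close>. The time interval is \<open>(0,T)\<close>.
\<close>

definition C_time :: "real set \<Rightarrow> ('a \<Rightarrow> 'b::real_normed_vector) set \<Rightarrow> (('a \<Rightarrow> 'b) \<Rightarrow> real)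
    \<Rightarrow> (real \<Rightarrow> 'a \<Rightarrow> 'b) set" where
  "C_time I X N = {u. (\<forall>t\<in>I. u t \<in> X) \<and>
     (\<forall>t\<in>I. ((\<lambda>r. N (\<lambda>x. u r x - u t x)) \<longlongrightarrow> 0) (at t within I))}"

definition X_simple :: "real \<Rightarrow> ('a \<Rightarrow> 'b::real_normed_vector) set \<Rightarrow> (real \<Rightarrow> 'a \<Rightarrow> 'b) \<Rightarrow> bool" where
  "X_simple T X S \<longleftrightarrow> simple_function (lebesgue_on {0<..<T}) S \<and> (\<forall>t\<in>{0<..<T}. S t \<in> X)"

definition strongly_measurable :: "real \<Rightarrow> ('a \<Rightarrow> 'b::real_normed_vector) set \<Rightarrow> (('a \<Rightarrow> 'b) \<Rightarrow> real)
    \<Rightarrow> (real \<Rightarrow> 'a \<Rightarrow> 'b) \<Rightarrow> bool" where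
  "strongly_measurable T X N u \<longleftrightarrow>
     (AE t in lebesgue_on {0<..<T}. u t \<in> X) \<and>
     (\<exists>S. (\<forall>n. X_simple T X (S n)) \<and>
          (AE t in lebesgue_on {0<..<T}. (\<lambda>n. N (\<lambda>x. u t x - S n t x)) \<longlonglongrightarrow> 0))"

text \<open>The Bochner space \<open>L\<^sup>2(0,T;X)\<close>.\<close>

definition L2_time :: "real \<Rightarrow> ('a \<Rightarrow> 'b::real_normed_vector) set \<Rightarrow> (('a \<Rightarrow> 'b) \<Rightarrow> real)
    \<Rightarrow> (real \<Rightarrow> 'a \<Rightarrow> 'b) set" where
  "L2_time T X N = {u. strongly_measurable T X N u \<and>
     integrable (lebesgue_on {0<..<T}) (\<lambda>t. (N (u t))\<^sup>2)}"

definition simple_integral_time :: "real \<Rightarrow> (real \<Rightarrow> 'a \<Rightarrow> 'b::real_normed_vector) \<Rightarrow> 'a \<Rightarrow> 'b" where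
  "simple_integral_time T S x =
     (\<Sum>y\<in>S ` {0<..<T}. measure lebesgue {t\<in>{0<..<T}. S t = y} *\<^sub>R y x)"

text \<open>\<open>J\<close> is (a representative of) the \<open>X\<close>-valued Bochner integral of \<open>f\<close> over \<open>(0,T)\<close>.\<close>

definition has_time_integral :: "real \<Rightarrow> ('a \<Rightarrow> 'b::real_normed_vector) set \<Rightarrow> (('a \<Rightarrow> 'b) \<Rightarrow> real)
    \<Rightarrow> (real \<Rightarrow> 'a \<Rightarrow> 'b) \<Rightarrow> ('a \<Rightarrow> 'b) \<Rightarrow> bool" where
  "has_time_integral T X N f J \<longleftrightarrow> J \<in> X \<and> strongly_measurable T X N f \<and>
     (\<exists>S. (\<forall>n. X_simple T X (S n)) \<and>
          (\<lambda>n. \<integral>\<^sup>+ t. ennreal (N (\<lambda>x. f t x - S n t x)) \<partial>lebesgue_on {0<..<T}) \<longlonglongrightarrow> 0 \<and>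
          (\<lambda>n. N (\<lambda>x. J x - simple_integral_time T (S n) x)) \<longlonglongrightarrow> 0)"

text \<open>Smooth functions with compact support in \<open>(0,T)\<close>.\<close>

definition time_test_function :: "real \<Rightarrow> (real \<Rightarrow> real) \<Rightarrow> bool" where
  "time_test_function T \<eta> \<longleftrightarrow> (\<forall>n t. (deriv ^^ n) \<eta> differentiable (at t)) \<and>
     (\<exists>a b. 0 < a \<and> b < T \<and> (\<forall>t. t \<notin> {a..b} \<longrightarrow> \<eta> t = 0))"

text \<open>\<open>u\<close> belongs to \<open>W\<^sup>1\<^sup>,\<^sup>2(0,T;X)\<close> and \<open>du\<close> is its weak time derivative.\<close>

definition W12_time :: "real \<Rightarrow> ('a \<Rightarrow> 'b::real_normed_vector) set \<Rightarrow> (('a \<Rightarrow> 'b) \<Rightarrow> real)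
    \<Rightarrow> (real \<Rightarrow> 'a \<Rightarrow> 'b) \<Rightarrow> (real \<Rightarrow> 'a \<Rightarrow> 'b) \<Rightarrow> bool" where
  "W12_time T X N u du \<longleftrightarrow> u \<in> L2_time T X N \<and> du \<in> L2_time T X N \<and>
     (\<forall>\<eta>. time_test_function T \<eta> \<longrightarrow>
        (\<exists>J. has_time_integral T X N (\<lambda>t x. deriv \<eta> t *\<^sub>R u t x) J \<and>
             has_time_integral T X N (\<lambda>t x. \<eta> t *\<^sub>R du t x) (\<lambda>x. - J x)))"

definition continuous_extension :: "real \<Rightarrow> ('a \<Rightarrow> 'b::real_normed_vector) set \<Rightarrow> (('a \<Rightarrow> 'b) \<Rightarrow> real)
    \<Rightarrow> (real \<Rightarrow> 'a \<Rightarrow> 'b) \<Rightarrow> (real \<Rightarrow> 'a \<Rightarrow> 'b) \<Rightarrow> bool" where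
  "continuous_extension T X N u U \<longleftrightarrow> U \<in> C_time {0..T} X N \<and> (\<forall>t\<in>{0..<T}. U t = u t)"

section \<open>Kolmogorov's two-equation system\<close>

text \<open>
  The arguments \<open>dv\<close>, \<open>d\<omega>\<close>, \<open>db\<close> are the time derivatives of \<open>v\<close>, \<open>\<omega>\<close>, \<open>b\<close>; that they really are is
  expressed separately through \<^const>\<open>W12_time\<close>.
\<close>

definition kolmogorov_weak_solution :: "real \<Rightarrow> real
    \<Rightarrow> (real \<Rightarrow> real^'n \<Rightarrow> real^'n) \<Rightarrow> (real \<Rightarrow> real^'n \<Rightarrow> real^'n)
    \<Rightarrow> (real \<Rightarrow> real^'n \<Rightarrow> real) \<Rightarrow> (real \<Rightarrow> real^'n \<Rightarrow> real)
    \<Rightarrow> (real \<Rightarrow> real^'n \<Rightarrow> real) \<Rightarrow> (real \<Rightarrow> real^'n \<Rightarrow> real) \<Rightarrow> bool" where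
  "kolmogorov_weak_solution \<alpha> T v dv \<omega> d\<omega> b db \<longleftrightarrow>
     (\<forall>t\<in>{0<..<T}. div_free (v t)) \<and>
     (AE t in lebesgue_on {0<..<T}.
       (\<forall>w\<in>sobolev_div 1.
          l2_inner (dv t) w
          + l2_inner (\<lambda>x. \<chi> i. convect (v t) (\<lambda>y. v t y $ i) x) w
          + l2_inner (\<lambda>x. (b t x / \<omega> t x) *\<^sub>R sym_grad (v t) x) (sym_grad w) = 0) \<and>
       (\<forall>z\<in>sobolev 1.
          l2_inner (d\<omega> t) z
          + l2_inner (convect (v t) (\<omega> t)) z
          + l2_inner (\<lambda>x. (b t x / \<omega> t x) *\<^sub>R grad (\<omega> t) x) (grad z)
          = - \<alpha> * l2_inner (\<lambda>x. (\<omega> t x)\<^sup>2) z) \<and>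
       (\<forall>q\<in>sobolev 1.
          l2_inner (db t) q
          + l2_inner (convect (v t) (b t)) q
          + l2_inner (\<lambda>x. (b t x / \<omega> t x) *\<^sub>R grad (b t) x) (grad q)
          = - l2_inner (\<lambda>x. b t x * \<omega> t x) q
            + l2_inner (\<lambda>x. b t x / \<omega> t x * (norm (sym_grad (v t) x))\<^sup>2) q))"

end

theory Submission
  imports Defs
begin

text \<open>
  Both solutions have \<open>v, \<omega>, b\<close> in \<open>H\<^sup>s\<^sup>+\<^sup>1\<close> for almost every time, hence by the Sobolev embedding they
  are continuously differentiable in space with gradients bounded by an \<open>L\<^sup>2\<close> function of time.
  Testing the equations for \<open>\<omega>\<close> and \<open>b\<close> with squares of truncations gives a minimum principle, so
  on \<open>[0, t\<^sub>1]\<close> with \<open>t\<^sub>1 < T\<close> the viscosity \<open>b/\<omega>\<close> is bounded above and below.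
  Testing the difference of the two systems with the difference of the solutions, and absorbing the
  gradients of the difference in the dissipation, bounds the growth of the \<open>L\<^sup>2\<close> energy \<open>F\<close> of the
  difference by an integrable multiple of \<open>F\<close>, and Gronwall's lemma gives \<open>F = 0\<close>.
  To avoid differentiating the energy in time, only increments are used: for convex \<open>G\<close>
  one has \<open>G(z(c)) - G(z(a)) \<le> G'(z(c)) (z(c) - z(a))\<close>, and \<open>z(c) - z(a)\<close> is the integral of the weak
  time derivative; summing over finer and finer partitions of the interval gives the energy inequality.
  The limit at time \<open>T\<close> exists because the \<open>H\<^sup>s\<close> energy has uniformly small increments near \<open>T\<close>.
\<close>

section \<open>Integration over the periodic cell\<close>

section \<open>Lebesgue measure on the torus\<close>

text \<open>Two reductions shape the proof. In space, functions in H^(s+1) are C1, so differences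
  and truncations of solutions are classical test functions and each equation becomes one integral
  of continuous functions. As d \<ge> 2 forces s > 1, the time derivative, known only in H^(s-1), is
  still an L^2 function. In time, the paths are seen only through real functionals
  \<open>l2_inner _ w\<close>, and one integrable \<open>h\<close> majorizes the squared H^(s+1)
  norms of the components and the squared H^(s-1) norms of their derivatives. Gradients enter the
  last estimate squared, which is just what \<open>h\<close> integrates. The minimum principle is
  circular by itself: the sign of the diffusion term presupposes b/\<omega> \<ge> 0. A
  first-touching-time argument breaks the circle. Truncations are squared because
  \<open>(max 0 r)^2\<close> is C1 while \<open>max 0 r\<close> is not. Near T, pairing H^(s+1) with
  H^(s-1) bounds the increments of every finite Fourier block of the H^s energy by the integral of
  2h. The bound does not depend on the block, so high frequencies stay small uniformly in time; low
  frequencies are controlled in L^2.\<close>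

lemma AE_lebesgue_on_iff:
  assumes "S \<in> sets lebesgue"
  shows "(AE x in lebesgue_on S. P x) \<longleftrightarrow> (AE x in lebesgue. x \<in> S \<longrightarrow> P x)"
  using assms by (subst AE_restrict_space_iff) auto

lemma AE_lebesgue_onE:
  assumes "AE x in lebesgue_on S. P x" "S \<in> sets lebesgue"
  obtains N where "negligible N" "\<And>x. x \<in> S \<Longrightarrow> x \<notin> N \<Longrightarrow> P x"
proof -
  have "AE x in lebesgue. x \<in> S \<longrightarrow> P x" using assms AE_lebesgue_on_iff by blast
  then obtain N where "{x \<in> space lebesgue. \<not> (x \<in> S \<longrightarrow> P x)} \<subseteq> N" "N \<in> null_sets lebesgue"
    unfolding eventually_ae_filter by auto
  then show ?thesis using that[of N] by (auto simp: negligible_iff_null_sets)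
qed

lemma AE_lebesgue_onI:
  assumes "negligible N" "\<And>x. x \<in> S \<Longrightarrow> x \<notin> N \<Longrightarrow> P x" "S \<in> sets lebesgue"
  shows "AE x in lebesgue_on S. P x"
proof -
  have "AE x in lebesgue. x \<in> S \<longrightarrow> P x"
    using assms by (intro AE_I'[of N]) (auto simp: negligible_iff_null_sets)
  then show ?thesis using assms AE_lebesgue_on_iff by blast
qed

text \<open>Lebesgue measure is complete, so values on a null set do not affect measurability;
  \<open>measurable_on\<close> carries the argument because it is stable under such changes. This
  allows a chosen weak derivative to be exchanged for a classical one under an integral.\<close>

lemma measurable_AE_cong:
  fixes f g :: "'a::euclidean_space \<Rightarrow> 'b::euclidean_space"
  assumes S: "S \<in> sets lebesgue" and f: "f \<in> borel_measurable (lebesgue_on S)"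
    and ae: "AE x in lebesgue_on S. g x = f x"
  shows "g \<in> borel_measurable (lebesgue_on S)"
proof -
  obtain N where N: "negligible N" "\<And>x. x \<in> S \<Longrightarrow> x \<notin> N \<Longrightarrow> g x = f x"
    using AE_lebesgue_onE[OF ae S] by blast
  have "f measurable_on S" using f S measurable_on_iff_borel_measurable by blast
  then have "g measurable_on S" by (rule measurable_on_spike[where S=N]) (use N in auto)
  then show ?thesis using S measurable_on_iff_borel_measurable by blast
qed

lemma integral_AE_cong:
  fixes f g :: "'a::euclidean_space \<Rightarrow> 'b::euclidean_space"
  assumes S: "S \<in> sets lebesgue" and f: "f \<in> borel_measurable (lebesgue_on S)"
    and ae: "AE x in lebesgue_on S. g x = f x"
  shows "integral\<^sup>L (lebesgue_on S) g = integral\<^sup>L (lebesgue_on S) f"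
  using measurable_AE_cong[OF assms] f ae by (intro integral_cong_AE) auto

lemma torus_borel [measurable]: "torus \<in> sets (borel :: (real^'n) measure)"
proof -
  have "torus = (\<Inter>i. {x::real^'n. 0 \<le> x $ i} \<inter> {x. x $ i < 1})" by (auto simp: torus_def)
  also have "\<dots> \<in> sets borel"
    by (intro sets.countable_INT'' sets.Int borel_closed borel_open closed_halfspace_component_ge_cart open_halfspace_component_lt_cart) auto
  finally show ?thesis .
qed

lemma torus_lebesgue [simp, measurable]: "torus \<in> sets lebesgue"
  using torus_borel by auto

lemma torus_subset_cbox: "torus \<subseteq> cbox 0 (1 :: real^'n)"
  by (auto simp: torus_def mem_box_cart less_imp_le)

lemma box_subset_torus: "box 0 (1 :: real^'n) \<subseteq> torus"
  by (auto simp: torus_def mem_box_cart less_imp_le)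

lemma negligible_cbox_minus_torus: "negligible (cbox 0 (1 :: real^'n) - torus)"
  by (rule negligible_subset[OF negligible_frontier_interval[of 0 "1::real^'n"]])
     (use box_subset_torus in auto)

lemma emeasure_torus: "emeasure lebesgue (torus :: (real^'n) set) = 1"
proof -
  have "emeasure lebesgue (torus :: (real^'n) set) = emeasure lebesgue (cbox 0 (1::real^'n))"
  proof (rule emeasure_eq_AE)
    show "AE x in lebesgue. (x \<in> torus) = (x \<in> cbox 0 (1::real^'n))"
      using negligible_cbox_minus_torus torus_subset_cbox
      by (intro AE_I'[of "cbox 0 (1::real^'n) - torus"]) (auto simp: negligible_iff_null_sets)
  qed auto
  also have "\<dots> = 1"
  proof -
    have "0 \<in> cbox 0 (1::real^'n)" by (simp add: mem_box_cart)
    then have "cbox 0 (1::real^'n) \<noteq> {}" by blast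
    then have c: "measure lborel (cbox 0 (1::real^'n)) = 1" by (simp add: content_cbox_cart)
    have "emeasure lborel (cbox 0 (1::real^'n)) = ennreal (measure lborel (cbox 0 (1::real^'n)))"
      by (rule emeasure_eq_ennreal_measure) (use emeasure_lborel_cbox_finite[of 0 "1::real^'n"] in simp)
    then show ?thesis using c by simp
  qed
  finally show ?thesis .
qed

lemma finite_measure_torus: "finite_measure (lebesgue_on (torus :: (real^'n) set))"
  by standard (simp add: emeasure_restrict_space emeasure_torus)

lemma measure_torus: "measure (lebesgue_on torus) (torus :: (real^'n) set) = 1"
  by (simp add: measure_def emeasure_restrict_space emeasure_torus)

lemma integral_const_torus [simp]: "(LINT x|lebesgue_on (torus :: (real^'n) set). (c::real)) = c"
  using measure_torus[where 'n='n] by simp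

lemma continuous_borel_torus:
  "continuous_on UNIV (f :: real^'n \<Rightarrow> 'b::euclidean_space) \<Longrightarrow> f \<in> borel_measurable (lebesgue_on torus)"
  by (intro measurable_restrict_space1 measurable_completion) (auto intro: borel_measurable_continuous_onI)

lemma integrable_bounded_torus:
  fixes f :: "real^'n \<Rightarrow> 'b::euclidean_space"
  assumes "f \<in> borel_measurable (lebesgue_on torus)" "\<And>x. x \<in> torus \<Longrightarrow> norm (f x) \<le> B"
  shows "integrable (lebesgue_on torus) f"
  using assms by (intro finite_measure.integrable_const_bound[OF finite_measure_torus, of _ B]) (auto simp: space_restrict_space)

lemma integrable_continuous_torus:
  fixes f :: "real^'n \<Rightarrow> 'b::euclidean_space"
  assumes "continuous_on UNIV f"
  shows "integrable (lebesgue_on torus) f"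
proof -
  have "compact (f ` cbox 0 1)"
    by (intro compact_continuous_image continuous_on_subset[OF assms]) auto
  then obtain B where "\<And>x. x \<in> cbox 0 1 \<Longrightarrow> norm (f x) \<le> B"
    by (meson bounded_iff compact_imp_bounded imageI)
  then show ?thesis
    using torus_subset_cbox assms by (intro integrable_bounded_torus[of f B] continuous_borel_torus) auto
qed

section \<open>Periodic functions\<close>

lemma periodic_axis_int:
  fixes x :: "real^'n"
  assumes "periodic f"
  shows "f (x + axis i (of_int m)) = f x"
proof (induction m arbitrary: x rule: int_induct[of _ 0])
  case base
  have "axis i (of_int 0 :: real) = (0 :: real^'n)" by (simp add: vec_eq_iff axis_def)
  then show ?case by (metis add.right_neutral)
next
  case (step1 m)
  have "x + axis i (of_int (m + 1)) = (x + axis i (of_int m)) + axis i 1"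
    by (simp add: vec_eq_iff axis_def)
  then show ?case using step1 assms unfolding periodic_def by metis
next
  case (step2 m)
  have "x + axis i (of_int m) = (x + axis i (of_int (m - 1))) + axis i 1"
    by (simp add: vec_eq_iff axis_def)
  then show ?case using step2 assms unfolding periodic_def by metis
qed

lemma periodic_int:
  fixes k :: "int^'n"
  assumes "periodic f"
  shows "f (x + (\<chi> i. of_int (k $ i))) = f x"
proof -
  have *: "f (x + (\<Sum>i\<in>A. axis i (of_int (k $ i)))) = f x" if "finite A" for A
    using that
  proof (induction A)
    case (insert i A)
    have "x + (\<Sum>i\<in>insert i A. axis i (of_int (k $ i))) = (x + (\<Sum>i\<in>A. axis i (of_int (k $ i)))) + axis i (of_int (k $ i))"
      using insert by (simp add: algebra_simps)
    then show ?case using insert periodic_axis_int[OF assms] by metis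
  qed simp
  have "(\<Sum>i\<in>UNIV. axis i (real_of_int (k $ i))) = (\<chi> i. of_int (k $ i))"
    by (simp add: vec_eq_iff axis_def if_distrib cong: if_cong)
  with *[of UNIV] show ?thesis by simp
qed

lemma periodic_torus:
  fixes f :: "real^'n \<Rightarrow> 'b"
  assumes "periodic f"
  obtains y where "y \<in> torus" "f y = f x"
proof
  let ?y = "\<chi> i. frac (x $ i)"
  show "?y \<in> torus" by (auto simp: torus_def frac_lt_1)
  have "?y + (\<chi> i. of_int ((\<chi> i. floor (x $ i)) $ i)) = x" by (simp add: vec_eq_iff frac_def)
  then show "f ?y = f x" using periodic_int[OF assms, of ?y "\<chi> i. floor (x $ i)"] by metis
qed

lemma periodic_bounded:
  fixes f :: "real^'n \<Rightarrow> 'b::real_normed_vector"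
  assumes "periodic f" "continuous_on UNIV f"
  obtains B where "B > 0" "\<And>x. norm (f x) \<le> B"
proof -
  have "compact (f ` cbox 0 1)"
    by (intro compact_continuous_image continuous_on_subset[OF assms(2)]) auto
  then obtain B where B: "\<And>x. x \<in> cbox 0 1 \<Longrightarrow> norm (f x) \<le> B"
    by (meson bounded_iff compact_imp_bounded imageI)
  have "norm (f x) \<le> max 1 B" for x
    using periodic_torus[OF assms(1), of x] B torus_subset_cbox by (metis in_mono max.coboundedI2)
  then show ?thesis using that[of "max 1 B"] by auto
qed

text \<open>Moving to the Borel version of the measure makes translation invariance of
  \<open>lborel\<close> available.\<close>

lemma integral_torus_lborel:
  fixes f :: "real^'n \<Rightarrow> real"
  assumes "continuous_on UNIV f"
  shows "(LINT x|lebesgue_on torus. f x) = (LINT x|lborel. indicator torus x * f x)"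
proof -
  have "(LINT x|lebesgue_on torus. f x) = (LINT x|lebesgue. indicator torus x * f x)"
    by (subst integral_restrict_space) auto
  also have "\<dots> = (LINT x|lborel. indicator torus x * f x)"
    using borel_measurable_continuous_onI[OF assms] by (intro integral_completion borel_measurable_times borel_measurable_indicator)
      (auto simp: torus_borel)
  finally show ?thesis .
qed

lemma integrable_indicator_continuous:
  fixes f :: "real^'n \<Rightarrow> real"
  assumes "continuous_on UNIV f" "A \<in> sets borel" "bounded A"
  shows "integrable lborel (\<lambda>x. indicator A x * f x)"
proof -
  obtain a where a: "A \<subseteq> cbox (-a) a" using bounded_subset_cbox_symmetric[OF assms(3)] by blast
  have "set_integrable lborel (cbox (-a) a) f"
    unfolding set_integrable_def by (intro borel_integrable_compact continuous_on_subset[OF assms(1)]) auto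
  then have "set_integrable lborel A f" by (rule set_integrable_subset) (use assms a in auto)
  then show ?thesis by (simp add: set_integrable_def)
qed

lemma lborel_integral_shift:
  fixes g :: "'a::euclidean_space \<Rightarrow> real"
  assumes "g \<in> borel_measurable borel"
  shows "(LINT x|lborel. g (x + c)) = (LINT x|lborel. g x)"
proof -
  have "(LINT x|lborel. g x) = (LINT x|distr lborel borel ((+) c). g x)"
    by (simp add: lborel_distr_plus)
  also have "\<dots> = (LINT x|lborel. g (c + x))"
    using assms by (subst integral_distr) auto
  finally show ?thesis by (simp add: add.commute)
qed

text \<open>The translated cell leaves the unit cell only in direction \<open>i\<close>. The
  protruding slab \<open>Q\<close>, moved back by one period, fills exactly the gap left behind, and
  periodicity makes that move invisible to \<open>f\<close>.\<close>

lemma integral_torus_shift: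
  fixes f :: "real^'n \<Rightarrow> real"
  assumes per: "periodic f" and cont: "continuous_on UNIV f" and h: "0 \<le> h" "h \<le> 1"
  shows "(LINT x|lebesgue_on torus. f (x + axis i h)) = (LINT x|lebesgue_on torus. f x)"
proof -
  define P where "P = {y. y - axis i h \<in> torus \<and> y $ i < 1}"
  define Q where "Q = {y. y - axis i h \<in> torus \<and> \<not> y $ i < 1}"
  have meas: "(\<lambda>y. y - axis i h) \<in> borel_measurable borel" by simp
  have S: "{y. y - axis i h \<in> torus} \<in> sets borel"
    using measurable_sets[OF meas torus_borel] by (simp add: vimage_def)
  have hs: "{y::real^'n. y $ i < 1} \<in> sets borel" by (intro borel_open open_halfspace_component_lt_cart)
  have PQ: "P \<in> sets borel" "Q \<in> sets borel"
  proof -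
    have "P = {y. y - axis i h \<in> torus} \<inter> {y. y $ i < 1}" "Q = {y. y - axis i h \<in> torus} - {y. y $ i < 1}"
      by (auto simp: P_def Q_def)
    then show "P \<in> sets borel" "Q \<in> sets borel" using S hs by auto
  qed
  have bT: "bounded (torus :: (real^'n) set)" using torus_subset_cbox bounded_cbox bounded_subset by blast
  have bS: "bounded {y. y - axis i h \<in> torus}"
  proof -
    have "{y. y - axis i h \<in> torus} = (\<lambda>y. axis i h + y) ` torus" by (force simp: image_iff)
    then show ?thesis using bounded_translation[OF bT] by simp
  qed
  have bPQ: "bounded P" "bounded Q" by (rule bounded_subset[OF bS], auto simp: P_def Q_def)+
  have bQ1: "bounded {y. y + axis i 1 \<in> Q}"
  proof -
    have "{y. y + axis i 1 \<in> Q} = (\<lambda>y. - axis i 1 + y) ` Q" by (force simp: image_iff)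
    then show ?thesis using bounded_translation[OF bPQ(2), of "- axis i 1"] by simp
  qed
  have Q1: "{y. y + axis i 1 \<in> Q} \<in> sets borel"
  proof -
    have "(\<lambda>y. y + axis i (1::real)) \<in> borel_measurable borel" by simp
    from measurable_sets[OF this PQ(2)] show ?thesis by (simp add: vimage_def)
  qed
  have fm: "f \<in> borel_measurable borel" using cont by (rule borel_measurable_continuous_onI)
  have "(LINT x|lebesgue_on torus. f (x + axis i h)) = (LINT x|lborel. indicator torus x * f (x + axis i h))"
    by (intro integral_torus_lborel continuous_on_compose2[OF cont] continuous_intros) auto
  also have "\<dots> = (LINT x|lborel. indicator {y. y - axis i h \<in> torus} (x + axis i h) * f (x + axis i h))"
    by (simp add: indicator_def)
  also have "\<dots> = (LINT y|lborel. indicator {y. y - axis i h \<in> torus} y * f y)"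
    using S fm by (subst lborel_integral_shift[where g="\<lambda>y. indicator {y. y - axis i h \<in> torus} y * f y"])
      (auto intro!: borel_measurable_times borel_measurable_indicator)
  also have "\<dots> = (LINT y|lborel. indicator P y * f y + indicator Q y * f y)"
    by (intro Bochner_Integration.integral_cong) (auto simp: indicator_def P_def Q_def)
  also have "\<dots> = (LINT y|lborel. indicator P y * f y) + (LINT y|lborel. indicator Q y * f y)"
    by (intro Bochner_Integration.integral_add integrable_indicator_continuous cont PQ bPQ)
  also have "(LINT y|lborel. indicator Q y * f y) = (LINT y|lborel. indicator Q (y + axis i 1) * f (y + axis i 1))"
    using PQ fm by (subst lborel_integral_shift[where g="\<lambda>y. indicator Q y * f y"])
      (auto intro!: borel_measurable_times borel_measurable_indicator)
  also have "\<dots> = (LINT y|lborel. indicator {y. y + axis i 1 \<in> Q} y * f y)"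
    using per by (simp add: periodic_def indicator_def)
  also have "(LINT y|lborel. indicator P y * f y) + \<dots> =
      (LINT y|lborel. indicator P y * f y + indicator {y. y + axis i 1 \<in> Q} y * f y)"
    by (intro Bochner_Integration.integral_add[symmetric] integrable_indicator_continuous cont PQ bPQ Q1 bQ1)
  also have "\<dots> = (LINT y|lborel. indicator torus y * f y)"
  proof (rule Bochner_Integration.integral_cong[OF refl])
    fix y :: "real^'n"
    have t: "y \<in> torus \<longleftrightarrow> (\<forall>j. j \<noteq> i \<longrightarrow> 0 \<le> y $ j \<and> y $ j < 1) \<and> 0 \<le> y $ i \<and> y $ i < 1"
      by (auto simp: torus_def)
    have p: "y \<in> P \<longleftrightarrow> (\<forall>j. j \<noteq> i \<longrightarrow> 0 \<le> y $ j \<and> y $ j < 1) \<and> h \<le> y $ i \<and> y $ i < 1"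
      using h by (auto simp: torus_def P_def axis_def split: if_splits)
    have c: "(y + axis i 1 - axis i h) $ j = (if j = i then y $ i + 1 - h else y $ j)" for j
      by (auto simp: axis_def)
    have c1: "(y + axis i 1) $ i = y $ i + 1" by (simp add: axis_def)
    have "y + axis i 1 \<in> Q \<longleftrightarrow> (\<forall>j. 0 \<le> (if j = i then y $ i + 1 - h else y $ j) \<and>
        (if j = i then y $ i + 1 - h else y $ j) < 1) \<and> \<not> y $ i + 1 < 1"
      unfolding Q_def torus_def mem_Collect_eq c c1 ..
    also have "\<dots> \<longleftrightarrow> (\<forall>j. j \<noteq> i \<longrightarrow> 0 \<le> y $ j \<and> y $ j < 1) \<and> 0 \<le> y $ i \<and> y $ i < h"
    proof -
      have "(\<forall>j. 0 \<le> (if j = i then y $ i + 1 - h else y $ j) \<and> (if j = i then y $ i + 1 - h else y $ j) < 1) \<longleftrightarrow>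
          (\<forall>j. j \<noteq> i \<longrightarrow> 0 \<le> y $ j \<and> y $ j < 1) \<and> 0 \<le> y $ i + 1 - h \<and> y $ i + 1 - h < 1"
        by (smt (verit))
      moreover have "0 \<le> y $ i + 1 - h \<and> y $ i + 1 - h < 1 \<and> \<not> y $ i + 1 < 1 \<longleftrightarrow> 0 \<le> y $ i \<and> y $ i < h" 
        using h by auto
      ultimately show ?thesis by blast
    qed
    finally have q: "y + axis i 1 \<in> Q \<longleftrightarrow> (\<forall>j. j \<noteq> i \<longrightarrow> 0 \<le> y $ j \<and> y $ j < 1) \<and> 0 \<le> y $ i \<and> y $ i < h" .
    show "indicator P y * f y + indicator {y. y + axis i 1 \<in> Q} y * f y = indicator torus y * f y"
      using t p q h by (cases "y $ i < h") (auto simp: indicator_def)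
  qed
  also have "\<dots> = (LINT x|lebesgue_on torus. f x)" using cont by (simp add: integral_torus_lborel)
  finally show ?thesis .
qed

section \<open>Continuously differentiable functions on the torus\<close>

definition C1_torus :: "(real^'n \<Rightarrow> real) set" where
  "C1_torus = {f. periodic f \<and> (\<forall>x. f differentiable (at x)) \<and> (\<forall>i. continuous_on UNIV (classical_partial i f))}"

lemma C1_torusD:
  assumes "f \<in> C1_torus"
  shows "periodic f" "f differentiable (at x)" "continuous_on UNIV (classical_partial i f)" "continuous_on UNIV f"
  using assms by (auto simp: C1_torus_def intro!: differentiable_imp_continuous_on simp: differentiable_on_def)

lemma classical_partial_eqI:
  "(f has_derivative f') (at x) \<Longrightarrow> classical_partial i f x = f' (axis i 1)"
  unfolding classical_partial_def using frechet_derivative_at by metis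

lemma classical_partial_periodic:
  assumes "periodic f"
  shows "periodic (classical_partial i f)"
proof -
  show ?thesis unfolding periodic_def
  proof (intro allI)
    fix x j
    have 1: "f (x + axis j 1) = f x" using assms by (simp add: periodic_def)
    have 2: "f (x + axis j 1 + h) = f (x + h)" for h
      using assms unfolding periodic_def by (metis add.assoc add.commute)
    have "(f has_derivative F) (at (x + axis j 1)) \<longleftrightarrow> (f has_derivative F) (at x)" for F
      unfolding has_derivative_at 1 2 ..
    then show "classical_partial i f (x + axis j 1) = classical_partial i f x"
      by (simp add: classical_partial_def frechet_derivative_def)
  qed
qed

lemma C1_partial_bounded:
  assumes "f \<in> C1_torus"
  obtains B where "B > 0" "\<And>x. \<bar>classical_partial i f x\<bar> \<le> B"
  using periodic_bounded[OF classical_partial_periodic[OF C1_torusD(1)[OF assms]] C1_torusD(3)[OF assms]]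
  by (metis real_norm_def)

lemma has_real_derivative_along_axis:
  fixes x :: "real^'n"
  assumes "f \<in> C1_torus"
  shows "((\<lambda>h. f (x + axis i h)) has_real_derivative classical_partial i f (x + axis i h)) (at h)"
proof -
  define e where "e = (axis i 1 :: real^'n)"
  have ax: "axis i h = h *\<^sub>R e" for h by (simp add: vec_eq_iff axis_def e_def)
  have 1: "((\<lambda>h. x + h *\<^sub>R e) has_derivative (\<lambda>t. t *\<^sub>R e)) (at h)"
    by (auto intro!: derivative_eq_intros)
  have 2: "(f has_derivative frechet_derivative f (at (x + h *\<^sub>R e))) (at (x + h *\<^sub>R e))"
    using C1_torusD(2)[OF assms] frechet_derivative_works by blast
  have "((\<lambda>h. f (x + h *\<^sub>R e)) has_derivative (\<lambda>t. frechet_derivative f (at (x + h *\<^sub>R e)) (t *\<^sub>R e))) (at h)"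
    using diff_chain_at[OF 1 2] by (simp add: o_def)
  moreover have "(\<lambda>t. frechet_derivative f (at (x + h *\<^sub>R e)) (t *\<^sub>R e)) = (\<lambda>t. classical_partial i f (x + h *\<^sub>R e) * t)"
    using linear_scale[OF has_derivative_linear[OF 2]] by (simp add: classical_partial_def e_def mult.commute)
  ultimately show ?thesis unfolding ax has_field_derivative_def by simp
qed

text \<open>Difference quotients integrate to zero by translation invariance; the mean value theorem
  dominates them by the bound of the partial derivative, so the limit may be taken under the
  integral.\<close>

lemma integral_partial_eq_0:
  fixes f :: "real^'n \<Rightarrow> real"
  assumes f: "f \<in> C1_torus"
  shows "(LINT x|lebesgue_on torus. classical_partial i f x) = 0"
proof -
  note cont = C1_torusD(4)[OF f] and per = C1_torusD(1)[OF f]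
  obtain B where B: "B > 0" "\<And>x. \<bar>classical_partial i f x\<bar> \<le> B" using C1_partial_bounded[OF f] by blast
  \<comment> \<open>Positive steps of length at most 1 are the ones covered by
    \<open>integral_torus_shift\<close>.\<close>
  define h where "h n = inverse (real (Suc n))" for n
  have h: "h n > 0" "h n \<le> 1" for n by (auto simp: h_def field_simps)
  have h0: "h \<longlonglongrightarrow> 0" unfolding h_def by (rule LIMSEQ_inverse_real_of_nat)
  let ?q = "\<lambda>n x. (f (x + axis i (h n)) - f x) / h n"
  have shiftc: "continuous_on UNIV (\<lambda>x. f (x + axis i (h n)))" for n
    by (intro continuous_on_compose2[OF cont] continuous_intros) auto
  have "(\<lambda>n. LINT x|lebesgue_on torus. ?q n x) \<longlonglongrightarrow> (LINT x|lebesgue_on torus. classical_partial i f x)"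
  proof (rule integral_dominated_convergence[where w="\<lambda>_. B"])
    show "classical_partial i f \<in> borel_measurable (lebesgue_on torus)"
      by (rule continuous_borel_torus[OF C1_torusD(3)[OF f]])
    show "?q n \<in> borel_measurable (lebesgue_on torus)" for n
      by (rule continuous_borel_torus) (use h[of n] in \<open>intro continuous_intros shiftc cont, auto\<close>)
    show "integrable (lebesgue_on (torus::(real^'n) set)) (\<lambda>_. B)" by (rule integrable_continuous_torus) simp
    show "AE x in lebesgue_on torus. (\<lambda>n. ?q n x) \<longlonglongrightarrow> classical_partial i f x"
    proof (rule AE_I2)
      fix x :: "real^'n"
      have z: "axis i (0::real) = (0 :: real^'n)" by (simp add: vec_eq_iff axis_def)
      have "((\<lambda>k. (f (x + axis i k) - f x) / k) \<longlongrightarrow> classical_partial i f x) (at 0)"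
        using has_real_derivative_along_axis[OF f, of x i 0] by (simp add: has_field_derivative_iff z)
      moreover have "filterlim h (at 0) sequentially"
        using h0 h(1) by (simp add: filterlim_at less_imp_neq[symmetric])
      ultimately show "(\<lambda>n. ?q n x) \<longlonglongrightarrow> classical_partial i f x"
        by (rule filterlim_compose)
    qed
    show "AE x in lebesgue_on torus. norm (?q n x) \<le> B" for n
    proof (rule AE_I2)
      fix x :: "real^'n"
      have z: "axis i (0::real) = (0 :: real^'n)" by (simp add: vec_eq_iff axis_def)
      obtain u where "f (x + axis i (h n)) - f (x + axis i 0) = (h n - 0) * classical_partial i f (x + axis i u)"
        using MVT2[of 0 "h n" "\<lambda>h. f (x + axis i h)" "\<lambda>h. classical_partial i f (x + axis i h)"] h[of n] has_real_derivative_along_axis[OF f, of x i] by blast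
      then show "norm (?q n x) \<le> B" using B(2) h(1)[of n] by (simp add: z)
    qed
  qed
  moreover have "(LINT x|lebesgue_on torus. ?q n x) = 0" for n
  proof -
    have "(LINT x|lebesgue_on torus. ?q n x) = ((LINT x|lebesgue_on torus. f (x + axis i (h n))) - (LINT x|lebesgue_on torus. f x)) / h n"
      using shiftc cont by (simp add: integrable_continuous_torus)
    then show ?thesis using integral_torus_shift[OF per cont, of "h n" i] h[of n] by simp
  qed
  ultimately have "(\<lambda>n. 0 :: real) \<longlonglongrightarrow> (LINT x|lebesgue_on torus. classical_partial i f x)" by (simp only:)
  then show ?thesis using LIMSEQ_unique tendsto_const by blast
qed

section \<open>Fourier series, Sobolev spaces and weak derivatives on the torus\<close>

section \<open>Square-integrable functions on the torus\<close>

abbreviation torus_measure :: "(real^'n) measure" where "torus_measure \<equiv> lebesgue_on torus"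

lemma continuous_eq_0_of_integral_eq_0:
  fixes f :: "real^'n \<Rightarrow> real"
  assumes cont: "continuous_on UNIV f" and nn: "\<And>x. 0 \<le> f x" and z: "(LINT x|torus_measure. f x) = 0"
    and x: "x \<in> torus"
  shows "f x = 0"
proof -
  have "(f has_integral 0) torus"
    using has_integral_integral_lebesgue_on[OF integrable_continuous_torus[OF cont]] z by simp
  then have I: "(f has_integral 0) (cbox 0 1)"
  proof (rule has_integral_spike_set_eq[THEN iffD1, rotated 2])
    show "negligible {x \<in> torus - cbox 0 1. f x \<noteq> 0}" 
      by (rule negligible_subset[of "{}"]) (use torus_subset_cbox in auto)
    show "negligible {x \<in> cbox 0 1 - torus. f x \<noteq> 0}" 
      by (rule negligible_subset[OF negligible_cbox_minus_torus]) auto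
  qed
  have "(\<chi> i. 1/2) \<in> box 0 (1 :: real^'n)" by (simp add: mem_box_cart)
  then have ne: "box 0 1 \<noteq> ({} :: (real^'n) set)" by blast
  show ?thesis
    by (rule has_integral_0_cbox_imp_0[OF continuous_on_subset[OF cont subset_UNIV] nn I ne])
      (use x torus_subset_cbox in blast)
qed

lemma continuous_periodic_L2: 
  assumes "periodic f" "continuous_on UNIV f"
  shows "f \<in> L2_torus"
proof -
  have "continuous_on UNIV (\<lambda>x. (f x)\<^sup>2)" using assms by (intro continuous_intros)
  then show ?thesis unfolding L2_torus_def
    using assms integrable_continuous_torus continuous_borel_torus by blast
qed

lemma L2_torusD:
  assumes "u \<in> L2_torus"
  shows "periodic u" "u \<in> borel_measurable torus_measure" "integrable torus_measure (\<lambda>x. (u x)\<^sup>2)"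
  using assms unfolding L2_torus_def by blast+

lemma L2_torusI:
  "periodic u \<Longrightarrow> u \<in> borel_measurable torus_measure \<Longrightarrow> integrable torus_measure (\<lambda>x. (u x)\<^sup>2) \<Longrightarrow> u \<in> L2_torus"
  unfolding L2_torus_def by blast

lemma L2_integrable_mult:
  assumes "u \<in> L2_torus" "v \<in> L2_torus"
  shows "integrable torus_measure (\<lambda>x. u x * v x)"
proof (rule Bochner_Integration.integrable_bound)
  show "integrable torus_measure (\<lambda>x. (u x)\<^sup>2 + (v x)\<^sup>2)" 
    by (intro Bochner_Integration.integrable_add L2_torusD assms)
  show "(\<lambda>x. u x * v x) \<in> borel_measurable torus_measure"
    by (intro borel_measurable_times L2_torusD assms)
  have "\<bar>a * b\<bar> \<le> a\<^sup>2 + b\<^sup>2" for a b :: real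
  proof -
    have "2 * (\<bar>a\<bar> * \<bar>b\<bar>) \<le> a\<^sup>2 + b\<^sup>2" using sum_squares_bound[of "\<bar>a\<bar>" "\<bar>b\<bar>"] by simp
    moreover have "0 \<le> \<bar>a\<bar> * \<bar>b\<bar>" by simp
    ultimately show ?thesis unfolding abs_mult by linarith
  qed
  then show "AE x in torus_measure. norm (u x * v x) \<le> norm ((u x)\<^sup>2 + (v x)\<^sup>2)"
    by (intro AE_I2) (simp add: abs_of_nonneg)
qed

lemma L2_const: "(\<lambda>x. c) \<in> L2_torus"
  by (rule continuous_periodic_L2) (auto simp: periodic_def)

lemma L2_integrable: "u \<in> L2_torus \<Longrightarrow> integrable torus_measure u"
  using L2_integrable_mult[OF _ L2_const[of 1], of u] by (simp only: mult_1_right)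

lemma L2_add:
  assumes "u \<in> L2_torus" "v \<in> L2_torus"
  shows "(\<lambda>x. u x + v x) \<in> L2_torus"
proof -
  have "integrable torus_measure (\<lambda>x. (u x)\<^sup>2 + 2 * (u x * v x) + (v x)\<^sup>2)"
    by (intro Bochner_Integration.integrable_add integrable_mult_right L2_integrable_mult L2_torusD assms)
  then have I: "integrable torus_measure (\<lambda>x. (u x + v x)\<^sup>2)" by (simp add: power2_sum algebra_simps)
  have P: "periodic (\<lambda>x. u x + v x)" 
    using L2_torusD(1)[OF assms(1)] L2_torusD(1)[OF assms(2)] unfolding periodic_def by metis
  show ?thesis by (rule L2_torusI[OF P borel_measurable_add[OF L2_torusD(2)[OF assms(1)] L2_torusD(2)[OF assms(2)]] I])
qed

lemma L2_scale: 
  assumes "u \<in> L2_torus"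
  shows "(\<lambda>x. c * u x) \<in> L2_torus"
proof (rule L2_torusI)
  show "periodic (\<lambda>x. c * u x)" using L2_torusD(1)[OF assms] unfolding periodic_def by metis
  show "(\<lambda>x. c * u x) \<in> borel_measurable torus_measure" 
    by (intro borel_measurable_times borel_measurable_const L2_torusD(2) assms)
  show "integrable torus_measure (\<lambda>x. (c * u x)\<^sup>2)"
    unfolding power_mult_distrib by (intro integrable_mult_right L2_torusD(3) assms)
qed

lemma L2_diff: "u \<in> L2_torus \<Longrightarrow> v \<in> L2_torus \<Longrightarrow> (\<lambda>x. u x - v x) \<in> L2_torus"
  using L2_add[of u "\<lambda>x. -1 * v x"] L2_scale[of v "-1"] by (simp only: mult_minus1 add_uminus_conv_diff)

lemma L2_sum: "(\<And>i. i \<in> I \<Longrightarrow> u i \<in> L2_torus) \<Longrightarrow> (\<lambda>x. \<Sum>i\<in>I. u i x) \<in> L2_torus"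
  by (induction I rule: infinite_finite_induct) (auto intro: L2_const L2_add)

section \<open>Trigonometric functions\<close>

definition phase :: "int^'n \<Rightarrow> real^'n \<Rightarrow> real" where
  "phase k x = 2 * pi * (\<Sum>j\<in>UNIV. x $ j * of_int (k $ j))"

definition mode :: "int^'n \<Rightarrow> real^'n \<Rightarrow> complex" where
  "mode k x = cis (phase k x)"

lemma phase_add: "phase k (x + y) = phase k x + phase k y"
  by (simp add: phase_def algebra_simps sum.distrib)

lemma phase_add_freq: "phase (k + l) x = phase k x + phase l x"
  by (simp add: phase_def algebra_simps sum.distrib)

lemma phase_uminus_freq: "phase (- k) x = - phase k x"
  by (simp add: phase_def sum_negf)

lemma phase_zero_freq [simp]: "phase 0 x = 0"
  by (simp add: phase_def)

lemma phase_axis: "phase k (axis i h) = 2 * pi * h * of_int (k $ i)"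
  by (simp add: phase_def axis_def if_distrib if_distribR cong: if_cong)

lemma phase_axis_freq: "phase (axis i 1) x = 2 * pi * x $ i"
proof -
  have "(\<Sum>j\<in>UNIV. x $ j * of_int (axis i 1 $ j)) = (\<Sum>j\<in>UNIV. if j = i then x $ j else 0)"
    by (intro sum.cong) (auto simp: axis_def)
  then show ?thesis by (simp add: phase_def)
qed

lemma mode_mult: "mode k x * mode l x = mode (k + l) x"
  by (simp add: mode_def cis_mult phase_add_freq)

lemma mode_cnj: "cnj (mode k x) = mode (- k) x"
  by (simp add: mode_def cis_cnj phase_uminus_freq)

lemma norm_mode [simp]: "cmod (mode k x) = 1"
  by (simp add: mode_def)

lemma cis_phase_periodic: "cis (phase k (x + axis i 1)) = cis (phase k x)"
proof -
  have "cis (phase k (x + axis i 1)) = cis (phase k x) * cis (2 * pi * of_int (k $ i))"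
    by (simp only: phase_add phase_axis cis_mult mult_1_right)
  also have "cis (2 * pi * of_int (k $ i)) = 1" by (rule cis_multiple_2pi) simp
  finally show ?thesis by simp
qed

lemma periodic_mode: "periodic (mode k)"
  by (simp add: periodic_def mode_def cis_phase_periodic)

lemma periodic_cos_phase: "periodic (\<lambda>x. cos (phase k x))"
  and periodic_sin_phase: "periodic (\<lambda>x. sin (phase k x))"
  unfolding periodic_def cis.simps(1,2)[symmetric] cis_phase_periodic by simp_all

lemma has_derivative_phase: "(phase k has_derivative phase k) (at x)"
proof (rule bounded_linear_imp_has_derivative)
  show "bounded_linear (phase k)"
    unfolding phase_def
    by (intro bounded_linear_const_mult bounded_linear_sum bounded_linear_mult_const bounded_linear_vec_nth)
qed

lemma continuous_phase [continuous_intros]: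
  "continuous_on S f \<Longrightarrow> continuous_on S (\<lambda>x. phase k (f x))"
  unfolding phase_def by (intro continuous_intros)

lemma continuous_mode: "continuous_on S (mode k)"
  unfolding mode_def by (intro continuous_intros)

lemma has_derivative_cos_phase:
  "((\<lambda>x. cos (phase k x)) has_derivative (\<lambda>h. - sin (phase k x) * phase k h)) (at x)"
  by (auto intro!: derivative_eq_intros has_derivative_phase)

lemma has_derivative_sin_phase:
  "((\<lambda>x. sin (phase k x)) has_derivative (\<lambda>h. cos (phase k x) * phase k h)) (at x)"
  by (auto intro!: derivative_eq_intros has_derivative_phase)

lemma classical_partial_cos_phase:
  "classical_partial i (\<lambda>x. cos (phase k x)) = (\<lambda>x. - (2 * pi * of_int (k $ i)) * sin (phase k x))"
  by (rule ext) (subst classical_partial_eqI[OF has_derivative_cos_phase], simp add: phase_axis)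

lemma classical_partial_sin_phase:
  "classical_partial i (\<lambda>x. sin (phase k x)) = (\<lambda>x. (2 * pi * of_int (k $ i)) * cos (phase k x))"
  by (rule ext) (subst classical_partial_eqI[OF has_derivative_sin_phase], simp add: phase_axis)

lemma C1_cos_phase: "(\<lambda>x. cos (phase k x)) \<in> C1_torus"
  and C1_sin_phase: "(\<lambda>x. sin (phase k x)) \<in> C1_torus"
  unfolding C1_torus_def
  by (auto simp: periodic_cos_phase periodic_sin_phase classical_partial_cos_phase classical_partial_sin_phase
      intro!: continuous_intros differentiableI[OF has_derivative_cos_phase] differentiableI[OF has_derivative_sin_phase])

lemma L2_cos_phase: "(\<lambda>x. cos (phase k x)) \<in> L2_torus"
  and L2_sin_phase: "(\<lambda>x. sin (phase k x)) \<in> L2_torus"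
  by (auto intro!: continuous_periodic_L2 periodic_cos_phase periodic_sin_phase continuous_intros)

lemma integrable_mode: "integrable torus_measure (mode k)"
  by (intro integrable_continuous_torus continuous_mode)

text \<open>For \<open>k \<noteq> 0\<close> some component \<open>k $ i\<close> is nonzero, and then
  cosine and sine of the phase are multiples of \<open>i\<close>-th partial derivatives of periodic
  functions, so both integrate to zero.\<close>

lemma integral_mode: "(LINT x|torus_measure. mode k x) = (if k = 0 then 1 else 0)"
proof (cases "k = 0")
  case True
  then show ?thesis by (simp add: mode_def measure_torus)
next
  case False
  then obtain i where i: "k $ i \<noteq> 0" by (metis vec_eq_iff zero_index)
  have "(LINT x|torus_measure. cos (phase k x)) = 0"
    using integral_partial_eq_0[OF C1_sin_phase, of i k] i by (simp add: classical_partial_sin_phase)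
  moreover have "(LINT x|torus_measure. sin (phase k x)) = 0"
    using integral_partial_eq_0[OF C1_cos_phase, of i k] i by (simp add: classical_partial_cos_phase)
  moreover have "(LINT x|torus_measure. mode k x) =
      Complex (LINT x|torus_measure. cos (phase k x)) (LINT x|torus_measure. sin (phase k x))"
    using integral_Re[OF integrable_mode, of k] integral_Im[OF integrable_mode, of k]
    by (simp add: complex_eq_iff mode_def[abs_def])
  ultimately show ?thesis using False by (simp add: Complex_eq_0)
qed

lemma fourier_coeff_eq: "fourier_coeff u k = (LINT x|torus_measure. complex_of_real (u x) * mode (- k) x)"
proof -
  have "exp (- 2 * complex_of_real pi * \<i> * complex_of_real (\<Sum>j\<in>UNIV. x $ j * of_int (k $ j))) = mode (- k) x" for x
    by (simp add: mode_def cis_conv_exp phase_def sum_negf algebra_simps)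
  then show ?thesis by (simp add: fourier_coeff_def)
qed

lemma integrable_fourier:
  assumes "u \<in> L2_torus"
  shows "integrable torus_measure (\<lambda>x. complex_of_real (u x) * mode k x)"
proof (rule Bochner_Integration.integrable_bound[OF L2_integrable[OF assms]])
  show "(\<lambda>x. complex_of_real (u x) * mode k x) \<in> borel_measurable torus_measure"
    using measurable_compose[OF L2_torusD(2)[OF assms] borel_measurable_of_real]
    by (intro borel_measurable_times continuous_borel_torus[OF continuous_mode])
qed (simp add: norm_mult)

lemma cnj_fourier:
  "(LINT x|torus_measure. complex_of_real (u x) * mode k x) = cnj (fourier_coeff u k)"
proof -
  have "cnj (fourier_coeff u k) = (LINT x|torus_measure. cnj (complex_of_real (u x) * mode (- k) x))"
    unfolding fourier_coeff_eq by (rule Bochner_Integration.integral_cnj[symmetric])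
  then show ?thesis by (simp add: mode_cnj)
qed

lemma Re_fourier_coeff:
  assumes "u \<in> L2_torus"
  shows "Re (fourier_coeff u k) = l2_inner u (\<lambda>x. cos (phase k x))"
    "Im (fourier_coeff u k) = - l2_inner u (\<lambda>x. sin (phase k x))"
  unfolding fourier_coeff_eq l2_inner_def
  using integral_Re[OF integrable_fourier[OF assms], of "- k"] integral_Im[OF integrable_fourier[OF assms], of "- k"]
  by (simp_all add: mode_def phase_uminus_freq)

lemma fourier_coeff_add:
  assumes "u \<in> L2_torus" "v \<in> L2_torus"
  shows "fourier_coeff (\<lambda>x. u x + v x) k = fourier_coeff u k + fourier_coeff v k"
  using integrable_fourier[OF assms(1)] integrable_fourier[OF assms(2)]
  unfolding fourier_coeff_eq by (simp add: ring_distribs)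

lemma fourier_coeff_scale:
  shows "fourier_coeff (\<lambda>x. c * u x) k = of_real c * fourier_coeff u k"
  unfolding fourier_coeff_eq by (simp add: mult.assoc)

lemma fourier_coeff_diff:
  assumes "u \<in> L2_torus" "v \<in> L2_torus"
  shows "fourier_coeff (\<lambda>x. u x - v x) k = fourier_coeff u k - fourier_coeff v k"
  using integrable_fourier[OF assms(1)] integrable_fourier[OF assms(2)]
  unfolding fourier_coeff_eq by (simp add: ring_distribs)

text \<open>Expansion of the square and orthonormality of the modes. Keeping the coefficients
  \<open>c\<close> free serves two purposes: \<open>c = fourier_coeff u\<close> gives Bessel's
  inequality, and arbitrary \<open>c\<close> shows that no trigonometric sum over \<open>F\<close>
  comes closer to \<open>u\<close> than the Fourier sum.\<close>

lemma L2_distance_trig_sum: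
  assumes u: "u \<in> L2_torus" and F: "finite F"
  shows "integrable torus_measure (\<lambda>x. (cmod (complex_of_real (u x) - (\<Sum>k\<in>F. c k * mode k x)))\<^sup>2)" (is ?I)
   and "(LINT x|torus_measure. (cmod (complex_of_real (u x) - (\<Sum>k\<in>F. c k * mode k x)))\<^sup>2)
      = (LINT x|torus_measure. (u x)\<^sup>2) - (\<Sum>k\<in>F. (cmod (fourier_coeff u k))\<^sup>2) + (\<Sum>k\<in>F. (cmod (c k - fourier_coeff u k))\<^sup>2)"
proof -
  let ?p = "\<lambda>x. \<Sum>k\<in>F. c k * mode k x"
  let ?U = "\<lambda>x. complex_of_real (u x)"
  have eq: "complex_of_real ((cmod (?U x - ?p x))\<^sup>2) = of_real ((u x)\<^sup>2) - (\<Sum>k\<in>F. c k * (?U x * mode k x))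
      - (\<Sum>k\<in>F. cnj (c k) * (?U x * mode (- k) x)) + (\<Sum>k\<in>F. \<Sum>l\<in>F. c k * cnj (c l) * mode (k - l) x)" for x
  proof -
    have "complex_of_real ((cmod (?U x - ?p x))\<^sup>2) = (?U x - ?p x) * (?U x - cnj (?p x))"
      by (simp only: complex_norm_square) simp
    also have "\<dots> = ?U x * ?U x - ?U x * ?p x - ?U x * cnj (?p x) + ?p x * cnj (?p x)"
      by (simp add: algebra_simps)
    also have "?p x * cnj (?p x) = (\<Sum>k\<in>F. \<Sum>l\<in>F. c k * cnj (c l) * mode (k - l) x)"
      by (simp add: sum_product mode_cnj mode_mult algebra_simps flip: mode_mult[of _ x "- _"])
    also have "?U x * ?p x = (\<Sum>k\<in>F. c k * (?U x * mode k x))"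
      by (simp add: sum_distrib_left algebra_simps)
    also have "?U x * cnj (?p x) = (\<Sum>k\<in>F. cnj (c k) * (?U x * mode (- k) x))"
      by (simp add: sum_distrib_left mode_cnj algebra_simps)
    finally show ?thesis by (simp add: power2_eq_square)
  qed
  have i1: "integrable torus_measure (\<lambda>x. complex_of_real ((u x)\<^sup>2))"
    using L2_torusD(3)[OF u] by (rule integrable_of_real)
  note i2 = integrable_fourier[OF u]
  have I: "integrable torus_measure (\<lambda>x. complex_of_real ((cmod (?U x - ?p x))\<^sup>2))"
    unfolding eq by (intro Bochner_Integration.integrable_add Bochner_Integration.integrable_diff
       Bochner_Integration.integrable_sum integrable_mult_right i1 i2 integrable_mode)
  then show ?I by (simp only: complex_of_real_integrable_eq)
  have "complex_of_real (LINT x|torus_measure. (cmod (?U x - ?p x))\<^sup>2) = 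
     (LINT x|torus_measure. complex_of_real ((cmod (?U x - ?p x))\<^sup>2))"
    by (rule integral_complex_of_real[symmetric])
  also have "\<dots> = of_real (LINT x|torus_measure. (u x)\<^sup>2) - (\<Sum>k\<in>F. c k * cnj (fourier_coeff u k))
      - (\<Sum>k\<in>F. cnj (c k) * fourier_coeff u k) + (\<Sum>k\<in>F. \<Sum>l\<in>F. c k * cnj (c l) * (if k - l = 0 then 1 else 0))"
  proof -
    have "(LINT x|torus_measure. complex_of_real ((cmod (?U x - ?p x))\<^sup>2)) = 
       (LINT x|torus_measure. of_real ((u x)\<^sup>2)) - (LINT x|torus_measure. (\<Sum>k\<in>F. c k * (?U x * mode k x)))
      - (LINT x|torus_measure. (\<Sum>k\<in>F. cnj (c k) * (?U x * mode (- k) x))) 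
      + (LINT x|torus_measure. (\<Sum>k\<in>F. \<Sum>l\<in>F. c k * cnj (c l) * mode (k - l) x))"
      unfolding eq 
      by (subst Bochner_Integration.integral_add Bochner_Integration.integral_diff; 
          (intro Bochner_Integration.integrable_add Bochner_Integration.integrable_diff
            Bochner_Integration.integrable_sum integrable_mult_right i1 i2 integrable_mode)?)+
         simp
    also have "(LINT x|torus_measure. (\<Sum>k\<in>F. c k * (?U x * mode k x))) = (\<Sum>k\<in>F. c k * cnj (fourier_coeff u k))"
      by (subst Bochner_Integration.integral_sum) (auto intro!: integrable_mult_right i2 simp: cnj_fourier)
    also have "(LINT x|torus_measure. (\<Sum>k\<in>F. cnj (c k) * (?U x * mode (- k) x))) = (\<Sum>k\<in>F. cnj (c k) * fourier_coeff u k)"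
      by (subst Bochner_Integration.integral_sum) (auto intro!: integrable_mult_right i2 simp: fourier_coeff_eq)
    also have "(LINT x|torus_measure. (\<Sum>k\<in>F. \<Sum>l\<in>F. c k * cnj (c l) * mode (k - l) x)) = 
       (\<Sum>k\<in>F. \<Sum>l\<in>F. c k * cnj (c l) * (if k - l = 0 then 1 else 0))"
      by (subst Bochner_Integration.integral_sum, (intro Bochner_Integration.integrable_sum integrable_mult_right integrable_mode)[])
         (intro sum.cong refl, subst Bochner_Integration.integral_sum, auto intro!: integrable_mult_right integrable_mode simp: integral_mode)
    finally show ?thesis by (simp only: integral_complex_of_real)
  qed
  also have "(\<Sum>k\<in>F. \<Sum>l\<in>F. c k * cnj (c l) * (if k - l = 0 then 1 else 0)) = (\<Sum>k\<in>F. c k * cnj (c k))"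
  proof (rule sum.cong[OF refl])
    fix k assume k: "k \<in> F"
    have "(\<Sum>l\<in>F. c k * cnj (c l) * (if k - l = 0 then 1 else 0)) = (\<Sum>l\<in>F. if l = k then c k * cnj (c k) else 0)"
      by (intro sum.cong) auto
    then show "(\<Sum>l\<in>F. c k * cnj (c l) * (if k - l = 0 then 1 else 0)) = c k * cnj (c k)" using F k by simp
  qed
  also have "of_real (LINT x|torus_measure. (u x)\<^sup>2) - (\<Sum>k\<in>F. c k * cnj (fourier_coeff u k))
      - (\<Sum>k\<in>F. cnj (c k) * fourier_coeff u k) + (\<Sum>k\<in>F. c k * cnj (c k)) = 
      of_real (LINT x|torus_measure. (u x)\<^sup>2) - (\<Sum>k\<in>F. fourier_coeff u k * cnj (fourier_coeff u k))
      + (\<Sum>k\<in>F. (c k - fourier_coeff u k) * cnj (c k - fourier_coeff u k))"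
    by (simp add: algebra_simps sum.distrib sum_subtractf)
  also have "\<dots> = complex_of_real ((LINT x|torus_measure. (u x)\<^sup>2) - (\<Sum>k\<in>F. (cmod (fourier_coeff u k))\<^sup>2) + (\<Sum>k\<in>F. (cmod (c k - fourier_coeff u k))\<^sup>2))"
    by (simp only: of_real_add of_real_diff of_real_sum complex_norm_square)
  finally show "(LINT x|torus_measure. (cmod (?U x - ?p x))\<^sup>2)
      = (LINT x|torus_measure. (u x)\<^sup>2) - (\<Sum>k\<in>F. (cmod (fourier_coeff u k))\<^sup>2) + (\<Sum>k\<in>F. (cmod (c k - fourier_coeff u k))\<^sup>2)"
    by (simp only: of_real_eq_iff)
qed

lemma bessel_inequality:
  assumes "u \<in> L2_torus" "finite F"
  shows "(\<Sum>k\<in>F. (cmod (fourier_coeff u k))\<^sup>2) \<le> (LINT x|torus_measure. (u x)\<^sup>2)"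
proof -
  have "0 \<le> (LINT x|torus_measure. (cmod (complex_of_real (u x) - (\<Sum>k\<in>F. fourier_coeff u k * mode k x)))\<^sup>2)" by simp
  then show ?thesis using L2_distance_trig_sum(2)[OF assms, of "fourier_coeff u"] by simp
qed

section \<open>Density of trigonometric polynomials\<close>

text \<open>The inductive form turns closure under products, which Stone-Weierstrass asks for, into
  a double induction; the explicit finite sum is recovered afterwards by
  \<open>trig_sum_repr\<close>.\<close>

inductive trig :: "(real^'n \<Rightarrow> complex) \<Rightarrow> bool" where
  trig_mode: "trig (\<lambda>x. c * mode k x)"
| trig_add: "trig p \<Longrightarrow> trig q \<Longrightarrow> trig (\<lambda>x. p x + q x)"

lemma trig_mult:
  assumes "trig p" "trig q"
  shows "trig (\<lambda>x. p x * q x)"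
  using assms(1)
proof induction
  case (trig_mode c k)
  show ?case using assms(2)
  proof induction
    case (trig_mode d l)
    show ?case using trig.trig_mode[of "c * d" "k + l"] by (simp add: mode_mult[symmetric] mult_ac)
  next
    case (trig_add p q)
    then show ?case using trig.trig_add by (simp add: ring_distribs)
  qed
next
  case (trig_add p q)
  then show ?case using trig.trig_add by (simp add: ring_distribs)
qed

lemma trig_const: "trig (\<lambda>x. c)"
  using trig_mode[of c 0] by (simp add: mode_def)

lemma trig_sum_repr:
  assumes "trig p"
  obtains F c where "finite F" "\<And>x. p x = (\<Sum>k\<in>F. c k * mode k x)"
proof -
  have "\<exists>F c. finite F \<and> (\<forall>x. p x = (\<Sum>k\<in>F. c k * mode k x))"
    using assms
  proof induction
    case (trig_mode c k)
    show ?case by (rule exI[of _ "{k}"], rule exI[of _ "\<lambda>_. c"]) simp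
  next
    case (trig_add p q)
    then obtain F c G d where F: "finite F" "\<forall>x. p x = (\<Sum>k\<in>F. c k * mode k x)"
      and G: "finite G" "\<forall>x. q x = (\<Sum>k\<in>G. d k * mode k x)" by auto
    let ?e = "\<lambda>k. (if k \<in> F then c k else 0) + (if k \<in> G then d k else 0)"
    have "(\<Sum>k\<in>F. c k * mode k x) + (\<Sum>k\<in>G. d k * mode k x) = (\<Sum>k\<in>F \<union> G. ?e k * mode k x)" for x
    proof -
      have "(\<Sum>k\<in>F. c k * mode k x) = (\<Sum>k\<in>F \<union> G. (if k \<in> F then c k else 0) * mode k x)"
        using F G by (intro sum.mono_neutral_cong_left) auto
      moreover have "(\<Sum>k\<in>G. d k * mode k x) = (\<Sum>k\<in>F \<union> G. (if k \<in> G then d k else 0) * mode k x)"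
        using F G by (intro sum.mono_neutral_cong_left) auto
      ultimately show ?thesis by (simp add: sum.distrib ring_distribs)
    qed
    then show ?case using F G by (intro exI[of _ "F \<union> G"] exI[of _ ?e]) auto
  qed
  then show ?thesis using that by blast
qed

lemma trig_cos_sin: "trig (\<lambda>x. complex_of_real (cos (2 * pi * x $ i)))" "trig (\<lambda>x. complex_of_real (sin (2 * pi * x $ i)))"
proof -
  have c: "complex_of_real (cos (2 * pi * x $ i)) = 1/2 * mode (axis i 1) x + 1/2 * mode (- axis i 1) x" 
    and s: "complex_of_real (sin (2 * pi * x $ i)) = (-\<i>/2) * mode (axis i 1) x + (\<i>/2) * mode (- axis i 1) x" for x
    by (simp_all add: mode_def phase_uminus_freq phase_axis_freq complex_eq_iff)
  show "trig (\<lambda>x. complex_of_real (cos (2 * pi * x $ i)))" unfolding c by (intro trig.intros)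
  show "trig (\<lambda>x. complex_of_real (sin (2 * pi * x $ i)))" unfolding s by (intro trig.intros)
qed

text \<open>A continuous function on the closed cell that vanishes on its boundary factors through the
  embedding of the torus into \<open>complex^'n\<close>, where the Stone--Weierstrass theorem applies.\<close>

lemma trig_uniform_approx:
  fixes h :: "real^'n \<Rightarrow> real"
  assumes cont: "continuous_on (cbox 0 1) h" and bd: "\<And>x. x \<in> cbox 0 1 - box 0 1 \<Longrightarrow> h x = 0" and "e > 0"
  obtains p where "trig p" "\<And>x. x \<in> cbox 0 1 \<Longrightarrow> cmod (complex_of_real (h x) - p x) < e"
proof -
  define \<Phi> where "\<Phi> x = (\<chi> i. cis (2 * pi * x $ i))" for x :: "real^'n"
  define C where "C = cbox 0 (1 :: real^'n)"
  define K where "K = \<Phi> ` C"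
  define H where "H z = h (SOME x. x \<in> C \<and> \<Phi> x = z)" for z
  have "continuous_on C \<Phi>" unfolding \<Phi>_def by (intro continuous_intros continuous_on_cis)
  then have cK: "compact K" unfolding K_def C_def by (intro compact_continuous_image) auto
  \<comment> \<open>Distinct points of the closed cube with the same image differ by exactly 1 in
    some coordinate, hence both lie on the boundary, where \<open>h\<close> vanishes.\<close>
  have inj: "h x = h y" if x: "x \<in> C" and y: "y \<in> C" and eq: "\<Phi> x = \<Phi> y" for x y
  proof (cases "x = y")
    case False
    then obtain i where i: "x $ i \<noteq> y $ i" by (metis vec_eq_iff)
    have "cis (2 * pi * x $ i) = cis (2 * pi * y $ i)" using eq by (metis \<Phi>_def vec_lambda_beta)
    then obtain n :: int where "2 * pi * x $ i = 2 * pi * y $ i + 2 * pi * n"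
      using sin_cos_eq_iff[of "2 * pi * x $ i" "2 * pi * y $ i"] by (auto simp: complex_eq_iff)
    then have "2 * pi * (x $ i - y $ i - n) = 0" by (simp add: algebra_simps)
    then have n: "x $ i - y $ i = n" by simp
    have b: "0 \<le> x $ i" "x $ i \<le> 1" "0 \<le> y $ i" "y $ i \<le> 1" using x y by (auto simp: C_def mem_box_cart)
    have "n = 1 \<or> n = -1"
    proof -
      have "real_of_int n \<le> 1" "real_of_int n \<ge> -1" "n \<noteq> 0" using n b i by auto
      then show ?thesis by linarith
    qed
    then have "(x $ i = 1 \<and> y $ i = 0) \<or> (x $ i = 0 \<and> y $ i = 1)" using n b by auto
    then have "x \<notin> box 0 1" "y \<notin> box 0 1" by (auto simp: mem_box_cart intro!: exI[of _ i])
    then show ?thesis using bd x y by (auto simp: C_def)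
  qed simp
  have H\<Phi>: "H (\<Phi> x) = h x" if "x \<in> C" for x
    unfolding H_def using that by (intro inj) (rule someI2[of _ x]; auto)+
  \<comment> \<open>Continuity descends to the quotient because preimages of closed sets under
    \<open>H\<close> are images of compact sets under \<open>\<Phi>\<close>.\<close>
  have contH: "continuous_on K H"
    unfolding continuous_closedin_preimage_eq
  proof (intro allI impI)
    fix T :: "real set" assume T: "closed T"
    have eq: "K \<inter> H -` T = \<Phi> ` (C \<inter> h -` T)" using H\<Phi> by (auto simp: K_def)
    have "compact (C \<inter> h -` T)"
      using continuous_closedin_preimage[OF cont T] unfolding C_def
      by (metis closedin_compact compact_cbox)
    then have "compact (\<Phi> ` (C \<inter> h -` T))"
      by (intro compact_continuous_image) (auto intro: continuous_on_subset[OF \<open>continuous_on C \<Phi>\<close>])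
    then show "closedin (top_of_set K) (K \<inter> H -` T)" 
      unfolding eq using K_def by (intro closed_subset compact_imp_closed) auto
  qed
  let ?P = "\<lambda>f. continuous_on K f \<and> trig (\<lambda>x. complex_of_real (f (\<Phi> x)))"
  have "\<exists>g. ?P g \<and> (\<forall>z\<in>K. \<bar>H z - g z\<bar> < e)"
  proof (rule Stone_Weierstrass_HOL)
    show "compact K" by fact
    show "continuous_on K H" by fact
    show "e > 0" by fact
    show "?P (\<lambda>x. c)" for c by (auto intro: trig_const)
    show "?P (\<lambda>x. f x + g x)" if "?P f \<and> ?P g" for f g
      using that by (auto intro!: continuous_intros trig_add)
    show "?P (\<lambda>x. f x * g x)" if "?P f \<and> ?P g" for f g
      using that by (auto intro!: continuous_intros trig_mult)
    show "\<exists>f. ?P f \<and> f z \<noteq> f w" if "z \<in> K \<and> w \<in> K \<and> z \<noteq> w" for z w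
    proof -
      obtain i where i: "z $ i \<noteq> w $ i" using \<open>z \<in> K \<and> w \<in> K \<and> z \<noteq> w\<close> by (metis vec_eq_iff)
      have "?P (\<lambda>z. Re (z $ i))" "?P (\<lambda>z. Im (z $ i))"
        using trig_cos_sin[of i] by (auto intro!: continuous_intros simp: \<Phi>_def)
      moreover have "Re (z $ i) \<noteq> Re (w $ i) \<or> Im (z $ i) \<noteq> Im (w $ i)" using i complex_eqI by blast
      ultimately show ?thesis by blast
    qed
  qed auto
  then obtain g where g: "?P g" "\<forall>z\<in>K. \<bar>H z - g z\<bar> < e" by blast
  show ?thesis
  proof
    show "trig (\<lambda>x. complex_of_real (g (\<Phi> x)))" using g by simp
    fix x :: "real^'n" assume x: "x \<in> cbox 0 1"
    then have "\<bar>H (\<Phi> x) - g (\<Phi> x)\<bar> < e" using g(2) by (auto simp: K_def C_def)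
    then show "cmod (complex_of_real (h x) - complex_of_real (g (\<Phi> x))) < e"
      using H\<Phi> x by (simp add: C_def flip: of_real_diff)
  qed
qed

section \<open>Calculus of continuously differentiable functions\<close>

lemma C1_has_derivative:
  "f \<in> C1_torus \<Longrightarrow> (f has_derivative frechet_derivative f (at x)) (at x)"
  using C1_torusD(2) frechet_derivative_works by blast

lemma C1_torusI:
  assumes "periodic f" "\<And>x. (f has_derivative f' x) (at x)" "\<And>i. continuous_on UNIV (\<lambda>x. f' x (axis i 1))"
  shows "f \<in> C1_torus" "classical_partial i f = (\<lambda>x. f' x (axis i 1))"
proof -
  have eq: "classical_partial i f = (\<lambda>x. f' x (axis i 1))" for i
    by (rule ext) (rule classical_partial_eqI[OF assms(2)])
  then show "classical_partial i f = (\<lambda>x. f' x (axis i 1))" .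
  show "f \<in> C1_torus" unfolding C1_torus_def mem_Collect_eq eq
    using assms differentiableI by blast
qed

lemma periodicD: "periodic f \<Longrightarrow> f (x + axis i 1) = f x"
  by (simp add: periodic_def)

lemma C1_add:
  assumes "f \<in> C1_torus" "g \<in> C1_torus"
  shows "(\<lambda>x. f x + g x) \<in> C1_torus"
    "classical_partial i (\<lambda>x. f x + g x) = (\<lambda>x. classical_partial i f x + classical_partial i g x)"
proof -
  have p: "periodic (\<lambda>x. f x + g x)"
    unfolding periodic_def using periodicD[OF C1_torusD(1)[OF assms(1)]] periodicD[OF C1_torusD(1)[OF assms(2)]] by simp
  note d = has_derivative_add[OF C1_has_derivative[OF assms(1)] C1_has_derivative[OF assms(2)]]
  note c = continuous_on_add[OF C1_torusD(3)[OF assms(1)] C1_torusD(3)[OF assms(2)], unfolded classical_partial_def]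
  show "(\<lambda>x. f x + g x) \<in> C1_torus" by (rule C1_torusI(1)[OF p d c])
  show "classical_partial i (\<lambda>x. f x + g x) = (\<lambda>x. classical_partial i f x + classical_partial i g x)"
    by (subst C1_torusI(2)[OF p d c]) (simp add: classical_partial_def)
qed

lemma C1_mult:
  assumes "f \<in> C1_torus" "g \<in> C1_torus"
  shows "(\<lambda>x. f x * g x) \<in> C1_torus"
    "classical_partial i (\<lambda>x. f x * g x) = (\<lambda>x. f x * classical_partial i g x + classical_partial i f x * g x)"
proof -
  have p: "periodic (\<lambda>x. f x * g x)"
    unfolding periodic_def using periodicD[OF C1_torusD(1)[OF assms(1)]] periodicD[OF C1_torusD(1)[OF assms(2)]] by simp
  note d = has_derivative_mult[OF C1_has_derivative[OF assms(1)] C1_has_derivative[OF assms(2)]]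
  have c: "continuous_on UNIV (\<lambda>x. f x * frechet_derivative g (at x) (axis i 1) + frechet_derivative f (at x) (axis i 1) * g x)" for i
    using C1_torusD(3)[OF assms(1), of i] C1_torusD(3)[OF assms(2), of i] C1_torusD(4)[OF assms(1)] C1_torusD(4)[OF assms(2)]
    unfolding classical_partial_def by (intro continuous_intros)
  show "(\<lambda>x. f x * g x) \<in> C1_torus" by (rule C1_torusI(1)[OF p d c])
  show "classical_partial i (\<lambda>x. f x * g x) = (\<lambda>x. f x * classical_partial i g x + classical_partial i f x * g x)"
    by (subst C1_torusI(2)[OF p d c]) (simp add: classical_partial_def)
qed

lemma C1_const: "(\<lambda>x. c) \<in> C1_torus" "classical_partial i (\<lambda>x. c) = (\<lambda>x. 0)"
  using C1_torusI[of "\<lambda>x. c" "\<lambda>_ _. 0"] by (auto simp: periodic_def)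

lemma C1_scale:
  assumes "f \<in> C1_torus"
  shows "(\<lambda>x. c * f x) \<in> C1_torus" "classical_partial i (\<lambda>x. c * f x) = (\<lambda>x. c * classical_partial i f x)"
  using C1_mult[OF C1_const(1)[of c] assms] C1_const(2)[of i c] by simp_all

lemma C1_diff:
  assumes "f \<in> C1_torus" "g \<in> C1_torus"
  shows "(\<lambda>x. f x - g x) \<in> C1_torus"
    "classical_partial i (\<lambda>x. f x - g x) = (\<lambda>x. classical_partial i f x - classical_partial i g x)"
  using C1_add[OF assms(1) C1_scale(1)[OF assms(2), of "-1"]] C1_scale(2)[OF assms(2), of _ "-1"] by simp_all

lemma C1_compose:
  assumes f: "f \<in> C1_torus" and \<phi>: "\<And>r. (\<phi> has_real_derivative \<phi>' r) (at r)" and c: "continuous_on UNIV \<phi>'"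
  shows "(\<lambda>x. \<phi> (f x)) \<in> C1_torus"
    "classical_partial i (\<lambda>x. \<phi> (f x)) = (\<lambda>x. \<phi>' (f x) * classical_partial i f x)"
proof -
  have p: "periodic (\<lambda>x. \<phi> (f x))"
    unfolding periodic_def using periodicD[OF C1_torusD(1)[OF f]] by simp
  have d: "((\<lambda>x. \<phi> (f x)) has_derivative (\<lambda>h. \<phi>' (f x) * frechet_derivative f (at x) h)) (at x)" for x
    using diff_chain_at[OF C1_has_derivative[OF f] \<phi>[unfolded has_field_derivative_def]] by (simp add: o_def)
  have c': "continuous_on UNIV (\<lambda>x. \<phi>' (f x) * frechet_derivative f (at x) (axis i 1))" for i
    using C1_torusD(3)[OF f, of i] unfolding classical_partial_def
    by (intro continuous_intros continuous_on_compose2[OF c C1_torusD(4)[OF f]]) auto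
  show "(\<lambda>x. \<phi> (f x)) \<in> C1_torus" by (rule C1_torusI(1)[OF p d c'])
  show "classical_partial i (\<lambda>x. \<phi> (f x)) = (\<lambda>x. \<phi>' (f x) * classical_partial i f x)"
    by (subst C1_torusI(2)[OF p d c']) (simp add: classical_partial_def)
qed

lemma integration_by_parts_torus:
  fixes f g :: "real^'n \<Rightarrow> real"
  assumes f: "f \<in> C1_torus" and g: "g \<in> C1_torus"
  shows "(LINT x|lebesgue_on torus. classical_partial i f x * g x) = - (LINT x|lebesgue_on torus. f x * classical_partial i g x)"
proof -
  have i1: "integrable (lebesgue_on torus) (\<lambda>x. f x * classical_partial i g x)"
    and i2: "integrable (lebesgue_on torus) (\<lambda>x. classical_partial i f x * g x)"
    by (intro integrable_continuous_torus continuous_on_mult C1_torusD(3,4) f g)+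
  have "(LINT x|lebesgue_on torus. f x * classical_partial i g x + classical_partial i f x * g x) = 0"
    using integral_partial_eq_0[OF C1_mult(1)[OF f g], of i] C1_mult(2)[OF f g, of i] by simp
  then show ?thesis using Bochner_Integration.integral_add[OF i1 i2] by linarith
qed

text \<open>First truncate the values at a height M, then approximate the truncation by continuous
  functions, clipped at the same height and cut off near the boundary of the cube. Boundedness
  supplies the dominating function in the second limit; vanishing on the boundary is what
  \<open>trig_uniform_approx\<close> expects.\<close>

lemma L2_approx_continuous:
  fixes u :: "real^'n \<Rightarrow> real"
  assumes u: "u \<in> L2_torus" and e: "e > 0"
  obtains h where "continuous_on UNIV h" "\<And>x. x \<in> cbox 0 1 - box 0 1 \<Longrightarrow> h x = 0"
    "(LINT x|torus_measure. (u x - h x)\<^sup>2) < e"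
proof -
  let ?cl = "\<lambda>M y. max (- M) (min M y) :: real"
  note um = L2_torusD(2)[OF u]
  have clm: "(\<lambda>x. ?cl M (u x)) \<in> borel_measurable torus_measure" for M
    by (intro borel_measurable_max borel_measurable_min borel_measurable_const um)
  have "(\<lambda>m. LINT x|torus_measure. (u x - ?cl (real m) (u x))\<^sup>2) \<longlonglongrightarrow> (LINT x|(torus_measure :: (real^'n) measure). 0::real)"
  proof (rule integral_dominated_convergence[where w="\<lambda>x. (u x)\<^sup>2"])
    show "(\<lambda>x. (u x - ?cl (real m) (u x))\<^sup>2) \<in> borel_measurable torus_measure" for m
      by (intro borel_measurable_power borel_measurable_diff um clm)
    show "integrable torus_measure (\<lambda>x. (u x)\<^sup>2)" by (rule L2_torusD(3)[OF u])
    show "AE x in torus_measure. (\<lambda>m. (u x - ?cl (real m) (u x))\<^sup>2) \<longlonglongrightarrow> 0"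
    proof (rule AE_I2)
      fix x
      obtain m0 :: nat where m0: "\<bar>u x\<bar> \<le> real m0" using real_arch_simple by blast
      have "\<forall>\<^sub>F m in sequentially. (u x - ?cl (real m) (u x))\<^sup>2 = 0"
        using eventually_ge_at_top[of m0]
      proof eventually_elim
        case (elim m)
        then have "\<bar>u x\<bar> \<le> real m" using m0 by linarith
        then have "?cl (real m) (u x) = u x" by linarith
        then show ?case by simp
      qed
      then show "(\<lambda>m. (u x - ?cl (real m) (u x))\<^sup>2) \<longlonglongrightarrow> 0" by (rule tendsto_eventually)
    qed
    show "AE x in torus_measure. norm ((u x - ?cl (real m) (u x))\<^sup>2) \<le> (u x)\<^sup>2" for m
    proof (rule AE_I2)
      fix x
      have "\<bar>u x - ?cl (real m) (u x)\<bar> \<le> \<bar>u x\<bar>" by linarith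
      then have "(u x - ?cl (real m) (u x))\<^sup>2 \<le> (u x)\<^sup>2" by (simp only: abs_le_square_iff)
      then show "norm ((u x - ?cl (real m) (u x))\<^sup>2) \<le> (u x)\<^sup>2" by simp
    qed
  qed simp
  then have "\<forall>\<^sub>F m in sequentially. (LINT x|torus_measure. (u x - ?cl (real m) (u x))\<^sup>2) < e / 4"
    using e by (intro order_tendstoD(2)) auto
  then obtain M :: nat where M: "(LINT x|torus_measure. (u x - ?cl (real M) (u x))\<^sup>2) < e / 4"
    using eventually_happens'[OF sequentially_bot] by blast
  define v where "v x = ?cl (real M) (u x)" for x
  have vb: "\<bar>v x\<bar> \<le> real M" for x unfolding v_def by linarith
  have vm: "v \<in> borel_measurable torus_measure" unfolding v_def[abs_def] by (rule clm)
  \<comment> \<open>This form of measurability hands over continuous functions that converge to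
    \<open>u\<close> off a null set.\<close>
  have "u measurable_on torus" using um measurable_on_iff_borel_measurable torus_lebesgue by blast
  then obtain N g where N: "negligible N" and gc: "\<And>n. continuous_on UNIV (g n :: real^'n \<Rightarrow> real)"
    and gl: "\<And>x. x \<notin> N \<Longrightarrow> (\<lambda>n. g n x) \<longlonglongrightarrow> (if x \<in> torus then u x else 0)"
    unfolding measurable_on_def by auto
  \<comment> \<open>Each factor is 0 on two opposite faces and, at a fixed interior point, becomes 1
    once \<open>n\<close> is large; the product therefore vanishes on the boundary and tends to 1
    inside.\<close>
  define cut where "cut n x = (\<Prod>i\<in>UNIV. max 0 (min 1 (real n * (x $ i * (1 - x $ i)))))" for n and x :: "real^'n"
  have cutc: "continuous_on UNIV (cut n)" for n unfolding cut_def by (intro continuous_intros)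
  have cutb: "0 \<le> cut n x" "cut n x \<le> 1" for n x
    unfolding cut_def by (auto intro!: prod_nonneg prod_le_1)
  have cut0: "cut n x = 0" if "x \<in> cbox 0 1 - box 0 1" for n x
  proof -
    have x: "\<And>i. 0 \<le> x $ i \<and> x $ i \<le> 1" "\<not> (\<forall>i. 0 < x $ i \<and> x $ i < 1)"
      using that by (simp_all add: mem_box_cart)
    then obtain i where "x $ i = 0 \<or> x $ i = 1" by (metis order_le_less)
    then have "\<exists>i\<in>UNIV. max 0 (min 1 (real n * (x $ i * (1 - x $ i)))) = 0" by (intro bexI[of _ i]) auto
    then show ?thesis unfolding cut_def by (subst prod_zero_iff) auto
  qed
  have cut1: "(\<lambda>n. cut n x) \<longlonglongrightarrow> 1" if "x \<in> box 0 1" for x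
  proof -
    have "(\<lambda>n. max 0 (min 1 (real n * (x $ i * (1 - x $ i))))) \<longlonglongrightarrow> 1" for i
    proof (rule tendsto_eventually)
      have pos: "x $ i * (1 - x $ i) > 0" using that by (simp add: mem_box_cart)
      obtain n0 :: nat where n0: "1 < real n0 * (x $ i * (1 - x $ i))" using reals_Archimedean3[OF pos] by blast
      show "\<forall>\<^sub>F n in sequentially. max 0 (min 1 (real n * (x $ i * (1 - x $ i)))) = 1"
        using eventually_ge_at_top[of n0]
      proof eventually_elim
        case (elim n)
        then have "real n0 * (x $ i * (1 - x $ i)) \<le> real n * (x $ i * (1 - x $ i))"
          using pos by (intro mult_right_mono) auto
        then show ?case using n0 by linarith
      qed
    qed
    then have "(\<lambda>n. cut n x) \<longlonglongrightarrow> (\<Prod>i\<in>(UNIV::'n set). 1)" unfolding cut_def by (intro tendsto_prod)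
    then show ?thesis by simp
  qed
  define h where "h n x = ?cl (real M) (g n x) * cut n x" for n x
  have hc: "continuous_on UNIV (h n)" for n unfolding h_def by (intro continuous_intros gc cutc)
  have hb: "\<bar>h n x\<bar> \<le> real M" for n x
  proof -
    have "\<bar>h n x\<bar> \<le> real M * 1" unfolding h_def abs_mult
      by (intro mult_mono) (use cutb[of n x] in auto)
    then show ?thesis by simp
  qed
  have "(\<lambda>n. LINT x|torus_measure. (v x - h n x)\<^sup>2) \<longlonglongrightarrow> (LINT x|(torus_measure :: (real^'n) measure). 0::real)"
  proof (rule integral_dominated_convergence[where w="\<lambda>x. (2 * real M)\<^sup>2"])
    show "(\<lambda>x. (v x - h n x)\<^sup>2) \<in> borel_measurable torus_measure" for n
      by (intro borel_measurable_power borel_measurable_diff vm continuous_borel_torus hc)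
    show "integrable (torus_measure :: (real^'n) measure) (\<lambda>x. (2 * real M)\<^sup>2)"
      by (intro integrable_continuous_torus continuous_on_const)
    show "AE x in torus_measure. (\<lambda>n. (v x - h n x)\<^sup>2) \<longlonglongrightarrow> 0"
    proof (rule AE_lebesgue_onI[of "N \<union> (cbox 0 1 - box 0 1)"])
      show "negligible (N \<union> (cbox 0 1 - box 0 (1::real^'n)))"
        by (intro negligible_Un N negligible_frontier_interval)
      fix x :: "real^'n" assume x: "x \<in> torus" "x \<notin> N \<union> (cbox 0 1 - box 0 1)"
      then have xb: "x \<in> box 0 1" using torus_subset_cbox by blast
      have "(\<lambda>n. g n x) \<longlonglongrightarrow> u x" using gl[of x] x by simp
      then have "(\<lambda>n. (v x - h n x)\<^sup>2) \<longlonglongrightarrow> (v x - ?cl (real M) (u x) * 1)\<^sup>2"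
        unfolding h_def by (intro tendsto_intros cut1[OF xb])
      then show "(\<lambda>n. (v x - h n x)\<^sup>2) \<longlonglongrightarrow> 0" by (simp add: v_def)
    qed simp
    show "AE x in torus_measure. norm ((v x - h n x)\<^sup>2) \<le> (2 * real M)\<^sup>2" for n
    proof (rule AE_I2)
      fix x
      have "\<bar>v x - h n x\<bar> \<le> \<bar>2 * real M\<bar>" using vb[of x] hb[of n x] by linarith
      then have "(v x - h n x)\<^sup>2 \<le> (2 * real M)\<^sup>2" by (simp only: abs_le_square_iff)
      then show "norm ((v x - h n x)\<^sup>2) \<le> (2 * real M)\<^sup>2" by simp
    qed
  qed simp
  then have "\<forall>\<^sub>F n in sequentially. (LINT x|torus_measure. (v x - h n x)\<^sup>2) < e / 4"
    using e by (intro order_tendstoD(2)) auto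
  then obtain n where n: "(LINT x|torus_measure. (v x - h n x)\<^sup>2) < e / 4"
    using eventually_happens'[OF sequentially_bot] by blast
  have i1: "integrable torus_measure (\<lambda>x. (u x - v x)\<^sup>2)"
  proof (rule Bochner_Integration.integrable_bound[OF L2_torusD(3)[OF u]])
    show "(\<lambda>x. (u x - v x)\<^sup>2) \<in> borel_measurable torus_measure"
      by (intro borel_measurable_power borel_measurable_diff um vm)
    show "AE x in torus_measure. norm ((u x - v x)\<^sup>2) \<le> norm ((u x)\<^sup>2)"
    proof (rule AE_I2)
      fix x
      have "\<bar>u x - v x\<bar> \<le> \<bar>u x\<bar>" unfolding v_def by linarith
      then show "norm ((u x - v x)\<^sup>2) \<le> norm ((u x)\<^sup>2)" by (simp add: abs_le_square_iff)
    qed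
  qed
  have i2: "integrable torus_measure (\<lambda>x. (v x - h n x)\<^sup>2)"
  proof (rule integrable_bounded_torus[where B="(2 * real M)\<^sup>2"])
    show "(\<lambda>x. (v x - h n x)\<^sup>2) \<in> borel_measurable torus_measure"
      by (intro borel_measurable_power borel_measurable_diff vm continuous_borel_torus hc)
    fix x
    have "\<bar>v x - h n x\<bar> \<le> \<bar>2 * real M\<bar>" using vb[of x] hb[of n x] by linarith
    then have "(v x - h n x)\<^sup>2 \<le> (2 * real M)\<^sup>2" by (simp only: abs_le_square_iff)
    then show "norm ((v x - h n x)\<^sup>2) \<le> (2 * real M)\<^sup>2" by simp
  qed
  \<comment> \<open>By \<open>(a + b)^2 \<le> 2 * a^2 + 2 * b^2\<close> each of the two errors
    counts twice, hence the choice of e/4 for both.\<close>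
  have "(LINT x|torus_measure. (u x - h n x)\<^sup>2) \<le> (LINT x|torus_measure. 2 * (u x - v x)\<^sup>2 + 2 * (v x - h n x)\<^sup>2)"
  proof (rule integral_mono')
    show "integrable torus_measure (\<lambda>x. 2 * (u x - v x)\<^sup>2 + 2 * (v x - h n x)\<^sup>2)"
      by (intro Bochner_Integration.integrable_add integrable_mult_right i1 i2)
    fix x
    have "(a + b)\<^sup>2 \<le> 2 * a\<^sup>2 + 2 * b\<^sup>2" for a b :: real using sum_squares_bound[of a b] by (simp add: power2_sum)
    from this[of "u x - v x" "v x - h n x"]
    show "(u x - h n x)\<^sup>2 \<le> 2 * (u x - v x)\<^sup>2 + 2 * (v x - h n x)\<^sup>2" by simp
    show "0 \<le> 2 * (u x - v x)\<^sup>2 + 2 * (v x - h n x)\<^sup>2" by simp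
  qed
  also have "\<dots> = 2 * (LINT x|torus_measure. (u x - v x)\<^sup>2) + 2 * (LINT x|torus_measure. (v x - h n x)\<^sup>2)"
    by (subst Bochner_Integration.integral_add) (auto intro!: integrable_mult_right i1 i2)
  also have "\<dots> < e" using M n unfolding v_def by linarith
  finally show ?thesis using that[of "h n"] hc cut0 by (simp add: h_def)
qed

section \<open>Parseval's identity and Fourier inversion\<close>

text \<open>One inequality is Bessel's. For the other, \<open>u\<close> is within any e of some
  trigonometric polynomial, and the squared distance to such a polynomial is at least the defect in
  Bessel's inequality for its set of frequencies.\<close>

lemma parseval:
  fixes u :: "real^'n \<Rightarrow> real"
  assumes u: "u \<in> L2_torus"
  shows "((\<lambda>k. (cmod (fourier_coeff u k))\<^sup>2) has_sum (LINT x|torus_measure. (u x)\<^sup>2)) UNIV"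
proof -
  let ?f = "\<lambda>k. (cmod (fourier_coeff u k))\<^sup>2"
  have summ: "?f summable_on UNIV"
    by (rule nonneg_bounded_partial_sums_imp_summable_on[where C="LINT x|torus_measure. (u x)\<^sup>2"])
       (auto intro!: eventually_finite_subsets_at_top_weakI bessel_inequality[OF u])
  have le: "infsum ?f UNIV \<le> (LINT x|torus_measure. (u x)\<^sup>2)"
    by (rule infsum_le_finite_sums[OF summ]) (auto intro: bessel_inequality[OF u])
  have ge: "(LINT x|torus_measure. (u x)\<^sup>2) \<le> infsum ?f UNIV + e" if e: "e > 0" for e
  proof -
    obtain h where h: "continuous_on UNIV h" "\<And>x. x \<in> cbox 0 1 - box 0 1 \<Longrightarrow> h x = 0"
      "(LINT x|torus_measure. (u x - h x)\<^sup>2) < e / 4" using L2_approx_continuous[OF u, of "e/4"] e by auto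
    \<comment> \<open>A uniform error sqrt (e/4) contributes at most e/2 after squaring and
      doubling; the L^2 error below e/4 contributes the other half.\<close>
    have sq: "sqrt (e / 4) > 0" using e by simp
    obtain p where p: "trig p" "\<And>x. x \<in> cbox 0 1 \<Longrightarrow> cmod (complex_of_real (h x) - p x) < sqrt (e / 4)"
      using trig_uniform_approx[OF continuous_on_subset[OF h(1)] h(2) sq] by auto
    obtain F c where F: "finite F" "\<And>x. p x = (\<Sum>k\<in>F. c k * mode k x)" using trig_sum_repr[OF p(1)] by blast
    note D = L2_distance_trig_sum[OF u F(1), of c, folded F(2)]
    have im: "integrable torus_measure (\<lambda>x. (u x - h x)\<^sup>2)"
    proof -
      have "integrable torus_measure (\<lambda>x. (u x)\<^sup>2 * 2 + (h x)\<^sup>2 * 2)"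
        using h(1) by (intro Bochner_Integration.integrable_add integrable_mult_left L2_torusD(3)[OF u] 
           integrable_continuous_torus continuous_intros)
      then show ?thesis
      proof (rule Bochner_Integration.integrable_bound)
        show "(\<lambda>x. (u x - h x)\<^sup>2) \<in> borel_measurable torus_measure"
          by (intro borel_measurable_power borel_measurable_diff L2_torusD(2)[OF u] continuous_borel_torus h)
        have "(a - b)\<^sup>2 \<le> a\<^sup>2 * 2 + b\<^sup>2 * 2" for a b :: real
          using sum_squares_bound[of a "- b"] by (simp add: power2_diff)
        then show "AE x in torus_measure. norm ((u x - h x)\<^sup>2) \<le> norm ((u x)\<^sup>2 * 2 + (h x)\<^sup>2 * 2)"
          by (intro AE_I2) (simp add: abs_of_nonneg)
      qed
    qed
    have "(LINT x|torus_measure. (cmod (complex_of_real (u x) - p x))\<^sup>2) \<le> (LINT x|torus_measure. 2 * (u x - h x)\<^sup>2 + e / 2)"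
    proof (rule integral_mono)
      show "integrable torus_measure (\<lambda>x. (cmod (complex_of_real (u x) - p x))\<^sup>2)" by (rule D(1))
      show "integrable torus_measure (\<lambda>x. 2 * (u x - h x)\<^sup>2 + e / 2)"
        by (intro Bochner_Integration.integrable_add integrable_mult_right im L2_integrable L2_const)
      fix x :: "real^'n" assume "x \<in> space torus_measure"
      then have x: "x \<in> cbox 0 1" using torus_subset_cbox by (auto simp: space_restrict_space)
      have "cmod (complex_of_real (u x) - p x) \<le> \<bar>u x - h x\<bar> + cmod (complex_of_real (h x) - p x)"
        by (metis (no_types) add_diff_eq diff_add_cancel norm_of_real norm_triangle_ineq of_real_diff)
      also have "\<dots> \<le> \<bar>u x - h x\<bar> + sqrt (e / 4)" using p(2)[OF x] by simp
      finally have "(cmod (complex_of_real (u x) - p x))\<^sup>2 \<le> (\<bar>u x - h x\<bar> + sqrt (e / 4))\<^sup>2"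
        by (intro power_mono) auto
      also have "\<dots> \<le> 2 * (u x - h x)\<^sup>2 + 2 * (sqrt (e / 4))\<^sup>2"
        using sum_squares_bound[of "\<bar>u x - h x\<bar>" "sqrt (e / 4)"] by (simp add: power2_sum)
      finally show "(cmod (complex_of_real (u x) - p x))\<^sup>2 \<le> 2 * (u x - h x)\<^sup>2 + e / 2" using e by simp
    qed
    also have "\<dots> = 2 * (LINT x|torus_measure. (u x - h x)\<^sup>2) + e / 2"
      by (subst Bochner_Integration.integral_add) (auto intro!: integrable_mult_right im L2_integrable L2_const simp: measure_torus)
    also have "\<dots> \<le> e" using h(3) by linarith
    finally have "(LINT x|torus_measure. (u x)\<^sup>2) - sum ?f F + (\<Sum>k\<in>F. (cmod (c k - fourier_coeff u k))\<^sup>2) \<le> e"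
      using D(2) by simp
    moreover have "0 \<le> (\<Sum>k\<in>F. (cmod (c k - fourier_coeff u k))\<^sup>2)" by (intro sum_nonneg) simp
    moreover have "sum ?f F \<le> infsum ?f UNIV" by (intro finite_sum_le_infsum summ F) auto
    ultimately show ?thesis by linarith
  qed
  have "(LINT x|torus_measure. (u x)\<^sup>2) \<le> infsum ?f UNIV" using ge field_le_epsilon by blast
  with le have "infsum ?f UNIV = (LINT x|torus_measure. (u x)\<^sup>2)" by linarith
  then show ?thesis using summ has_sum_infsum by metis
qed

text \<open>Absolute summability makes the series converge uniformly to a continuous periodic
  \<open>g\<close>. Parseval's identity shows that the partial sums also approach \<open>u\<close>
  in L^2, so \<open>u - g\<close> has zero L^2 norm, and continuity makes the equality
  pointwise.\<close>

lemma fourier_inversion: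
  fixes u :: "real^'n \<Rightarrow> real"
  assumes per: "periodic u" and cont: "continuous_on UNIV u"
    and summ: "(\<lambda>k. cmod (fourier_coeff u k)) summable_on UNIV"
  shows "((\<lambda>k. fourier_coeff u k * mode k x) has_sum complex_of_real (u x)) UNIV"
proof -
  have u: "u \<in> L2_torus" by (rule continuous_periodic_L2[OF per cont])
  let ?t = "\<lambda>k x. fourier_coeff u k * mode k x"
  define g where "g x = (\<Sum>\<^sub>\<infinity>k. ?t k x)" for x
  have ul: "uniform_limit UNIV (\<lambda>F x. \<Sum>k\<in>F. ?t k x) g (finite_subsets_at_top UNIV)"
    unfolding g_def by (rule Weierstrass_m_test_general[OF _ summ]) (simp add: norm_mult)
  have "continuous_on UNIV (\<lambda>x. \<Sum>k\<in>F. ?t k x)" for F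
    by (intro continuous_on_sum continuous_on_mult continuous_on_const continuous_mode)
  then have ev: "\<forall>\<^sub>F F in finite_subsets_at_top UNIV. continuous_on UNIV (\<lambda>x. \<Sum>k\<in>F. ?t k x)"
    by simp
  have contg: "continuous_on UNIV g"
    by (rule uniform_limit_theorem[OF ev ul finite_subsets_at_top_neq_bot])
  have hs: "((\<lambda>k. ?t k x) has_sum g x) UNIV" for x
  proof -
    have "(\<lambda>k. norm (?t k x)) summable_on UNIV" using summ by (simp add: norm_mult)
    then show ?thesis unfolding g_def by (rule has_sum_infsum[OF abs_summable_summable])
  qed
  have perg: "periodic g" unfolding g_def periodic_def by (simp add: periodicD[OF periodic_mode])
  let ?d = "\<lambda>x. (cmod (complex_of_real (u x) - g x))\<^sup>2"
  have dc: "continuous_on UNIV ?d" using cont contg by (intro continuous_intros)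
  have "(LINT x|torus_measure. ?d x) \<le> e" if e: "e > 0" for e
  proof -
    have sq: "sqrt (e / 4) > 0" using e by simp
    have "\<forall>\<^sub>F F in finite_subsets_at_top UNIV. \<forall>x\<in>UNIV. dist (\<Sum>k\<in>F. ?t k x) (g x) < sqrt (e / 4)"
      using ul sq unfolding uniform_limit_iff by blast
    moreover have "\<forall>\<^sub>F F in finite_subsets_at_top UNIV. dist (\<Sum>k\<in>F. (cmod (fourier_coeff u k))\<^sup>2) (LINT x|torus_measure. (u x)\<^sup>2) < e / 4"
      using parseval[OF u] e unfolding has_sum_def by (intro tendstoD) auto
    moreover have "\<forall>\<^sub>F F in finite_subsets_at_top UNIV. finite (F :: (int^'n) set)"
      by (rule eventually_finite_subsets_at_top_weakI)
    ultimately have "\<forall>\<^sub>F F in finite_subsets_at_top UNIV. (\<forall>x\<in>UNIV. dist (\<Sum>k\<in>F. ?t k x) (g x) < sqrt (e / 4)) \<and>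
       dist (\<Sum>k\<in>F. (cmod (fourier_coeff u k))\<^sup>2) (LINT x|torus_measure. (u x)\<^sup>2) < e / 4 \<and> finite (F :: (int^'n) set)"
      by (intro eventually_conj)
    from eventually_happens'[OF finite_subsets_at_top_neq_bot this]
    obtain F where F0: "(\<forall>x\<in>UNIV. dist (\<Sum>k\<in>F. ?t k x) (g x) < sqrt (e / 4)) \<and>
       dist (\<Sum>k\<in>F. (cmod (fourier_coeff u k))\<^sup>2) (LINT x|torus_measure. (u x)\<^sup>2) < e / 4 \<and> finite (F :: (int^'n) set)"
      by (rule exE)
    have F: "\<And>x. dist (\<Sum>k\<in>F. ?t k x) (g x) < sqrt (e / 4)" "finite F"
       "dist (\<Sum>k\<in>F. (cmod (fourier_coeff u k))\<^sup>2) (LINT x|torus_measure. (u x)\<^sup>2) < e / 4"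
      using F0 by simp_all
    note D = L2_distance_trig_sum[OF u F(2), of "fourier_coeff u"]
    have "(LINT x|torus_measure. ?d x) \<le> (LINT x|torus_measure. 2 * (cmod (complex_of_real (u x) - (\<Sum>k\<in>F. ?t k x)))\<^sup>2 + e / 2)"
    proof (rule integral_mono)
      show "integrable torus_measure ?d" by (rule integrable_continuous_torus[OF dc])
      show "integrable torus_measure (\<lambda>x. 2 * (cmod (complex_of_real (u x) - (\<Sum>k\<in>F. ?t k x)))\<^sup>2 + e / 2)"
        by (intro Bochner_Integration.integrable_add integrable_mult_right D(1) L2_integrable L2_const)
      fix x :: "real^'n"
      have "cmod (complex_of_real (u x) - g x) \<le> cmod (complex_of_real (u x) - (\<Sum>k\<in>F. ?t k x)) + cmod ((\<Sum>k\<in>F. ?t k x) - g x)"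
        using norm_triangle_ineq[of "complex_of_real (u x) - (\<Sum>k\<in>F. ?t k x)" "(\<Sum>k\<in>F. ?t k x) - g x"] by simp
      also have "\<dots> \<le> cmod (complex_of_real (u x) - (\<Sum>k\<in>F. ?t k x)) + sqrt (e / 4)"
        using F(1)[of x] by (simp add: dist_norm)
      finally have "?d x \<le> (cmod (complex_of_real (u x) - (\<Sum>k\<in>F. ?t k x)) + sqrt (e / 4))\<^sup>2"
        by (intro power_mono) auto
      also have "\<dots> \<le> 2 * (cmod (complex_of_real (u x) - (\<Sum>k\<in>F. ?t k x)))\<^sup>2 + 2 * (sqrt (e / 4))\<^sup>2"
        using sum_squares_bound[of "cmod (complex_of_real (u x) - (\<Sum>k\<in>F. ?t k x))" "sqrt (e / 4)"] by (simp add: power2_sum)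
      finally show "?d x \<le> 2 * (cmod (complex_of_real (u x) - (\<Sum>k\<in>F. ?t k x)))\<^sup>2 + e / 2" using e by simp
    qed
    also have "\<dots> = 2 * (LINT x|torus_measure. (cmod (complex_of_real (u x) - (\<Sum>k\<in>F. ?t k x)))\<^sup>2) + e / 2"
      by (subst Bochner_Integration.integral_add) (auto intro!: integrable_mult_right D(1) L2_integrable L2_const simp: measure_torus)
    also have "\<dots> \<le> e"
    proof -
      have A: "(LINT x|torus_measure. (cmod (complex_of_real (u x) - (\<Sum>k\<in>F. ?t k x)))\<^sup>2) =
          (LINT x|torus_measure. (u x)\<^sup>2) - (\<Sum>k\<in>F. (cmod (fourier_coeff u k))\<^sup>2)" using D(2) by simp
      have "(LINT x|torus_measure. (u x)\<^sup>2) - (\<Sum>k\<in>F. (cmod (fourier_coeff u k))\<^sup>2) < e / 4"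
        using F(3) unfolding dist_real_def by argo
      then show ?thesis unfolding A by argo
    qed
    finally show ?thesis .
  qed
  then have "(LINT x|torus_measure. ?d x) \<le> 0 + e" if "e > 0" for e using that by simp
  then have "(LINT x|torus_measure. ?d x) \<le> 0" by (rule field_le_epsilon)
  moreover have "0 \<le> (LINT x|torus_measure. ?d x)" by simp
  ultimately have "(LINT x|torus_measure. ?d x) = 0" by linarith
  then have "?d y = 0" if "y \<in> torus" for y
    using continuous_eq_0_of_integral_eq_0[OF dc _ _ that] by simp
  then have eq: "complex_of_real (u y) = g y" if "y \<in> torus" for y using that by simp
  \<comment> \<open>Treating the pair as one periodic map yields a single representative in the cell
    for both functions.\<close>
  obtain y where y: "y \<in> torus" "u y = u x \<and> g y = g x"
    using periodic_torus[of "\<lambda>x. (u x, g x)" x] per perg unfolding periodic_def by auto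
  show ?thesis using hs[of x] eq[OF y(1)] y(2) by simp
qed

section \<open>Sobolev embedding\<close>

text \<open>The symbol of 1 minus the Laplacian, that is, the weight of the Sobolev norms.\<close>

definition lam :: "int^'n \<Rightarrow> real" where
  "lam k = 1 + 4 * pi\<^sup>2 * (\<Sum>j\<in>UNIV. (of_int (k $ j))\<^sup>2)"

lemma sobolev_term_lam: "sobolev_term s u k = lam k powr s * (cmod (fourier_coeff u k))\<^sup>2"
  by (simp add: sobolev_term_def lam_def)

lemma lam_ge_1: "1 \<le> lam k"
  unfolding lam_def by (simp add: sum_nonneg)

lemma lam_pos: "0 < lam k"
  using lam_ge_1[of k] by linarith

lemma lam_ge_component: "1 + (of_int (k $ i))\<^sup>2 \<le> lam k"
proof -
  have "(of_int (k $ i) :: real)\<^sup>2 \<le> (\<Sum>j\<in>UNIV. (of_int (k $ j))\<^sup>2)"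
    by (rule member_le_sum) auto
  also have "\<dots> \<le> 4 * pi\<^sup>2 * (\<Sum>j\<in>UNIV. (of_int (k $ j))\<^sup>2)"
  proof -
    have "1 \<le> pi\<^sup>2" using pi_ge_two by (intro one_le_power) linarith
    then have "1 * (\<Sum>j\<in>UNIV. (of_int (k $ j))\<^sup>2) \<le> 4 * pi\<^sup>2 * (\<Sum>j\<in>UNIV. (of_int (k $ j) :: real)\<^sup>2)"
      by (intro mult_right_mono sum_nonneg) auto
    then show ?thesis by simp
  qed
  finally show ?thesis by (simp add: lam_def)
qed

text \<open>Differentiating a mode costs one factor \<open>lam k powr (1/2)\<close>; this is how one
  extra Sobolev index pays for one derivative.\<close>

lemma abs_phase_le: 
  fixes k :: "int^'n"
  shows "\<bar>phase k h\<bar> \<le> lam k powr (1/2) * norm h"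
proof -
  let ?k = "(\<chi> j. of_int (k $ j)) :: real^'n"
  have "phase k h = 2 * pi * (h \<bullet> ?k)" by (simp add: phase_def inner_vec_def)
  then have "\<bar>phase k h\<bar> = 2 * pi * \<bar>h \<bullet> ?k\<bar>" by (simp add: abs_mult)
  also have "\<dots> \<le> 2 * pi * (norm h * norm ?k)" by (intro mult_left_mono Cauchy_Schwarz_ineq2) simp
  also have "\<dots> = (2 * pi * norm ?k) * norm h" by simp
  also have "\<dots> \<le> lam k powr (1/2) * norm h"
  proof (rule mult_right_mono)
    have "norm ?k = sqrt (\<Sum>j\<in>UNIV. (of_int (k $ j))\<^sup>2)"
      by (simp add: norm_vec_def L2_set_def)
    then have "2 * pi * norm ?k = sqrt ((2 * pi)\<^sup>2 * (\<Sum>j\<in>UNIV. (of_int (k $ j))\<^sup>2))"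
      by (simp add: real_sqrt_mult)
    also have "\<dots> \<le> sqrt (lam k)" unfolding lam_def by (intro real_sqrt_le_mono) (simp add: power_mult_distrib)
    finally show "2 * pi * norm ?k \<le> lam k powr (1/2)" using lam_pos[of k] by (simp add: powr_half_sqrt less_imp_le)
  qed simp
  finally show ?thesis .
qed

text \<open>Comparison with the series of \<open>n powr (- 2 * p)\<close>, whose exponent is beyond
  the threshold 1; negative indices are folded onto positive ones.\<close>

lemma int_weight_sum_bounded:
  assumes "p > 1/2"
  obtains A where "\<And>G :: int set. finite G \<Longrightarrow> (\<Sum>j\<in>G. (1 + (of_int j)\<^sup>2) powr (-p)) \<le> (A::real)"
proof -
  let ?f = "\<lambda>j::int. (1 + (of_int j)\<^sup>2 :: real) powr (-p)"
  let ?a = "\<lambda>n::nat. ?f (int n)"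
  have "summable (\<lambda>n. real n powr (- 2 * p))" using assms by (subst summable_real_powr_iff) linarith
  then have sm: "summable ?a"
  proof (rule summable_comparison_test'[where N=1])
    fix n :: nat assume n: "1 \<le> n"
    have "?a n \<le> ((real n)\<^sup>2) powr (-p)"
      using n assms by (intro powr_mono2') auto
    also have "\<dots> = (real n powr 2) powr (-p)" using n by simp
    also have "\<dots> = real n powr (2 * (-p))" by (rule powr_powr)
    finally show "norm (?a n) \<le> real n powr (- 2 * p)" by simp
  qed
  have "(\<Sum>j\<in>G. ?f j) \<le> 2 * suminf ?a" if G: "finite G" for G
  proof -
    obtain N where N: "\<And>j. j \<in> G \<Longrightarrow> nat \<bar>j\<bar> \<le> N"
      using finite_nat_set_iff_bounded_le[THEN iffD1, of "(\<lambda>j. nat \<bar>j\<bar>) ` G"] G by auto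
    have "(\<Sum>j\<in>G. ?f j) \<le> (\<Sum>j \<in> int ` {..N} \<union> (\<lambda>n. - int n) ` {..N}. ?f j)"
    proof (rule sum_mono2)
      show "G \<subseteq> int ` {..N} \<union> (\<lambda>n. - int n) ` {..N}"
      proof
        fix j assume "j \<in> G"
        then have "nat \<bar>j\<bar> \<in> {..N}" using N by simp
        moreover have "j = int (nat \<bar>j\<bar>) \<or> j = - int (nat \<bar>j\<bar>)" by linarith
        ultimately show "j \<in> int ` {..N} \<union> (\<lambda>n. - int n) ` {..N}" by blast
      qed
    qed auto
    also have "\<dots> \<le> (\<Sum>j \<in> int ` {..N}. ?f j) + (\<Sum>j \<in> (\<lambda>n. - int n) ` {..N}. ?f j)"
    proof -
      have "(\<Sum>j \<in> A \<union> B. ?f j) \<le> (\<Sum>j\<in>A. ?f j) + (\<Sum>j\<in>B. ?f j)" if "finite A" "finite B" for A B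
        using sum_Un[OF that, of ?f] by (simp add: sum_nonneg)
      then show ?thesis by simp
    qed
    also have "\<dots> = 2 * (\<Sum>n\<le>N. ?a n)"
      by (simp add: sum.reindex inj_on_def)
    also have "\<dots> \<le> 2 * suminf ?a" using sum_le_suminf[OF sm, of "{..N}"] by simp
    finally show ?thesis .
  qed
  then show ?thesis using that by blast
qed

text \<open>Writing \<open>lam k powr (-s)\<close> as a product of d equal factors and bounding the
  i-th one through \<open>1 + (k $ i)^2 \<le> lam k\<close> separates the variables. Each
  one-dimensional series has exponent s/d > 1/2 and converges.\<close>

lemma summable_lam:
  assumes s: "s > real CARD('n) / 2"
  shows "(\<lambda>k::int^'n. lam k powr (-s)) summable_on UNIV"
proof -
  let ?d = "real CARD('n)"
  have d: "?d > 0" by simp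
  have "s / ?d > 1/2" using s d by (simp add: field_simps)
  then obtain A where A: "\<And>G :: int set. finite G \<Longrightarrow> (\<Sum>j\<in>G. (1 + (of_int j)\<^sup>2) powr (- (s / ?d))) \<le> (A::real)"
    using int_weight_sum_bounded by blast
  let ?f = "\<lambda>j::int. (1 + (of_int j)\<^sup>2 :: real) powr (- (s / ?d))"
  have s0: "s \<ge> 0" using s d by (smt (verit) divide_nonneg_pos)
  show ?thesis
  proof (rule nonneg_bounded_partial_sums_imp_summable_on[where C="A ^ CARD('n)"])
    show "\<forall>\<^sub>F F in finite_subsets_at_top UNIV. (\<Sum>k\<in>F. lam (k::int^'n) powr (-s)) \<le> A ^ CARD('n)"
    proof (rule eventually_finite_subsets_at_top_weakI)
      fix F :: "(int^'n) set" assume F: "finite F"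
      \<comment> \<open>All entries that occur in \<open>F\<close>; the sum over the cube with side
        \<open>G\<close> contains the sum over \<open>F\<close> and factors.\<close>
      define G where "G = (\<Union>k\<in>F. range (($) k))"
      have G: "finite G" using F by (auto simp: G_def)
      have "(\<Sum>k\<in>F. lam k powr (-s)) \<le> (\<Sum>k\<in>F. \<Prod>i\<in>UNIV. ?f (k $ i))"
      proof (rule sum_mono)
        fix k :: "int^'n"
        have "lam k powr (-s) = (\<Prod>i\<in>(UNIV::'n set). lam k powr (- (s / ?d)))"
          using lam_pos[of k] by (simp add: powr_powr flip: powr_realpow)
        also have "\<dots> \<le> (\<Prod>i\<in>UNIV. ?f (k $ i))"
          using s0 by (intro prod_mono conjI powr_mono2' lam_ge_component) (auto simp: add_pos_nonneg)
        finally show "lam k powr (-s) \<le> (\<Prod>i\<in>UNIV. ?f (k $ i))" .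
      qed
      also have "\<dots> = (\<Sum>g\<in>($) ` F. \<Prod>i\<in>(UNIV::'n set). ?f (g i))"
        by (subst sum.reindex) (auto simp: inj_on_def vec_nth_inject)
      also have "\<dots> \<le> (\<Sum>g\<in>PiE (UNIV::'n set) (\<lambda>_. G). \<Prod>i\<in>UNIV. ?f (g i))"
      proof (rule sum_mono2)
        show "finite ((UNIV::'n set) \<rightarrow>\<^sub>E G)" by (intro finite_PiE G finite)
        show "($) ` F \<subseteq> (UNIV::'n set) \<rightarrow>\<^sub>E G" by (auto simp: G_def)
        show "0 \<le> (\<Prod>i\<in>UNIV. ?f (g i))" for g by (intro prod_nonneg) simp
      qed
      also have "\<dots> = (\<Prod>i\<in>(UNIV::'n set). \<Sum>j\<in>G. ?f j)"
        by (rule prod_sum_PiE[symmetric]) (auto simp: G)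
      also have "\<dots> \<le> (\<Prod>i\<in>(UNIV::'n set). A)"
        by (intro prod_mono conjI sum_nonneg A G) auto
      finally show "(\<Sum>k\<in>F. lam k powr (-s)) \<le> A ^ CARD('n)" by simp
    qed
  qed auto
qed

text \<open>The Sobolev embedding constant that Cauchy-Schwarz produces. The first argument only
  carries the dimension, as a type.\<close>

definition emb :: "'n::finite itself \<Rightarrow> real \<Rightarrow> real" where
  "emb _ s = sqrt (\<Sum>\<^sub>\<infinity>k::int^'n. lam k powr (-s))"

lemma emb_nonneg: "0 \<le> emb TYPE('n::finite) s"
  unfolding emb_def by (simp add: infsum_nonneg)

lemma sobolev_term_nonneg: "0 \<le> sobolev_term s u k"
  by (simp add: sobolev_term_def)

lemma sobolev_norm_nonneg: "0 \<le> sobolev_norm s u"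
  unfolding sobolev_norm_def by (simp add: infsum_nonneg sobolev_term_nonneg)

lemma sobolev_norm_sq: "(sobolev_norm s u)\<^sup>2 = (\<Sum>\<^sub>\<infinity>k. sobolev_term s u k)"
  unfolding sobolev_norm_def by (simp add: infsum_nonneg sobolev_term_nonneg)

lemma sobolevD:
  assumes "u \<in> sobolev s"
  shows "u \<in> L2_torus" "sobolev_term s u summable_on UNIV"
  using assms unfolding sobolev_def by blast+

lemma sobolev_continuous:
  fixes u :: "real^'n \<Rightarrow> real"
  assumes "u \<in> sobolev s" "s > real CARD('n) / 2"
  shows "continuous_on UNIV u"
  using assms unfolding sobolev_def by blast

lemma sobolev_finite_sum_le:
  assumes "u \<in> sobolev s" "finite F"
  shows "(\<Sum>k\<in>F. sobolev_term s u k) \<le> (sobolev_norm s u)\<^sup>2"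
  unfolding sobolev_norm_sq using assms 
  by (intro finite_sum_le_infsum sobolevD(2)[OF assms(1)]) (auto simp: sobolev_term_nonneg)

text \<open>Cauchy-Schwarz after splitting the weight as \<open>lam k powr (- s / 2)\<close> times
  \<open>lam k powr ((s + r) / 2)\<close>. The case r = 0 bounds the function itself, r = 1 its
  gradient.\<close>

lemma weighted_coeff_sum_le:
  fixes u :: "real^'n \<Rightarrow> real"
  assumes s: "s > real CARD('n) / 2" and u: "u \<in> sobolev (s + r)" and F: "finite F"
  shows "(\<Sum>k\<in>F. lam k powr (r / 2) * cmod (fourier_coeff u k)) \<le> emb TYPE('n) s * sobolev_norm (s + r) u"
proof -
  let ?a = "\<lambda>k::int^'n. lam k powr (- s / 2)" and ?b = "\<lambda>k. lam k powr ((s + r) / 2) * cmod (fourier_coeff u k)"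
  have "(\<Sum>k\<in>F. lam k powr (r / 2) * cmod (fourier_coeff u k)) = (\<Sum>k\<in>F. \<bar>?a k\<bar> * \<bar>?b k\<bar>)"
    by (intro sum.cong refl) (simp add: abs_mult mult.assoc[symmetric] add_divide_distrib flip: powr_add)
  also have "\<dots> \<le> L2_set ?a F * L2_set ?b F" by (rule L2_set_mult_ineq)
  also have "\<dots> \<le> emb TYPE('n) s * sobolev_norm (s + r) u"
  proof (rule mult_mono)
    have "(\<Sum>k\<in>F. (?a k)\<^sup>2) = (\<Sum>k\<in>F. lam k powr (- s))"
      using lam_pos by (intro sum.cong refl) (simp add: power2_eq_square flip: powr_add)
    also have "\<dots> \<le> (\<Sum>\<^sub>\<infinity>k::int^'n. lam k powr (-s))"
      using summable_lam[OF s] F by (intro finite_sum_le_infsum) auto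
    finally show "L2_set ?a F \<le> emb TYPE('n) s" unfolding L2_set_def emb_def by (rule real_sqrt_le_mono)
    have "(\<Sum>k\<in>F. (?b k)\<^sup>2) = (\<Sum>k\<in>F. sobolev_term (s + r) u k)"
      using lam_pos by (intro sum.cong refl) 
        (simp add: sobolev_term_lam power_mult_distrib power2_eq_square[of "_ powr _"] flip: powr_add)
    also have "\<dots> \<le> (sobolev_norm (s + r) u)\<^sup>2" by (rule sobolev_finite_sum_le[OF u F])
    finally show "L2_set ?b F \<le> sobolev_norm (s + r) u" unfolding L2_set_def
      using real_sqrt_le_mono sobolev_norm_nonneg real_sqrt_abs abs_of_nonneg by metis
  qed (auto simp: emb_nonneg L2_set_nonneg)
  finally show ?thesis .
qed

lemma weighted_coeff_summable:
  fixes u :: "real^'n \<Rightarrow> real"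
  assumes s: "s > real CARD('n) / 2" and u: "u \<in> sobolev (s + r)"
  shows "(\<lambda>k. lam k powr (r / 2) * cmod (fourier_coeff u k)) summable_on UNIV"
    "(\<Sum>\<^sub>\<infinity>k. lam k powr (r / 2) * cmod (fourier_coeff u k)) \<le> emb TYPE('n) s * sobolev_norm (s + r) u"
proof -
  show sm: "(\<lambda>k. lam k powr (r / 2) * cmod (fourier_coeff u k)) summable_on UNIV"
    by (rule nonneg_bounded_partial_sums_imp_summable_on[where C="emb TYPE('n) s * sobolev_norm (s + r) u"])
      (auto intro!: eventually_finite_subsets_at_top_weakI weighted_coeff_sum_le[OF s u])
  show "(\<Sum>\<^sub>\<infinity>k. lam k powr (r / 2) * cmod (fourier_coeff u k)) \<le> emb TYPE('n) s * sobolev_norm (s + r) u"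
    by (rule infsum_le_finite_sums[OF sm]) (auto intro: weighted_coeff_sum_le[OF s u])
qed

lemma sobolev_fourier_inversion:
  fixes u :: "real^'n \<Rightarrow> real"
  assumes s: "s > real CARD('n) / 2" and u: "u \<in> sobolev s"
  shows "((\<lambda>k. fourier_coeff u k * mode k x) has_sum complex_of_real (u x)) UNIV"
proof (rule fourier_inversion)
  show "periodic u" using L2_torusD(1)[OF sobolevD(1)[OF u]] .
  show "continuous_on UNIV u" using sobolev_continuous[OF u s] .
  show "(\<lambda>k. cmod (fourier_coeff u k)) summable_on UNIV"
  proof -
    have "lam k \<noteq> 0" for k :: "int^'n" using lam_pos[of k] by simp
    then show ?thesis using weighted_coeff_summable(1)[OF s, of u 0] u by simp
  qed
qed

lemma sobolev_sup_bound:
  fixes u :: "real^'n \<Rightarrow> real"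
  assumes s: "s > real CARD('n) / 2" and u: "u \<in> sobolev s"
  shows "\<bar>u x\<bar> \<le> emb TYPE('n) s * sobolev_norm s u"
proof -
  have n0: "lam k \<noteq> 0" for k :: "int^'n" using lam_pos[of k] by simp
  have sm: "(\<lambda>k. cmod (fourier_coeff u k)) summable_on UNIV"
    using weighted_coeff_summable(1)[OF s, of u 0] u n0 by simp
  have "complex_of_real (u x) = (\<Sum>\<^sub>\<infinity>k. fourier_coeff u k * mode k x)"
    by (rule infsumI[OF sobolev_fourier_inversion[OF s u], symmetric])
  then have "\<bar>u x\<bar> = cmod (\<Sum>\<^sub>\<infinity>k. fourier_coeff u k * mode k x)" by (metis norm_of_real)
  also have "\<dots> \<le> (\<Sum>\<^sub>\<infinity>k. cmod (fourier_coeff u k * mode k x))"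
    by (rule norm_infsum_bound) (simp add: norm_mult sm)
  also have "\<dots> = (\<Sum>\<^sub>\<infinity>k. cmod (fourier_coeff u k))" by (simp add: norm_mult)
  also have "\<dots> \<le> emb TYPE('n) s * sobolev_norm s u"
    using weighted_coeff_summable(2)[OF s, of u 0] u n0 by simp
  finally show ?thesis .
qed

lemma infinite_int_vec: "infinite (UNIV :: (int^'n) set)"
proof
  assume "finite (UNIV :: (int^'n) set)"
  then have "finite (range (\<lambda>m::int. (\<chi> i. m) :: int^'n))" by (rule finite_subset[rotated]) simp
  moreover have "inj (\<lambda>m::int. (\<chi> i. m) :: int^'n)" by (auto simp: inj_def vec_eq_iff)
  ultimately show False using finite_imageD infinite_UNIV_int by blast
qed

text \<open>Termwise differentiation of the Fourier series: the differentiated terms have a summable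
  majorant independent of the point, whose sum is controlled by the H^(s+1) norm.\<close>

lemma sobolev_C1:
  fixes u :: "real^'n \<Rightarrow> real"
  assumes s: "s > real CARD('n) / 2" and u: "u \<in> sobolev (s + 1)"
  shows "u \<in> C1_torus" "\<bar>classical_partial i u x\<bar> \<le> emb TYPE('n) s * sobolev_norm (s + 1) u"
proof -
  \<comment> \<open>The frequencies are put in a sequence, since the theorem on differentiating
    series speaks of sequences.\<close>
  obtain \<kappa> :: "nat \<Rightarrow> int^'n" where \<kappa>: "bij \<kappa>"
    using bij_betw_from_nat_into[OF countableI_type infinite_int_vec] by blast
  define M where "M n = lam (\<kappa> n) powr (1/2) * cmod (fourier_coeff u (\<kappa> n))" for n
  let ?c = "\<lambda>n. fourier_coeff u (\<kappa> n)"
  \<comment> \<open>\<open>f n\<close> is the real part of the n-th term of the series and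
    \<open>d n\<close> its derivative with respect to the phase, so
    \<open>d n x * phase (\<kappa> n) h\<close> is the directional derivative of \<open>f n\<close>
    along \<open>h\<close>.\<close>
  define f where "f n x = Re (?c n) * cos (phase (\<kappa> n) x) - Im (?c n) * sin (phase (\<kappa> n) x)" for n x
  define d where "d n x = - Re (?c n) * sin (phase (\<kappa> n) x) - Im (?c n) * cos (phase (\<kappa> n) x)" for n x
  have "(\<lambda>n. M n) summable_on UNIV"
    unfolding M_def using summable_on_reindex_bij_betw[of \<kappa> UNIV UNIV "\<lambda>k. lam k powr (1/2) * cmod (fourier_coeff u k)"]
      weighted_coeff_summable(1)[OF s u] \<kappa> by simp
  then have Ms: "summable M" by (rule summable_on_imp_summable)
  have M0: "0 \<le> M n" for n by (simp add: M_def)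
  have Mle: "suminf M \<le> emb TYPE('n) s * sobolev_norm (s + 1) u"
  proof (rule suminf_le_const[OF Ms])
    fix n
    have "sum M {..<n} = (\<Sum>k\<in>\<kappa> ` {..<n}. lam k powr (1/2) * cmod (fourier_coeff u k))"
      using \<kappa> by (subst sum.reindex) (auto simp: M_def bij_def inj_on_def)
    also have "\<dots> \<le> emb TYPE('n) s * sobolev_norm (s + 1) u"
      by (rule weighted_coeff_sum_le[OF s u]) simp
    finally show "sum M {..<n} \<le> emb TYPE('n) s * sobolev_norm (s + 1) u" .
  qed
  have dle: "\<bar>d n x * phase (\<kappa> n) h\<bar> \<le> M n * norm h" for n x h
  proof -
    have "d n x = - Im (?c n * mode (\<kappa> n) x)" by (simp add: d_def mode_def)
    then have "\<bar>d n x\<bar> \<le> cmod (?c n * mode (\<kappa> n) x)" using abs_Im_le_cmod by (metis abs_minus)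
    then have "\<bar>d n x\<bar> \<le> cmod (?c n)" by (simp add: norm_mult)
    then have "\<bar>d n x * phase (\<kappa> n) h\<bar> \<le> cmod (?c n) * (lam (\<kappa> n) powr (1/2) * norm h)"
      unfolding abs_mult by (intro mult_mono abs_phase_le) auto
    then show ?thesis by (simp add: M_def mult_ac)
  qed
  have sd: "summable (\<lambda>n. d n x * phase (\<kappa> n) h)" for x h
    by (rule summable_comparison_test'[OF summable_mult2[OF Ms, of "norm h"], of 0]) (simp add: dle)
  define g' where "g' x h = (\<Sum>n. d n x * phase (\<kappa> n) h)" for x h
  have fs: "(\<lambda>n. f n x) sums u x" for x
  proof -
    have s1: "s + 1 > real CARD('n) / 2" using s by linarith
    have "((\<lambda>k. fourier_coeff u k * mode k x) has_sum complex_of_real (u x)) UNIV"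
      by (rule sobolev_fourier_inversion[OF s1 u])
    then have "((\<lambda>n. ?c n * mode (\<kappa> n) x) has_sum complex_of_real (u x)) UNIV"
      using has_sum_reindex_bij_betw[of \<kappa> UNIV UNIV "\<lambda>k. fourier_coeff u k * mode k x"] \<kappa> by simp
    then have "(\<lambda>n. ?c n * mode (\<kappa> n) x) sums complex_of_real (u x)" by (rule has_sum_imp_sums)
    then have "(\<lambda>n. Re (?c n * mode (\<kappa> n) x)) sums Re (complex_of_real (u x))" by (rule sums_Re)
    then show ?thesis by (simp add: f_def mode_def)
  qed
  have tail: "\<forall>\<^sub>F n in sequentially. \<forall>x\<in>UNIV. \<forall>h. norm ((\<Sum>i<n. d i x * phase (\<kappa> i) h) - g' x h) \<le> e * norm h" if e: "e > 0" for e
  proof -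
    have "\<forall>\<^sub>F n in sequentially. norm (\<Sum>i. M (i + n)) < e"
      using suminf_exist_split[OF e Ms] by (auto simp: eventually_sequentially)
    then show ?thesis
    proof eventually_elim
      case (elim n)
      show ?case
      proof (intro ballI allI)
        fix x h
        have "g' x h - (\<Sum>i<n. d i x * phase (\<kappa> i) h) = (\<Sum>i. d (i + n) x * phase (\<kappa> (i + n)) h)"
          unfolding g'_def using suminf_minus_initial_segment[OF sd] by simp
        then have "norm ((\<Sum>i<n. d i x * phase (\<kappa> i) h) - g' x h) = norm (\<Sum>i. d (i + n) x * phase (\<kappa> (i + n)) h)"
          by (subst norm_minus_commute) (rule arg_cong)
        also have "\<dots> \<le> (\<Sum>i. M (i + n) * norm h)"
        proof (rule norm_suminf_le)
          show "norm (d (i + n) x * phase (\<kappa> (i + n)) h) \<le> M (i + n) * norm h" for i using dle by simp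
          show "summable (\<lambda>i. M (i + n) * norm h)" using Ms by (intro summable_mult2) simp
        qed
        also have "\<dots> = (\<Sum>i. M (i + n)) * norm h" using Ms by (intro suminf_mult2[symmetric]) simp
        also have "\<dots> \<le> e * norm h" using elim by (intro mult_right_mono) auto
        finally show "norm ((\<Sum>i<n. d i x * phase (\<kappa> i) h) - g' x h) \<le> e * norm h" .
      qed
    qed
  qed
  have fd: "(f n has_derivative (\<lambda>h. d n x * phase (\<kappa> n) h)) (at x within UNIV)" for n x
    unfolding f_def d_def
    using has_derivative_diff[OF has_derivative_mult_right[OF has_derivative_cos_phase[of "\<kappa> n" x], of "Re (?c n)"]
       has_derivative_mult_right[OF has_derivative_sin_phase[of "\<kappa> n" x], of "Im (?c n)"]]
    by (rule has_derivative_eq_rhs) (simp add: fun_eq_iff algebra_simps)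
  obtain g where g: "\<And>x. (\<lambda>n. f n x) sums g x" "\<And>x. (g has_derivative g' x) (at x)"
    using has_derivative_series[OF convex_UNIV fd tail UNIV_I fs[of 0]] by blast
  have "g = u" using g(1) fs sums_unique2 by blast
  then have du: "(u has_derivative g' x) (at x)" for x using g(2) by simp
  have per: "periodic u" using L2_torusD(1)[OF sobolevD(1)[OF u]] .
  have cg: "continuous_on UNIV (\<lambda>x. g' x (axis i 1))" for i
    unfolding g'_def
  proof (rule uniform_limit_theorem)
    show "uniform_limit UNIV (\<lambda>n x. \<Sum>m<n. d m x * phase (\<kappa> m) (axis i 1)) (\<lambda>x. \<Sum>m. d m x * phase (\<kappa> m) (axis i 1)) sequentially"
      by (rule Weierstrass_m_test[OF _ Ms]) (use dle[of _ _ "axis i 1"] in simp)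
    show "\<forall>\<^sub>F n in sequentially. continuous_on UNIV (\<lambda>x. \<Sum>m<n. d m x * phase (\<kappa> m) (axis i 1))"
      unfolding d_def by (intro always_eventually allI continuous_intros)
  qed simp
  show "u \<in> C1_torus" by (rule C1_torusI(1)[OF per du cg])
  have "classical_partial i u x = g' x (axis i 1)" using C1_torusI(2)[OF per du cg] by metis
  also have "\<bar>\<dots>\<bar> \<le> suminf M"
    unfolding g'_def real_norm_def[symmetric]
    by (rule norm_suminf_le[OF _ Ms]) (use dle[of _ x "axis i 1"] in simp)
  finally show "\<bar>classical_partial i u x\<bar> \<le> emb TYPE('n) s * sobolev_norm (s + 1) u" using Mle by linarith
qed

section \<open>The inner product of square-integrable functions\<close>

lemma l2_inner_eq: "l2_inner u v = (LINT x|torus_measure. u x * v x)" for u v :: "real^'n \<Rightarrow> real"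
  by (simp add: l2_inner_def)

lemma l2_inner_self: "l2_inner u u = (LINT x|torus_measure. (u x)\<^sup>2)" for u :: "real^'n \<Rightarrow> real"
  by (simp add: l2_inner_def power2_eq_square)

lemma l2_inner_self_nonneg: "0 \<le> l2_inner u u" for u :: "real^'n \<Rightarrow> real"
  by (simp add: l2_inner_self)

lemma l2_inner_commute: "l2_inner u v = l2_inner v u"
  by (simp add: l2_inner_def inner_commute)

lemma l2_inner_scale: "l2_inner (\<lambda>x. c * u x) v = c * l2_inner u v" for u v :: "real^'n \<Rightarrow> real"
  by (simp add: l2_inner_eq mult.assoc)

lemma l2_inner_scale_right: "l2_inner u (\<lambda>x. c * v x) = c * l2_inner u v" for u v :: "real^'n \<Rightarrow> real"
  using l2_inner_scale[of c v u] by (simp add: l2_inner_commute)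

lemma l2_inner_add:
  assumes "u \<in> L2_torus" "v \<in> L2_torus" "w \<in> L2_torus"
  shows "l2_inner (\<lambda>x. u x + v x) w = l2_inner u w + l2_inner v w"
  using Bochner_Integration.integral_add[OF L2_integrable_mult[OF assms(1,3)] L2_integrable_mult[OF assms(2,3)]]
  by (simp add: l2_inner_eq ring_distribs)

lemma l2_inner_diff:
  assumes "u \<in> L2_torus" "v \<in> L2_torus" "w \<in> L2_torus"
  shows "l2_inner (\<lambda>x. u x - v x) w = l2_inner u w - l2_inner v w"
  using Bochner_Integration.integral_diff[OF L2_integrable_mult[OF assms(1,3)] L2_integrable_mult[OF assms(2,3)]]
  by (simp add: l2_inner_eq ring_distribs)

lemma l2_inner_diff_right:
  assumes "u \<in> L2_torus" "v \<in> L2_torus" "w \<in> L2_torus"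
  shows "l2_inner w (\<lambda>x. u x - v x) = l2_inner w u - l2_inner w v"
  using l2_inner_diff[OF assms] by (simp add: l2_inner_commute)

lemma l2_inner_sum:
  assumes "finite I" "\<And>i. i \<in> I \<Longrightarrow> u i \<in> L2_torus" "w \<in> L2_torus"
  shows "l2_inner (\<lambda>x. \<Sum>i\<in>I. u i x) w = (\<Sum>i\<in>I. l2_inner (u i) w)"
  using Bochner_Integration.integral_sum[of I torus_measure "\<lambda>i x. u i x * w x"] L2_integrable_mult[OF assms(2,3)]
  by (simp add: l2_inner_eq sum_distrib_right)

text \<open>The quadratic polynomial in t given by the squared norm of \<open>u - t v\<close> is
  nonnegative.\<close>

lemma l2_cauchy_schwarz:
  fixes u v :: "real^'n \<Rightarrow> real"
  assumes u: "u \<in> L2_torus" and v: "v \<in> L2_torus"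
  shows "\<bar>l2_inner u v\<bar> \<le> sqrt (l2_inner u u) * sqrt (l2_inner v v)"
proof -
  let ?A = "l2_inner u u" and ?B = "l2_inner v v" and ?C = "l2_inner u v"
  have q: "0 \<le> ?A - 2 * t * ?C + t\<^sup>2 * ?B" for t
  proof -
    have w: "(\<lambda>x. u x - t * v x) \<in> L2_torus" by (intro L2_diff L2_scale u v)
    have "0 \<le> l2_inner (\<lambda>x. u x - t * v x) (\<lambda>x. u x - t * v x)" by (rule l2_inner_self_nonneg)
    also have "\<dots> = l2_inner u (\<lambda>x. u x - t * v x) - t * l2_inner v (\<lambda>x. u x - t * v x)"
      using l2_inner_diff[OF u L2_scale[OF v] w] by (simp add: l2_inner_scale)
    also have "\<dots> = ?A - t * ?C - t * (?C - t * ?B)"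
      using l2_inner_diff_right[OF u L2_scale[OF v] u, of t] l2_inner_diff_right[OF u L2_scale[OF v] v, of t]
        l2_inner_scale[of t v u] l2_inner_scale[of t v v]
      by (simp add: l2_inner_commute)
    finally show ?thesis by (simp add: power2_eq_square algebra_simps)
  qed
  have "?C\<^sup>2 \<le> ?A * ?B"
  proof (cases "?B = 0")
    case True
    have "?C = 0"
    proof (rule ccontr)
      assume "?C \<noteq> 0"
      \<comment> \<open>For a vanishing quadratic coefficient this value of t would make the
        polynomial equal to -1.\<close>
      then have "2 * ((?A + 1) / (2 * ?C)) * ?C = ?A + 1" by (simp add: field_simps)
      then show False using q[of "(?A + 1) / (2 * ?C)"] True by simp
    qed
    then show ?thesis using True by simp
  next
    case False
    then have B: "?B > 0" using l2_inner_self_nonneg[of v] by linarith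
    have "2 * (?C / ?B) * ?C = 2 * (?C\<^sup>2 / ?B)" "(?C / ?B)\<^sup>2 * ?B = ?C\<^sup>2 / ?B"
      using B by (simp_all add: power2_eq_square)
    then have "0 \<le> ?A - ?C\<^sup>2 / ?B" using q[of "?C / ?B"] by linarith
    then show ?thesis using B by (simp add: field_simps)
  qed
  then have "sqrt (?C\<^sup>2) \<le> sqrt (?A * ?B)" by (rule real_sqrt_le_mono)
  then show ?thesis by (simp add: real_sqrt_mult)
qed

lemma l2_inner_vec:
  fixes v w :: "real^'n \<Rightarrow> real^'m"
  assumes "\<And>i. (\<lambda>x. v x $ i) \<in> L2_torus" "\<And>i. (\<lambda>x. w x $ i) \<in> L2_torus"
  shows "l2_inner v w = (\<Sum>i\<in>UNIV. l2_inner (\<lambda>x. v x $ i) (\<lambda>x. w x $ i))"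
  unfolding l2_inner_eq unfolding l2_inner_def inner_vec_def inner_real_def
  by (rule Bochner_Integration.integral_sum) (rule L2_integrable_mult[OF assms])

text \<open>Cosine and sine tests are the real and imaginary parts of the Fourier coefficients, and
  Parseval's identity recovers the norm from these.\<close>

lemma L2_eq_0_AE:
  fixes u :: "real^'n \<Rightarrow> real"
  assumes u: "u \<in> L2_torus" and c: "\<And>k. l2_inner u (\<lambda>x. cos (phase k x)) = 0" "\<And>k. l2_inner u (\<lambda>x. sin (phase k x)) = 0"
  shows "AE x in torus_measure. u x = 0"
proof -
  have "fourier_coeff u k = 0" for k
    using Re_fourier_coeff[OF u, of k] c by (simp add: complex_eq_iff)
  then have "((\<lambda>k::int^'n. 0::real) has_sum (LINT x|torus_measure. (u x)\<^sup>2)) UNIV"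
    using parseval[OF u] by simp
  then have "(LINT x|torus_measure. (u x)\<^sup>2) = 0" by (metis infsumI infsum_0)
  then have "AE x in torus_measure. (u x)\<^sup>2 = 0"
    using integral_nonneg_eq_0_iff_AE[OF L2_torusD(3)[OF u]] by simp
  then show ?thesis by simp
qed

section \<open>Sobolev spaces as vector spaces\<close>

lemma sobolev_mono:
  assumes "r \<le> s" "u \<in> sobolev s"
  shows "u \<in> sobolev r" "sobolev_norm r u \<le> sobolev_norm s u"
proof -
  have le: "sobolev_term r u k \<le> sobolev_term s u k" for k
    unfolding sobolev_term_lam using assms(1) lam_ge_1 by (intro mult_right_mono powr_mono) auto
  have sm: "sobolev_term r u summable_on UNIV"
    by (rule summable_on_comparison_test[OF sobolevD(2)[OF assms(2)]]) (auto intro: le sobolev_term_nonneg)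
  show "u \<in> sobolev r" using sm assms unfolding sobolev_def by auto
  show "sobolev_norm r u \<le> sobolev_norm s u"
    unfolding sobolev_norm_def by (intro real_sqrt_le_mono infsum_mono sm sobolevD(2)[OF assms(2)] le)
qed

lemma l2_le_sobolev_norm:
  fixes u :: "real^'n \<Rightarrow> real"
  assumes "0 \<le> s" "u \<in> sobolev s"
  shows "l2_inner u u \<le> (sobolev_norm s u)\<^sup>2"
proof -
  have u0: "u \<in> sobolev 0" by (rule sobolev_mono[OF assms])
  have "(sobolev_norm 0 u)\<^sup>2 = (\<Sum>\<^sub>\<infinity>k. (cmod (fourier_coeff u k))\<^sup>2)"
  proof -
    have "lam k \<noteq> 0" for k :: "int^'n" using lam_pos[of k] by simp
    then show ?thesis unfolding sobolev_norm_sq by (intro infsum_cong) (simp add: sobolev_term_lam)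
  qed
  also have "\<dots> = l2_inner u u"
    unfolding l2_inner_self using parseval[OF sobolevD(1)[OF u0]] by (rule infsumI)
  finally have "l2_inner u u = (sobolev_norm 0 u)\<^sup>2" ..
  also have "\<dots> \<le> (sobolev_norm s u)\<^sup>2"
    by (intro power_mono sobolev_mono[OF assms] sobolev_norm_nonneg)
  finally show ?thesis .
qed

lemma sobolev_term_add:
  assumes "u \<in> L2_torus" "v \<in> L2_torus"
  shows "sobolev_term s (\<lambda>x. u x + v x) k \<le> 2 * sobolev_term s u k + 2 * sobolev_term s v k"
proof -
  have "cmod (fourier_coeff (\<lambda>x. u x + v x) k) \<le> cmod (fourier_coeff u k) + cmod (fourier_coeff v k)"
    unfolding fourier_coeff_add[OF assms] by (rule norm_triangle_ineq)
  then have "(cmod (fourier_coeff (\<lambda>x. u x + v x) k))\<^sup>2 \<le> (cmod (fourier_coeff u k) + cmod (fourier_coeff v k))\<^sup>2"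
    by (intro power_mono) auto
  also have "\<dots> \<le> 2 * (cmod (fourier_coeff u k))\<^sup>2 + 2 * (cmod (fourier_coeff v k))\<^sup>2"
    using sum_squares_bound[of "cmod (fourier_coeff u k)" "cmod (fourier_coeff v k)"] by (simp add: power2_sum)
  finally have "lam k powr s * (cmod (fourier_coeff (\<lambda>x. u x + v x) k))\<^sup>2 \<le>
     lam k powr s * (2 * (cmod (fourier_coeff u k))\<^sup>2 + 2 * (cmod (fourier_coeff v k))\<^sup>2)"
    by (intro mult_left_mono) auto
  then show ?thesis by (simp add: sobolev_term_lam algebra_simps)
qed

lemma sobolev_add:
  assumes "u \<in> sobolev s" "v \<in> sobolev s"
  shows "(\<lambda>x. u x + v x) \<in> sobolev s"
proof -
  note L = sobolevD(1)[OF assms(1)] sobolevD(1)[OF assms(2)]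
  have "(\<lambda>k. 2 * sobolev_term s u k + 2 * sobolev_term s v k) summable_on UNIV"
    using assms by (intro summable_on_add summable_on_cmult_right sobolevD(2))
  then have "sobolev_term s (\<lambda>x. u x + v x) summable_on UNIV"
    by (rule summable_on_comparison_test) (auto intro: sobolev_term_add[OF L] sobolev_term_nonneg)
  then show ?thesis using assms L2_add[OF L] unfolding sobolev_def by (auto intro: continuous_on_add)
qed

lemma sobolev_scale:
  assumes "u \<in> sobolev s"
  shows "(\<lambda>x. c * u x) \<in> sobolev s"
proof -
  have "sobolev_term s (\<lambda>x. c * u x) = (\<lambda>k. c\<^sup>2 * sobolev_term s u k)"
    by (simp add: fun_eq_iff sobolev_term_lam fourier_coeff_scale norm_mult power_mult_distrib)
  then have "sobolev_term s (\<lambda>x. c * u x) summable_on UNIV"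
    using summable_on_cmult_right[OF sobolevD(2)[OF assms], of "c\<^sup>2"] by simp
  then show ?thesis using assms L2_scale[OF sobolevD(1)[OF assms], of c] unfolding sobolev_def
    by (auto intro: continuous_on_mult_left)
qed

lemma sobolev_diff:
  assumes "u \<in> sobolev s" "v \<in> sobolev s"
  shows "(\<lambda>x. u x - v x) \<in> sobolev s"
  using sobolev_add[OF assms(1) sobolev_scale[OF assms(2), of "-1"]] by simp

lemma fourier_coeff_zero: "fourier_coeff (\<lambda>x. 0) k = 0"
  by (simp add: fourier_coeff_def)

lemma sobolev_zero: "(\<lambda>x::real^'n. 0) \<in> sobolev s"
proof -
  have "sobolev_term s (\<lambda>x::real^'n. 0) = (\<lambda>k. 0)" by (simp add: fun_eq_iff sobolev_term_def fourier_coeff_zero)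
  then show ?thesis using L2_const[of 0] by (simp add: sobolev_def)
qed

lemma C1_L2: "f \<in> C1_torus \<Longrightarrow> f \<in> L2_torus"
  by (intro continuous_periodic_L2 C1_torusD)

lemma C1_partial_L2: "f \<in> C1_torus \<Longrightarrow> classical_partial i f \<in> L2_torus"
  by (intro continuous_periodic_L2 C1_torusD classical_partial_periodic)

text \<open>Integration by parts against cosine and sine multiplies the coefficient by
  \<open>2 * pi * \<i> * (k $ i)\<close>; the modulus is all that the Sobolev norms see.\<close>

lemma fourier_coeff_partial:
  assumes f: "f \<in> C1_torus"
  shows "cmod (fourier_coeff (classical_partial i f) k) = \<bar>2 * pi * of_int (k $ i)\<bar> * cmod (fourier_coeff f k)"
proof -
  let ?a = "2 * pi * of_int (k $ i) :: real"
  have "l2_inner (classical_partial i f) (\<lambda>x. cos (phase k x)) = - (- ?a * l2_inner f (\<lambda>x. sin (phase k x)))"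
    unfolding l2_inner_scale_right[symmetric] classical_partial_cos_phase[symmetric] 
    unfolding l2_inner_eq by (rule integration_by_parts_torus[OF f C1_cos_phase])
  moreover have "l2_inner (classical_partial i f) (\<lambda>x. sin (phase k x)) = - (?a * l2_inner f (\<lambda>x. cos (phase k x)))"
    unfolding l2_inner_scale_right[symmetric] classical_partial_sin_phase[symmetric] 
    unfolding l2_inner_eq by (rule integration_by_parts_torus[OF f C1_sin_phase])
  ultimately have "fourier_coeff (classical_partial i f) k = Complex 0 ?a * fourier_coeff f k"
    using Re_fourier_coeff[OF C1_L2[OF f], of k] Re_fourier_coeff[OF C1_partial_L2[OF f, of i], of k]
    by (simp add: complex_eq_iff)
  moreover have "cmod (Complex 0 ?a) = \<bar>?a\<bar>" by (simp add: cmod_def)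
  ultimately show ?thesis by (simp only: norm_mult)
qed

text \<open>The weight \<open>lam k\<close> splits the H^1 term of \<open>f\<close> into the squared
  coefficients of \<open>f\<close> and of its partial derivatives, and Bessel's inequality bounds
  each sum. Continuously differentiable functions thereby become admissible in the weak
  equations.\<close>

lemma C1_sobolev:
  fixes f :: "real^'n \<Rightarrow> real"
  assumes f: "f \<in> C1_torus" and d: "CARD('n) \<ge> 2"
  shows "f \<in> sobolev 1"
proof -
  let ?C = "(LINT x|torus_measure. (f x)\<^sup>2) + (\<Sum>i\<in>UNIV. LINT x|torus_measure. (classical_partial i f x)\<^sup>2)"
  have "sobolev_term 1 f summable_on UNIV"
  proof (rule nonneg_bounded_partial_sums_imp_summable_on[where C="?C"])
    show "\<forall>\<^sub>F F in finite_subsets_at_top UNIV. sum (sobolev_term 1 f) F \<le> ?C"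
    proof (rule eventually_finite_subsets_at_top_weakI)
      fix F :: "(int^'n) set" assume F: "finite F"
      have "sobolev_term 1 f k = (cmod (fourier_coeff f k))\<^sup>2 + (\<Sum>i\<in>UNIV. (cmod (fourier_coeff (classical_partial i f) k))\<^sup>2)" for k
        using lam_pos[of k] unfolding sobolev_term_lam fourier_coeff_partial[OF f]
        by (simp add: lam_def power_mult_distrib ring_distribs sum_distrib_left sum_distrib_right mult_ac)
      then have "sum (sobolev_term 1 f) F = (\<Sum>k\<in>F. (cmod (fourier_coeff f k))\<^sup>2) + 
          (\<Sum>i\<in>UNIV. \<Sum>k\<in>F. (cmod (fourier_coeff (classical_partial i f) k))\<^sup>2)"
        by (simp add: sum.distrib sum.swap[of _ UNIV F])
      also have "\<dots> \<le> ?C"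
        by (intro add_mono sum_mono bessel_inequality F C1_L2 C1_partial_L2 f)
      finally show "sum (sobolev_term 1 f) F \<le> ?C" .
    qed
  qed (rule sobolev_term_nonneg)
  \<comment> \<open>For d \<ge> 2 the exponent 1 does not exceed d/2, so membership in
    \<open>sobolev 1\<close> carries no continuity condition.\<close>
  moreover have "\<not> 1 > real CARD('n) / 2" using d by simp
  ultimately show ?thesis using C1_L2[OF f] by (simp add: sobolev_def)
qed

section \<open>Weak partial derivatives\<close>

lemma test_function_C1:
  assumes "test_function \<phi>"
  shows "\<phi> \<in> C1_torus"
proof -
  have d: "fold classical_partial is \<phi> differentiable (at x)" for "is" x
    using assms by (simp add: test_function_def)
  have "continuous_on UNIV (classical_partial i \<phi>)" for i
    using d[of "[i]"] by (intro differentiable_imp_continuous_on) (simp add: differentiable_on_def)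
  moreover have "\<phi> differentiable (at x)" for x using d[of "[]"] by simp
  ultimately show ?thesis using assms by (simp add: C1_torus_def test_function_def)
qed

text \<open>For fixed \<open>k\<close> these combinations are closed under partial derivatives, so
  an induction over the list of derivatives works once the two coefficients are generalized.\<close>

lemma test_function_phase:
  "test_function (\<lambda>x. a * cos (phase k x) + b * sin (phase k x))"
proof -
  have "\<exists>a' b'. fold classical_partial is (\<lambda>x. a * cos (phase k x) + b * sin (phase k x)) = 
     (\<lambda>x. a' * cos (phase k x) + b' * sin (phase k x))" for "is"
  proof (induction "is" arbitrary: a b)
    case (Cons i "is")
    have eq: "classical_partial i (\<lambda>x. a * cos (phase k x) + b * sin (phase k x)) = 
      (\<lambda>x. (b * (2 * pi * of_int (k $ i))) * cos (phase k x) + (- a * (2 * pi * of_int (k $ i))) * sin (phase k x))"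
      unfolding C1_add(2)[OF C1_scale(1)[OF C1_cos_phase] C1_scale(1)[OF C1_sin_phase]]
        C1_scale(2)[OF C1_cos_phase] C1_scale(2)[OF C1_sin_phase] classical_partial_cos_phase classical_partial_sin_phase
      by (simp add: fun_eq_iff)
    show ?case unfolding fold_simps(2) eq by (rule Cons.IH)
  qed auto
  moreover have "(\<lambda>x. a * cos (phase k x) + b * sin (phase k x)) differentiable (at x)" for a b x
    by (intro C1_torusD(2) C1_add(1) C1_scale(1) C1_cos_phase C1_sin_phase)
  moreover have "periodic (\<lambda>x. a * cos (phase k x) + b * sin (phase k x))"
    by (intro C1_torusD(1) C1_add(1) C1_scale(1) C1_cos_phase C1_sin_phase)
  ultimately show ?thesis unfolding test_function_def by metis
qed

lemma test_function_cos_phase: "test_function (\<lambda>x. cos (phase k x))"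
  and test_function_sin_phase: "test_function (\<lambda>x. sin (phase k x))"
  using test_function_phase[of 1 k 0] test_function_phase[of 0 k 1] by simp_all

lemma is_weak_partial_classical:
  assumes "f \<in> C1_torus"
  shows "is_weak_partial i f (classical_partial i f)"
  unfolding is_weak_partial_def l2_inner_eq
  using C1_partial_L2[OF assms] integration_by_parts_torus[OF assms test_function_C1, of _ i] by simp

text \<open>The classical derivative witnesses that the choice in \<open>weak_partial\<close> is
  sound. Trigonometric functions are test functions, so two weak derivatives have the same Fourier
  coefficients and coincide almost everywhere.\<close>

lemma weak_partial_classical:
  assumes f: "f \<in> C1_torus"
  shows "weak_partial i f \<in> L2_torus" "AE x in torus_measure. weak_partial i f x = classical_partial i f x"
proof -
  have w: "is_weak_partial i f (weak_partial i f)"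
    unfolding weak_partial_def by (rule someI[where P="is_weak_partial i f", OF is_weak_partial_classical[OF f]])
  then show L: "weak_partial i f \<in> L2_torus" by (simp add: is_weak_partial_def)
  have eq: "l2_inner (\<lambda>x. weak_partial i f x - classical_partial i f x) \<phi> = 0" if \<phi>: "test_function \<phi>" for \<phi>
  proof -
    have "l2_inner (\<lambda>x. weak_partial i f x - classical_partial i f x) \<phi> = l2_inner (weak_partial i f) \<phi> - l2_inner (classical_partial i f) \<phi>"
      by (intro l2_inner_diff L C1_partial_L2 f C1_L2 test_function_C1 \<phi>)
    also have "l2_inner (weak_partial i f) \<phi> = l2_inner (classical_partial i f) \<phi>"
      using w is_weak_partial_classical[OF f, of i] \<phi> unfolding is_weak_partial_def by (metis neg_equal_iff_equal)
    finally show ?thesis by simp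
  qed
  have "AE x in torus_measure. weak_partial i f x - classical_partial i f x = 0"
    by (rule L2_eq_0_AE) (intro L2_diff L C1_partial_L2 f eq test_function_cos_phase test_function_sin_phase)+
  then show "AE x in torus_measure. weak_partial i f x = classical_partial i f x" by simp
qed

section \<open>Divergence-free vector fields\<close>

lemma div_free_diff:
  fixes v w :: "real^'n \<Rightarrow> real^'n"
  assumes "\<And>i. (\<lambda>x. v x $ i) \<in> L2_torus" "\<And>i. (\<lambda>x. w x $ i) \<in> L2_torus" "div_free v" "div_free w"
  shows "div_free (\<lambda>x. v x - w x)"
  unfolding div_free_def
proof (intro allI impI)
  fix \<phi> :: "real^'n \<Rightarrow> real" assume \<phi>: "test_function \<phi>"
  have L: "(\<lambda>x. (\<chi> i. classical_partial i \<phi> x) $ i) \<in> L2_torus" for i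
    using C1_partial_L2[OF test_function_C1[OF \<phi>]] by simp
  have "l2_inner (\<lambda>x. v x - w x) (\<lambda>x. \<chi> i. classical_partial i \<phi> x) = 
      l2_inner v (\<lambda>x. \<chi> i. classical_partial i \<phi> x) - l2_inner w (\<lambda>x. \<chi> i. classical_partial i \<phi> x)"
    using L2_diff[OF assms(1,2)] l2_inner_diff[OF assms(1,2) C1_partial_L2[OF test_function_C1[OF \<phi>]]]
    by (subst (1 2 3) l2_inner_vec) (simp_all add: assms L sum_subtractf del: vec_lambda_beta, simp add: sum_subtractf)
  then show "l2_inner (\<lambda>x. v x - w x) (\<lambda>x. \<chi> i. classical_partial i \<phi> x) = 0"
    using assms \<phi> by (simp add: div_free_def)
qed

text \<open>The classical divergence is orthogonal to all trigonometric functions, hence zero almost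
  everywhere, and everywhere by continuity and periodicity.\<close>

lemma div_free_classical:
  fixes v :: "real^'n \<Rightarrow> real^'n"
  assumes v: "\<And>i. (\<lambda>x. v x $ i) \<in> C1_torus" and div: "div_free v"
  shows "(\<Sum>i\<in>UNIV. classical_partial i (\<lambda>x. v x $ i) x) = 0"
proof -
  define D where "D x = (\<Sum>i\<in>UNIV. classical_partial i (\<lambda>x. v x $ i) x)" for x
  have DL: "D \<in> L2_torus" unfolding D_def[abs_def] by (intro L2_sum C1_partial_L2 v)
  have Dc: "continuous_on UNIV D" unfolding D_def[abs_def] by (intro continuous_on_sum C1_torusD(3) v)
  have "l2_inner D \<phi> = 0" if \<phi>: "test_function \<phi>" for \<phi>
  proof -
    note \<phi>1 = test_function_C1[OF \<phi>]
    have "l2_inner D \<phi> = (\<Sum>i\<in>UNIV. l2_inner (classical_partial i (\<lambda>x. v x $ i)) \<phi>)"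
      unfolding D_def[abs_def] by (intro l2_inner_sum C1_partial_L2 C1_L2 v \<phi>1) simp
    also have "\<dots> = - (\<Sum>i\<in>UNIV. l2_inner (\<lambda>x. v x $ i) (classical_partial i \<phi>))"
      unfolding l2_inner_eq integration_by_parts_torus[OF v \<phi>1] by (simp add: sum_negf)
    also have "(\<Sum>i\<in>UNIV. l2_inner (\<lambda>x. v x $ i) (classical_partial i \<phi>)) = l2_inner v (\<lambda>x. \<chi> i. classical_partial i \<phi> x)"
      by (subst l2_inner_vec) (simp_all add: C1_L2[OF v] C1_partial_L2[OF \<phi>1])
    finally show ?thesis using div \<phi> by (simp add: div_free_def)
  qed
  then have c: "l2_inner D (\<lambda>x. cos (phase k x)) = 0" "l2_inner D (\<lambda>x. sin (phase k x)) = 0" for k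
    using test_function_cos_phase test_function_sin_phase by blast+
  have "AE x in torus_measure. D x = 0" by (rule L2_eq_0_AE[OF DL c])
  then have "AE x in torus_measure. (D x)\<^sup>2 = 0" by simp
  then have "(LINT x|torus_measure. (D x)\<^sup>2) = (LINT x|(torus_measure::(real^'n) measure). 0)"
    by (intro integral_AE_cong) auto
  then have z: "(LINT x|torus_measure. (D x)\<^sup>2) = 0" by simp
  obtain y where y: "y \<in> torus" "D y = D x" using periodic_torus[OF L2_torusD(1)[OF DL]] by blast
  have "(D y)\<^sup>2 = 0"
    by (rule continuous_eq_0_of_integral_eq_0[OF _ _ z y(1)]) (auto intro: continuous_on_power Dc)
  then show ?thesis using y(2) by (simp add: D_def)
qed

text \<open>Integration by parts moves every derivative from \<open>f\<close> to \<open>v\<close>,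
  where the divergence appears.\<close>

lemma transport_integral_eq_0:
  fixes v :: "real^'n \<Rightarrow> real^'n"
  assumes v: "\<And>i. (\<lambda>x. v x $ i) \<in> C1_torus" and div: "div_free v" and f: "f \<in> C1_torus"
  shows "(LINT x|torus_measure. (\<Sum>i\<in>UNIV. v x $ i * classical_partial i f x)) = 0"
proof -
  have "(LINT x|torus_measure. (\<Sum>i\<in>UNIV. v x $ i * classical_partial i f x)) = 
     (\<Sum>i\<in>UNIV. LINT x|torus_measure. v x $ i * classical_partial i f x)"
    by (intro Bochner_Integration.integral_sum L2_integrable_mult C1_L2 v C1_partial_L2 f)
  also have "\<dots> = - (\<Sum>i\<in>UNIV. LINT x|torus_measure. classical_partial i (\<lambda>x. v x $ i) x * f x)"
    unfolding integration_by_parts_torus[OF v f] by (simp add: sum_negf)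
  also have "(\<Sum>i\<in>UNIV. LINT x|torus_measure. classical_partial i (\<lambda>x. v x $ i) x * f x) = 
     (LINT x|torus_measure. (\<Sum>i\<in>UNIV. classical_partial i (\<lambda>x. v x $ i) x * f x))"
    by (intro Bochner_Integration.integral_sum[symmetric] L2_integrable_mult C1_L2 v C1_partial_L2 f)
  also have "\<dots> = 0" by (simp add: div_free_classical[OF v div] flip: sum_distrib_right)
  finally show ?thesis by simp
qed

section \<open>Weak time derivatives: from vector-valued paths to real functions of time\<close>

section \<open>A smooth cutoff function\<close>

text \<open>The coefficients that arise in front of exp (- 1 / (x (1 - x))) under repeated
  differentiation. The class is closed under derivatives on the open unit interval, which reduces
  smoothness of the bump to a single differentiation step.\<close>

inductive bump_factor :: "(real \<Rightarrow> real) \<Rightarrow> bool" where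
  bf_const: "bump_factor (\<lambda>x. c)"
| bf_id: "bump_factor (\<lambda>x. x)"
| bf_inverse: "bump_factor (\<lambda>x. 1 / (x * (1 - x)))"
| bf_add: "bump_factor a \<Longrightarrow> bump_factor b \<Longrightarrow> bump_factor (\<lambda>x. a x + b x)"
| bf_mult: "bump_factor a \<Longrightarrow> bump_factor b \<Longrightarrow> bump_factor (\<lambda>x. a x * b x)"

lemma has_derivative_inverse_quadratic:
  assumes "x \<in> {0<..<1::real}"
  shows "((\<lambda>x. 1 / (x * (1 - x))) has_real_derivative (2 * x + -1) * (1 / (x * (1 - x)) * (1 / (x * (1 - x))))) (at x)"
  using assms by (auto intro!: derivative_eq_intros simp: field_simps)

lemma bump_factor_deriv:
  assumes "bump_factor a"
  shows "\<exists>a'. bump_factor a' \<and> (\<forall>x\<in>{0<..<1}. (a has_real_derivative a' x) (at x))"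
  using assms
proof induction
  case (bf_const c)
  show ?case by (rule exI[of _ "\<lambda>_. 0"]) (auto intro: bump_factor.intros)
next
  case bf_id
  show ?case by (rule exI[of _ "\<lambda>_. 1"]) (auto intro: bump_factor.intros)
next
  case bf_inverse
  have m: "bump_factor (\<lambda>x. (2 * x + -1) * (1 / (x * (1 - x)) * (1 / (x * (1 - x)))))"
    by (intro bump_factor.intros)
  with has_derivative_inverse_quadratic show ?case by blast
next
  case (bf_add a b)
  then obtain a' b' where "bump_factor a'" "bump_factor b'"
    "\<And>x. x \<in> {0<..<1} \<Longrightarrow> (a has_real_derivative a' x) (at x)" "\<And>x. x \<in> {0<..<1} \<Longrightarrow> (b has_real_derivative b' x) (at x)" by blast
  then show ?case by (intro exI[of _ "\<lambda>x. a' x + b' x"]) (auto intro: bump_factor.bf_add DERIV_add)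
next
  case (bf_mult a b)
  then obtain a' b' where ab: "bump_factor a'" "bump_factor b'"
    "\<And>x. x \<in> {0<..<1} \<Longrightarrow> (a has_real_derivative a' x) (at x)" "\<And>x. x \<in> {0<..<1} \<Longrightarrow> (b has_real_derivative b' x) (at x)" by blast
  have "bump_factor (\<lambda>x. a' x * b x + b' x * a x)" using ab bf_mult by (intro bump_factor.intros)
  then show ?case using DERIV_mult ab(3,4) by blast
qed

text \<open>Blow-up at the endpoints is at most a power of 1 / (x (1 - x)), which the exponential
  later outweighs.\<close>

lemma bump_factor_bound:
  assumes "bump_factor a"
  shows "\<exists>C n. \<forall>x\<in>{0<..<1}. \<bar>a x\<bar> \<le> C * (1 / (x * (1 - x))) ^ n"
proof -
  \<comment> \<open>Since the base is at least 1, both exponents may be raised to the common value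
    \<open>n + m\<close>.\<close>
  have q1: "1 \<le> 1 / (x * (1 - x))" if "x \<in> {0<..<1}" for x :: real
  proof -
    have "x * (1 - x) \<le> 1 * 1" using that by (intro mult_mono) auto
    moreover have "0 < x * (1 - x)" using that by simp
    ultimately show ?thesis by simp
  qed
  have "\<exists>C n. C \<ge> 0 \<and> (\<forall>x\<in>{0<..<1}. \<bar>a x\<bar> \<le> C * (1 / (x * (1 - x))) ^ n)"
    using assms
  proof induction
    case (bf_const c)
    show ?case by (rule exI[of _ "\<bar>c\<bar>"], rule exI[of _ 0]) auto
  next
    case bf_id
    show ?case by (rule exI[of _ 1], rule exI[of _ 0]) auto
  next
    case bf_inverse
    show ?case by (rule exI[of _ 1], rule exI[of _ 1]) auto
  next
    case (bf_add a b)
    then obtain C n D m where c: "C \<ge> 0" "\<And>x. x \<in> {0<..<1} \<Longrightarrow> \<bar>a x\<bar> \<le> C * (1 / (x * (1 - x))) ^ n"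
      and d: "D \<ge> 0" "\<And>x. x \<in> {0<..<1} \<Longrightarrow> \<bar>b x\<bar> \<le> D * (1 / (x * (1 - x))) ^ m" by blast
    have "\<bar>a x + b x\<bar> \<le> (C + D) * (1 / (x * (1 - x))) ^ (n + m)" if x: "x \<in> {0<..<1}" for x
    proof -
      have "\<bar>a x\<bar> \<le> C * (1 / (x * (1 - x))) ^ (n + m)"
        using c(2)[OF x] mult_left_mono[OF power_increasing[of n "n + m", OF _ q1[OF x]] c(1)] by linarith
      moreover have "\<bar>b x\<bar> \<le> D * (1 / (x * (1 - x))) ^ (n + m)"
        using d(2)[OF x] mult_left_mono[OF power_increasing[of m "n + m", OF _ q1[OF x]] d(1)] by linarith
      ultimately show ?thesis unfolding distrib_right by linarith
    qed
    then show ?case using c(1) d(1) by (intro exI[of _ "C + D"] exI[of _ "n + m"]) auto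
  next
    case (bf_mult a b)
    then obtain C n D m where c: "C \<ge> 0" "\<And>x. x \<in> {0<..<1} \<Longrightarrow> \<bar>a x\<bar> \<le> C * (1 / (x * (1 - x))) ^ n"
      and d: "D \<ge> 0" "\<And>x. x \<in> {0<..<1} \<Longrightarrow> \<bar>b x\<bar> \<le> D * (1 / (x * (1 - x))) ^ m" by blast
    have "\<bar>a x * b x\<bar> \<le> (C * D) * (1 / (x * (1 - x))) ^ (n + m)" if x: "x \<in> {0<..<1}" for x
    proof -
      have "\<bar>a x\<bar> * \<bar>b x\<bar> \<le> (C * (1 / (x * (1 - x))) ^ n) * (D * (1 / (x * (1 - x))) ^ m)"
        by (intro mult_mono c(2) d(2) x mult_nonneg_nonneg c(1)) (use x in auto)
      then show ?thesis by (simp only: abs_mult power_add mult_ac)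
    qed
    then show ?case using c(1) d(1) by (intro exI[of _ "C * D"] exI[of _ "n + m"]) auto
  qed
  then show ?thesis by blast
qed

definition bump_fun :: "(real \<Rightarrow> real) \<Rightarrow> real \<Rightarrow> real" where
  "bump_fun a x = (if x \<in> {0<..<1} then a x * exp (- (1 / (x * (1 - x)))) else 0)"

lemma power_div_fact_le_exp:
  assumes "0 \<le> (y::real)"
  shows "y ^ n / fact n \<le> exp y"
proof -
  have "(\<Sum>k\<in>{n}. y ^ k /\<^sub>R fact k) \<le> (\<Sum>k. y ^ k /\<^sub>R fact k)"
    by (rule sum_le_suminf) (use assms summable_exp_generic[of y] in auto)
  then show ?thesis by (simp add: exp_def divide_inverse mult.commute)
qed

text \<open>The exponential beats the power \<open>n + 2\<close> of y = 1 / (x (1 - x)):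
  \<open>n\<close> factors cancel the growth of \<open>a\<close> and two are left over. Vanishing to
  second order is what gives the extension by zero a derivative equal to 0 at the endpoints.\<close>

lemma bump_fun_quadratic_bound:
  assumes "bump_factor a"
  shows "\<exists>K. \<forall>x\<in>{0<..<1}. \<bar>bump_fun a x\<bar> \<le> K * (x * (1 - x))\<^sup>2"
proof -
  obtain C n where C: "\<And>x. x \<in> {0<..<1} \<Longrightarrow> \<bar>a x\<bar> \<le> C * (1 / (x * (1 - x))) ^ n"
    using bump_factor_bound[OF assms] by blast
  have "\<bar>bump_fun a x\<bar> \<le> C * fact (n + 2) * (x * (1 - x))\<^sup>2" if x: "x \<in> {0<..<1}" for x
  proof -
    define y where "y = 1 / (x * (1 - x))"
    have y: "y > 0" using x by (simp add: y_def)
    have e: "exp (- y) \<le> fact (n + 2) / y ^ (n + 2)"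
    proof -
      have "y ^ (n + 2) \<le> exp y * fact (n + 2)"
        using power_div_fact_le_exp[of y "n + 2"] y by (simp only: divide_le_eq fact_gt_zero if_True less_imp_le)
      then show ?thesis using y by (simp only: exp_minus pos_le_divide_eq zero_less_power)
         (simp only: inverse_eq_divide times_divide_eq_left mult_1_left pos_divide_le_eq exp_gt_zero mult.commute)
    qed
    have Cn: "0 \<le> C * y ^ n" using C[OF x] unfolding y_def by linarith
    have "\<bar>bump_fun a x\<bar> = \<bar>a x\<bar> * exp (- y)" using x by (simp add: bump_fun_def y_def abs_mult)
    also have "\<dots> \<le> (C * y ^ n) * (fact (n + 2) / y ^ (n + 2))"
      using C[OF x] e Cn unfolding y_def[symmetric] by (intro mult_mono) auto
    also have "\<dots> = C * fact (n + 2) * (1 / y)\<^sup>2"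
    proof -
      have "(C * y ^ n) * (D / y ^ (n + 2)) = C * D * (1 / y)\<^sup>2" for D
        using y by (simp add: power_add power_divide power2_eq_square)
      then show ?thesis .
    qed
    also have "1 / y = x * (1 - x)" by (simp add: y_def)
    finally show ?thesis .
  qed
  then show ?thesis by blast
qed

lemma bump_fun_deriv:
  assumes a: "bump_factor a"
  shows "\<exists>b. bump_factor b \<and> (\<forall>x. (bump_fun a has_real_derivative bump_fun b x) (at x))"
proof -
  obtain a' where a': "bump_factor a'" "\<And>x. x \<in> {0<..<1} \<Longrightarrow> (a has_real_derivative a' x) (at x)"
    using bump_factor_deriv[OF a] by blast
  obtain K where K: "\<And>x. x \<in> {0<..<1} \<Longrightarrow> \<bar>bump_fun a x\<bar> \<le> K * (x * (1 - x))\<^sup>2"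
    using bump_fun_quadratic_bound[OF a] by blast
  \<comment> \<open>The product rule: the exponent -1 / (x (1 - x)) has derivative (1 - 2 x) / (x (1
    - x))^2.\<close>
  define b where "b x = a' x + a x * ((1 + (-2) * x) * (1 / (x * (1 - x)) * (1 / (x * (1 - x)))))" for x
  have "bump_factor b" unfolding b_def[abs_def] by (intro bump_factor.intros a a')
  moreover have "(bump_fun a has_real_derivative bump_fun b x) (at x)" for x
  proof (cases "x \<in> {0<..<1}")
    case True
    have "((\<lambda>x. a x * exp (- (1 / (x * (1 - x))))) has_real_derivative bump_fun b x) (at x)"
    proof -
      let ?R = "(2 * x + -1) * (1 / (x * (1 - x)) * (1 / (x * (1 - x))))" and ?e = "exp (- (1 / (x * (1 - x))))"
      have "((\<lambda>x. exp (- (1 / (x * (1 - x))))) has_real_derivative ?e * (- ?R)) (at x)"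
        by (rule DERIV_chain2[OF DERIV_exp DERIV_minus[OF has_derivative_inverse_quadratic[OF True]]])
      from DERIV_mult[OF a'(2)[OF True] this]
      have "((\<lambda>x. a x * exp (- (1 / (x * (1 - x))))) has_real_derivative a' x * ?e + ?e * (- ?R) * a x) (at x)" .
      moreover have "a' x * ?e + ?e * (- ?R) * a x = bump_fun b x"
      proof -
        have "1 + (-2) * x = - (2 * x + -1)" by simp
        then have "b x = a' x + a x * (- ?R)" unfolding b_def by (simp only: minus_mult_left)
        then show ?thesis using True unfolding bump_fun_def by (simp only: if_True) (simp only: distrib_left distrib_right mult_ac)
      qed
      ultimately show ?thesis by (simp only:)
    qed
    then show ?thesis
      by (rule has_field_derivative_transform_within_open[where S="{0<..<1}"]) (use True in \<open>auto simp: bump_fun_def\<close>)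
  next
    case False
    \<comment> \<open>As \<open>x\<close> lies outside the open unit interval, y (1 - y) is at most
      the distance from \<open>y\<close> to \<open>x\<close>; the quadratic bound then forces the
      difference quotients at \<open>x\<close> to 0.\<close>
    have bd: "\<bar>bump_fun a y\<bar> \<le> \<bar>K\<bar> * (y - x)\<^sup>2" for y
    proof (cases "y \<in> {0<..<1}")
      case True
      have "0 \<le> y * (1 - y)" "y * (1 - y) \<le> \<bar>y - x\<bar>"
      proof -
        have "y * (1 - y) \<le> y * 1" "y * (1 - y) \<le> 1 * (1 - y)"
          using True by (intro mult_mono; auto)+
        moreover have "x \<le> 0 \<or> 1 \<le> x" using False by auto
        ultimately show "y * (1 - y) \<le> \<bar>y - x\<bar>" by argo
      qed (use True in auto)
      then have "(y * (1 - y))\<^sup>2 \<le> \<bar>y - x\<bar>\<^sup>2" by (intro power_mono)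
      then have "K * (y * (1 - y))\<^sup>2 \<le> \<bar>K\<bar> * (y - x)\<^sup>2" by (intro mult_mono) auto
      then show ?thesis using K[OF True] by linarith
    qed (auto simp: bump_fun_def)
    have "((\<lambda>y. (bump_fun a y - bump_fun a x) / (y - x)) \<longlongrightarrow> 0) (at x)"
    proof (rule Lim_null_comparison)
      show "\<forall>\<^sub>F y in at x. norm ((bump_fun a y - bump_fun a x) / (y - x)) \<le> \<bar>K\<bar> * \<bar>y - x\<bar>"
      proof (rule eventually_at_topological[THEN iffD2], intro exI conjI allI impI ballI)
        show "open (UNIV::real set)" "x \<in> UNIV" by auto
        fix y assume "y \<noteq> x"
        moreover have "bump_fun a x = 0" using False by (auto simp: bump_fun_def)
        ultimately show "norm ((bump_fun a y - bump_fun a x) / (y - x)) \<le> \<bar>K\<bar> * \<bar>y - x\<bar>"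
          using bd[of y] by (simp add: abs_divide divide_le_eq power2_eq_square mult.assoc)
      qed
      show "((\<lambda>y. \<bar>K\<bar> * \<bar>y - x\<bar>) \<longlongrightarrow> 0) (at x)" by (auto intro!: tendsto_eq_intros)
    qed
    then show ?thesis using False by (auto simp: has_field_derivative_iff bump_fun_def)
  qed
  ultimately show ?thesis by blast
qed

definition smooth :: "(real \<Rightarrow> real) \<Rightarrow> bool" where
  "smooth f \<longleftrightarrow> (\<forall>n t. (deriv ^^ n) f differentiable (at t))"

lemma smooth_bump_fun:
  assumes "bump_factor a"
  shows "smooth (bump_fun a)"
proof -
  have "\<exists>b. bump_factor b \<and> (deriv ^^ n) (bump_fun a) = bump_fun b" for n
  proof (induction n)
    case 0
    then show ?case using assms by auto
  next
    case (Suc n)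
    then obtain b where b: "bump_factor b" "(deriv ^^ n) (bump_fun a) = bump_fun b" by blast
    obtain c where c: "bump_factor c" "\<And>x. (bump_fun b has_real_derivative bump_fun c x) (at x)"
      using bump_fun_deriv[OF b(1)] by blast
    have "deriv (bump_fun b) = bump_fun c" using c(2) DERIV_imp_deriv by blast
    then show ?case using b c by (intro exI[of _ c]) simp
  qed
  then show ?thesis unfolding smooth_def
    using bump_fun_deriv real_differentiable_def by metis
qed

lemma smooth_deriv: "smooth f \<Longrightarrow> smooth (deriv f)"
  unfolding smooth_def by (metis comp_apply funpow_Suc_right)

lemma smooth_has_deriv:
  assumes "smooth f"
  shows "(f has_real_derivative deriv f t) (at t)"
proof -
  have "f differentiable (at t)" using assms unfolding smooth_def by (metis funpow_0)
  then show ?thesis using DERIV_deriv_iff_real_differentiable by blast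
qed

lemma smooth_primitive:
  assumes "\<And>t. (f has_real_derivative g t) (at t)" "smooth g"
  shows "smooth f"
proof -
  have "deriv f = g" using assms(1) DERIV_imp_deriv by blast
  then have "(deriv ^^ n) f differentiable (at t)" for n t
    using assms by (cases n) (auto simp: smooth_def funpow_Suc_right real_differentiable_def simp del: funpow.simps(2))
  then show ?thesis by (simp add: smooth_def)
qed

text \<open>A combination of two shifts, because the time test functions are differences of two
  rescaled steps. The coefficients stay general so that the class is stable under
  differentiation.\<close>

lemma smooth_diff_affine:
  assumes "smooth f"
  shows "smooth (\<lambda>x. c * f (a * x + p) + d * f (a * x + q))"
  using assms unfolding smooth_def[of "\<lambda>x. c * f (a * x + p) + d * f (a * x + q)"]
proof (intro allI)
  fix n t
  have D: "((\<lambda>x. c * g (a * x + p) + d * g (a * x + q)) has_real_derivative 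
      (c * a) * deriv g (a * t + p) + (d * a) * deriv g (a * t + q)) (at t)" if g: "smooth g" for c d g t
  proof -
    have "((\<lambda>x. g (a * x + r)) has_real_derivative deriv g (a * t + r) * a) (at t)" for r
      by (rule DERIV_chain2[OF smooth_has_deriv[OF g]]) (auto intro!: derivative_eq_intros)
    then show ?thesis by (auto intro!: derivative_eq_intros)
  qed
  show "(deriv ^^ n) (\<lambda>x. c * f (a * x + p) + d * f (a * x + q)) differentiable (at t)"
    using assms
  proof (induction n arbitrary: c d f)
    case 0
    then show ?case using D[of f c d t] by (auto simp: real_differentiable_def)
  next
    case (Suc n)
    have "deriv (\<lambda>x. c * f (a * x + p) + d * f (a * x + q)) = (\<lambda>x. (c * a) * deriv f (a * x + p) + (d * a) * deriv f (a * x + q))"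
      using D[OF Suc.prems, of c d] by (intro ext DERIV_imp_deriv)
    then show ?case using Suc.IH[OF smooth_deriv[OF Suc.prems], of "c * a" "d * a"]
      by (simp add: funpow_Suc_right del: funpow.simps(2))
  qed
qed

text \<open>\<open>H\<close> is the primitive of the bump, normalized to total mass 1.\<close>

lemma smooth_step_exists:
  obtains H :: "real \<Rightarrow> real" where "smooth H" "\<And>x. x \<le> 0 \<Longrightarrow> H x = 0" "\<And>x. x \<ge> 1 \<Longrightarrow> H x = 1"
    "\<And>x. 0 \<le> H x" "\<And>x. H x \<le> 1" "\<And>x. 0 \<le> deriv H x" "\<And>x. x \<notin> {0<..<1} \<Longrightarrow> deriv H x = 0" "continuous_on UNIV (deriv H)"
proof -
  define B where "B = bump_fun (\<lambda>_. 1)"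
  have sB: "smooth B" unfolding B_def by (intro smooth_bump_fun bump_factor.intros)
  have cB: "continuous_on S B" for S
    using smooth_has_deriv[OF sB] by (meson DERIV_isCont continuous_at_imp_continuous_on)
  have B0: "0 \<le> B x" "x \<notin> {0<..<1} \<Longrightarrow> B x = 0" "x \<in> {0<..<1} \<Longrightarrow> B x > 0" for x by (auto simp: B_def bump_fun_def)
  \<comment> \<open>Starting at -1 rather than 0 makes every x \<ge> 0 an interior point of the
    interval on which the fundamental theorem is applied.\<close>
  define F where "F x = integral {-1..x} B" for x
  have F0: "F x = 0" if "x \<le> 0" for x
  proof -
    have "integral {-1..x} B = integral {-1..x} (\<lambda>_. 0)" by (rule integral_cong) (use that B0 in auto)
    then show ?thesis by (simp add: F_def)
  qed
  have dF: "(F has_real_derivative B x) (at x)" for x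
  proof (cases "x < 0")
    case True
    have "((\<lambda>_. 0) has_real_derivative B x) (at x)" using True B0(2)[of x] by simp
    then show ?thesis
      by (rule has_field_derivative_transform_within_open[where S="{..<0}"]) (use True F0 in auto)
  next
    case False
    have "(F has_real_derivative B x) (at x within {-1..x+1})"
      unfolding F_def[abs_def] by (rule integral_has_real_derivative[OF cB]) (use False in auto)
    then show ?thesis using at_within_interior[of x "{-1..x+1}"] False by (simp add: interior_atLeastAtMost_real)
  qed
  have mono: "F x \<le> F y" if "x \<le> y" for x y
    by (rule DERIV_nonneg_imp_nondecreasing[OF that]) (use dF B0 in blast)
  have Fc: "continuous_on {0..1} F" using dF by (meson DERIV_isCont continuous_at_imp_continuous_on)
  have Fd: "\<exists>y. (F has_real_derivative y) (at x) \<and> 0 < y" if "0 < x" "x < 1" for x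
    using dF[of x] B0(3)[of x] that by auto
  have "F 0 < F 1" by (rule DERIV_pos_imp_increasing_open[OF zero_less_one Fd Fc])
  then have I: "F 1 > 0" using F0[of 0] by simp
  have F1: "F x = F 1" if "x \<ge> 1" for x
  proof -
    have "integral {-1..x} B = integral {-1..1} B + integral {1..x} B"
      by (rule Henstock_Kurzweil_Integration.integral_combine[symmetric]) (use that cB in \<open>auto intro: integrable_continuous_real\<close>)
    moreover have "integral {1..x} B = integral {1..x} (\<lambda>_. 0)" by (rule integral_cong) (use B0 in auto)
    ultimately show ?thesis by (simp add: F_def)
  qed
  have dH: "((\<lambda>x. F x / F 1) has_real_derivative B x / F 1) (at x)" for x
    by (intro DERIV_cdivide dF)
  have sH: "smooth (\<lambda>x. 1 / F 1 * B (1 * x + 0) + 0 * B (1 * x + 0))" by (rule smooth_diff_affine[OF sB])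
  then have sH': "smooth (\<lambda>x. B x / F 1)" by simp
  have deq: "deriv (\<lambda>x. F x / F 1) = (\<lambda>x. B x / F 1)" using dH DERIV_imp_deriv by blast
  show ?thesis
  proof (rule that[of "\<lambda>x. F x / F 1"])
    show "smooth (\<lambda>x. F x / F 1)" by (rule smooth_primitive[OF dH sH'])
    show "0 \<le> F x / F 1" for x using mono[of "min x 0" x] F0[of "min x 0"] I by simp
    show "F x / F 1 \<le> 1" for x using mono[of x "max x 1"] F1[of "max x 1"] I by simp
    show "continuous_on UNIV (deriv (\<lambda>x. F x / F 1))" unfolding deq using I by (intro continuous_intros cB) auto
    show "F x / F 1 = 0" if "x \<le> 0" for x using F0[OF that] by simp
    show "F x / F 1 = 1" if "1 \<le> x" for x using F1[OF that] I by simp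
    show "0 \<le> deriv (\<lambda>x. F x / F 1) x" for x unfolding deq using I B0(1)[of x] by simp
    show "deriv (\<lambda>x. F x / F 1) x = 0" if "x \<notin> {0<..<1}" for x unfolding deq using B0(2)[OF that] by simp
  qed
qed

section \<open>Weak derivatives of scalar functions of time\<close>

text \<open>The kernels \<open>real n * k (real n * (x - r))\<close> form a one-sided approximate
  identity: nonnegative, supported in [r, r + 1/n], and of mass 1 because \<open>K\<close> is a
  primitive that climbs from 0 to 1.\<close>

lemma cutoff_concentrates:
  fixes \<phi> k :: "real \<Rightarrow> real" and K :: "real \<Rightarrow> real"
  assumes \<phi>: "continuous_on {0..<T} \<phi>" and r: "0 < r"
    and K: "\<And>n x. n > 0 \<Longrightarrow> ((\<lambda>x. K (real n * (x - r))) has_real_derivative real n * k (real n * (x - r))) (at x)"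
    and k: "\<And>x. 0 \<le> k x" "\<forall>x. x \<notin> {0<..<1} \<longrightarrow> k x = 0" "continuous_on UNIV k"
    and K01: "K 0 = 0" "K 1 = 1" and rT: "r < T"
  shows "(\<lambda>n. LINT x|lebesgue_on {0<..<T}. real n * k (real n * (x - r)) * \<phi> x) \<longlonglongrightarrow> \<phi> r"
    "n > 0 \<Longrightarrow> r + 1 / real n < T \<Longrightarrow> integrable (lebesgue_on {0<..<T}) (\<lambda>x. real n * k (real n * (x - r)) * \<phi> x)"
proof -
  let ?f = "\<lambda>n x. real n * k (real n * (x - r)) * \<phi> x"
  have kc: "continuous_on S (\<lambda>x. real n * k (real n * (x - r)))" for S n
    by (intro continuous_on_mult continuous_on_const continuous_on_compose2[OF k(3)] continuous_on_diff continuous_on_id) auto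
  have zero: "?f n x = 0" if "x \<notin> {r..r + 1 / real n}" "n > 0" for n x
  proof -
    have "real n * (x - r) \<notin> {0<..<1}" using that by (auto simp: field_simps)
    then show ?thesis using k(2) by simp
  qed
  have sub: "{r..r + 1 / real n} \<subseteq> {0<..<T}" if "n > 0" "r + 1 / real n < T" for n
    using that r by auto
  have fc: "continuous_on {r..r + 1 / real n} (?f n)" if "n > 0" "r + 1 / real n < T" for n
    using sub[OF that] by (intro continuous_on_mult kc continuous_on_subset[OF \<phi>]) auto
  have int: "integrable (lebesgue_on {0<..<T}) (?f n)" if n: "n > 0" "r + 1 / real n < T" for n
  proof -
    have "?f n absolutely_integrable_on {r..r + 1 / real n}"
      by (rule absolutely_integrable_continuous_real[OF fc[OF n]])
    moreover have "(\<lambda>x. indicator {0<..<T} x *\<^sub>R ?f n x) = (\<lambda>x. indicator {r..r + 1 / real n} x *\<^sub>R ?f n x)"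
    proof
      fix x
      show "indicator {0<..<T} x *\<^sub>R ?f n x = indicator {r..r + 1 / real n} x *\<^sub>R ?f n x"
      proof (cases "x \<in> {r..r + 1 / real n}")
        case True
        then have "x \<in> {0<..<T}" using sub[OF n] by blast
        then show ?thesis using True by simp
      next
        case False
        show ?thesis by (simp only: zero[OF False n(1)] scaleR_zero_right)
      qed
    qed
    ultimately have "?f n absolutely_integrable_on {0<..<T}" unfolding set_integrable_def by (simp only:)
    then show ?thesis by (simp add: integrable_restrict_space set_integrable_def)
  qed
  show "n > 0 \<Longrightarrow> r + 1 / real n < T \<Longrightarrow> integrable (lebesgue_on {0<..<T}) (?f n)" by (rule int)
  have eq: "(LINT x|lebesgue_on {0<..<T}. ?f n x) = integral {r..r + 1 / real n} (?f n)" if n: "n > 0" "r + 1 / real n < T" for n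
  proof -
    have "(LINT x|lebesgue_on {0<..<T}. ?f n x) = integral {0<..<T} (?f n)"
      by (rule lebesgue_integral_eq_integral[OF int[OF n]]) simp
    also have "\<dots> = integral {r..r + 1 / real n} (?f n)"
    proof -
      have "((?f n) has_integral integral {r..r + 1 / real n} (?f n)) {r..r + 1 / real n}"
        by (intro integrable_integral integrable_continuous_real fc n)
      then have "((?f n) has_integral integral {r..r + 1 / real n} (?f n)) {0<..<T}"
        by (rule has_integral_on_superset[OF _ _ sub[OF n]]) (use zero n in blast)
      then show ?thesis by (rule integral_unique)
    qed
    finally show ?thesis .
  qed
  have one: "((\<lambda>x. real n * k (real n * (x - r))) has_integral 1) {r..r + 1 / real n}" if n: "n > 0" for n
  proof -
    have "((\<lambda>x. real n * k (real n * (x - r))) has_integral K (real n * (r + 1 / real n - r)) - K (real n * (r - r))) {r..r + 1 / real n}"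
      using K[OF n] by (intro fundamental_theorem_of_calculus)
        (auto simp: has_real_derivative_iff_has_vector_derivative[symmetric] intro: has_field_derivative_at_within)
    then show ?thesis using n K01 by simp
  qed
  show "(\<lambda>n. LINT x|lebesgue_on {0<..<T}. ?f n x) \<longlonglongrightarrow> \<phi> r"
  proof (rule LIMSEQ_I)
    fix e :: real assume e: "e > 0"
    have "\<exists>d>0. \<forall>x\<in>{0..<T}. dist x r < d \<longrightarrow> dist (\<phi> x) (\<phi> r) < e / 2"
      using \<phi>[unfolded continuous_on_iff, THEN bspec[of _ _ r], THEN spec[of _ "e / 2"]] r rT e by simp
    then obtain d where d: "d > 0" "\<And>x. x \<in> {0..<T} \<Longrightarrow> dist x r < d \<Longrightarrow> dist (\<phi> x) (\<phi> r) < e / 2" by blast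
    \<comment> \<open>The second entry keeps the support [r, r + 1/n] inside the time
      interval.\<close>
    define d' where "d' = min d (T - r)"
    have d': "d' > 0" using d(1) rT by (simp add: d'_def)
    obtain N :: nat where N: "N > 0" "inverse (real N) < d'" using ex_inverse_of_nat_less[OF d'] by blast
    show "\<exists>no. \<forall>n\<ge>no. norm ((LINT x|lebesgue_on {0<..<T}. ?f n x) - \<phi> r) < e"
    proof (intro exI[of _ N] allI impI)
      fix n assume nN: "N \<le> n"
      have n: "n > 0" using N nN by simp
      have nd: "1 / real n < d'"
      proof -
        have "1 / real n \<le> 1 / real N" using N nN by (intro divide_left_mono) auto
        then show ?thesis using N(2) by (simp add: inverse_eq_divide)
      qed
      then have nT: "r + 1 / real n < T" by (simp add: d'_def)
      let ?S = "{r..r + 1 / real n}"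
      have h1: "((\<lambda>x. real n * k (real n * (x - r)) * \<phi> r) has_integral 1 * \<phi> r) ?S"
        by (rule has_integral_mult_left[OF one[OF n]])
      have h2: "(?f n has_integral (LINT x|lebesgue_on {0<..<T}. ?f n x)) ?S"
        unfolding eq[OF n nT] by (intro integrable_integral integrable_continuous_real fc n nT)
      have h3: "((\<lambda>x. ?f n x - real n * k (real n * (x - r)) * \<phi> r) has_integral (LINT x|lebesgue_on {0<..<T}. ?f n x) - 1 * \<phi> r) ?S"
        by (rule has_integral_diff[OF h2 h1])
      have h4: "((\<lambda>x. real n * k (real n * (x - r)) * (e / 2)) has_integral 1 * (e / 2)) ?S"
        by (rule has_integral_mult_left[OF one[OF n]])
      have "norm (integral ?S (\<lambda>x. ?f n x - real n * k (real n * (x - r)) * \<phi> r)) \<le> integral ?S (\<lambda>x. real n * k (real n * (x - r)) * (e / 2))"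
      proof (rule integral_norm_bound_integral)
        show "(\<lambda>x. ?f n x - real n * k (real n * (x - r)) * \<phi> r) integrable_on ?S" using h3 by blast
        show "(\<lambda>x. real n * k (real n * (x - r)) * (e / 2)) integrable_on ?S" using h4 by blast
        fix x assume x: "x \<in> ?S"
        then have "dist (\<phi> x) (\<phi> r) < e / 2" using nd r nT by (intro d(2)) (auto simp: dist_real_def d'_def)
        then have "real n * k (real n * (x - r)) * \<bar>\<phi> x - \<phi> r\<bar> \<le> real n * k (real n * (x - r)) * (e / 2)"
          using k(1) by (intro mult_left_mono) (auto simp: dist_real_def)
        moreover have "?f n x - real n * k (real n * (x - r)) * \<phi> r = real n * k (real n * (x - r)) * (\<phi> x - \<phi> r)"
          by (simp add: right_diff_distrib)
        ultimately show "norm (?f n x - real n * k (real n * (x - r)) * \<phi> r) \<le> real n * k (real n * (x - r)) * (e / 2)"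
          using k(1) by (simp add: abs_mult)
      qed
      then have "norm ((LINT x|lebesgue_on {0<..<T}. ?f n x) - 1 * \<phi> r) \<le> 1 * (e / 2)"
        unfolding integral_unique[OF h3] integral_unique[OF h4] .
      then show "norm ((LINT x|lebesgue_on {0<..<T}. ?f n x) - \<phi> r) < e" using e by simp
    qed
  qed
qed

text \<open>Test with smooth plateaus that rise just after \<open>r\<close> and fall just after
  \<open>t\<close>. Their derivatives concentrate at the two times and produce
  \<open>\<phi> r - \<phi> t\<close>, while the plateaus converge boundedly to the indicator of the
  interval between.\<close>

lemma du_bois_reymond:
  fixes \<phi> \<psi> :: "real \<Rightarrow> real"
  assumes \<phi>: "continuous_on {0..<T} \<phi>" and \<psi>: "integrable (lebesgue_on {0<..<T}) \<psi>"
    and weak: "\<And>\<eta>. time_test_function T \<eta> \<Longrightarrow>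
      (LINT t|lebesgue_on {0<..<T}. deriv \<eta> t * \<phi> t) = - (LINT t|lebesgue_on {0<..<T}. \<eta> t * \<psi> t)"
    and r: "0 \<le> r" "r \<le> t" "t < T"
  shows "\<phi> t - \<phi> r = integral {r..t} \<psi>"
proof -
  have T: "T > 0" using r by linarith
  have \<psi>i: "\<psi> integrable_on {0..t}" if "t < T" for t
  proof -
    have "\<psi> absolutely_integrable_on {0<..<T}" using \<psi> by (simp add: integrable_restrict_space set_integrable_def)
    then have "\<psi> absolutely_integrable_on {0<..t}" by (rule set_integrable_subset) (use that in auto)
    then have "\<psi> absolutely_integrable_on {0..t}"
      by (rule absolutely_integrable_spike_set) (auto intro: negligible_subset[of "{0}"])
    then show ?thesis by (rule absolutely_integrable_on_def[THEN iffD1, THEN conjunct1])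
  qed
  have main: "\<phi> t - \<phi> r = integral {r..t} \<psi>" if r: "0 < r" "r < t" "t < T" for r t
  proof -
    obtain H :: "real \<Rightarrow> real" where H: "smooth H" "\<And>x. x \<le> 0 \<Longrightarrow> H x = 0" "\<And>x. x \<ge> 1 \<Longrightarrow> H x = 1"
      "\<And>x. 0 \<le> H x" "\<And>x. H x \<le> 1" "\<And>x. 0 \<le> deriv H x" "\<And>x. x \<notin> {0<..<1} \<Longrightarrow> deriv H x = 0" "continuous_on UNIV (deriv H)"
      using smooth_step_exists by blast
    have dHn: "((\<lambda>x. H (real n * (x - c))) has_real_derivative real n * deriv H (real n * (x - c))) (at x)" for n c x
    proof -
      have "((\<lambda>x. H (real n * (x - c))) has_real_derivative deriv H (real n * (x - c)) * real n) (at x)"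
        by (rule DERIV_chain2[OF smooth_has_deriv[OF H(1)]]) (auto intro!: derivative_eq_intros)
      then show ?thesis by (simp add: mult.commute)
    qed
    \<comment> \<open>Two copies of the step, steepened by the factor \<open>n\<close>.\<close>
    define \<eta> where "\<eta> n x = H (real n * (x - r)) - H (real n * (x - t))" for n x
    have d\<eta>: "deriv (\<eta> n) x = real n * deriv H (real n * (x - r)) - real n * deriv H (real n * (x - t))" for n x
      unfolding \<eta>_def[abs_def] by (intro DERIV_imp_deriv DERIV_diff dHn)
    have rT: "r < T" using r by linarith
    obtain N :: nat where N: "N > 0" "inverse (real N) < T - t" using ex_inverse_of_nat_less[of "T - t"] r by auto
    have nT: "n > 0" "t + 1 / real n < T" "r + 1 / real n < T" if "n \<ge> N" for n
    proof -
      show n: "n > 0" using N that by simp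
      have "1 / real n \<le> 1 / real N" using N that by (intro divide_left_mono) auto
      then show "t + 1 / real n < T" using N(2) by (simp add: inverse_eq_divide)
      then show "r + 1 / real n < T" using r by linarith
    qed
    \<comment> \<open>The support is contained in [r, t + 1/n], and \<open>N\<close> was chosen so
      that t + 1/n < T.\<close>
    have test: "time_test_function T (\<eta> n)" if n: "n \<ge> N" for n
      unfolding time_test_function_def
    proof (intro conjI)
      have "smooth (\<lambda>x. 1 * H (real n * x + (- real n * r)) + (-1) * H (real n * x + (- real n * t)))"
        by (rule smooth_diff_affine[OF H(1)])
      then have "smooth (\<eta> n)" unfolding \<eta>_def[abs_def] by (simp add: right_diff_distrib)
      then show "\<forall>m t. (deriv ^^ m) (\<eta> n) differentiable (at t)" by (simp add: smooth_def)
      show "\<exists>a b. 0 < a \<and> b < T \<and> (\<forall>x. x \<notin> {a..b} \<longrightarrow> \<eta> n x = 0)"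
      proof (intro exI conjI allI impI)
        show "0 < r" "t + 1 / real n < T" using r nT[OF n] by auto
        fix x assume x: "x \<notin> {r..t + 1 / real n}"
        show "\<eta> n x = 0"
        proof (cases "x < r")
          case True
          then have "real n * (x - r) \<le> 0" "real n * (x - t) \<le> 0" using r by (simp_all add: mult_nonneg_nonpos)
          then show ?thesis using H(2) by (simp add: \<eta>_def)
        next
          case False
          then have "1 / real n \<le> x - t" using x by auto
          then have t1: "1 \<le> real n * (x - t)" using nT(1)[OF n] by (simp add: field_simps)
          moreover have "real n * (x - t) \<le> real n * (x - r)" using r by (intro mult_left_mono) auto
          ultimately have "1 \<le> real n * (x - r)" by linarith
          then show ?thesis using H(3) t1 by (simp add: \<eta>_def)
        qed
      qed
    qed
    have H7: "\<forall>x. x \<notin> {0<..<1} \<longrightarrow> deriv H x = 0" using H(7) by blast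
    have H01: "H 0 = 0" "H 1 = 1" using H by auto
    note Cr = cutoff_concentrates[where K=H and k="deriv H", OF \<phi> r(1) dHn H(6) H7 H(8) H01 rT]
    have t0: "0 < t" using r by linarith
    note Ct = cutoff_concentrates[where K=H and k="deriv H", OF \<phi> t0 dHn H(6) H7 H(8) H01 r(3)]
    have lhs: "(\<lambda>n. LINT x|lebesgue_on {0<..<T}. deriv (\<eta> n) x * \<phi> x) \<longlonglongrightarrow> \<phi> r - \<phi> t"
    proof (rule Lim_transform_eventually[OF tendsto_diff[OF Cr(1) Ct(1)]])
      show "\<forall>\<^sub>F n in sequentially. (LINT x|lebesgue_on {0<..<T}. real n * deriv H (real n * (x - r)) * \<phi> x) -
         (LINT x|lebesgue_on {0<..<T}. real n * deriv H (real n * (x - t)) * \<phi> x) = (LINT x|lebesgue_on {0<..<T}. deriv (\<eta> n) x * \<phi> x)"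
        using eventually_ge_at_top[of N]
      proof eventually_elim
        case (elim n)
        show ?case unfolding d\<eta> left_diff_distrib
          by (rule Bochner_Integration.integral_diff[symmetric, OF Cr(2)[OF nT(1,3)[OF elim]] Ct(2)[OF nT(1,2)[OF elim]]])
      qed
    qed
    have rhs: "(\<lambda>n. LINT x|lebesgue_on {0<..<T}. \<eta> n x * \<psi> x) \<longlonglongrightarrow> (LINT x|lebesgue_on {0<..<T}. indicator {r<..t} x * \<psi> x)"
    proof (rule integral_dominated_convergence[where w="\<lambda>x. \<bar>\<psi> x\<bar>"])
      have \<psi>m: "\<psi> \<in> borel_measurable (lebesgue_on {0<..<T})" using \<psi> by (rule borel_measurable_integrable)
      show "(\<lambda>x. indicator {r<..t} x * \<psi> x) \<in> borel_measurable (lebesgue_on {0<..<T})"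
        by (intro borel_measurable_times \<psi>m borel_measurable_indicator) (use r in \<open>auto simp: sets_restrict_space_iff\<close>)
      have "continuous_on UNIV (\<eta> n)" for n
        unfolding \<eta>_def[abs_def] using dHn by (intro continuous_on_diff continuous_at_imp_continuous_on ballI) (blast intro: DERIV_isCont)+
      then have "\<eta> n \<in> borel_measurable borel" for n by (rule borel_measurable_continuous_onI)
      then have "\<eta> n \<in> borel_measurable (lebesgue_on {0<..<T})" for n
        by (intro measurable_restrict_space1 measurable_completion) simp
      then show "(\<lambda>x. \<eta> n x * \<psi> x) \<in> borel_measurable (lebesgue_on {0<..<T})" for n
        by (intro borel_measurable_times \<psi>m)
      show "integrable (lebesgue_on {0<..<T}) (\<lambda>x. \<bar>\<psi> x\<bar>)" using \<psi> by (rule integrable_abs)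
      show "AE x in lebesgue_on {0<..<T}. (\<lambda>n. \<eta> n x * \<psi> x) \<longlonglongrightarrow> indicator {r<..t} x * \<psi> x"
      proof (rule AE_I2)
        fix x
        have HL: "(\<lambda>n. H (real n * (x - c))) \<longlonglongrightarrow> indicator {c<..} x" for c
        proof (cases "c < x")
          case True
          obtain m :: nat where m: "1 < real m * (x - c)" using reals_Archimedean3[of "x - c"] True by auto
          show ?thesis
          proof (rule tendsto_eventually)
            show "\<forall>\<^sub>F n in sequentially. H (real n * (x - c)) = indicator {c<..} x"
              using eventually_ge_at_top[of m]
            proof eventually_elim
              case (elim n)
              have "real m * (x - c) \<le> real n * (x - c)" using elim True by (intro mult_right_mono) auto
              then have "1 \<le> real n * (x - c)" using m by linarith
              then show ?case using True H(3) by simp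
            qed
          qed
        next
          case False
          then have "real n * (x - c) \<le> 0" for n by (simp add: mult_nonneg_nonpos)
          then show ?thesis using False H(2) by simp
        qed
        have "(\<lambda>n. \<eta> n x * \<psi> x) \<longlonglongrightarrow> (indicator {r<..} x - indicator {t<..} x) * \<psi> x"
          unfolding \<eta>_def by (intro tendsto_mult tendsto_diff HL tendsto_const)
        moreover have "indicator {r<..} x - indicator {t<..} x = (indicator {r<..t} x :: real)"
          using r by (auto simp: indicator_def)
        ultimately show "(\<lambda>n. \<eta> n x * \<psi> x) \<longlonglongrightarrow> indicator {r<..t} x * \<psi> x" by simp
      qed
      show "AE x in lebesgue_on {0<..<T}. norm (\<eta> n x * \<psi> x) \<le> \<bar>\<psi> x\<bar>" for n
      proof (rule AE_I2)
        fix x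
        have "\<bar>\<eta> n x\<bar> \<le> 1" using H(4,5)[of "real n * (x - r)"] H(4,5)[of "real n * (x - t)"] unfolding \<eta>_def by linarith
        then have "\<bar>\<eta> n x\<bar> * \<bar>\<psi> x\<bar> \<le> 1 * \<bar>\<psi> x\<bar>" by (intro mult_right_mono) auto
        then show "norm (\<eta> n x * \<psi> x) \<le> \<bar>\<psi> x\<bar>" by (simp add: abs_mult)
      qed
    qed
    have "(\<lambda>n. LINT x|lebesgue_on {0<..<T}. deriv (\<eta> n) x * \<phi> x) \<longlonglongrightarrow> - (LINT x|lebesgue_on {0<..<T}. indicator {r<..t} x * \<psi> x)"
    proof (rule Lim_transform_eventually[OF tendsto_minus[OF rhs]])
      show "\<forall>\<^sub>F n in sequentially. - (LINT x|lebesgue_on {0<..<T}. \<eta> n x * \<psi> x) = (LINT x|lebesgue_on {0<..<T}. deriv (\<eta> n) x * \<phi> x)"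
        using eventually_ge_at_top[of N] by eventually_elim (simp add: weak[OF test])
    qed
    then have eq: "\<phi> r - \<phi> t = - (LINT x|lebesgue_on {0<..<T}. indicator {r<..t} x * \<psi> x)"
      using LIMSEQ_unique[OF lhs] by blast
    have "(LINT x|lebesgue_on {0<..<T}. indicator {r<..t} x * \<psi> x) = (LINT x|lebesgue. indicator {0<..<T} x * (indicator {r<..t} x * \<psi> x))"
      by (subst integral_restrict_space) auto
    also have "\<dots> = (LINT x|lebesgue. indicator {r<..t} x * \<psi> x)"
      by (intro Bochner_Integration.integral_cong) (use r in \<open>auto simp: indicator_def\<close>)
    also have "\<dots> = (LINT x:{r<..t}|lebesgue. \<psi> x)" by (simp add: set_lebesgue_integral_def)
    also have "\<dots> = integral {r<..t} \<psi>"
    proof (rule set_lebesgue_integral_eq_integral)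
      have "\<psi> absolutely_integrable_on {0<..<T}" using \<psi> by (simp add: integrable_restrict_space set_integrable_def)
      then show "\<psi> absolutely_integrable_on {r<..t}" by (rule set_integrable_subset) (use r in auto)
    qed
    also have "\<dots> = integral {r..t} \<psi>"
      by (rule integral_spike_set) (auto intro: negligible_subset[of "{r}"])
    finally show ?thesis using eq by linarith
  qed
  show ?thesis
  proof (cases "r = t")
    case False
    then have rt: "r < t" using r by simp
    show ?thesis
    proof (cases "r = 0")
      case True
      \<comment> \<open>Test functions are supported away from time 0, so the left endpoint r = 0 is
        only reached as a limit, using continuity of \<open>\<phi>\<close> and of the integral in
        its lower endpoint.\<close>
      have lim: "((\<lambda>x. \<phi> t - \<phi> x) \<longlongrightarrow> \<phi> t - \<phi> 0) (at 0 within {0..t})"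
        using \<phi> T r(3) rt True by (intro tendsto_diff tendsto_const) (auto simp: continuous_on_def intro: tendsto_within_subset[where S="{0..<T}"])
      have "continuous_on {0..t} (\<lambda>x. integral {x..t} \<psi>)" by (rule indefinite_integral_continuous_1'[OF \<psi>i[OF r(3)]])
      then have lim2: "((\<lambda>x. integral {x..t} \<psi>) \<longlongrightarrow> integral {0..t} \<psi>) (at 0 within {0..t})"
        using rt True by (simp add: continuous_on_def)
      have "\<forall>\<^sub>F x in at 0 within {0..t}. integral {x..t} \<psi> = \<phi> t - \<phi> x"
      proof -
        have "\<forall>\<^sub>F x in at 0 within {0..t}. x \<in> {0..t} \<and> x \<noteq> 0 \<and> x < t"
          using rt True unfolding eventually_at by (intro exI[of _ t]) (auto simp: dist_real_def)
        then show ?thesis by eventually_elim (use main r in auto)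
      qed
      then have "((\<lambda>x. \<phi> t - \<phi> x) \<longlongrightarrow> integral {0..t} \<psi>) (at 0 within {0..t})"
        by (rule Lim_transform_eventually[OF lim2])
      moreover have "at 0 within {0..t} \<noteq> bot" using rt True by (simp add: at_within_Icc_at_right)
      ultimately show ?thesis using tendsto_unique[OF _ lim] True by auto
    next
      case False
      then show ?thesis using main rt r by simp
    qed
  qed simp
qed

section \<open>Bochner-type time integrals tested with functionals\<close>

text \<open>The bridge from Bochner-type notions to real analysis: a linear functional dominated by
  \<open>N\<close> carries simple functions, strong measurability and time integrals over to real
  functions of time. The instances pair a path, or one velocity component, with a fixed L^2
  function.\<close>

locale bounded_functional =
  fixes X :: "('a \<Rightarrow> 'b::real_normed_vector) set" and N :: "('a \<Rightarrow> 'b) \<Rightarrow> real" and \<Phi> :: "('a \<Rightarrow> 'b) \<Rightarrow> real" and C :: real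
  assumes X_zero: "(\<lambda>x. 0) \<in> X"
    and X_add: "f \<in> X \<Longrightarrow> g \<in> X \<Longrightarrow> (\<lambda>x. f x + g x) \<in> X"
    and X_scale: "f \<in> X \<Longrightarrow> (\<lambda>x. c *\<^sub>R f x) \<in> X"
    and add: "f \<in> X \<Longrightarrow> g \<in> X \<Longrightarrow> \<Phi> (\<lambda>x. f x + g x) = \<Phi> f + \<Phi> g"
    and scale: "f \<in> X \<Longrightarrow> \<Phi> (\<lambda>x. c *\<^sub>R f x) = c * \<Phi> f"
    and bound: "f \<in> X \<Longrightarrow> \<bar>\<Phi> f\<bar> \<le> C * N f"
    and C_pos: "C > 0"
begin

lemma X_diff: "f \<in> X \<Longrightarrow> g \<in> X \<Longrightarrow> (\<lambda>x. f x - g x) \<in> X"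
  using X_add[of f "\<lambda>x. (-1) *\<^sub>R g x"] X_scale[of g "-1"] by simp

lemma diff: "f \<in> X \<Longrightarrow> g \<in> X \<Longrightarrow> \<Phi> (\<lambda>x. f x - g x) = \<Phi> f - \<Phi> g"
  using add[of f "\<lambda>x. (-1) *\<^sub>R g x"] X_scale[of g "-1"] scale[of g "-1"] by simp

lemma X_sum_and_functional:
  assumes "finite Y" "Y \<subseteq> X"
  shows "(\<lambda>x. \<Sum>y\<in>Y. m y *\<^sub>R y x) \<in> X \<and> \<Phi> (\<lambda>x. \<Sum>y\<in>Y. m y *\<^sub>R y x) = (\<Sum>y\<in>Y. m y * \<Phi> y)"
  using assms
proof (induction Y)
  case empty
  then show ?case using X_zero scale[of "\<lambda>x. 0" 0] by simp
next
  case (insert y Y)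
  then show ?case
    using X_add[OF X_scale[of y "m y"], of "\<lambda>x. \<Sum>y\<in>Y. m y *\<^sub>R y x"] add[OF X_scale[of y "m y"], of "\<lambda>x. \<Sum>y\<in>Y. m y *\<^sub>R y x"]
      scale[of y "m y"] by simp
qed

lemma simple_measurable:
  assumes "X_simple T X S"
  shows "(\<lambda>t. \<Phi> (S t)) \<in> borel_measurable (lebesgue_on {0<..<T})"
proof -
  have "simple_function (lebesgue_on {0<..<T}) (\<Phi> \<circ> S)"
    using assms unfolding X_simple_def by (intro simple_function_compose) simp
  then show ?thesis using borel_measurable_simple_function by (auto simp: comp_def)
qed

lemma strongly_measurable_functional:
  assumes "strongly_measurable T X N u"
  shows "(\<lambda>t. \<Phi> (u t)) \<in> borel_measurable (lebesgue_on {0<..<T})"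
proof -
  obtain S where S: "\<And>n. X_simple T X (S n)"
    and lim: "AE t in lebesgue_on {0<..<T}. (\<lambda>n. N (\<lambda>x. u t x - S n t x)) \<longlonglongrightarrow> 0"
    and uX: "AE t in lebesgue_on {0<..<T}. u t \<in> X"
    using assms unfolding strongly_measurable_def by blast
  have "AE t in lebesgue_on {0<..<T}. \<Phi> (u t) = lim (\<lambda>n. \<Phi> (S n t))"
    using lim uX AE_space
  proof eventually_elim
    case (elim t)
    then have SX: "S n t \<in> X" for n using S unfolding X_simple_def by (simp add: space_restrict_space)
    have b: "\<bar>\<Phi> (u t) - \<Phi> (S n t)\<bar> \<le> C * N (\<lambda>x. u t x - S n t x)" for n
      using bound[OF X_diff[OF elim(2) SX]] diff[OF elim(2) SX] by simp
    have "(\<lambda>n. \<Phi> (u t) - \<Phi> (S n t)) \<longlonglongrightarrow> 0"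
    proof (rule Lim_null_comparison)
      show "\<forall>\<^sub>F n in sequentially. norm (\<Phi> (u t) - \<Phi> (S n t)) \<le> C * N (\<lambda>x. u t x - S n t x)" using b by simp
      show "(\<lambda>n. C * N (\<lambda>x. u t x - S n t x)) \<longlonglongrightarrow> 0" using tendsto_mult_right_zero[OF elim(1)] by simp
    qed
    then have "(\<lambda>n. \<Phi> (S n t)) \<longlonglongrightarrow> \<Phi> (u t)" using tendsto_diff[of "\<lambda>n. \<Phi> (u t)" "\<Phi> (u t)" _ "\<lambda>n. \<Phi> (u t) - \<Phi> (S n t)" 0] by simp
    then show ?case by (simp add: limI)
  qed
  then show ?thesis
    by (rule measurable_AE_cong[rotated 2]) (auto intro!: borel_measurable_lim_metric simple_measurable S)
qed

lemma finite_measure_time: "finite_measure (lebesgue_on {0<..<T::real})"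
  using emeasure_bounded_finite[of "{0<..<T}"] by (intro finite_measureI) (simp add: emeasure_restrict_space)

lemma functional_simple_integral:
  assumes S: "X_simple T X S"
  shows "integrable (lebesgue_on {0<..<T}) (\<lambda>t. \<Phi> (S t))"
    "(LINT t|lebesgue_on {0<..<T}. \<Phi> (S t)) = \<Phi> (simple_integral_time T S)"
    "simple_integral_time T S \<in> X"
proof -
  let ?M = "lebesgue_on {0<..<T}" and ?Y = "S ` {0<..<T}"
  have sf: "simple_function ?M S" and SX: "?Y \<subseteq> X" using S by (auto simp: X_simple_def)
  have fin: "finite ?Y" using simple_functionD(1)[OF sf] by (simp add: space_restrict_space)
  have set: "{t \<in> {0<..<T}. S t = y} \<in> sets ?M" for y
    using simple_functionD(2)[OF sf, of "{y}"] by (simp add: space_restrict_space vimage_def Int_def conj_commute)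
  have eq: "\<Phi> (S t) = (\<Sum>y\<in>?Y. indicator {t \<in> {0<..<T}. S t = y} t * \<Phi> y)" if "t \<in> space ?M" for t
  proof -
    have t: "t \<in> {0<..<T}" using that by (simp add: space_restrict_space)
    have "(\<Sum>y\<in>?Y. indicator {t \<in> {0<..<T}. S t = y} t * \<Phi> y) = (\<Sum>y\<in>?Y. if y = S t then \<Phi> y else 0)"
      using t by (intro sum.cong) (auto simp: indicator_def)
    then show ?thesis using fin t by simp
  qed
  have ii: "integrable ?M (\<lambda>t. indicator {t \<in> {0<..<T}. S t = y} t * \<Phi> y)" for y
    by (intro integrable_mult_left finite_measure.integrable_const_bound[OF finite_measure_time, of _ 1] borel_measurable_indicator set)
      (simp add: indicator_def)
  have i: "integrable ?M (\<lambda>t. \<Sum>y\<in>?Y. indicator {t \<in> {0<..<T}. S t = y} t * \<Phi> y)"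
    by (rule Bochner_Integration.integrable_sum) (rule ii)
  show "integrable ?M (\<lambda>t. \<Phi> (S t))"
    by (subst Bochner_Integration.integrable_cong[OF refl eq]) (use i in auto)
  have "(LINT t|?M. \<Phi> (S t)) = (LINT t|?M. (\<Sum>y\<in>?Y. indicator {t \<in> {0<..<T}. S t = y} t * \<Phi> y))"
    by (rule Bochner_Integration.integral_cong[OF refl eq])
  also have "\<dots> = (\<Sum>y\<in>?Y. (LINT t|?M. indicator {t \<in> {0<..<T}. S t = y} t * \<Phi> y))"
    by (rule Bochner_Integration.integral_sum) (rule ii)
  also have "\<dots> = (\<Sum>y\<in>?Y. measure lebesgue {t \<in> {0<..<T}. S t = y} * \<Phi> y)"
  proof (rule sum.cong[OF refl])
    fix y
    have "(LINT t|?M. indicator {t \<in> {0<..<T}. S t = y} t * \<Phi> y) = measure ?M {t \<in> {0<..<T}. S t = y} * \<Phi> y"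
    proof -
      have "{t. 0 < t \<and> t < T \<and> S t = y} \<inter> {0<..<T} = {t. 0 < t \<and> t < T \<and> S t = y}" by auto
      then show ?thesis using set[of y] by simp
    qed
    also have "measure ?M {t \<in> {0<..<T}. S t = y} = measure lebesgue {t \<in> {0<..<T}. S t = y}"
      by (rule measure_restrict_space) auto
    finally show "(LINT t|?M. indicator {t \<in> {0<..<T}. S t = y} t * \<Phi> y) = measure lebesgue {t \<in> {0<..<T}. S t = y} * \<Phi> y" .
  qed
  also have "\<dots> = \<Phi> (simple_integral_time T S)"
    unfolding simple_integral_time_def[abs_def] using X_sum_and_functional[OF fin SX] by simp
  finally show "(LINT t|?M. \<Phi> (S t)) = \<Phi> (simple_integral_time T S)" .
  show "simple_integral_time T S \<in> X"
    unfolding simple_integral_time_def[abs_def] by (rule X_sum_and_functional[OF fin SX, of "\<lambda>y. measure lebesgue {t \<in> {0<..<T}. S t = y}", THEN conjunct1])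
qed

text \<open>Both the integral of \<open>\<Phi> (f t)\<close> and \<open>\<Phi> J\<close> are limits
  of \<open>\<Phi>\<close> applied to the integrals of the same simple functions.\<close>

lemma functional_time_integral:
  assumes "has_time_integral T X N f J"
  shows "integrable (lebesgue_on {0<..<T}) (\<lambda>t. \<Phi> (f t))" "(LINT t|lebesgue_on {0<..<T}. \<Phi> (f t)) = \<Phi> J"
proof -
  let ?M = "lebesgue_on {0<..<T}"
  from assms obtain S where J: "J \<in> X" and sm: "strongly_measurable T X N f" and S: "\<And>n. X_simple T X (S n)"
    and l1: "(\<lambda>n. \<integral>\<^sup>+ t. ennreal (N (\<lambda>x. f t x - S n t x)) \<partial>?M) \<longlonglongrightarrow> 0"
    and l2: "(\<lambda>n. N (\<lambda>x. J x - simple_integral_time T (S n) x)) \<longlonglongrightarrow> 0"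
    unfolding has_time_integral_def by blast
  have fX: "AE t in ?M. f t \<in> X" using sm by (simp add: strongly_measurable_def)
  note fm = strongly_measurable_functional[OF sm]
  \<comment> \<open>A measurable minorant of \<open>N (f - S n)\<close>. The nonnegative integral is
    monotone, so convergence to 0 passes to \<open>?d\<close> although measurability of the seminorm
    itself is not part of \<open>has_time_integral\<close>.\<close>
  let ?d = "\<lambda>n t. \<bar>\<Phi> (f t) - \<Phi> (S n t)\<bar> / C"
  have dm: "?d n \<in> borel_measurable ?M" for n
    by (intro borel_measurable_divide borel_measurable_abs borel_measurable_diff fm simple_measurable[OF S] borel_measurable_const)
  have le: "(\<integral>\<^sup>+ t. ennreal (?d n t) \<partial>?M) \<le> (\<integral>\<^sup>+ t. ennreal (N (\<lambda>x. f t x - S n t x)) \<partial>?M)" for n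
  proof (rule nn_integral_mono_AE)
    show "AE t in ?M. ennreal (?d n t) \<le> ennreal (N (\<lambda>x. f t x - S n t x))"
      using fX AE_space
    proof eventually_elim
      case (elim t)
      then have SX: "S n t \<in> X" using S unfolding X_simple_def by (simp add: space_restrict_space)
      have "\<bar>\<Phi> (f t) - \<Phi> (S n t)\<bar> \<le> C * N (\<lambda>x. f t x - S n t x)"
        using bound[OF X_diff[OF elim(1) SX]] diff[OF elim(1) SX] by simp
      then have "?d n t \<le> N (\<lambda>x. f t x - S n t x)" using C_pos by (simp add: divide_le_eq mult.commute)
      then show ?case by (rule ennreal_leI)
    qed
  qed
  have lim: "(\<lambda>n. \<integral>\<^sup>+ t. ennreal (?d n t) \<partial>?M) \<longlonglongrightarrow> 0"
    by (rule tendsto_sandwich[OF _ _ tendsto_const l1]) (simp, rule always_eventually, rule allI, rule le)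
  have "\<forall>\<^sub>F n in sequentially. (\<integral>\<^sup>+ t. ennreal (?d n t) \<partial>?M) < \<infinity>"
    by (rule order_tendstoD(2)[OF lim]) simp
  \<comment> \<open>Finiteness is only guaranteed from some index on, so integrability of
    \<open>\<Phi> (f t)\<close> is deduced from the approximation number \<open>n0\<close>.\<close>
  then obtain n0 where n0: "\<And>n. n \<ge> n0 \<Longrightarrow> (\<integral>\<^sup>+ t. ennreal (?d n t) \<partial>?M) < \<infinity>" by (auto simp: eventually_sequentially)
  have di: "integrable ?M (?d n)" if "n \<ge> n0" for n
    using n0[OF that] C_pos by (intro integrableI_nonneg dm) auto
  have fd: "integrable ?M (\<lambda>t. \<Phi> (f t) - \<Phi> (S n t))" if "n \<ge> n0" for n
  proof -
    have "integrable ?M (\<lambda>t. C * ?d n t)" by (intro integrable_mult_right di that)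
    then have "integrable ?M (\<lambda>t. \<bar>\<Phi> (f t) - \<Phi> (S n t)\<bar>)" using C_pos by simp
    then show ?thesis
      by (subst (asm) integrable_abs_iff) (intro borel_measurable_diff fm simple_measurable[OF S])
  qed
  show fi: "integrable ?M (\<lambda>t. \<Phi> (f t))"
    using Bochner_Integration.integrable_add[OF fd[OF order_refl] functional_simple_integral(1)[OF S[of n0]]] by simp
  have "(\<lambda>n. ennreal (LINT t|?M. ?d n t)) \<longlonglongrightarrow> ennreal 0"
  proof (rule Lim_transform_eventually[OF lim[folded ennreal_0]])
    show "\<forall>\<^sub>F n in sequentially. (\<integral>\<^sup>+ t. ennreal (?d n t) \<partial>?M) = ennreal (LINT t|?M. ?d n t)"
      using eventually_ge_at_top[of n0]
    proof eventually_elim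
      case (elim n)
      show ?case by (rule nn_integral_eq_integral[OF di[OF elim]]) (use C_pos in auto)
    qed
  qed
  then have dl: "(\<lambda>n. LINT t|?M. ?d n t) \<longlonglongrightarrow> 0"
    by (subst (asm) tendsto_ennreal_iff) (use C_pos in \<open>auto intro!: always_eventually integral_nonneg_AE\<close>)
  have "(\<lambda>n. (LINT t|?M. \<Phi> (f t)) - \<Phi> (simple_integral_time T (S n))) \<longlonglongrightarrow> 0"
  proof (rule Lim_null_comparison)
    show "(\<lambda>n. C * (LINT t|?M. ?d n t)) \<longlonglongrightarrow> 0" by (rule tendsto_mult_right_zero[OF dl])
    show "\<forall>\<^sub>F n in sequentially. norm ((LINT t|?M. \<Phi> (f t)) - \<Phi> (simple_integral_time T (S n))) \<le> C * (LINT t|?M. ?d n t)"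
      using eventually_ge_at_top[of n0]
    proof eventually_elim
      case (elim n)
      have "(LINT t|?M. \<Phi> (f t)) - \<Phi> (simple_integral_time T (S n)) = (LINT t|?M. \<Phi> (f t) - \<Phi> (S n t))"
        unfolding functional_simple_integral(2)[OF S, symmetric]
        by (rule Bochner_Integration.integral_diff[symmetric, OF fi functional_simple_integral(1)[OF S]])
      then have "norm ((LINT t|?M. \<Phi> (f t)) - \<Phi> (simple_integral_time T (S n))) \<le> (LINT t|?M. norm (\<Phi> (f t) - \<Phi> (S n t)))"
        by (simp only: integral_norm_bound)
      also have "\<dots> = C * (LINT t|?M. ?d n t)" using C_pos by simp
      finally show ?case .
    qed
  qed
  moreover have "(\<lambda>n. \<Phi> J - \<Phi> (simple_integral_time T (S n))) \<longlonglongrightarrow> 0"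
  proof (rule Lim_null_comparison)
    show "(\<lambda>n. C * N (\<lambda>x. J x - simple_integral_time T (S n) x)) \<longlonglongrightarrow> 0" using tendsto_mult_right_zero[OF l2] by simp
    show "\<forall>\<^sub>F n in sequentially. norm (\<Phi> J - \<Phi> (simple_integral_time T (S n))) \<le> C * N (\<lambda>x. J x - simple_integral_time T (S n) x)"
      using bound[OF X_diff[OF J functional_simple_integral(3)[OF S]]] diff[OF J functional_simple_integral(3)[OF S]]
      by (intro always_eventually allI) simp
  qed
  ultimately have "(\<lambda>n. ((LINT t|?M. \<Phi> (f t)) - \<Phi> (simple_integral_time T (S n))) - (\<Phi> J - \<Phi> (simple_integral_time T (S n)))) \<longlonglongrightarrow> 0 - 0"
    by (rule tendsto_diff)
  then have "(\<lambda>n. (LINT t|?M. \<Phi> (f t)) - \<Phi> J) \<longlonglongrightarrow> 0" by simp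
  then show "(LINT t|?M. \<Phi> (f t)) = \<Phi> J" by (simp add: LIMSEQ_const_iff)
qed

text \<open>Applying \<open>\<Phi>\<close> to the two time integrals in the definition of the weak
  derivative gives a scalar weak derivative, to which \<open>du_bois_reymond\<close>
  applies.\<close>

lemma W12_functional_increment:
  assumes W: "W12_time T X N u du" and cont: "continuous_on {0..<T} (\<lambda>t. \<Phi> (u t))"
  shows "integrable (lebesgue_on {0<..<T}) (\<lambda>t. \<Phi> (du t))"
    "0 \<le> r \<Longrightarrow> r \<le> t \<Longrightarrow> t < T \<Longrightarrow> \<Phi> (u t) - \<Phi> (u r) = integral {r..t} (\<lambda>t. \<Phi> (du t))"
proof -
  let ?M = "lebesgue_on {0<..<T}"
  have smu: "strongly_measurable T X N u" and smd: "strongly_measurable T X N du"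
    and i2: "integrable ?M (\<lambda>t. (N (du t))\<^sup>2)"
    using W by (auto simp: W12_time_def L2_time_def)
  have uX: "AE t in ?M. u t \<in> X" and dX: "AE t in ?M. du t \<in> X"
    using smu smd by (auto simp: strongly_measurable_def)
  show I: "integrable ?M (\<lambda>t. \<Phi> (du t))"
  proof (rule Bochner_Integration.integrable_bound)
    \<comment> \<open>On a bounded interval N \<le> 1 + N^2 turns square integrability into
      integrability.\<close>
    show "integrable ?M (\<lambda>t. C * (1 + (N (du t))\<^sup>2))"
      using i2 finite_measure.integrable_const[OF finite_measure_time]
      by (intro integrable_mult_right Bochner_Integration.integrable_add)
    show "(\<lambda>t. \<Phi> (du t)) \<in> borel_measurable ?M" by (rule strongly_measurable_functional[OF smd])
    show "AE t in ?M. norm (\<Phi> (du t)) \<le> norm (C * (1 + (N (du t))\<^sup>2))"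
      using dX
    proof eventually_elim
      case (elim t)
      have "2 * N (du t) \<le> 1 + (N (du t))\<^sup>2" using sum_squares_bound[of 1 "N (du t)"] by simp
      moreover have "0 \<le> 1 + (N (du t))\<^sup>2" by simp
      ultimately have "N (du t) \<le> 1 + (N (du t))\<^sup>2" by linarith
      then have "C * N (du t) \<le> C * (1 + (N (du t))\<^sup>2)" using C_pos by (intro mult_left_mono) auto
      then have "\<bar>\<Phi> (du t)\<bar> \<le> C * (1 + (N (du t))\<^sup>2)" using bound[OF elim] by linarith
      then show ?case using C_pos by simp
    qed
  qed
  show "\<Phi> (u t) - \<Phi> (u r) = integral {r..t} (\<lambda>t. \<Phi> (du t))" if "0 \<le> r" "r \<le> t" "t < T"
  proof (rule du_bois_reymond[OF cont I _ that])
    fix \<eta> assume \<eta>: "time_test_function T \<eta>"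
    obtain J where J1: "has_time_integral T X N (\<lambda>t x. deriv \<eta> t *\<^sub>R u t x) J"
      and J2: "has_time_integral T X N (\<lambda>t x. \<eta> t *\<^sub>R du t x) (\<lambda>x. - J x)"
      using W \<eta> unfolding W12_time_def by blast
    have JX: "J \<in> X" using J1 by (simp add: has_time_integral_def)
    have "(LINT t|?M. deriv \<eta> t * \<Phi> (u t)) = (LINT t|?M. \<Phi> (\<lambda>x. deriv \<eta> t *\<^sub>R u t x))"
    proof (rule integral_AE_cong)
      show "AE t in ?M. deriv \<eta> t * \<Phi> (u t) = \<Phi> (\<lambda>x. deriv \<eta> t *\<^sub>R u t x)" using uX by eventually_elim (simp add: scale)
    qed (use functional_time_integral(1)[OF J1] in auto)
    also have "\<dots> = \<Phi> J" by (rule functional_time_integral(2)[OF J1])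
    also have "\<dots> = - \<Phi> (\<lambda>x. - J x)" using scale[OF JX, of "-1"] by simp
    also have "\<Phi> (\<lambda>x. - J x) = (LINT t|?M. \<Phi> (\<lambda>x. \<eta> t *\<^sub>R du t x))" by (rule functional_time_integral(2)[OF J2, symmetric])
    also have "\<dots> = (LINT t|?M. \<eta> t * \<Phi> (du t))"
    proof (rule integral_AE_cong[symmetric])
      show "AE t in ?M. \<eta> t * \<Phi> (du t) = \<Phi> (\<lambda>x. \<eta> t *\<^sub>R du t x)" using dX by eventually_elim (simp add: scale)
    qed (use functional_time_integral(1)[OF J2] in auto)
    finally show "(LINT t|?M. deriv \<eta> t * \<Phi> (u t)) = - (LINT t|?M. \<eta> t * \<Phi> (du t))" .
  qed
qed

end

section \<open>Integral inequalities in time\<close>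

lemma time_absolutely_integrable:
  fixes f :: "real \<Rightarrow> real"
  assumes "integrable (lebesgue_on {0<..<T}) f"
  shows "f absolutely_integrable_on {0..T}"
proof -
  have "f absolutely_integrable_on {0<..<T}" using assms by (simp add: integrable_restrict_space set_integrable_def)
  then show ?thesis
    by (rule absolutely_integrable_spike_set) (auto intro: negligible_subset[of "{0, T}"])
qed

lemma time_integrable:
  fixes f :: "real \<Rightarrow> real"
  assumes "integrable (lebesgue_on {0<..<T}) f" "0 \<le> r" "t \<le> T"
  shows "f integrable_on {r..t}"
proof -
  have "f integrable_on {0..T}"
    using time_absolutely_integrable[OF assms(1)] by (rule absolutely_integrable_on_def[THEN iffD1, THEN conjunct1])
  then show ?thesis by (rule integrable_subinterval_real) (use assms in auto)
qed

lemma integral_le_off_negligible: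
  fixes f g :: "real \<Rightarrow> real"
  assumes "f integrable_on {r..t}" "g integrable_on {r..t}" "negligible E" "\<And>x. x \<in> {r..t} - E \<Longrightarrow> f x \<le> g x"
  shows "integral {r..t} f \<le> integral {r..t} g"
proof -
  define f' where "f' x = (if x \<in> E then g x else f x)" for x
  have "f' integrable_on {r..t}"
    by (rule integrable_spike[OF assms(1) assms(3)]) (simp add: f'_def)
  moreover have "integral {r..t} f = integral {r..t} f'"
    by (rule integral_spike[OF assms(3)]) (simp add: f'_def)
  ultimately show ?thesis using assms by (simp only:) (rule integral_le, auto simp: f'_def)
qed

text \<open>On n equal pieces the errors add up to \<open>K * (b - a) / n\<close> times the integral
  of \<open>g\<close>, which tends to 0. A remainder of second order in the length thus disappears
  without any differentiation of \<open>F\<close>.\<close>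

lemma integral_le_of_increments:
  fixes F h g :: "real \<Rightarrow> real"
  assumes ab: "a \<le> b" and h: "h integrable_on {a..b}" and g: "g integrable_on {a..b}"
    and inc: "\<And>r t. a \<le> r \<Longrightarrow> r \<le> t \<Longrightarrow> t \<le> b \<Longrightarrow> F t - F r \<le> integral {r..t} h + K * (t - r) * integral {r..t} g"
  shows "F b - F a \<le> integral {a..b} h"
proof -
  have step: "F b - F a \<le> integral {a..b} h + K * (b - a) * integral {a..b} g / real n" if n: "n > 0" for n
  proof -
    define d where "d = (b - a) / real n"
    define x where "x i = a + real i * d" for i
    have d0: "0 \<le> d" using ab by (simp add: d_def)
    have nd: "real n * d = b - a" using n by (simp add: d_def)
    have "F (x i) - F a \<le> integral {a..x i} h + K * d * integral {a..x i} g" if "i \<le> n" for i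
      using that
    proof (induction i)
      case (Suc i)
      have xi: "a \<le> x i" "x i \<le> x (Suc i)" using d0 by (auto simp: x_def distrib_right)
      have "x (Suc i) \<le> b"
      proof -
        have "real (Suc i) * d \<le> real n * d" using Suc.prems d0 by (intro mult_right_mono) auto
        then show ?thesis using nd by (simp add: x_def)
      qed
      note xi = xi this
      have "F (x (Suc i)) - F (x i) \<le> integral {x i..x (Suc i)} h + K * (x (Suc i) - x i) * integral {x i..x (Suc i)} g"
        by (rule inc[OF xi])
      moreover have "x (Suc i) - x i = d" by (simp add: x_def distrib_right)
      moreover have "integral {a..x i} h + integral {x i..x (Suc i)} h = integral {a..x (Suc i)} h"
        using xi by (intro Henstock_Kurzweil_Integration.integral_combine integrable_subinterval_real[OF h]) auto
      moreover have "integral {a..x i} g + integral {x i..x (Suc i)} g = integral {a..x (Suc i)} g"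
        using xi by (intro Henstock_Kurzweil_Integration.integral_combine integrable_subinterval_real[OF g]) auto
      moreover have "F (x i) - F a \<le> integral {a..x i} h + K * d * integral {a..x i} g" using Suc by simp
      ultimately show ?case by (smt (verit) distrib_left)
    qed (simp add: x_def)
    from this[of n] have "F b - F a \<le> integral {a..b} h + K * d * integral {a..b} g"
      using nd by (simp add: x_def)
    then show ?thesis by (simp add: d_def)
  qed
  have "(\<lambda>n. integral {a..b} h + K * (b - a) * integral {a..b} g * inverse (real (Suc n))) \<longlonglongrightarrow> integral {a..b} h + K * (b - a) * integral {a..b} g * 0"
    by (intro tendsto_intros LIMSEQ_inverse_real_of_nat)
  then have "F b - F a \<le> integral {a..b} h + K * (b - a) * integral {a..b} g * 0"
  proof (rule LIMSEQ_le_const, intro exI[of _ 0] allI impI)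
    fix n
    show "F b - F a \<le> integral {a..b} h + K * (b - a) * integral {a..b} g * inverse (real (Suc n))"
      using step[of "Suc n"] by (simp only: divide_inverse zero_less_Suc simp_thms)
  qed
  then show ?thesis by simp
qed

text \<open>Gronwall in a form that never integrates the product of \<open>F\<close> and
  \<open>h\<close>: an upper bound \<open>S\<close> of \<open>F\<close> stands in for
  \<open>F\<close> under the integral. On intervals where the integral of \<open>h\<close> is below
  1/2 the maximum of \<open>F\<close> is at most half of itself.\<close>

lemma gronwall_zero:
  fixes F h :: "real \<Rightarrow> real"
  assumes Fc: "continuous_on {0..b} F" and F0: "F 0 = 0" and Fn: "\<And>t. t \<in> {0..b} \<Longrightarrow> 0 \<le> F t"
    and h: "h integrable_on {0..b}" and hn: "\<And>t. t \<in> {0..b} \<Longrightarrow> 0 \<le> h t"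
    and inc: "\<And>a c S. 0 \<le> a \<Longrightarrow> a \<le> c \<Longrightarrow> c \<le> b \<Longrightarrow> (\<And>t. t \<in> {a..c} \<Longrightarrow> F t \<le> S) \<Longrightarrow> F c - F a \<le> S * integral {a..c} h"
    and t: "t \<in> {0..b}"
  shows "F t = 0"
proof -
  have b0: "0 \<le> b" using t by auto
  have "uniformly_continuous_on {0..b} (\<lambda>x. integral {0..x} h)"
    by (intro compact_uniformly_continuous indefinite_integral_continuous_1 h) auto
  then obtain \<delta> where \<delta>: "\<delta> > 0" "\<And>x y. x \<in> {0..b} \<Longrightarrow> y \<in> {0..b} \<Longrightarrow> dist y x < \<delta> \<Longrightarrow> dist (integral {0..y} h) (integral {0..x} h) < 1/2"
    unfolding uniformly_continuous_on_def by (metis half_gt_zero zero_less_one)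
  have small: "integral {x..y} h < 1/2" if "0 \<le> x" "x \<le> y" "y \<le> b" "y - x < \<delta>" for x y
  proof -
    have "integral {0..x} h + integral {x..y} h = integral {0..y} h"
      using that by (intro Henstock_Kurzweil_Integration.integral_combine integrable_subinterval_real[OF h]) auto
    moreover have "dist (integral {0..y} h) (integral {0..x} h) < 1/2" using that by (intro \<delta>(2)) (auto simp: dist_real_def)
    ultimately show ?thesis unfolding dist_real_def by argo
  qed
  \<comment> \<open>Steps of length \<delta>/2 leave the strict inequality that \<open>small\<close>
    asks for.\<close>
  have *: "\<forall>t\<in>{0..b}. t \<le> real k * (\<delta> / 2) \<longrightarrow> F t = 0" for k
  proof (induction k)
    case 0
    then show ?case using F0 by auto
  next
    case (Suc k)
    define a where "a = real k * (\<delta> / 2)"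
    have a0: "0 \<le> a" using \<delta> by (simp add: a_def)
    show ?case
    proof (intro ballI impI)
      fix t assume t: "t \<in> {0..b}" "t \<le> real (Suc k) * (\<delta> / 2)"
      show "F t = 0"
      proof (cases "t \<le> a")
        case True
        then show ?thesis using Suc t by (simp add: a_def)
      next
        case False
        have Fa: "F a = 0" using Suc False t a0 by (simp add: a_def)
        have "continuous_on {a..t} F" using Fc by (rule continuous_on_subset) (use a0 t in auto)
        \<comment> \<open>At a maximum point the value \<open>F c\<close> itself may serve as
          \<open>S\<close>.\<close>
        then obtain c where c: "c \<in> {a..t}" "\<And>y. y \<in> {a..t} \<Longrightarrow> F y \<le> F c"
          using continuous_attains_sup[of "{a..t}" F] False by auto
        have "F c - F a \<le> F c * integral {a..c} h"
          by (rule inc) (use a0 c t in auto)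
        also have "\<dots> \<le> F c * (1/2)"
        proof (rule mult_left_mono)
          have "c - a \<le> \<delta> / 2" using c t by (simp add: a_def distrib_right)
          then have "c - a < \<delta>" using \<delta>(1) by linarith
          then show "integral {a..c} h \<le> 1/2" using small[of a c] a0 c t by auto
          show "0 \<le> F c" using Fn c a0 t by auto
        qed
        finally have "F c \<le> 0" using Fa by linarith
        then show ?thesis using c(2)[of t] Fn[OF t(1)] False by auto
      qed
    qed
  qed
  obtain k :: nat where "t < real k * (\<delta> / 2)" using reals_Archimedean3[of "\<delta> / 2"] \<delta>(1) by auto
  then show ?thesis using *[of k] t by auto
qed

section \<open>Energy estimates along paths, without differentiating the energy\<close>

section \<open>Absolutely continuous paths of square-integrable functions\<close>

text \<open>The derivative is known only through its pairings with fixed functions \<open>w\<close>.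
  The integrable majorant \<open>\<gamma>\<close> of its squared norm is carried along, so the norm
  never has to be integrated in time.\<close>

definition l2_path :: "real \<Rightarrow> (real \<Rightarrow> real) \<Rightarrow> (real \<Rightarrow> real^'n \<Rightarrow> real) \<Rightarrow> (real \<Rightarrow> real^'n \<Rightarrow> real) \<Rightarrow> bool" where
  "l2_path T \<gamma> z dz \<longleftrightarrow> (\<forall>t\<in>{0..T}. z t \<in> L2_torus) \<and> \<gamma> integrable_on {0..T} \<and>
     (\<exists>E. negligible E \<and> (\<forall>t\<in>{0..T} - E. dz t \<in> L2_torus \<and> l2_inner (dz t) (dz t) \<le> \<gamma> t)) \<and>
     (\<forall>w\<in>L2_torus. (\<lambda>t. l2_inner (dz t) w) integrable_on {0..T} \<and>
        (\<forall>r t. 0 \<le> r \<longrightarrow> r \<le> t \<longrightarrow> t \<le> T \<longrightarrow> l2_inner (z t) w - l2_inner (z r) w = integral {r..t} (\<lambda>t. l2_inner (dz t) w)))"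

lemma l2_pathD:
  assumes "l2_path T \<gamma> z dz"
  shows "t \<in> {0..T} \<Longrightarrow> z t \<in> L2_torus" "\<gamma> integrable_on {0..T}"
    "w \<in> L2_torus \<Longrightarrow> (\<lambda>t. l2_inner (dz t) w) integrable_on {0..T}"
    "w \<in> L2_torus \<Longrightarrow> 0 \<le> r \<Longrightarrow> r \<le> t \<Longrightarrow> t \<le> T \<Longrightarrow> l2_inner (z t) w - l2_inner (z r) w = integral {r..t} (\<lambda>t. l2_inner (dz t) w)"
  using assms unfolding l2_path_def by blast+

lemma l2_pathE:
  assumes "l2_path T \<gamma> z dz"
  obtains E where "negligible E" "\<And>t. t \<in> {0..T} - E \<Longrightarrow> dz t \<in> L2_torus" "\<And>t. t \<in> {0..T} - E \<Longrightarrow> l2_inner (dz t) (dz t) \<le> \<gamma> t"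
  using assms unfolding l2_path_def by blast

lemma l2_inner_young:
  fixes u v :: "real^'n \<Rightarrow> real"
  assumes "u \<in> L2_torus" "v \<in> L2_torus" "c > 0"
  shows "2 * \<bar>l2_inner u v\<bar> \<le> c * l2_inner u u + l2_inner v v / c"
proof -
  let ?a = "sqrt (l2_inner u u)" and ?b = "sqrt (l2_inner v v)"
  have "2 * \<bar>l2_inner u v\<bar> \<le> 2 * (?a * ?b)" using l2_cauchy_schwarz[OF assms(1,2)] by simp
  also have "\<dots> = 2 * (sqrt c * ?a) * (?b / sqrt c)" using assms(3) by simp
  also have "\<dots> \<le> (sqrt c * ?a)\<^sup>2 + (?b / sqrt c)\<^sup>2" by (rule sum_squares_bound)
  also have "\<dots> = c * l2_inner u u + l2_inner v v / c"
    using assms(3) by (simp add: power_mult_distrib power_divide l2_inner_self_nonneg)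
  finally show ?thesis .
qed

text \<open>Test with the increment itself. Young's inequality with weight \<open>t - r\<close>
  leaves half of the squared norm of the increment on the right, where it is absorbed.\<close>

lemma l2_path_increment:
  assumes p: "l2_path T \<gamma> z dz" and r: "0 \<le> r" "r \<le> t" "t \<le> T"
  shows "l2_inner (\<lambda>x. z t x - z r x) (\<lambda>x. z t x - z r x) \<le> (t - r) * integral {r..t} \<gamma>"
proof (cases "r = t")
  case True
  then show ?thesis by (simp add: l2_inner_def)
next
  case False
  let ?w = "\<lambda>x. z t x - z r x"
  have L: "z t \<in> L2_torus" "z r \<in> L2_torus" using l2_pathD(1)[OF p] r by auto
  then have w: "?w \<in> L2_torus" by (rule L2_diff)
  obtain E where E: "negligible E" "\<And>t. t \<in> {0..T} - E \<Longrightarrow> dz t \<in> L2_torus" "\<And>t. t \<in> {0..T} - E \<Longrightarrow> l2_inner (dz t) (dz t) \<le> \<gamma> t"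
    using l2_pathE[OF p] by blast
  have \<gamma>i: "\<gamma> integrable_on {r..t}" by (rule integrable_subinterval_real[OF l2_pathD(2)[OF p]]) (use r in auto)
  let ?d = "t - r" and ?W = "l2_inner ?w ?w"
  have d: "?d > 0" using False r by simp
  have "?W = integral {r..t} (\<lambda>\<tau>. l2_inner (dz \<tau>) ?w)"
    using l2_inner_diff[OF L w] l2_pathD(4)[OF p w r] by simp
  also have "\<dots> \<le> integral {r..t} (\<lambda>\<tau>. ?d / 2 * \<gamma> \<tau> + ?W / ?d / 2)"
  proof (rule integral_le_off_negligible[OF _ _ E(1)])
    show "(\<lambda>\<tau>. l2_inner (dz \<tau>) ?w) integrable_on {r..t}"
      by (rule integrable_subinterval_real[OF l2_pathD(3)[OF p w]]) (use r in auto)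
    show "(\<lambda>\<tau>. ?d / 2 * \<gamma> \<tau> + ?W / ?d / 2) integrable_on {r..t}"
      by (intro integrable_add integrable_on_mult_right \<gamma>i) auto
    fix \<tau> assume "\<tau> \<in> {r..t} - E"
    then have \<tau>: "\<tau> \<in> {0..T} - E" using r by auto
    have "2 * l2_inner (dz \<tau>) ?w \<le> ?d * l2_inner (dz \<tau>) (dz \<tau>) + ?W / ?d"
      using l2_inner_young[OF E(2)[OF \<tau>] w d] by linarith
    also have "\<dots> \<le> ?d * \<gamma> \<tau> + ?W / ?d" using E(3)[OF \<tau>] d by simp
    finally show "l2_inner (dz \<tau>) ?w \<le> ?d / 2 * \<gamma> \<tau> + ?W / ?d / 2"
      by (simp only: times_divide_eq_left add_divide_distrib[symmetric] pos_le_divide_eq zero_less_numeral mult.commute[of _ "2::real"])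
  qed
  also have "\<dots> = ?d / 2 * integral {r..t} \<gamma> + ?W / 2"
  proof -
    have c: "((\<lambda>\<tau>. ?W / ?d / 2) has_integral ?d * (?W / ?d / 2)) {r..t}"
      using has_integral_const_real[of "?W / ?d / 2" r t] r by simp
    have I1: "((\<lambda>\<tau>. ?d / 2 * \<gamma> \<tau> + ?W / ?d / 2) has_integral ?d / 2 * integral {r..t} \<gamma> + ?d * (?W / ?d / 2)) {r..t}"
      by (intro has_integral_add has_integral_mult_right integrable_integral \<gamma>i c)
    have I2: "?d * (?W / ?d / 2) = ?W / 2"
    proof -
      have "x * (y / x / 2) = y / 2" if "x > 0" for x y :: real using that by simp
      from this[OF d] show ?thesis .
    qed
    show ?thesis by (rule integral_unique[OF I1, unfolded I2])
  qed
  finally show ?thesis by linarith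
qed

lemma l2_path_diff:
  assumes u: "l2_path T \<gamma> u du" and v: "l2_path T \<kappa> v dv"
  shows "l2_path T (\<lambda>t. 2 * \<gamma> t + 2 * \<kappa> t) (\<lambda>t x. u t x - v t x) (\<lambda>t x. du t x - dv t x)"
proof -
  obtain E where E: "negligible E" "\<And>t. t \<in> {0..T} - E \<Longrightarrow> du t \<in> L2_torus" "\<And>t. t \<in> {0..T} - E \<Longrightarrow> l2_inner (du t) (du t) \<le> \<gamma> t"
    using l2_pathE[OF u] by blast
  obtain E' where E': "negligible E'" "\<And>t. t \<in> {0..T} - E' \<Longrightarrow> dv t \<in> L2_torus" "\<And>t. t \<in> {0..T} - E' \<Longrightarrow> l2_inner (dv t) (dv t) \<le> \<kappa> t"
    using l2_pathE[OF v] by blast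
  have nE: "negligible (E \<union> E')" using E(1) E'(1) by (rule negligible_Un)
  have A: "(\<lambda>x. du t x - dv t x) \<in> L2_torus \<and> l2_inner (\<lambda>x. du t x - dv t x) (\<lambda>x. du t x - dv t x) \<le> 2 * \<gamma> t + 2 * \<kappa> t"
    if t: "t \<in> {0..T} - (E \<union> E')" for t
  proof
    have L: "du t \<in> L2_torus" "dv t \<in> L2_torus" using E(2) E'(2) t by auto
    then show w: "(\<lambda>x. du t x - dv t x) \<in> L2_torus" by (rule L2_diff)
    have "l2_inner (\<lambda>x. du t x - dv t x) (\<lambda>x. du t x - dv t x) = l2_inner (du t) (du t) + l2_inner (dv t) (dv t) - 2 * l2_inner (du t) (dv t)"
      using l2_inner_diff[OF L w] l2_inner_diff_right[OF L L(1)] l2_inner_diff_right[OF L L(2)] by (simp add: l2_inner_commute)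
    moreover have "- 2 * l2_inner (du t) (dv t) \<le> l2_inner (du t) (du t) + l2_inner (dv t) (dv t)"
      using l2_inner_young[OF L zero_less_one] by linarith
    moreover have "l2_inner (du t) (du t) \<le> \<gamma> t" "l2_inner (dv t) (dv t) \<le> \<kappa> t" using E(3) E'(3) t by auto
    ultimately show "l2_inner (\<lambda>x. du t x - dv t x) (\<lambda>x. du t x - dv t x) \<le> 2 * \<gamma> t + 2 * \<kappa> t" by linarith
  qed
  have B: "(\<lambda>t. l2_inner (\<lambda>x. du t x - dv t x) w) integrable_on {0..T} \<and>
        (\<forall>r t. 0 \<le> r \<longrightarrow> r \<le> t \<longrightarrow> t \<le> T \<longrightarrow> l2_inner (\<lambda>x. u t x - v t x) w - l2_inner (\<lambda>x. u r x - v r x) w = 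
          integral {r..t} (\<lambda>t. l2_inner (\<lambda>x. du t x - dv t x) w))" if w: "w \<in> L2_torus" for w
  proof
    have eq: "l2_inner (\<lambda>x. du t x - dv t x) w = l2_inner (du t) w - l2_inner (dv t) w" if "t \<in> {0..T} - (E \<union> E')" for t
      using that E(2) E'(2) w by (intro l2_inner_diff) auto
    note i = l2_pathD(3)[OF u w] l2_pathD(3)[OF v w]
    show "(\<lambda>t. l2_inner (\<lambda>x. du t x - dv t x) w) integrable_on {0..T}"
      by (rule integrable_spike[OF integrable_diff[OF i] nE eq])
    show "\<forall>r t. 0 \<le> r \<longrightarrow> r \<le> t \<longrightarrow> t \<le> T \<longrightarrow> l2_inner (\<lambda>x. u t x - v t x) w - l2_inner (\<lambda>x. u r x - v r x) w = 
          integral {r..t} (\<lambda>t. l2_inner (\<lambda>x. du t x - dv t x) w)"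
    proof (intro allI impI)
      fix r t assume r: "0 \<le> r" "r \<le> t" "t \<le> T"
      have "integral {r..t} (\<lambda>t. l2_inner (\<lambda>x. du t x - dv t x) w) = integral {r..t} (\<lambda>t. l2_inner (du t) w - l2_inner (dv t) w)"
        by (rule integral_spike[OF nE]) (use eq r in auto)
      also have "\<dots> = integral {r..t} (\<lambda>t. l2_inner (du t) w) - integral {r..t} (\<lambda>t. l2_inner (dv t) w)"
        by (rule Henstock_Kurzweil_Integration.integral_diff; rule integrable_subinterval_real[OF i(1)] integrable_subinterval_real[OF i(2)])
           (use r in auto)
      also have "\<dots> = (l2_inner (u t) w - l2_inner (u r) w) - (l2_inner (v t) w - l2_inner (v r) w)"
        using l2_pathD(4)[OF u w r] l2_pathD(4)[OF v w r] by simp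
      also have "\<dots> = l2_inner (\<lambda>x. u t x - v t x) w - l2_inner (\<lambda>x. u r x - v r x) w"
        using l2_pathD(1)[OF u] l2_pathD(1)[OF v] r w by (simp add: l2_inner_diff)
      finally show "l2_inner (\<lambda>x. u t x - v t x) w - l2_inner (\<lambda>x. u r x - v r x) w = integral {r..t} (\<lambda>t. l2_inner (\<lambda>x. du t x - dv t x) w)" ..
    qed
  qed
  have "(\<lambda>t. 2 * \<gamma> t + 2 * \<kappa> t) integrable_on {0..T}"
    by (intro integrable_add integrable_on_mult_right l2_pathD(2)[OF u] l2_pathD(2)[OF v])
  then show ?thesis unfolding l2_path_def
    using A B nE L2_diff[OF l2_pathD(1)[OF u] l2_pathD(1)[OF v]] by blast
qed

lemma l2_inner_const: "l2_inner (\<lambda>x. c) w = c * (LINT x|torus_measure. w x)" for w :: "real^'n \<Rightarrow> real"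
  by (simp add: l2_inner_eq)

text \<open>Makes a barrier that is constant in space into a path, so that a solution can be
  subtracted from it by \<open>l2_path_diff\<close>.\<close>

lemma l2_path_const:
  assumes m: "\<And>t. (m has_real_derivative m' t) (at t)" and c: "continuous_on {0..T} m'"
  shows "l2_path T (\<lambda>t. (m' t)\<^sup>2) (\<lambda>t x::real^'n. m t) (\<lambda>t x. m' t)"
proof -
  have B: "(\<lambda>t. l2_inner (\<lambda>x. m' t) w) integrable_on {0..T} \<and>
        (\<forall>r t. 0 \<le> r \<longrightarrow> r \<le> t \<longrightarrow> t \<le> T \<longrightarrow> l2_inner (\<lambda>x. m t) w - l2_inner (\<lambda>x. m r) w = 
          integral {r..t} (\<lambda>t. l2_inner (\<lambda>x. m' t) w))" for w :: "real^'n \<Rightarrow> real"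
  proof (intro conjI allI impI)
    show "(\<lambda>t. l2_inner (\<lambda>x. m' t) w) integrable_on {0..T}"
      unfolding l2_inner_const by (intro integrable_continuous_real continuous_intros c)
    fix r t :: real assume r: "0 \<le> r" "r \<le> t" "t \<le> T"
    have "(m' has_integral m t - m r) {r..t}"
      using r m by (intro fundamental_theorem_of_calculus)
        (auto simp: has_real_derivative_iff_has_vector_derivative[symmetric] intro: has_field_derivative_at_within)
    from integral_unique[OF has_integral_mult_left[OF this, of "LINT x|torus_measure. w x"]]
    show "l2_inner (\<lambda>x. m t) w - l2_inner (\<lambda>x. m r) w = integral {r..t} (\<lambda>t. l2_inner (\<lambda>x. m' t) w)"
      unfolding l2_inner_const by (simp only: left_diff_distrib)
  qed
  have "l2_inner (\<lambda>x::real^'n. m' t) (\<lambda>x. m' t) \<le> (m' t)\<^sup>2" for t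
    by (simp add: l2_inner_const power2_eq_square measure_torus)
  then show ?thesis unfolding l2_path_def using B
    by (auto intro!: L2_const integrable_continuous_real continuous_intros c exI[of _ "{}"])
qed

text \<open>The convexity inequality puts the derivative of \<open>G\<close> at the right endpoint, so that the weak time
  derivative is only ever tested with a fixed function; the resulting error is quadratic in \<open>t - r\<close>.\<close>

lemma l2_path_energy:
  fixes z dz :: "'i \<Rightarrow> real \<Rightarrow> real^'n \<Rightarrow> real" and G G' :: "real \<Rightarrow> real"
  assumes I: "finite I" and p: "\<And>i. i \<in> I \<Longrightarrow> l2_path T \<gamma> (z i) (dz i)"
    and R: "\<And>i t x. i \<in> I \<Longrightarrow> t \<in> {0..T} \<Longrightarrow> z i t x \<in> R"
    and convex: "\<And>a b. a \<in> R \<Longrightarrow> b \<in> R \<Longrightarrow> G a - G b \<le> G' a * (a - b)"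
    and lipschitz: "\<And>a b. a \<in> R \<Longrightarrow> b \<in> R \<Longrightarrow> \<bar>G' a - G' b\<bar> \<le> L * \<bar>a - b\<bar>" and L: "L \<ge> 0"
    and Gi: "\<And>i t. i \<in> I \<Longrightarrow> t \<in> {0..T} \<Longrightarrow> integrable torus_measure (\<lambda>x. G (z i t x))"
    and G'L: "\<And>i t. i \<in> I \<Longrightarrow> t \<in> {0..T} \<Longrightarrow> (\<lambda>x. G' (z i t x)) \<in> L2_torus"
    and h: "h integrable_on {a..b}" and ab: "0 \<le> a" "a \<le> b" "b \<le> T"
    and H: "negligible H" and le: "\<And>t. t \<in> {a..b} - H \<Longrightarrow> (\<Sum>i\<in>I. l2_inner (dz i t) (\<lambda>x. G' (z i t x))) \<le> h t"
  shows "(\<Sum>i\<in>I. LINT x|torus_measure. G (z i b x)) - (\<Sum>i\<in>I. LINT x|torus_measure. G (z i a x)) \<le> integral {a..b} h"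
proof (cases "I = {}")
  \<comment> \<open>Integrability of \<open>\<gamma>\<close> is read off from one of the paths, so
    an empty index set is treated apart.\<close>
  case True
  have "integral {a..b} (\<lambda>_. 0) \<le> integral {a..b} h"
    by (rule integral_le_off_negligible[OF _ h H]) (use le True in auto)
  then show ?thesis using True by simp
next
  case False
  then obtain i0 where i0: "i0 \<in> I" by blast
  note \<gamma>i = l2_pathD(2)[OF p[OF i0]]
  define F where "F t = (\<Sum>i\<in>I. LINT x|torus_measure. G (z i t x))" for t
  have "\<forall>i\<in>I. \<exists>E. negligible E \<and> (\<forall>t\<in>{0..T} - E. dz i t \<in> L2_torus \<and> l2_inner (dz i t) (dz i t) \<le> \<gamma> t)"
    using p unfolding l2_path_def by blast
  then obtain E where E: "\<And>i. i \<in> I \<Longrightarrow> negligible (E i)"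
    "\<And>i t. i \<in> I \<Longrightarrow> t \<in> {0..T} - E i \<Longrightarrow> dz i t \<in> L2_torus" "\<And>i t. i \<in> I \<Longrightarrow> t \<in> {0..T} - E i \<Longrightarrow> l2_inner (dz i t) (dz i t) \<le> \<gamma> t"
    by metis
  have nE: "negligible ((\<Union>i\<in>I. E i) \<union> H)" using negligible_Union[of "E ` I"] I E(1) H by (intro negligible_Un) auto
  have inc: "F t - F r \<le> integral {r..t} h + (real (card I) * L) * (t - r) * integral {r..t} \<gamma>"
    if r: "a \<le> r" "r \<le> t" "t \<le> b" for r t
  proof (cases "r = t")
    case True
    then show ?thesis by simp
  next
    case False
    have rT: "0 \<le> r" "t \<le> T" "r \<in> {0..T}" "t \<in> {0..T}" using r ab by auto
    let ?d = "t - r" and ?\<Gamma> = "integral {r..t} \<gamma>"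
    have d: "?d > 0" using False r by simp
    have \<gamma>rt: "\<gamma> integrable_on {r..t}" by (rule integrable_subinterval_real[OF \<gamma>i]) (use rT in auto)
    have hrt: "h integrable_on {r..t}" by (rule integrable_subinterval_real[OF h]) (use r in auto)
    have ii: "(\<lambda>\<tau>. l2_inner (dz i \<tau>) (\<lambda>x. G' (z i t x))) integrable_on {r..t}" if "i \<in> I" for i
      by (rule integrable_subinterval_real[OF l2_pathD(3)[OF p[OF that] G'L[OF that rT(4)]]]) (use rT in auto)
    have "F t - F r = (\<Sum>i\<in>I. (LINT x|torus_measure. G (z i t x)) - (LINT x|torus_measure. G (z i r x)))"
      by (simp add: F_def sum_subtractf)
    also have "\<dots> \<le> (\<Sum>i\<in>I. l2_inner (z i t) (\<lambda>x. G' (z i t x)) - l2_inner (z i r) (\<lambda>x. G' (z i t x)))"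
    proof (rule sum_mono)
      fix i assume i: "i \<in> I"
      have L2: "z i t \<in> L2_torus" "z i r \<in> L2_torus" using l2_pathD(1)[OF p[OF i]] rT by auto
      have "(LINT x|torus_measure. G (z i t x)) - (LINT x|torus_measure. G (z i r x)) = (LINT x|torus_measure. G (z i t x) - G (z i r x))"
        by (rule Bochner_Integration.integral_diff[symmetric, OF Gi[OF i rT(4)] Gi[OF i rT(3)]])
      also have "\<dots> \<le> (LINT x|torus_measure. (z i t x - z i r x) * G' (z i t x))"
      proof (rule integral_mono)
        show "integrable torus_measure (\<lambda>x. G (z i t x) - G (z i r x))"
          by (rule Bochner_Integration.integrable_diff[OF Gi[OF i rT(4)] Gi[OF i rT(3)]])
        show "integrable torus_measure (\<lambda>x. (z i t x - z i r x) * G' (z i t x))"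
          by (rule L2_integrable_mult[OF L2_diff[OF L2] G'L[OF i rT(4)]])
        show "G (z i t x) - G (z i r x) \<le> (z i t x - z i r x) * G' (z i t x)" for x
          using convex[OF R[OF i rT(4)] R[OF i rT(3)]] by (simp add: mult.commute)
      qed
      also have "\<dots> = l2_inner (z i t) (\<lambda>x. G' (z i t x)) - l2_inner (z i r) (\<lambda>x. G' (z i t x))"
        using l2_inner_diff[OF L2 G'L[OF i rT(4)]] by (simp add: l2_inner_eq)
      finally show "(LINT x|torus_measure. G (z i t x)) - (LINT x|torus_measure. G (z i r x)) \<le> 
        l2_inner (z i t) (\<lambda>x. G' (z i t x)) - l2_inner (z i r) (\<lambda>x. G' (z i t x))" .
    qed
    also have "\<dots> = (\<Sum>i\<in>I. integral {r..t} (\<lambda>\<tau>. l2_inner (dz i \<tau>) (\<lambda>x. G' (z i t x))))"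
      by (intro sum.cong refl l2_pathD(4)[OF p G'L[OF _ rT(4)] rT(1) r(2) rT(2)])
    also have "\<dots> = integral {r..t} (\<lambda>\<tau>. \<Sum>i\<in>I. l2_inner (dz i \<tau>) (\<lambda>x. G' (z i t x)))"
      by (rule integral_sum[symmetric, OF I ii])
    also have "\<dots> \<le> integral {r..t} (\<lambda>\<tau>. h \<tau> + real (card I) * (L / 2 * (?d * \<gamma> \<tau> + ?\<Gamma>)))"
    proof (rule integral_le_off_negligible[OF _ _ nE])
      show "(\<lambda>\<tau>. \<Sum>i\<in>I. l2_inner (dz i \<tau>) (\<lambda>x. G' (z i t x))) integrable_on {r..t}"
        by (rule integrable_sum[OF I ii])
      show "(\<lambda>\<tau>. h \<tau> + real (card I) * (L / 2 * (?d * \<gamma> \<tau> + ?\<Gamma>))) integrable_on {r..t}"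
        by (intro integrable_add integrable_on_mult_right \<gamma>rt hrt) auto
      fix \<tau> assume \<tau>: "\<tau> \<in> {r..t} - ((\<Union>i\<in>I. E i) \<union> H)"
      then have \<tau>T: "\<tau> \<in> {0..T}" "0 \<le> \<tau>" "\<tau> \<le> t" and \<tau>ab: "\<tau> \<in> {a..b} - H" using rT r by auto
      \<comment> \<open>The premise \<open>le\<close> has \<open>G'\<close> at the same time as the
        derivative. Moving it from \<open>t\<close> to \<tau> costs an amount whose integral over
        [r, t] is L (t - r) times the integral of \<open>\<gamma>\<close>, for each index.\<close>
      have "l2_inner (dz i \<tau>) (\<lambda>x. G' (z i t x)) \<le> l2_inner (dz i \<tau>) (\<lambda>x. G' (z i \<tau> x)) + L / 2 * (?d * \<gamma> \<tau> + ?\<Gamma>)" if i: "i \<in> I" for i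
      proof -
        have \<tau>E: "\<tau> \<in> {0..T} - E i" using \<tau> \<tau>T i by auto
        note dL = E(2)[OF i \<tau>E] and g1 = G'L[OF i rT(4)] and g2 = G'L[OF i \<tau>T(1)]
        let ?g = "\<lambda>x. G' (z i t x) - G' (z i \<tau> x)" and ?z = "\<lambda>x. z i t x - z i \<tau> x"
        have gL: "?g \<in> L2_torus" by (rule L2_diff[OF g1 g2])
        have zL: "?z \<in> L2_torus" using l2_pathD(1)[OF p[OF i]] rT \<tau>T by (intro L2_diff) auto
        have "l2_inner (dz i \<tau>) ?g \<le> L / 2 * (?d * \<gamma> \<tau> + ?\<Gamma>)"
        proof -
          have gz: "l2_inner ?g ?g \<le> L\<^sup>2 * l2_inner ?z ?z"
          proof -
            have "(LINT x|torus_measure. (?g x)\<^sup>2) \<le> (LINT x|torus_measure. L\<^sup>2 * (?z x)\<^sup>2)"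
            proof (rule integral_mono)
              show "integrable torus_measure (\<lambda>x. (?g x)\<^sup>2)" by (rule L2_torusD(3)[OF gL])
              show "integrable torus_measure (\<lambda>x. L\<^sup>2 * (?z x)\<^sup>2)" by (rule integrable_mult_right[OF L2_torusD(3)[OF zL]])
              fix x
              have "\<bar>?g x\<bar> \<le> L * \<bar>?z x\<bar>" by (rule lipschitz[OF R[OF i rT(4)] R[OF i \<tau>T(1)]])
              then have "\<bar>?g x\<bar>\<^sup>2 \<le> (L * \<bar>?z x\<bar>)\<^sup>2" by (rule power_mono) simp
              then show "(?g x)\<^sup>2 \<le> L\<^sup>2 * (?z x)\<^sup>2" by (simp add: power_mult_distrib)
            qed
            then show ?thesis by (simp add: l2_inner_self)
          qed
          have zz: "l2_inner ?z ?z \<le> ?d * ?\<Gamma>"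
          proof -
            have "l2_inner ?z ?z \<le> (t - \<tau>) * integral {\<tau>..t} \<gamma>"
              by (rule l2_path_increment[OF p[OF i] \<tau>T(2,3) rT(2)])
            also have "\<dots> \<le> ?d * ?\<Gamma>"
            proof (rule mult_mono)
              have n: "negligible (E i)" using E(1)[OF i] .
              have g0: "0 \<le> \<gamma> x" if "x \<in> {0..T} - E i" for x
                using E(3)[OF i that] l2_inner_self_nonneg[of "dz i x"] by linarith
              have nonneg: "0 \<le> integral {p..q} \<gamma>" if "0 \<le> p" "q \<le> T" for p q
              proof -
                have "integral {p..q} (\<lambda>_. 0) \<le> integral {p..q} \<gamma>"
                  by (rule integral_le_off_negligible[OF _ integrable_subinterval_real[OF \<gamma>i] n]) (use g0 that in auto)
                then show ?thesis by simp
              qed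
              have "integral {r..\<tau>} \<gamma> + integral {\<tau>..t} \<gamma> = ?\<Gamma>"
                using \<tau> by (intro Henstock_Kurzweil_Integration.integral_combine \<gamma>rt) auto
              then show "integral {\<tau>..t} \<gamma> \<le> ?\<Gamma>" using nonneg[of r \<tau>] rT \<tau>T by auto
              show "0 \<le> integral {\<tau>..t} \<gamma>" using nonneg \<tau>T rT by auto
            qed (use \<tau> d in auto)
            finally show ?thesis .
          qed
          show ?thesis
          proof (cases "L = 0")
            case True
            then have "l2_inner ?g ?g \<le> 0" using gz by simp
            then have "l2_inner ?g ?g = 0" using l2_inner_self_nonneg[of ?g] by linarith
            then have "\<bar>l2_inner (dz i \<tau>) ?g\<bar> \<le> 0" using l2_cauchy_schwarz[OF dL gL] by simp
            then show ?thesis using True by simp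
          next
            case False
            then have Lp: "L > 0" using L by simp
            \<comment> \<open>The weight \<open>L * ?d\<close> balances the two sides, since the
              squared norm of \<open>?g\<close> is at most \<open>L^2 * ?d * ?\<Gamma>\<close> by
              the Lipschitz bound and \<open>l2_path_increment\<close>. It must be positive, hence
              the separate case L = 0.\<close>
            have "2 * \<bar>l2_inner (dz i \<tau>) ?g\<bar> \<le> (L * ?d) * l2_inner (dz i \<tau>) (dz i \<tau>) + l2_inner ?g ?g / (L * ?d)"
              by (rule l2_inner_young[OF dL gL]) (use Lp d in simp)
            also have "\<dots> \<le> (L * ?d) * \<gamma> \<tau> + L\<^sup>2 * (?d * ?\<Gamma>) / (L * ?d)"
            proof (intro add_mono mult_left_mono divide_right_mono E(3)[OF i \<tau>E])
              show "l2_inner ?g ?g \<le> L\<^sup>2 * (?d * ?\<Gamma>)" using gz mult_left_mono[OF zz, of "L\<^sup>2"] by simp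
            qed (use Lp d in auto)
            also have "L\<^sup>2 * (?d * ?\<Gamma>) / (L * ?d) = L * ?\<Gamma>" using Lp d by (simp add: power2_eq_square)
            finally show ?thesis by (simp add: algebra_simps)
          qed
        qed
        moreover have "l2_inner (dz i \<tau>) ?g = l2_inner (dz i \<tau>) (\<lambda>x. G' (z i t x)) - l2_inner (dz i \<tau>) (\<lambda>x. G' (z i \<tau> x))"
          by (rule l2_inner_diff_right[OF g1 g2 dL])
        ultimately show ?thesis by linarith
      qed
      then have "(\<Sum>i\<in>I. l2_inner (dz i \<tau>) (\<lambda>x. G' (z i t x))) \<le> 
          (\<Sum>i\<in>I. l2_inner (dz i \<tau>) (\<lambda>x. G' (z i \<tau> x)) + L / 2 * (?d * \<gamma> \<tau> + ?\<Gamma>))"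
        by (rule sum_mono)
      also have "\<dots> = (\<Sum>i\<in>I. l2_inner (dz i \<tau>) (\<lambda>x. G' (z i \<tau> x))) + real (card I) * (L / 2 * (?d * \<gamma> \<tau> + ?\<Gamma>))"
        by (simp add: sum.distrib)
      also have "\<dots> \<le> h \<tau> + real (card I) * (L / 2 * (?d * \<gamma> \<tau> + ?\<Gamma>))" using le[OF \<tau>ab] by simp
      finally show "(\<Sum>i\<in>I. l2_inner (dz i \<tau>) (\<lambda>x. G' (z i t x))) \<le> h \<tau> + real (card I) * (L / 2 * (?d * \<gamma> \<tau> + ?\<Gamma>))" .
    qed
    also have "\<dots> = integral {r..t} h + real (card I) * (L / 2 * (?d * ?\<Gamma> + ?\<Gamma> * ?d))"
    proof (rule integral_unique)
      have c: "((\<lambda>\<tau>. ?\<Gamma>) has_integral ?\<Gamma> * ?d) {r..t}" using has_integral_const_real[of ?\<Gamma> r t] r by (simp add: mult.commute)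
      show "((\<lambda>\<tau>. h \<tau> + real (card I) * (L / 2 * (?d * \<gamma> \<tau> + ?\<Gamma>))) has_integral integral {r..t} h + real (card I) * (L / 2 * (?d * ?\<Gamma> + ?\<Gamma> * ?d))) {r..t}"
        by (intro has_integral_add has_integral_mult_right c integrable_integral hrt \<gamma>rt)
    qed
    also have "\<dots> = integral {r..t} h + (real (card I) * L) * ?d * ?\<Gamma>" by (simp add: algebra_simps)
    finally show ?thesis .
  qed
  have "F b - F a \<le> integral {a..b} h"
    by (rule integral_le_of_increments[OF ab(2) h integrable_subinterval_real[OF \<gamma>i] inc]) (use ab in auto)
  then show ?thesis by (simp add: F_def)
qed

section \<open>Sobolev-valued paths and their continuous extension\<close>

lemma bessel_l2: "u \<in> L2_torus \<Longrightarrow> finite F \<Longrightarrow> (\<Sum>k\<in>F. (cmod (fourier_coeff u k))\<^sup>2) \<le> l2_inner u u"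
  unfolding l2_inner_self by (rule bessel_inequality)

text \<open>The L^2 gradient at \<open>u\<close> of the truncated H^s energy, the sum of
  \<open>lam k powr s * (cmod (fourier_coeff u k))^2\<close> over \<open>F\<close>; compare
  \<open>l2_inner_trig_dual\<close>.\<close>

definition trig_dual :: "real \<Rightarrow> (int^'n) set \<Rightarrow> (real^'n \<Rightarrow> real) \<Rightarrow> real^'n \<Rightarrow> real" where
  "trig_dual s F u x = (\<Sum>k\<in>F. (2 * lam k powr s * Re (fourier_coeff u k)) * cos (phase k x) 
       + (- 2 * lam k powr s * Im (fourier_coeff u k)) * sin (phase k x))"

lemma trig_dual_L2: "trig_dual s F u \<in> L2_torus"
  unfolding trig_dual_def[abs_def] by (intro L2_sum L2_add L2_scale L2_cos_phase L2_sin_phase)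

lemma l2_inner_trig_dual:
  assumes f: "f \<in> L2_torus" and F: "finite F"
  shows "l2_inner f (trig_dual s F u) = (\<Sum>k\<in>F. 2 * lam k powr s * (fourier_coeff u k \<bullet> fourier_coeff f k))"
proof -
  have one: "l2_inner (\<lambda>x. A * cos (phase k x) + B * sin (phase k x)) f = 
      A * l2_inner (\<lambda>x. cos (phase k x)) f + B * l2_inner (\<lambda>x. sin (phase k x)) f" for A B k
    by (simp only: l2_inner_add[OF L2_scale[OF L2_cos_phase] L2_scale[OF L2_sin_phase] f] l2_inner_scale)
  have "l2_inner (trig_dual s F u) f = (\<Sum>k\<in>F. l2_inner (\<lambda>x. (2 * lam k powr s * Re (fourier_coeff u k)) * cos (phase k x) 
       + (- 2 * lam k powr s * Im (fourier_coeff u k)) * sin (phase k x)) f)"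
    unfolding trig_dual_def[abs_def]
    by (rule l2_inner_sum[OF F _ f]) (intro L2_add L2_scale L2_cos_phase L2_sin_phase)
  also have "\<dots> = (\<Sum>k\<in>F. 2 * lam k powr s * (fourier_coeff u k \<bullet> fourier_coeff f k))"
    unfolding one using Re_fourier_coeff[OF f] by (intro sum.cong refl) (simp add: inner_complex_def l2_inner_commute algebra_simps)
  finally show ?thesis by (simp add: l2_inner_commute)
qed

text \<open>The common interface of \<omega>, b and each velocity component. A single integrable
  \<open>h\<close> dominates both squared norms, and the weak derivative survives only as the
  increment formula \<open>inc\<close> against L^2 functions.\<close>

locale sobolev_path =
  fixes T s :: real and u du :: "real \<Rightarrow> real^'n \<Rightarrow> real" and h :: "real \<Rightarrow> real"
  assumes T: "T > 0" and dim: "CARD('n) \<ge> 2" and s: "s > real CARD('n) / 2"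
    and u_in: "\<And>t. t \<in> {0..<T} \<Longrightarrow> u t \<in> sobolev s"
    and u_cont: "\<And>t. t \<in> {0..<T} \<Longrightarrow> ((\<lambda>r. sobolev_norm s (\<lambda>x. u r x - u t x)) \<longlongrightarrow> 0) (at t within {0..<T})"
    and h_int: "integrable (lebesgue_on {0<..<T}) h"
    and u_ae: "AE t in lebesgue_on {0<..<T}. u t \<in> sobolev (s + 1) \<and> (sobolev_norm (s + 1) (u t))\<^sup>2 \<le> h t"
    and du_ae: "AE t in lebesgue_on {0<..<T}. du t \<in> sobolev (s - 1) \<and> (sobolev_norm (s - 1) (du t))\<^sup>2 \<le> h t"
    and inc_int: "\<And>w. w \<in> L2_torus \<Longrightarrow> integrable (lebesgue_on {0<..<T}) (\<lambda>t. l2_inner (du t) w)"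
    and inc: "\<And>w r t. w \<in> L2_torus \<Longrightarrow> 0 \<le> r \<Longrightarrow> r \<le> t \<Longrightarrow> t < T \<Longrightarrow> l2_inner (u t) w - l2_inner (u r) w = integral {r..t} (\<lambda>t. l2_inner (du t) w)"
begin

lemma s1: "s > 1" using s dim by linarith

lemma regular_times:
  obtains E where "negligible E" "\<And>t. t \<in> {0..T} - E \<Longrightarrow> t \<in> {0<..<T}"
    "\<And>t. t \<in> {0..T} - E \<Longrightarrow> u t \<in> sobolev (s + 1)" "\<And>t. t \<in> {0..T} - E \<Longrightarrow> (sobolev_norm (s + 1) (u t))\<^sup>2 \<le> h t"
    "\<And>t. t \<in> {0..T} - E \<Longrightarrow> du t \<in> sobolev (s - 1)" "\<And>t. t \<in> {0..T} - E \<Longrightarrow> (sobolev_norm (s - 1) (du t))\<^sup>2 \<le> h t"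
proof -
  have S: "{0<..<T} \<in> sets lebesgue" by simp
  obtain E1 where E1: "negligible E1" "\<And>t. t \<in> {0<..<T} \<Longrightarrow> t \<notin> E1 \<Longrightarrow> u t \<in> sobolev (s + 1) \<and> (sobolev_norm (s + 1) (u t))\<^sup>2 \<le> h t"
    by (rule AE_lebesgue_onE[OF u_ae S]) blast
  obtain E2 where E2: "negligible E2" "\<And>t. t \<in> {0<..<T} \<Longrightarrow> t \<notin> E2 \<Longrightarrow> du t \<in> sobolev (s - 1) \<and> (sobolev_norm (s - 1) (du t))\<^sup>2 \<le> h t"
    by (rule AE_lebesgue_onE[OF du_ae S]) blast
  have n: "negligible (E1 \<union> E2 \<union> {0, T})" using E1(1) E2(1) by (intro negligible_Un) auto
  have m: "t \<in> {0<..<T} \<and> t \<notin> E1 \<and> t \<notin> E2" if "t \<in> {0..T} - (E1 \<union> E2 \<union> {0, T})" for t using that by auto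
  show ?thesis
    by (rule that[OF n]) (use m E1(2) E2(2) in blast)+
qed

lemma path:
  assumes "0 \<le> t1" "t1 < T"
  shows "l2_path t1 h u du"
proof -
  obtain E where E: "negligible E" "\<And>t. t \<in> {0..T} - E \<Longrightarrow> du t \<in> sobolev (s - 1)" "\<And>t. t \<in> {0..T} - E \<Longrightarrow> (sobolev_norm (s - 1) (du t))\<^sup>2 \<le> h t"
    using regular_times by metis
  have "du t \<in> L2_torus \<and> l2_inner (du t) (du t) \<le> h t" if "t \<in> {0..t1} - E" for t
  proof -
    have t: "t \<in> {0..T} - E" using that assms by auto
    have "0 \<le> s - 1" using s1 by simp
    from l2_le_sobolev_norm[OF this E(2)[OF t]] show ?thesis using E(3)[OF t] sobolevD(1)[OF E(2)[OF t]] by linarith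
  qed
  moreover have "u t \<in> L2_torus" if "t \<in> {0..t1}" for t using u_in[of t] sobolevD(1) that assms by auto
  moreover have "h integrable_on {0..t1}" by (rule time_integrable[OF h_int]) (use assms in auto)
  moreover have "(\<lambda>t. l2_inner (du t) w) integrable_on {0..t1}" if "w \<in> L2_torus" for w
    by (rule time_integrable[OF inc_int[OF that]]) (use assms in auto)
  moreover have "l2_inner (u t) w - l2_inner (u r) w = integral {r..t} (\<lambda>t. l2_inner (du t) w)"
    if "w \<in> L2_torus" "0 \<le> r" "r \<le> t" "t \<le> t1" for w r t
    by (rule inc) (use that assms in auto)
  ultimately show ?thesis unfolding l2_path_def using E(1) by blast
qed

lemma sup_bound:
  assumes "t \<in> {0..<T}" "r \<in> {0..<T}"
  shows "\<bar>u t x - u r x\<bar> \<le> emb TYPE('n) s * sobolev_norm s (\<lambda>x. u t x - u r x)"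
  using sobolev_sup_bound[OF s sobolev_diff[OF u_in[OF assms(1)] u_in[OF assms(2)]]] .

lemma space_continuous: "t \<in> {0..<T} \<Longrightarrow> continuous_on UNIV (u t)"
  by (rule sobolev_continuous[OF u_in s])

lemma space_periodic: "t \<in> {0..<T} \<Longrightarrow> periodic (u t)"
  by (rule L2_torusD(1)[OF sobolevD(1)[OF u_in]])

text \<open>The Sobolev embedding, applied to \<open>u r - u t\<close>, converts continuity in H^s
  into continuity in the supremum norm.\<close>

lemma time_uniform_continuity:
  assumes t: "t \<in> {0..<T}" and e: "e > 0"
  obtains \<delta> where "\<delta> > 0" "\<And>r x. r \<in> {0..<T} \<Longrightarrow> \<bar>r - t\<bar> < \<delta> \<Longrightarrow> \<bar>u r x - u t x\<bar> < e"
proof -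
  let ?A = "emb TYPE('n) s"
  have "((\<lambda>r. ?A * sobolev_norm s (\<lambda>x. u r x - u t x)) \<longlongrightarrow> ?A * 0) (at t within {0..<T})"
    by (intro tendsto_intros u_cont t)
  then have "\<forall>\<^sub>F r in at t within {0..<T}. ?A * sobolev_norm s (\<lambda>x. u r x - u t x) < e"
    using e by (intro order_tendstoD(2)) auto
  then obtain \<delta> where \<delta>: "\<delta> > 0" "\<And>r. r \<in> {0..<T} \<Longrightarrow> r \<noteq> t \<Longrightarrow> dist r t < \<delta> \<Longrightarrow> ?A * sobolev_norm s (\<lambda>x. u r x - u t x) < e"
    unfolding eventually_at by blast
  show ?thesis
  proof (rule that[OF \<delta>(1)])
    fix r x assume r: "r \<in> {0..<T}" "\<bar>r - t\<bar> < \<delta>"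
    show "\<bar>u r x - u t x\<bar> < e"
    proof (cases "r = t")
      case False
      then show ?thesis using \<delta>(2)[OF r(1)] r(2) sup_bound[OF r(1) t, of x] by (simp add: dist_real_def)
    qed (use e in simp)
  qed
qed

lemma joint_continuous: "continuous_on ({0..<T} \<times> UNIV) (\<lambda>p. u (fst p) (snd p))"
  unfolding continuous_on_iff
proof (intro ballI allI impI)
  fix p :: "real \<times> (real^'n)" and e :: real assume p: "p \<in> {0..<T} \<times> UNIV" and e: "e > 0"
  then have t: "fst p \<in> {0..<T}" by auto
  obtain \<delta> where \<delta>: "\<delta> > 0" "\<And>r x. r \<in> {0..<T} \<Longrightarrow> \<bar>r - fst p\<bar> < \<delta> \<Longrightarrow> \<bar>u r x - u (fst p) x\<bar> < e / 2"
    using time_uniform_continuity[OF t, of "e/2"] e by auto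
  obtain \<delta>' where \<delta>': "\<delta>' > 0" "\<And>y. dist y (snd p) < \<delta>' \<Longrightarrow> dist (u (fst p) y) (u (fst p) (snd p)) < e / 2"
    using space_continuous[OF t, unfolded continuous_on_iff, THEN bspec[of _ _ "snd p"], THEN spec[of _ "e / 2"]] e by auto
  show "\<exists>d>0. \<forall>q\<in>{0..<T} \<times> UNIV. dist q p < d \<longrightarrow> dist (u (fst q) (snd q)) (u (fst p) (snd p)) < e"
  proof (intro exI conjI ballI impI)
    show "min \<delta> \<delta>' > 0" using \<delta> \<delta>' by simp
    fix q :: "real \<times> (real^'n)" assume q: "q \<in> {0..<T} \<times> UNIV" "dist q p < min \<delta> \<delta>'"
    have "\<bar>fst q - fst p\<bar> < \<delta>" using dist_fst_le[of q p] q by (simp add: dist_real_def)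
    then have "\<bar>u (fst q) (snd q) - u (fst p) (snd q)\<bar> < e / 2" using q by (intro \<delta>(2)) auto
    moreover have "dist (u (fst p) (snd q)) (u (fst p) (snd p)) < e / 2" using dist_snd_le[of q p] q by (intro \<delta>'(2)) simp
    ultimately show "dist (u (fst q) (snd q)) (u (fst p) (snd p)) < e" unfolding dist_real_def by linarith
  qed
qed

lemma locally_bounded:
  assumes "0 \<le> t1" "t1 < T"
  obtains M where "M > 0" "\<And>t x. t \<in> {0..t1} \<Longrightarrow> \<bar>u t x\<bar> \<le> M"
proof -
  have "compact ((\<lambda>p. u (fst p) (snd p)) ` ({0..t1} \<times> cbox 0 1))"
    by (intro compact_continuous_image continuous_on_subset[OF joint_continuous] compact_Times compact_cbox) (use assms in auto)
  then obtain B where B: "\<And>y. y \<in> (\<lambda>p. u (fst p) (snd p)) ` ({0..t1} \<times> cbox 0 1) \<Longrightarrow> norm y \<le> B"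
    by (meson bounded_iff compact_imp_bounded)
  have "\<bar>u t x\<bar> \<le> max 1 B" if t: "t \<in> {0..t1}" for t x
  proof -
    have "t \<in> {0..<T}" using t assms by auto
    from periodic_torus[OF space_periodic[OF this], of x]
    obtain y where y: "y \<in> torus" "u t y = u t x" by blast
    then have "(t, y) \<in> {0..t1} \<times> cbox 0 1" using t torus_subset_cbox by blast
    then have "norm (u t y) \<le> B" by (intro B) force
    then show ?thesis using y by simp
  qed
  then show ?thesis using that[of "max 1 B"] by auto
qed

text \<open>Formally the derivative of the energy is twice the H^s pairing of \<open>u\<close> and
  \<open>du\<close>, which is at most the squared H^(s+1) norm of \<open>u\<close> plus the squared
  H^(s-1) norm of \<open>du\<close>, hence at most \<open>2 * h\<close>. The bound does not depend
  on \<open>F\<close>; only the error of the partition does.\<close>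

lemma weighted_energy_increment:
  assumes F: "finite F" and ab: "0 \<le> a" "a \<le> b" "b < T"
  shows "(\<Sum>k\<in>F. sobolev_term s (u b) k) - (\<Sum>k\<in>F. sobolev_term s (u a) k) \<le> integral {a..b} (\<lambda>t. 2 * h t)"
proof -
  obtain E where E: "negligible E" "\<And>t. t \<in> {0..T} - E \<Longrightarrow> t \<in> {0<..<T}"
    "\<And>t. t \<in> {0..T} - E \<Longrightarrow> u t \<in> sobolev (s + 1)" "\<And>t. t \<in> {0..T} - E \<Longrightarrow> (sobolev_norm (s + 1) (u t))\<^sup>2 \<le> h t"
    "\<And>t. t \<in> {0..T} - E \<Longrightarrow> du t \<in> sobolev (s - 1)" "\<And>t. t \<in> {0..T} - E \<Longrightarrow> (sobolev_norm (s - 1) (du t))\<^sup>2 \<le> h t"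
    using regular_times by blast
  \<comment> \<open>Bounds the weights on \<open>F\<close>. It depends on \<open>F\<close>, but
    multiplies only the error that vanishes under refinement.\<close>
  define \<Lambda> where "\<Lambda> = (\<Sum>k\<in>F. lam k powr s)"
  have \<Lambda>: "lam k powr s \<le> \<Lambda>" if "k \<in> F" for k unfolding \<Lambda>_def using F that by (intro member_le_sum) auto
  have \<Lambda>0: "0 \<le> \<Lambda>" unfolding \<Lambda>_def by (intro sum_nonneg) simp
  let ?c = "\<lambda>t k. fourier_coeff (u t) k" and ?d = "\<lambda>t k. fourier_coeff (du t) k"
  have hi: "h integrable_on {p..q}" if "0 \<le> p" "q \<le> T" for p q by (rule time_integrable[OF h_int that])
  have h0: "0 \<le> h t" if "t \<in> {0..T} - E" for t using E(4)[OF that] zero_le_power2[of "sobolev_norm (s + 1) (u t)"] by linarith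
  have hint0: "0 \<le> integral {p..q} h" if "0 \<le> p" "q \<le> T" for p q
    using integral_le_off_negligible[OF _ hi[OF that] E(1), of "\<lambda>_. 0"] h0 that by auto
  show ?thesis
  proof (rule integral_le_of_increments[where K="2 * \<Lambda>" and g=h])
    show "a \<le> b" "h integrable_on {a..b}" "(\<lambda>t. 2 * h t) integrable_on {a..b}" using ab hi by (auto intro: integrable_on_mult_right)
    fix p q assume pq: "a \<le> p" "p \<le> q" "q \<le> b"
    show "(\<Sum>k\<in>F. sobolev_term s (u q) k) - (\<Sum>k\<in>F. sobolev_term s (u p) k) \<le> integral {p..q} (\<lambda>t. 2 * h t) + 2 * \<Lambda> * (q - p) * integral {p..q} h"
    proof (cases "p = q")
      case False
      define D where "D = q - p"
      define \<Gamma> where "\<Gamma> = integral {p..q} h"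
      have D: "D > 0" using False pq by (simp add: D_def)
      have pT: "0 \<le> p" "q < T" "p \<in> {0..<T}" "q \<in> {0..<T}" using pq ab by auto
      have L: "u q \<in> L2_torus" "u p \<in> L2_torus" using sobolevD(1)[OF u_in] pT by auto
      let ?w = "trig_dual s F (u q)"
      have "(\<Sum>k\<in>F. sobolev_term s (u q) k) - (\<Sum>k\<in>F. sobolev_term s (u p) k) \<le> (\<Sum>k\<in>F. 2 * lam k powr s * (?c q k \<bullet> ?c q k) - 2 * lam k powr s * (?c q k \<bullet> ?c p k))"
        unfolding sum_subtractf[symmetric]
      proof (rule sum_mono)
        fix k
        \<comment> \<open>Convexity of the square, with its gradient at the right endpoint q, so
          that the test function does not vary with the integration time.\<close>
        have "(cmod (?c q k))\<^sup>2 - (cmod (?c p k))\<^sup>2 \<le> 2 * (?c q k \<bullet> ?c q k) - 2 * (?c q k \<bullet> ?c p k)"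
        proof -
          have "0 \<le> (?c q k - ?c p k) \<bullet> (?c q k - ?c p k)" by simp
          then show ?thesis by (simp add: power2_norm_eq_inner inner_diff_left inner_diff_right inner_commute)
        qed
        then have "lam k powr s * ((cmod (?c q k))\<^sup>2 - (cmod (?c p k))\<^sup>2) \<le> lam k powr s * (2 * (?c q k \<bullet> ?c q k) - 2 * (?c q k \<bullet> ?c p k))"
          by (rule mult_left_mono) simp
        then show "sobolev_term s (u q) k - sobolev_term s (u p) k \<le> 2 * lam k powr s * (?c q k \<bullet> ?c q k) - 2 * lam k powr s * (?c q k \<bullet> ?c p k)"
          by (simp add: sobolev_term_lam right_diff_distrib mult_ac)
      qed
      also have "\<dots> = l2_inner (u q) ?w - l2_inner (u p) ?w"
        by (simp add: l2_inner_trig_dual[OF L(1) F] l2_inner_trig_dual[OF L(2) F] sum_subtractf)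
      also have "\<dots> = integral {p..q} (\<lambda>t. l2_inner (du t) ?w)" by (rule inc[OF trig_dual_L2 pT(1) pq(2) pT(2)])
      also have "\<dots> \<le> integral {p..q} (\<lambda>t. 2 * h t + \<Lambda> * (D * h t + \<Gamma>))"
      proof (rule integral_le_off_negligible[OF _ _ E(1)])
        show "(\<lambda>t. l2_inner (du t) ?w) integrable_on {p..q}"
          by (rule time_integrable[OF inc_int[OF trig_dual_L2]]) (use pT in auto)
        show "(\<lambda>t. 2 * h t + \<Lambda> * (D * h t + \<Gamma>)) integrable_on {p..q}"
          using pT by (intro integrable_add integrable_on_mult_right hi) auto
        fix t assume t0: "t \<in> {p..q} - E"
        then have t: "t \<in> {0..T} - E" "p \<le> t" "t \<le> q" using pT by auto
        have dL: "du t \<in> L2_torus" using sobolevD(1)[OF E(5)[OF t(1)]] .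
        have uL: "u t \<in> L2_torus" using sobolevD(1)[OF E(3)[OF t(1)]] .
        have "l2_inner (du t) ?w = (\<Sum>k\<in>F. 2 * lam k powr s * (?c q k \<bullet> ?d t k))" by (rule l2_inner_trig_dual[OF dL F])
        also have "\<dots> \<le> (\<Sum>k\<in>F. (sobolev_term (s + 1) (u t) k + sobolev_term (s - 1) (du t) k) +
            \<Lambda> * (D * (cmod (?d t k))\<^sup>2 + (cmod (?c q k - ?c t k))\<^sup>2 / D))"
        proof (rule sum_mono)
          fix k assume k: "k \<in> F"
          have "2 * lam k powr s * (?c t k \<bullet> ?d t k) \<le> 2 * lam k powr s * (cmod (?c t k) * cmod (?d t k))"
            by (intro mult_left_mono norm_cauchy_schwarz) simp
          \<comment> \<open>The weight is shared out as exponents (s+1)/2 and (s-1)/2, matching the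
            two norms that \<open>h\<close> controls.\<close>
          also have "\<dots> = 2 * (lam k powr ((s + 1) / 2) * cmod (?c t k)) * (lam k powr ((s - 1) / 2) * cmod (?d t k))"
          proof -
            have e1: "lam k powr ((s + 1) / 2) * lam k powr ((s - 1) / 2) = lam k powr s"
              by (simp add: powr_add[symmetric] add_divide_distrib[symmetric])
            have e2: "2 * (A * x) * (B * y) = 2 * (A * B) * (x * y)" for A B x y :: real by (simp only: mult_ac)
            show ?thesis by (rule sym, rule trans[OF e2]) (simp only: e1)
          qed
          also have "\<dots> \<le> (lam k powr ((s + 1) / 2) * cmod (?c t k))\<^sup>2 + (lam k powr ((s - 1) / 2) * cmod (?d t k))\<^sup>2"
            by (rule sum_squares_bound)
          also have "\<dots> = sobolev_term (s + 1) (u t) k + sobolev_term (s - 1) (du t) k"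
          proof -
            have "(lam k powr (r / 2))\<^sup>2 = lam k powr r" for r
              using lam_pos[of k] by (simp add: power2_eq_square powr_add[symmetric])
            then show ?thesis by (simp add: sobolev_term_lam power_mult_distrib)
          qed
          finally have 1: "2 * lam k powr s * (?c t k \<bullet> ?d t k) \<le> sobolev_term (s + 1) (u t) k + sobolev_term (s - 1) (du t) k" .
          \<comment> \<open>The price for having the coefficient at q in place of t. Young's weight
            D is right because the squared L^2 increment is at most \<open>D * \<Gamma>\<close>, so
            division by D leaves a bounded quantity.\<close>
          have "2 * ((?c q k - ?c t k) \<bullet> ?d t k) \<le> 2 * (cmod (?c q k - ?c t k) * cmod (?d t k))"
            by (intro mult_left_mono norm_cauchy_schwarz) simp
          also have "\<dots> = 2 * (sqrt D * cmod (?d t k)) * (cmod (?c q k - ?c t k) / sqrt D)" using D by simp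
          also have "\<dots> \<le> (sqrt D * cmod (?d t k))\<^sup>2 + (cmod (?c q k - ?c t k) / sqrt D)\<^sup>2" by (rule sum_squares_bound)
          also have "\<dots> = D * (cmod (?d t k))\<^sup>2 + (cmod (?c q k - ?c t k))\<^sup>2 / D"
            using D by (simp add: power_mult_distrib power_divide)
          finally have "lam k powr s * (2 * ((?c q k - ?c t k) \<bullet> ?d t k)) \<le> \<Lambda> * (D * (cmod (?d t k))\<^sup>2 + (cmod (?c q k - ?c t k))\<^sup>2 / D)"
            by (rule order_trans[OF mult_left_mono mult_right_mono[OF \<Lambda>[OF k]]]) (use D in auto)
          then show "2 * lam k powr s * (?c q k \<bullet> ?d t k) \<le> (sobolev_term (s + 1) (u t) k + sobolev_term (s - 1) (du t) k) +
            \<Lambda> * (D * (cmod (?d t k))\<^sup>2 + (cmod (?c q k - ?c t k))\<^sup>2 / D)"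
            using 1 by (simp add: inner_diff_left algebra_simps)
        qed
        also have "\<dots> = (\<Sum>k\<in>F. sobolev_term (s + 1) (u t) k) + (\<Sum>k\<in>F. sobolev_term (s - 1) (du t) k) +
            \<Lambda> * (D * (\<Sum>k\<in>F. (cmod (?d t k))\<^sup>2) + (\<Sum>k\<in>F. (cmod (?c q k - ?c t k))\<^sup>2) / D)"
          by (simp add: sum.distrib sum_distrib_left sum_divide_distrib distrib_left)
        also have "\<dots> \<le> h t + h t + \<Lambda> * (D * h t + (D * \<Gamma>) / D)"
        proof (intro add_mono mult_left_mono divide_right_mono)
          show "(\<Sum>k\<in>F. sobolev_term (s + 1) (u t) k) \<le> h t" using sobolev_finite_sum_le[OF E(3)[OF t(1)] F] E(4)[OF t(1)] by linarith
          show "(\<Sum>k\<in>F. sobolev_term (s - 1) (du t) k) \<le> h t" using sobolev_finite_sum_le[OF E(5)[OF t(1)] F] E(6)[OF t(1)] by linarith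
          have "(\<Sum>k\<in>F. (cmod (?d t k))\<^sup>2) \<le> l2_inner (du t) (du t)" by (rule bessel_l2[OF dL F])
          also have "\<dots> \<le> (sobolev_norm (s - 1) (du t))\<^sup>2" using s1 by (intro l2_le_sobolev_norm E(5)[OF t(1)]) simp
          finally show "(\<Sum>k\<in>F. (cmod (?d t k))\<^sup>2) \<le> h t" using E(6)[OF t(1)] by linarith
          have "(\<Sum>k\<in>F. (cmod (?c q k - ?c t k))\<^sup>2) = (\<Sum>k\<in>F. (cmod (fourier_coeff (\<lambda>x. u q x - u t x) k))\<^sup>2)"
            by (simp add: fourier_coeff_diff[OF L(1) uL])
          also have "\<dots> \<le> l2_inner (\<lambda>x. u q x - u t x) (\<lambda>x. u q x - u t x)" by (rule bessel_l2[OF L2_diff[OF L(1) uL] F])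
          also have "\<dots> \<le> (q - t) * integral {t..q} h"
            using path[of q] pT t by (intro l2_path_increment[of q]) auto
          also have "\<dots> \<le> D * \<Gamma>"
          proof (rule mult_mono)
            have "integral {p..t} h + integral {t..q} h = \<Gamma>" unfolding \<Gamma>_def
              using t pT by (intro Henstock_Kurzweil_Integration.integral_combine hi) auto
            then show "integral {t..q} h \<le> \<Gamma>" using hint0[of p t] t pT by auto
            show "0 \<le> integral {t..q} h" using hint0 t pT by auto
          qed (use t D in \<open>auto simp: D_def\<close>)
          finally show "(\<Sum>k\<in>F. (cmod (?c q k - ?c t k))\<^sup>2) \<le> D * \<Gamma>" .
        qed (use D \<Lambda>0 in auto)
        finally show "l2_inner (du t) ?w \<le> 2 * h t + \<Lambda> * (D * h t + \<Gamma>)" using D by simp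
      qed
      also have "\<dots> = integral {p..q} (\<lambda>t. 2 * h t) + \<Lambda> * (D * \<Gamma> + D * \<Gamma>)"
      proof (rule integral_unique)
        have c: "((\<lambda>\<tau>. \<Gamma>) has_integral D * \<Gamma>) {p..q}" using has_integral_const_real[of \<Gamma> p q] pq by (simp add: D_def)
        have H: "(h has_integral \<Gamma>) {p..q}" unfolding \<Gamma>_def using pT by (intro integrable_integral hi) auto
        have H2: "((\<lambda>t. 2 * h t) has_integral integral {p..q} (\<lambda>t. 2 * h t)) {p..q}"
          using pT by (intro integrable_integral integrable_on_mult_right hi) auto
        show "((\<lambda>t. 2 * h t + \<Lambda> * (D * h t + \<Gamma>)) has_integral integral {p..q} (\<lambda>t. 2 * h t) + \<Lambda> * (D * \<Gamma> + D * \<Gamma>)) {p..q}"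
          by (intro has_integral_add has_integral_mult_right c H H2)
      qed
      finally show ?thesis unfolding D_def[symmetric] \<Gamma>_def[symmetric] by (simp add: algebra_simps)
    qed simp
  qed
qed

end

section \<open>The limit in H^s at the final time\<close>

context sobolev_path
begin

text \<open>Frequencies are split by a finite set \<open>F0\<close>. Outside it the energy is small
  at a time \<open>r0\<close> close to T and can grow afterwards by at most the integral of
  \<open>2 * h\<close>; inside it the weights are bounded and the L^2 increments tend to 0.\<close>

lemma cauchy_at_end:
  assumes e: "e > 0"
  obtains r where "0 \<le> r" "r < T" "\<And>t t' F. t \<in> {r..<T} \<Longrightarrow> t' \<in> {r..<T} \<Longrightarrow> finite F \<Longrightarrow>
    (\<Sum>k\<in>F. sobolev_term s (\<lambda>x. u t x - u t' x) k) \<le> e"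
proof -
  obtain E where E: "negligible E" "\<And>t. t \<in> {0..T} - E \<Longrightarrow> (sobolev_norm (s + 1) (u t))\<^sup>2 \<le> h t"
    using regular_times by metis
  have hi: "h integrable_on {p..q}" if "0 \<le> p" "q \<le> T" for p q by (rule time_integrable[OF h_int that])
  have h0: "0 \<le> h t" if "t \<in> {0..T} - E" for t using E(2)[OF that] zero_le_power2[of "sobolev_norm (s + 1) (u t)"] by linarith
  have hint0: "0 \<le> integral {p..q} h" if "0 \<le> p" "q \<le> T" for p q
    using integral_le_off_negligible[OF _ hi[OF that] E(1), of "\<lambda>_. 0"] h0 that by auto
  have hmono: "integral {p..q} h \<le> integral {p'..q'} h" if "0 \<le> p'" "p' \<le> p" "p \<le> q" "q \<le> q'" "q' \<le> T" for p q p' q'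
  proof -
    have "integral {p'..p} h + integral {p..q'} h = integral {p'..q'} h"
      using that by (intro Henstock_Kurzweil_Integration.integral_combine hi) auto
    moreover have "integral {p..q} h + integral {q..q'} h = integral {p..q'} h"
      using that by (intro Henstock_Kurzweil_Integration.integral_combine hi) auto
    moreover have "0 \<le> integral {p'..p} h" "0 \<le> integral {q..q'} h" using that by (auto intro!: hint0)
    ultimately show ?thesis by linarith
  qed
  \<comment> \<open>The block \<open>F0\<close> contributes \<epsilon>, and the two tails, each at
    most 2 \<epsilon>, are doubled by \<open>sobolev_term_add\<close>: 1 + 4 + 4 = 9.\<close>
  define \<epsilon> where "\<epsilon> = e / 9"
  have \<epsilon>: "\<epsilon> > 0" using e by (simp add: \<epsilon>_def)
  have "continuous_on {0..T} (\<lambda>x. integral {x..T} h)"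
    by (rule indefinite_integral_continuous_1') (rule hi, auto)
  then obtain \<delta> where \<delta>: "\<delta> > 0" "\<And>x. x \<in> {0..T} \<Longrightarrow> dist x T < \<delta> \<Longrightarrow> dist (integral {x..T} h) (integral {T..T} h) < \<epsilon> / 2"
    using T \<epsilon> unfolding continuous_on_iff by (metis atLeastAtMost_iff half_gt_zero less_imp_le order_refl)
  define r0 where "r0 = max 0 (T - \<delta> / 2)"
  have r0: "0 \<le> r0" "r0 < T" using T \<delta>(1) by (auto simp: r0_def)
  have "dist r0 T < \<delta>" using \<delta>(1) T by (auto simp: r0_def dist_real_def)
  then have I: "integral {r0..T} h < \<epsilon> / 2" using \<delta>(2)[of r0] r0 hint0[of r0 T] by (simp add: dist_real_def)
  note sm = sobolevD(2)[OF u_in, of r0]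
  have "\<forall>\<^sub>F F in finite_subsets_at_top UNIV. dist (sum (sobolev_term s (u r0)) F) (infsum (sobolev_term s (u r0)) UNIV) < \<epsilon> / 2"
    using infsum_tendsto[OF sm] r0 \<epsilon> by (intro tendstoD) auto
  then obtain F0 where F0: "finite F0" "\<And>F. finite F \<Longrightarrow> F0 \<subseteq> F \<Longrightarrow> dist (sum (sobolev_term s (u r0)) F) (infsum (sobolev_term s (u r0)) UNIV) < \<epsilon> / 2"
    unfolding eventually_finite_subsets_at_top by auto
  have tail0: "sum (sobolev_term s (u r0)) G \<le> \<epsilon>" if G: "finite G" "G \<inter> F0 = {}" for G
  proof -
    have "sum (sobolev_term s (u r0)) (G \<union> F0) = sum (sobolev_term s (u r0)) G + sum (sobolev_term s (u r0)) F0"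
      using G F0(1) by (intro sum.union_disjoint) auto
    moreover have "dist (sum (sobolev_term s (u r0)) (G \<union> F0)) (infsum (sobolev_term s (u r0)) UNIV) < \<epsilon> / 2"
      using G F0(1) by (intro F0(2)) auto
    moreover have "dist (sum (sobolev_term s (u r0)) F0) (infsum (sobolev_term s (u r0)) UNIV) < \<epsilon> / 2"
      using F0(1) by (intro F0(2)) auto
    ultimately show ?thesis unfolding dist_real_def by argo
  qed
  \<comment> \<open>One \<epsilon> is inherited from time \<open>r0\<close>; the other is twice the
    integral of \<open>h\<close> from \<open>r0\<close> to T, which is below \<epsilon>/2.\<close>
  have tail: "sum (sobolev_term s (u t)) G \<le> 2 * \<epsilon>" if G: "finite G" "G \<inter> F0 = {}" and t: "t \<in> {r0..<T}" for G t
  proof -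
    have "sum (sobolev_term s (u t)) G - sum (sobolev_term s (u r0)) G \<le> integral {r0..t} (\<lambda>t. 2 * h t)"
      by (rule weighted_energy_increment[OF G(1)]) (use r0 t in auto)
    also have "\<dots> = 2 * integral {r0..t} h" by simp
    also have "\<dots> \<le> 2 * integral {r0..T} h" using hmono[of r0 r0 t T] r0 t by simp
    finally show ?thesis using tail0[OF G] I by linarith
  qed
  define \<Lambda> where "\<Lambda> = (\<Sum>k\<in>F0. lam k powr s)"
  define \<Gamma> where "\<Gamma> = integral {0..T} h"
  have \<Lambda>0: "0 \<le> \<Lambda>" unfolding \<Lambda>_def by (intro sum_nonneg) simp
  have \<Gamma>0: "0 \<le> \<Gamma>" unfolding \<Gamma>_def by (rule hint0) auto
  \<comment> \<open>Chosen so that \<open>\<Lambda> * (\<eta> * \<Gamma>)\<close> is at most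
    \<epsilon>; the summand 1 keeps the denominator positive.\<close>
  define \<eta> where "\<eta> = \<epsilon> / (\<Lambda> * \<Gamma> + 1)"
  have den: "\<Lambda> * \<Gamma> + 1 > 0" using \<Lambda>0 \<Gamma>0 by (simp add: add_nonneg_pos)
  have \<eta>: "\<eta> > 0" using \<epsilon> den by (simp add: \<eta>_def)
  have \<eta>le: "\<Lambda> * (\<eta> * \<Gamma>) \<le> \<epsilon>"
  proof -
    have "\<Lambda> * (\<eta> * \<Gamma>) = \<eta> * (\<Lambda> * \<Gamma>)" by simp
    also have "\<dots> \<le> \<eta> * (\<Lambda> * \<Gamma> + 1)" using \<eta> by simp
    also have "\<dots> = \<epsilon>" using den by (simp add: \<eta>_def)
    finally show ?thesis .
  qed
  define r where "r = max r0 (T - \<eta> / 2)"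
  have rT: "0 \<le> r" "r < T" "r0 \<le> r" using r0 \<eta> by (auto simp: r_def)
  have core: "sum (sobolev_term s (\<lambda>x. u t x - u t' x)) F0 \<le> \<epsilon>" if t: "t \<in> {r..<T}" "t' \<in> {r..<T}" "t' \<le> t" for t t'
  proof -
    have L: "u t \<in> L2_torus" "u t' \<in> L2_torus" using sobolevD(1)[OF u_in] t rT by auto
    let ?d = "\<lambda>x. u t x - u t' x"
    have "sum (sobolev_term s ?d) F0 \<le> (\<Sum>k\<in>F0. \<Lambda> * (cmod (fourier_coeff ?d k))\<^sup>2)"
      unfolding sobolev_term_lam \<Lambda>_def using F0(1)
      by (intro sum_mono mult_right_mono member_le_sum) auto
    also have "\<dots> \<le> \<Lambda> * l2_inner ?d ?d"
      unfolding sum_distrib_left[symmetric] by (intro mult_left_mono bessel_l2 L2_diff L F0(1) \<Lambda>0)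
    also have "\<dots> \<le> \<Lambda> * (\<eta> * \<Gamma>)"
    proof (rule mult_left_mono[OF _ \<Lambda>0])
      have "l2_inner ?d ?d \<le> (t - t') * integral {t'..t} h"
        using path[of t] t rT by (intro l2_path_increment[of t]) auto
      also have "\<dots> \<le> \<eta> * \<Gamma>"
      proof (rule mult_mono)
        have "t - t' \<le> \<eta> / 2" using t by (auto simp: r_def)
        then show "t - t' \<le> \<eta>" using \<eta> by linarith
        show "integral {t'..t} h \<le> \<Gamma>" unfolding \<Gamma>_def using t rT by (intro hmono) auto
        show "0 \<le> integral {t'..t} h" using t rT by (intro hint0) auto
      qed (use \<eta> in auto)
      finally show "l2_inner ?d ?d \<le> \<eta> * \<Gamma>" .
    qed
    finally show ?thesis using \<eta>le by linarith
  qed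
  have sym: "sobolev_term s (\<lambda>x. u t x - u t' x) k = sobolev_term s (\<lambda>x. u t' x - u t x) k"
    if "t \<in> {r..<T}" "t' \<in> {r..<T}" for t t' k
  proof -
    have "u t \<in> L2_torus" "u t' \<in> L2_torus" using sobolevD(1)[OF u_in] that rT by auto
    then show ?thesis by (simp add: sobolev_term_lam fourier_coeff_diff norm_minus_commute)
  qed
  show ?thesis
  proof (rule that[OF rT(1,2)])
    fix t t' F assume t: "t \<in> {r..<T}" "t' \<in> {r..<T}" and F: "finite (F :: (int^'n) set)"
    have m: "t \<in> {0..<T}" "t' \<in> {0..<T}" using t rT by auto
    note L = sobolevD(1)[OF u_in[OF m(1)]] L2_scale[OF sobolevD(1)[OF u_in[OF m(2)]], of "-1"]
    let ?d = "\<lambda>x. u t x - u t' x"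
    have c: "sum (sobolev_term s ?d) F0 \<le> \<epsilon>"
      using core[OF t] core[OF t(2,1)] sym[OF t] by (cases "t' \<le> t") auto
    have "sum (sobolev_term s ?d) F \<le> sum (sobolev_term s ?d) (F0 \<union> (F - F0))"
      using F F0(1) by (intro sum_mono2) (auto simp: sobolev_term_nonneg)
    also have "\<dots> = sum (sobolev_term s ?d) F0 + sum (sobolev_term s ?d) (F - F0)"
      using F F0(1) by (intro sum.union_disjoint) auto
    also have "sum (sobolev_term s ?d) (F - F0) \<le> (\<Sum>k\<in>F - F0. 2 * sobolev_term s (u t) k + 2 * sobolev_term s (u t') k)"
    proof (rule sum_mono)
      fix k
      have "sobolev_term s (\<lambda>x. - 1 * u t' x) k = sobolev_term s (u t') k"
        unfolding sobolev_term_lam fourier_coeff_scale by simp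
      then show "sobolev_term s ?d k \<le> 2 * sobolev_term s (u t) k + 2 * sobolev_term s (u t') k"
        using sobolev_term_add[OF L, of s k] by simp
    qed
    also have "\<dots> = 2 * sum (sobolev_term s (u t)) (F - F0) + 2 * sum (sobolev_term s (u t')) (F - F0)"
      by (simp add: sum.distrib sum_distrib_left)
    also have "\<dots> \<le> 2 * (2 * \<epsilon>) + 2 * (2 * \<epsilon>)"
    proof -
      have dj: "finite (F - F0)" "(F - F0) \<inter> F0 = {}" using F by auto
      have "t \<in> {r0..<T}" "t' \<in> {r0..<T}" using t rT by auto
      from tail[OF dj this(1)] tail[OF dj this(2)] show ?thesis by linarith
    qed
    finally show "sum (sobolev_term s ?d) F \<le> e" using c by (simp add: \<epsilon>_def)
  qed
qed

text \<open>The values along a sequence of times tending to T converge uniformly to a continuous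
  \<open>U\<close>. Fourier coefficients converge too, so the Cauchy bounds on finite blocks pass to
  the limit, and being independent of the block they bound the H^s norm.\<close>

lemma end_limit:
  obtains U where "U \<in> sobolev s" "((\<lambda>t. sobolev_norm s (\<lambda>x. u t x - U x)) \<longlongrightarrow> 0) (at T within {0..<T})"
proof -
  let ?A = "emb TYPE('n) s"
  define \<tau> where "\<tau> n = T - T * inverse (real (Suc n))" for n
  have \<tau>: "\<tau> n \<in> {0..<T}" for n
  proof -
    have "T * inverse (real (Suc n)) \<le> T * 1" using T by (intro mult_left_mono) (auto simp: field_simps)
    then show ?thesis using T by (auto simp: \<tau>_def)
  qed
  have "\<tau> \<longlonglongrightarrow> T - T * 0" unfolding \<tau>_def by (intro tendsto_intros LIMSEQ_inverse_real_of_nat)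
  then have \<tau>lim: "\<tau> \<longlonglongrightarrow> T" by simp
  have \<tau>ev: "\<forall>\<^sub>F n in sequentially. \<tau> n \<in> {r..<T}" if "r < T" for r
    using order_tendstoD(1)[OF \<tau>lim that] by eventually_elim (use \<tau> in auto)
  have normle: "sobolev_norm s f \<le> sqrt e" if "\<And>F. finite F \<Longrightarrow> sum (sobolev_term s f) F \<le> e" "sobolev_term s f summable_on UNIV" for f e
    unfolding sobolev_norm_def by (intro real_sqrt_le_mono infsum_le_finite_sums that) auto
  \<comment> \<open>Two faces of the same Cauchy property: the supremum bound constructs the limit,
    and the bound on finite blocks identifies it in H^s.\<close>
  have uni: "\<exists>r. 0 \<le> r \<and> r < T \<and> (\<forall>t\<in>{r..<T}. \<forall>t'\<in>{r..<T}. (\<forall>F. finite F \<longrightarrow> (\<Sum>k\<in>F. sobolev_term s (\<lambda>x. u t x - u t' x) k) \<le> e) \<and>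
      (\<forall>x. \<bar>u t x - u t' x\<bar> \<le> ?A * sqrt e))" if e: "e > 0" for e
  proof -
    obtain r where r: "0 \<le> r" "r < T" "\<And>t t' F. t \<in> {r..<T} \<Longrightarrow> t' \<in> {r..<T} \<Longrightarrow> finite F \<Longrightarrow>
       (\<Sum>k\<in>F. sobolev_term s (\<lambda>x. u t x - u t' x) k) \<le> e" using cauchy_at_end[OF e] by blast
    have "\<bar>u t x - u t' x\<bar> \<le> ?A * sqrt e" if t: "t \<in> {r..<T}" "t' \<in> {r..<T}" for t t' x
    proof -
      have m: "t \<in> {0..<T}" "t' \<in> {0..<T}" using t r by auto
      have "sobolev_norm s (\<lambda>x. u t x - u t' x) \<le> sqrt e"
        by (rule normle[OF r(3)[OF t]]) (use sobolevD(2)[OF sobolev_diff[OF u_in[OF m(1)] u_in[OF m(2)]]] in auto)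
      then have "?A * sobolev_norm s (\<lambda>x. u t x - u t' x) \<le> ?A * sqrt e" by (rule mult_left_mono[OF _ emb_nonneg])
      then show ?thesis using sup_bound[OF m, of x] by linarith
    qed
    then show ?thesis using r by blast
  qed
  have small: "\<exists>e>0. ?A * sqrt e < \<epsilon>" if "\<epsilon> > 0" for \<epsilon>
  proof (intro exI conjI)
    show "(\<epsilon> / (?A + 1))\<^sup>2 > 0" using that emb_nonneg[where 'n='n, of s] by simp
    have "?A * sqrt ((\<epsilon> / (?A + 1))\<^sup>2) = ?A * (\<epsilon> / (?A + 1))" using that emb_nonneg[where 'n='n, of s] by simp
    also have "\<dots> < (?A + 1) * (\<epsilon> / (?A + 1))" using that emb_nonneg[where 'n='n, of s] by (intro mult_strict_right_mono) auto
    also have "\<dots> = \<epsilon>" using emb_nonneg[where 'n='n, of s] by simp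
    finally show "?A * sqrt ((\<epsilon> / (?A + 1))\<^sup>2) < \<epsilon>" .
  qed
  have conv: "(\<lambda>n. u (\<tau> n) x) \<longlonglongrightarrow> lim (\<lambda>n. u (\<tau> n) x)" for x
  proof -
    have "Cauchy (\<lambda>n. u (\<tau> n) x)"
    proof (rule metric_CauchyI)
      fix \<epsilon> :: real assume "\<epsilon> > 0"
      then obtain e where e: "e > 0" "?A * sqrt e < \<epsilon>" using small by blast
      then obtain r where r: "r < T" "\<And>t t' x. t \<in> {r..<T} \<Longrightarrow> t' \<in> {r..<T} \<Longrightarrow> \<bar>u t x - u t' x\<bar> \<le> ?A * sqrt e" using uni[OF e(1)] by blast
      obtain N where N: "\<And>n. n \<ge> N \<Longrightarrow> \<tau> n \<in> {r..<T}" using \<tau>ev[OF r(1)] unfolding eventually_sequentially by blast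
      show "\<exists>M. \<forall>m\<ge>M. \<forall>n\<ge>M. dist (u (\<tau> m) x) (u (\<tau> n) x) < \<epsilon>"
        using r(2)[OF N N, of _ _ x] e(2) by (intro exI[of _ N]) (auto simp: dist_real_def intro: le_less_trans)
    qed
    then show ?thesis using Cauchy_convergent convergent_LIMSEQ_iff by blast
  qed
  define U where "U x = lim (\<lambda>n. u (\<tau> n) x)" for x
  have Ulim: "(\<lambda>n. u (\<tau> n) x) \<longlonglongrightarrow> U x" for x using conv by (simp add: U_def)
  have close: "\<bar>u t x - U x\<bar> \<le> ?A * sqrt e" if "r < T" "t \<in> {r..<T}"
    "\<And>t t' x. t \<in> {r..<T} \<Longrightarrow> t' \<in> {r..<T} \<Longrightarrow> \<bar>u t x - u t' x\<bar> \<le> ?A * sqrt e" for r t x e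
  proof (rule LIMSEQ_le_const2)
    show "(\<lambda>n. \<bar>u t x - u (\<tau> n) x\<bar>) \<longlonglongrightarrow> \<bar>u t x - U x\<bar>" by (intro tendsto_intros Ulim)
    show "\<exists>N. \<forall>n\<ge>N. \<bar>u t x - u (\<tau> n) x\<bar> \<le> ?A * sqrt e"
      using \<tau>ev[OF that(1)] that(2,3) unfolding eventually_sequentially by meson
  qed
  have perU: "periodic U" unfolding periodic_def U_def using space_periodic[OF \<tau>] by (simp add: periodic_def)
  have ul: "uniform_limit UNIV (\<lambda>n. u (\<tau> n)) U sequentially"
  proof (rule uniform_limitI)
    fix \<epsilon> :: real assume "\<epsilon> > 0"
    then obtain e where e: "e > 0" "?A * sqrt e < \<epsilon>" using small by blast
    then obtain r where r: "r < T" "\<And>t t' x. t \<in> {r..<T} \<Longrightarrow> t' \<in> {r..<T} \<Longrightarrow> \<bar>u t x - u t' x\<bar> \<le> ?A * sqrt e" using uni[OF e(1)] by blast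
    show "\<forall>\<^sub>F n in sequentially. \<forall>x\<in>UNIV. dist (u (\<tau> n) x) (U x) < \<epsilon>"
      using \<tau>ev[OF r(1)]
    proof eventually_elim
      case (elim n)
      show ?case
      proof
        fix x
        have "\<bar>u (\<tau> n) x - U x\<bar> \<le> ?A * sqrt e" by (rule close[OF r(1) elim r(2)])
        then show "dist (u (\<tau> n) x) (U x) < \<epsilon>" using e(2) by (simp add: dist_real_def)
      qed
    qed
  qed
  have evc: "\<forall>\<^sub>F n in sequentially. continuous_on UNIV (u (\<tau> n))" using space_continuous[OF \<tau>] by simp
  have contU: "continuous_on UNIV U" by (rule uniform_limit_theorem[OF evc ul sequentially_bot])
  have UL: "U \<in> L2_torus" by (rule continuous_periodic_L2[OF perU contU])
  \<comment> \<open>Bessel's inequality for a single frequency bounds the error by the L^2 distance,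
    hence by the uniform one.\<close>
  have coeff: "(\<lambda>n. fourier_coeff (u (\<tau> n)) k) \<longlonglongrightarrow> fourier_coeff U k" for k
  proof (rule LIMSEQ_I)
    fix \<epsilon> :: real assume "\<epsilon> > 0"
    then have "\<epsilon> / 2 > 0" by simp
    with ul have "\<forall>\<^sub>F n in sequentially. \<forall>x\<in>UNIV. dist (u (\<tau> n) x) (U x) < \<epsilon> / 2" unfolding uniform_limit_iff by blast
    then obtain N where N: "\<And>n x. n \<ge> N \<Longrightarrow> \<bar>u (\<tau> n) x - U x\<bar> < \<epsilon> / 2" unfolding eventually_sequentially dist_real_def by blast
    have "norm (fourier_coeff (u (\<tau> n)) k - fourier_coeff U k) < \<epsilon>" if n: "n \<ge> N" for n
    proof -
      have L: "u (\<tau> n) \<in> L2_torus" using sobolevD(1)[OF u_in[OF \<tau>]] .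
      let ?d = "\<lambda>x. u (\<tau> n) x - U x"
      have "(cmod (fourier_coeff ?d k))\<^sup>2 \<le> (LINT x|torus_measure. (?d x)\<^sup>2)"
        using bessel_inequality[OF L2_diff[OF L UL], of "{k}"] by simp
      also have "\<dots> \<le> (LINT x|(torus_measure :: (real^'n) measure). (\<epsilon> / 2)\<^sup>2)"
      proof (rule integral_mono)
        show "integrable torus_measure (\<lambda>x. (?d x)\<^sup>2)" by (rule L2_torusD(3)[OF L2_diff[OF L UL]])
        show "integrable (torus_measure :: (real^'n) measure) (\<lambda>x. (\<epsilon> / 2)\<^sup>2)" by (rule L2_integrable[OF L2_const])
        fix x
        have "\<bar>?d x\<bar>\<^sup>2 \<le> (\<epsilon> / 2)\<^sup>2" using N[OF n, of x] by (intro power_mono) auto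
        then show "(?d x)\<^sup>2 \<le> (\<epsilon> / 2)\<^sup>2" by simp
      qed
      also have "\<dots> = (\<epsilon> / 2)\<^sup>2" by (rule integral_const_torus)
      finally have "cmod (fourier_coeff ?d k) \<le> \<epsilon> / 2" by (rule power2_le_imp_le) (use \<open>\<epsilon> > 0\<close> in simp)
      then show ?thesis using \<open>\<epsilon> > 0\<close> by (simp add: fourier_coeff_diff[OF L UL])
    qed
    then show "\<exists>no. \<forall>n\<ge>no. norm (fourier_coeff (u (\<tau> n)) k - fourier_coeff U k) < \<epsilon>" by blast
  qed
  have bnd: "sum (sobolev_term s (\<lambda>x. u t x - U x)) F \<le> e" if "r < T" "0 \<le> r" "t \<in> {r..<T}" "finite F"
    "\<And>t t' F. t \<in> {r..<T} \<Longrightarrow> t' \<in> {r..<T} \<Longrightarrow> finite F \<Longrightarrow> (\<Sum>k\<in>F. sobolev_term s (\<lambda>x. u t x - u t' x) k) \<le> e" for r t F e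
  proof (rule LIMSEQ_le_const2)
    have L: "u t \<in> L2_torus" using sobolevD(1)[OF u_in] that by auto
    have Ln: "u (\<tau> n) \<in> L2_torus" for n using sobolevD(1)[OF u_in[OF \<tau>]] .
    show "(\<lambda>n. sum (sobolev_term s (\<lambda>x. u t x - u (\<tau> n) x)) F) \<longlonglongrightarrow> sum (sobolev_term s (\<lambda>x. u t x - U x)) F"
      unfolding sobolev_term_lam fourier_coeff_diff[OF L UL] fourier_coeff_diff[OF L Ln]
      by (intro tendsto_intros coeff)
    show "\<exists>N. \<forall>n\<ge>N. sum (sobolev_term s (\<lambda>x. u t x - u (\<tau> n) x)) F \<le> e"
      using \<tau>ev[OF that(1)] that(3,4,5) unfolding eventually_sequentially by meson
  qed
  have memb: "(\<lambda>x. u t x - U x) \<in> sobolev s \<and> sobolev_norm s (\<lambda>x. u t x - U x) \<le> sqrt e" if e: "e > 0" "r < T" "0 \<le> r" "t \<in> {r..<T}"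
    "\<And>t t' F. t \<in> {r..<T} \<Longrightarrow> t' \<in> {r..<T} \<Longrightarrow> finite F \<Longrightarrow> (\<Sum>k\<in>F. sobolev_term s (\<lambda>x. u t x - u t' x) k) \<le> e" for r t e
  proof -
    have tm: "t \<in> {0..<T}" using e by auto
    have b: "sum (sobolev_term s (\<lambda>x. u t x - U x)) F \<le> e" if "finite F" for F by (rule bnd[OF e(2,3,4) that e(5)])
    have sm: "sobolev_term s (\<lambda>x. u t x - U x) summable_on UNIV"
      by (rule nonneg_bounded_partial_sums_imp_summable_on[where C=e])
        (auto intro!: eventually_finite_subsets_at_top_weakI b sobolev_term_nonneg)
    then have "(\<lambda>x. u t x - U x) \<in> sobolev s"
      using L2_diff[OF sobolevD(1)[OF u_in[OF tm]] UL] continuous_on_diff[OF space_continuous[OF tm] contU] by (simp add: sobolev_def)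
    then show ?thesis using normle[OF b sm] by blast
  qed
  have main: "\<exists>r. 0 \<le> r \<and> r < T \<and> (\<forall>t\<in>{r..<T}. (\<lambda>x. u t x - U x) \<in> sobolev s \<and> sobolev_norm s (\<lambda>x. u t x - U x) \<le> sqrt e)" if e: "e > 0" for e
  proof -
    obtain r where r: "0 \<le> r" "r < T" "\<And>t t' F. t \<in> {r..<T} \<Longrightarrow> t' \<in> {r..<T} \<Longrightarrow> finite F \<Longrightarrow> (\<Sum>k\<in>F. sobolev_term s (\<lambda>x. u t x - u t' x) k) \<le> e"
      using cauchy_at_end[OF e] by blast
    show ?thesis using memb[OF e r(2,1) _ r(3)] r(1,2) by blast
  qed
  have Us: "U \<in> sobolev s"
  proof -
    obtain r where r: "0 \<le> r" "r < T" "(\<lambda>x. u r x - U x) \<in> sobolev s" using main[OF zero_less_one] by auto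
    have "r \<in> {0..<T}" using r by simp
    from sobolev_diff[OF u_in[OF this] r(3)] have "(\<lambda>x. u r x - (u r x - U x)) \<in> sobolev s" .
    then show ?thesis by simp
  qed
  have "((\<lambda>t. sobolev_norm s (\<lambda>x. u t x - U x)) \<longlongrightarrow> 0) (at T within {0..<T})"
  proof (rule tendstoI)
    fix \<epsilon> :: real assume \<epsilon>: "\<epsilon> > 0"
    then have "(\<epsilon> / 2)\<^sup>2 > 0" by simp
    then obtain r where r: "0 \<le> r" "r < T" "\<And>t. t \<in> {r..<T} \<Longrightarrow> sobolev_norm s (\<lambda>x. u t x - U x) \<le> sqrt ((\<epsilon> / 2)\<^sup>2)" using main by blast
    show "\<forall>\<^sub>F t in at T within {0..<T}. dist (sobolev_norm s (\<lambda>x. u t x - U x)) 0 < \<epsilon>"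
      unfolding eventually_at
    proof (intro exI[of _ "T - r"] conjI ballI impI)
      show "0 < T - r" using r by simp
      fix t assume "t \<in> {0..<T}" "t \<noteq> T \<and> dist t T < T - r"
      then have "t \<in> {r..<T}" by (auto simp: dist_real_def)
      then show "dist (sobolev_norm s (\<lambda>x. u t x - U x)) 0 < \<epsilon>"
        using r(3)[of t] \<epsilon> sobolev_norm_nonneg[of s "\<lambda>x. u t x - U x"] by (simp add: real_sqrt_abs)
    qed
  qed
  with Us show ?thesis by (rule that)
qed

end

lemma continuous_extensionI:
  assumes T: "T > 0" and u: "u \<in> C_time {0..<T} X N" and U: "U \<in> X"
    and lim: "((\<lambda>t. N (\<lambda>x. u t x - U x)) \<longlongrightarrow> 0) (at T within {0..<T})"
  shows "continuous_extension T X N u (\<lambda>t. if t < T then u t else U)"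
proof -
  let ?V = "\<lambda>t. if t < T then u t else U"
  have "((\<lambda>r. N (\<lambda>x. ?V r x - ?V t x)) \<longlongrightarrow> 0) (at t within {0..T})" if t: "t \<in> {0..T}" for t
  proof -
    have l: "((\<lambda>r. N (\<lambda>x. u r x - ?V t x)) \<longlongrightarrow> 0) (at t within {0..<T})"
    proof (cases "t < T")
      case True
      then show ?thesis using u t by (auto simp: C_time_def)
    next
      case False
      then have "t = T" using t by simp
      then show ?thesis using lim by simp
    qed
    \<comment> \<open>For t = T the punctured neighbourhoods omit T anyway, and for t < T the
      endpoint is far away; adjoining it to the interval changes no filter.\<close>
    have f: "at t within {0..T} = at t within {0..<T}"
    proof (cases "t < T")
      case True
      show ?thesis by (rule at_within_nhd[of t "{..<T}"]) (use True in auto)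
    next
      case False
      then have "t = T" using t by simp
      then show ?thesis by (intro at_within_nhd[where S=UNIV and T="{0..T}" and U="{0..<T}"]) auto
    qed
    have "\<forall>\<^sub>F r in at t within {0..<T}. N (\<lambda>x. u r x - ?V t x) = N (\<lambda>x. ?V r x - ?V t x)"
      unfolding eventually_at by (intro exI[of _ 1]) auto
    then show ?thesis unfolding f by (rule Lim_transform_eventually[OF l])
  qed
  moreover have "?V t \<in> X" if "t \<in> {0..T}" for t using u U that by (auto simp: C_time_def)
  ultimately show ?thesis unfolding continuous_extension_def C_time_def by auto
qed

section \<open>The system at a single regular time\<close>

section \<open>The weak equations at a fixed time\<close>

text \<open>The continuous representative of \<open>grad\<close> for C1 functions.
  \<open>grad\<close> rests on a choice and agrees with it only almost everywhere, so pointwise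
  estimates are made with this one.\<close>

definition cgrad :: "(real^'n \<Rightarrow> real) \<Rightarrow> real^'n \<Rightarrow> real^'n" where
  "cgrad f x = (\<chi> i. classical_partial i f x)"

definition csym :: "(real^'n \<Rightarrow> real^'n) \<Rightarrow> real^'n \<Rightarrow> real^'n^'n" where
  "csym v x = (\<chi> i j. (classical_partial j (\<lambda>y. v y $ i) x + classical_partial i (\<lambda>y. v y $ j) x) / 2)"

lemma continuous_cgrad: "f \<in> C1_torus \<Longrightarrow> continuous_on UNIV (cgrad f)"
  unfolding cgrad_def[abs_def] by (intro continuous_on_vec_lambda C1_torusD(3))

lemma continuous_csym: "(\<And>i. (\<lambda>x. v x $ i) \<in> C1_torus) \<Longrightarrow> continuous_on UNIV (csym v)"
  unfolding csym_def[abs_def]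
  by (intro continuous_on_vec_lambda continuous_on_divide continuous_on_add C1_torusD(3) continuous_on_const) auto

lemma AE_all_components:
  fixes P :: "'i::finite \<Rightarrow> 'a \<Rightarrow> bool"
  assumes "\<And>i. AE x in M. P i x"
  shows "AE x in M. \<forall>i. P i x"
proof -
  have "AE x in M. \<forall>i\<in>UNIV. P i x" by (rule AE_finite_allI) (use assms in auto)
  then show ?thesis by simp
qed

lemma grad_AE:
  assumes "f \<in> C1_torus"
  shows "AE x in torus_measure. grad f x = cgrad f x"
proof -
  have "AE x in torus_measure. \<forall>i. weak_partial i f x = classical_partial i f x"
    by (intro AE_all_components weak_partial_classical(2) assms)
  then show ?thesis by eventually_elim (simp add: grad_def cgrad_def)
qed

lemma sym_grad_AE:
  fixes v :: "real^'n \<Rightarrow> real^'n"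
  assumes "\<And>i. (\<lambda>x. v x $ i) \<in> C1_torus"
  shows "AE x in torus_measure. sym_grad v x = csym v x"
proof -
  have "AE x in torus_measure. \<forall>i j. weak_partial j (\<lambda>y. v y $ i) x = classical_partial j (\<lambda>y. v y $ i) x"
    by (intro AE_all_components weak_partial_classical(2) assms)
  then show ?thesis by eventually_elim (simp add: sym_grad_def csym_def)
qed

text \<open>The continuous representatives supply the measurability of the integrand.\<close>

lemma l2_inner_AE_eq:
  fixes F F' G G' :: "real^'n \<Rightarrow> 'b::euclidean_space"
  assumes "AE x in torus_measure. F x = F' x" "AE x in torus_measure. G x = G' x"
    and "continuous_on UNIV F'" "continuous_on UNIV G'"
  shows "l2_inner F G = (LINT x|torus_measure. F' x \<bullet> G' x)"
  unfolding l2_inner_def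
proof (rule integral_AE_cong)
  show "(\<lambda>x. F' x \<bullet> G' x) \<in> borel_measurable torus_measure"
    by (intro continuous_borel_torus continuous_intros assms)
  show "AE x in torus_measure. F x \<bullet> G x = F' x \<bullet> G' x" using assms(1,2) by eventually_elim simp
qed simp

lemma integral_continuous_add:
  fixes f g :: "real^'n \<Rightarrow> real"
  assumes "continuous_on UNIV f" "continuous_on UNIV g"
  shows "(LINT x|torus_measure. f x) + (LINT x|torus_measure. g x) = (LINT x|torus_measure. f x + g x)"
  by (rule Bochner_Integration.integral_add[symmetric]) (intro integrable_continuous_torus assms)+

lemma cgrad_inner: "v \<bullet> cgrad f x = (\<Sum>i\<in>UNIV. v $ i * classical_partial i f x)"
  by (simp add: inner_vec_def cgrad_def)

lemma transport_cgrad: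
  assumes "\<And>i. (\<lambda>x. v x $ i) \<in> C1_torus" "div_free v" "f \<in> C1_torus"
  shows "(LINT x|torus_measure. v x \<bullet> cgrad f x) = 0"
  unfolding cgrad_inner by (rule transport_integral_eq_0[OF assms])

text \<open>The system with time frozen at a moment when all unknowns are C1 and \<omega> is
  positive. Here \<open>dv\<close>, \<open>d\<omega>\<close> and \<open>db\<close> are just
  functions that satisfy the three identities.\<close>

locale slice =
  fixes \<alpha> :: real and v dv :: "real^'n \<Rightarrow> real^'n" and \<omega> d\<omega> b db :: "real^'n \<Rightarrow> real"
  assumes dim: "CARD('n) \<ge> 2"
    and v: "\<And>i. (\<lambda>x. v x $ i) \<in> C1_torus" and \<omega>: "\<omega> \<in> C1_torus" and b: "b \<in> C1_torus"
    and div: "div_free v" and \<omega>_pos: "\<And>x. \<omega> x > 0"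
    and eq_v: "\<And>w. w \<in> sobolev_div 1 \<Longrightarrow>
          l2_inner dv w + l2_inner (\<lambda>x. \<chi> i. convect v (\<lambda>y. v y $ i) x) w
          + l2_inner (\<lambda>x. (b x / \<omega> x) *\<^sub>R sym_grad v x) (sym_grad w) = 0"
    and eq_\<omega>: "\<And>z. z \<in> sobolev 1 \<Longrightarrow>
          l2_inner d\<omega> z + l2_inner (convect v \<omega>) z
          + l2_inner (\<lambda>x. (b x / \<omega> x) *\<^sub>R grad \<omega> x) (grad z) = - \<alpha> * l2_inner (\<lambda>x. (\<omega> x)\<^sup>2) z"
    and eq_b: "\<And>q. q \<in> sobolev 1 \<Longrightarrow>
          l2_inner db q + l2_inner (convect v b) q
          + l2_inner (\<lambda>x. (b x / \<omega> x) *\<^sub>R grad b x) (grad q)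
          = - l2_inner (\<lambda>x. b x * \<omega> x) q + l2_inner (\<lambda>x. b x / \<omega> x * (norm (sym_grad v x))\<^sup>2) q"
begin

lemma continuous_v: "continuous_on UNIV v"
  using C1_torusD(4)[OF v] by (subst continuous_on_componentwise) (auto simp: Basis_vec_def cart_eq_inner_axis[symmetric])

lemma continuous_ratio: "continuous_on UNIV (\<lambda>x. b x / \<omega> x)"
  using \<omega>_pos by (intro continuous_on_divide C1_torusD(4) b \<omega>) (metis less_irrefl)

lemma convect_AE: 
  assumes "f \<in> C1_torus"
  shows "AE x in torus_measure. convect v f x = v x \<bullet> cgrad f x"
  using grad_AE[OF assms] by eventually_elim (simp add: convect_def)

text \<open>With classical derivatives all terms merge into one integral of a continuous function,
  so later estimates may be made pointwise under the integral.\<close>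

lemma velocity_equation:
  assumes w: "\<And>i. (\<lambda>x. w x $ i) \<in> C1_torus" and dw: "div_free w"
  shows "l2_inner dv w = - (LINT x|torus_measure. (\<Sum>i\<in>UNIV. (v x \<bullet> cgrad (\<lambda>y. v y $ i) x) * w x $ i)
      + (b x / \<omega> x) * (csym v x \<bullet> csym w x))"
proof -
  have cw: "continuous_on UNIV w"
    using C1_torusD(4)[OF w] by (subst continuous_on_componentwise) (auto simp: Basis_vec_def cart_eq_inner_axis[symmetric])
  have "w \<in> sobolev_div 1" using dw C1_sobolev[OF w dim] by (simp add: sobolev_div_def sobolev_vec_def)
  from eq_v[OF this] have "l2_inner dv w = - (l2_inner (\<lambda>x. \<chi> i. convect v (\<lambda>y. v y $ i) x) w
     + l2_inner (\<lambda>x. (b x / \<omega> x) *\<^sub>R sym_grad v x) (sym_grad w))" by linarith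
  also have "l2_inner (\<lambda>x. \<chi> i. convect v (\<lambda>y. v y $ i) x) w = (LINT x|torus_measure. (\<chi> i. v x \<bullet> cgrad (\<lambda>y. v y $ i) x) \<bullet> w x)"
  proof (rule l2_inner_AE_eq)
    have "AE x in torus_measure. \<forall>i. convect v (\<lambda>y. v y $ i) x = v x \<bullet> cgrad (\<lambda>y. v y $ i) x"
      by (intro AE_all_components convect_AE v)
    then show "AE x in torus_measure. (\<chi> i. convect v (\<lambda>y. v y $ i) x) = (\<chi> i. v x \<bullet> cgrad (\<lambda>y. v y $ i) x)"
      by eventually_elim simp
    show "continuous_on UNIV (\<lambda>x. \<chi> i. v x \<bullet> cgrad (\<lambda>y. v y $ i) x)"
      by (intro continuous_on_vec_lambda continuous_on_inner continuous_v continuous_cgrad v)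
  qed (simp_all add: cw)
  also have "\<dots> = (LINT x|torus_measure. (\<Sum>i\<in>UNIV. (v x \<bullet> cgrad (\<lambda>y. v y $ i) x) * w x $ i))"
    by (simp add: inner_vec_def[of _ "w _"])
  also have "l2_inner (\<lambda>x. (b x / \<omega> x) *\<^sub>R sym_grad v x) (sym_grad w) = (LINT x|torus_measure. ((b x / \<omega> x) *\<^sub>R csym v x) \<bullet> csym w x)"
  proof (rule l2_inner_AE_eq)
    show "AE x in torus_measure. (b x / \<omega> x) *\<^sub>R sym_grad v x = (b x / \<omega> x) *\<^sub>R csym v x"
      using sym_grad_AE[OF v] by eventually_elim simp
  qed (intro sym_grad_AE w continuous_on_scaleR continuous_ratio continuous_csym v)+
  also have "(LINT x|torus_measure. (\<Sum>i\<in>UNIV. (v x \<bullet> cgrad (\<lambda>y. v y $ i) x) * w x $ i)) + (LINT x|torus_measure. ((b x / \<omega> x) *\<^sub>R csym v x) \<bullet> csym w x)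
     = (LINT x|torus_measure. (\<Sum>i\<in>UNIV. (v x \<bullet> cgrad (\<lambda>y. v y $ i) x) * w x $ i) + ((b x / \<omega> x) *\<^sub>R csym v x) \<bullet> csym w x)"
    by (intro integral_continuous_add continuous_on_sum continuous_on_mult continuous_on_inner continuous_v continuous_cgrad v
       C1_torusD(4)[OF w] continuous_on_scaleR continuous_ratio continuous_csym w)
  finally show ?thesis by simp
qed

lemma scalar_terms:
  assumes f: "f \<in> C1_torus" and z: "z \<in> C1_torus"
  shows "l2_inner (convect v f) z + l2_inner (\<lambda>x. (b x / \<omega> x) *\<^sub>R grad f x) (grad z) =
    (LINT x|torus_measure. (v x \<bullet> cgrad f x) * z x + (b x / \<omega> x) * (cgrad f x \<bullet> cgrad z x))"
proof -
  have "l2_inner (convect v f) z = (LINT x|torus_measure. (v x \<bullet> cgrad f x) \<bullet> z x)"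
    by (rule l2_inner_AE_eq[OF convect_AE[OF f] _ continuous_on_inner[OF continuous_v continuous_cgrad[OF f]] C1_torusD(4)[OF z]]) simp
  moreover have "l2_inner (\<lambda>x. (b x / \<omega> x) *\<^sub>R grad f x) (grad z) = (LINT x|torus_measure. ((b x / \<omega> x) *\<^sub>R cgrad f x) \<bullet> cgrad z x)"
  proof (rule l2_inner_AE_eq)
    show "AE x in torus_measure. (b x / \<omega> x) *\<^sub>R grad f x = (b x / \<omega> x) *\<^sub>R cgrad f x"
      using grad_AE[OF f] by eventually_elim simp
  qed (intro grad_AE z continuous_on_scaleR continuous_ratio continuous_cgrad f)+
  moreover have "(LINT x|torus_measure. (v x \<bullet> cgrad f x) \<bullet> z x) + (LINT x|torus_measure. ((b x / \<omega> x) *\<^sub>R cgrad f x) \<bullet> cgrad z x) =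
     (LINT x|torus_measure. (v x \<bullet> cgrad f x) \<bullet> z x + ((b x / \<omega> x) *\<^sub>R cgrad f x) \<bullet> cgrad z x)"
    by (intro integral_continuous_add continuous_on_inner continuous_v continuous_cgrad f z C1_torusD(4) continuous_on_scaleR continuous_ratio)
  ultimately show ?thesis by simp
qed

lemma continuous_scalar_terms:
  assumes f: "f \<in> C1_torus" and z: "z \<in> C1_torus"
  shows "continuous_on UNIV (\<lambda>x. (v x \<bullet> cgrad f x) * z x + (b x / \<omega> x) * (cgrad f x \<bullet> cgrad z x))"
  by (intro continuous_on_add continuous_on_mult continuous_on_inner continuous_v continuous_cgrad f z C1_torusD(4) continuous_ratio)

lemma omega_equation:
  assumes z: "z \<in> C1_torus"
  shows "l2_inner d\<omega> z = - (LINT x|torus_measure. (v x \<bullet> cgrad \<omega> x) * z x + (b x / \<omega> x) * (cgrad \<omega> x \<bullet> cgrad z x) + \<alpha> * (\<omega> x)\<^sup>2 * z x)"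
proof -
  have c: "continuous_on UNIV (\<lambda>x. \<alpha> * (\<omega> x)\<^sup>2 * z x)" by (intro continuous_intros C1_torusD(4) \<omega> z)
  have "\<alpha> * l2_inner (\<lambda>x. (\<omega> x)\<^sup>2) z = (LINT x|torus_measure. \<alpha> * (\<omega> x)\<^sup>2 * z x)"
    by (simp add: l2_inner_eq mult.assoc)
  then have "l2_inner d\<omega> z = - ((LINT x|torus_measure. (v x \<bullet> cgrad \<omega> x) * z x + (b x / \<omega> x) * (cgrad \<omega> x \<bullet> cgrad z x)) + (LINT x|torus_measure. \<alpha> * (\<omega> x)\<^sup>2 * z x))"
    using eq_\<omega>[OF C1_sobolev[OF z dim]] scalar_terms[OF \<omega> z] by linarith
  then show ?thesis unfolding integral_continuous_add[OF continuous_scalar_terms[OF \<omega> z] c] .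
qed

lemma b_equation:
  assumes q: "q \<in> C1_torus"
  shows "l2_inner db q = - (LINT x|torus_measure. (v x \<bullet> cgrad b x) * q x + (b x / \<omega> x) * (cgrad b x \<bullet> cgrad q x)
      + (b x * \<omega> x - b x / \<omega> x * (norm (csym v x))\<^sup>2) * q x)"
proof -
  have c: "continuous_on UNIV (\<lambda>x. b x * \<omega> x * q x)" by (intro continuous_intros C1_torusD(4) \<omega> b q)
  have cq: "continuous_on UNIV q" by (rule C1_torusD(4)[OF q])
  have c2: "continuous_on UNIV (\<lambda>x. b x / \<omega> x * (norm (csym v x))\<^sup>2)"
    by (intro continuous_on_mult continuous_ratio continuous_on_power continuous_on_norm continuous_csym v)
  have "l2_inner (\<lambda>x. b x / \<omega> x * (norm (sym_grad v x))\<^sup>2) q = (LINT x|torus_measure. (b x / \<omega> x * (norm (csym v x))\<^sup>2) \<bullet> q x)"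
  proof (rule l2_inner_AE_eq[OF _ _ c2 cq])
    show "AE x in torus_measure. b x / \<omega> x * (norm (sym_grad v x))\<^sup>2 = b x / \<omega> x * (norm (csym v x))\<^sup>2"
      using sym_grad_AE[OF v] by eventually_elim simp
  qed simp
  moreover have "(LINT x|torus_measure. b x * \<omega> x * q x) - (LINT x|torus_measure. (b x / \<omega> x * (norm (csym v x))\<^sup>2) * q x) =
     (LINT x|torus_measure. b x * \<omega> x * q x - (b x / \<omega> x * (norm (csym v x))\<^sup>2) * q x)"
    by (intro Bochner_Integration.integral_diff[symmetric] integrable_continuous_torus c continuous_on_mult[OF c2 cq])
  ultimately have "l2_inner db q = - ((LINT x|torus_measure. (v x \<bullet> cgrad b x) * q x + (b x / \<omega> x) * (cgrad b x \<bullet> cgrad q x))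
      + (LINT x|torus_measure. b x * \<omega> x * q x - (b x / \<omega> x * (norm (csym v x))\<^sup>2) * q x))"
    using eq_b[OF C1_sobolev[OF q dim]] scalar_terms[OF b q] by (simp add: l2_inner_eq)
  then show ?thesis
    unfolding integral_continuous_add[OF continuous_scalar_terms[OF b q] continuous_on_diff[OF c continuous_on_mult[OF c2 cq]]]
    by (simp add: left_diff_distrib)
qed

text \<open>The square is the test function of the minimum principle. The cube over 3 has the square
  times \<open>- cgrad f x\<close> as its gradient and so provides a potential for the transport
  term.\<close>

lemma truncation_C1:
  assumes f: "f \<in> C1_torus"
  shows "(\<lambda>x. (max 0 (m - f x))\<^sup>2) \<in> C1_torus" "cgrad (\<lambda>x. (max 0 (m - f x))\<^sup>2) x = (- 2 * max 0 (m - f x)) *\<^sub>R cgrad f x"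
    "(\<lambda>x. (max 0 (m - f x))^3 / 3) \<in> C1_torus" "cgrad (\<lambda>x. (max 0 (m - f x))^3 / 3) x = (- (max 0 (m - f x))\<^sup>2) *\<^sub>R cgrad f x"
proof -
  \<comment> \<open>Exponents of at least 2 make the positive part differentiable at 0, where the
    difference quotient is at most a positive power of \<open>\<bar>y\<bar>\<close>.\<close>
  have power_deriv: "((\<lambda>r::real. (max 0 r) ^ Suc (Suc k)) has_real_derivative real (Suc (Suc k)) * (max 0 r) ^ Suc k) (at r)" for k r
  proof (cases "r = 0")
    case True
    have "((\<lambda>y. (max 0 y ^ Suc (Suc k) - 0) / (y - 0)) \<longlongrightarrow> 0) (at (0::real))"
    proof (rule Lim_null_comparison)
      show "\<forall>\<^sub>F y in at (0::real). norm ((max 0 y ^ Suc (Suc k) - 0) / (y - 0)) \<le> \<bar>y\<bar> ^ Suc k"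
      proof (rule always_eventually, rule allI)
        fix y :: real
        show "norm ((max 0 y ^ Suc (Suc k) - 0) / (y - 0)) \<le> \<bar>y\<bar> ^ Suc k" 
        proof (cases "y > 0")
          case False
          then have "(max 0 y ^ Suc (Suc k) - 0) / (y - 0) = 0" by simp
          then show ?thesis unfolding real_norm_def by (simp only: abs_zero) (rule zero_le_power, simp)
        qed simp
      qed
      show "((\<lambda>y. \<bar>y\<bar> ^ Suc k) \<longlongrightarrow> 0) (at (0::real))" by (auto intro!: tendsto_eq_intros)
    qed
    then show ?thesis using True by (simp add: has_field_derivative_iff)
  next
    case False
    show ?thesis
    proof (cases "r > 0")
      case True
      have "((\<lambda>y. y ^ Suc (Suc k)) has_real_derivative real (Suc (Suc k)) * (max 0 r) ^ Suc k) (at r)"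
        using DERIV_pow[of "Suc (Suc k)" r] True by simp
      then show ?thesis
        by (rule has_field_derivative_transform_within_open[where S="{0<..}"]) (use True in auto)
    next
      case False
      then have r: "r < 0" using \<open>r \<noteq> 0\<close> by simp
      have "((\<lambda>y. 0) has_real_derivative real (Suc (Suc k)) * (max 0 r) ^ Suc k) (at r)" using r by simp
      then show ?thesis
        by (rule has_field_derivative_transform_within_open[where S="{..<0}"]) (use r in auto)
    qed
  qed
  have g: "(\<lambda>x. m - f x) \<in> C1_torus" "classical_partial i (\<lambda>x. m - f x) = (\<lambda>x. - classical_partial i f x)" for i
    unfolding C1_diff(2)[OF C1_const(1) f] C1_const(2) by (rule C1_diff(1)[OF C1_const(1) f]) simp
  have d2: "((\<lambda>r::real. (max 0 r)\<^sup>2) has_real_derivative 2 * max 0 r) (at r)" for r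
    using power_deriv[of 0 r] by (simp add: numeral_2_eq_2)
  have d3: "((\<lambda>r::real. (max 0 r) ^ 3 / 3) has_real_derivative (max 0 r)\<^sup>2) (at r)" for r
    using DERIV_cdivide[OF power_deriv[of 1 r], of 3] by (simp add: numeral_3_eq_3 numeral_2_eq_2)
  have c2: "continuous_on UNIV (\<lambda>r::real. 2 * max 0 r)" and c3: "continuous_on UNIV (\<lambda>r::real. (max 0 r)\<^sup>2)"
    by (intro continuous_intros)+
  show "(\<lambda>x. (max 0 (m - f x))\<^sup>2) \<in> C1_torus" by (rule C1_compose(1)[OF g(1) d2 c2])
  show "(\<lambda>x. (max 0 (m - f x))^3 / 3) \<in> C1_torus" by (rule C1_compose(1)[OF g(1) d3 c3])
  show "cgrad (\<lambda>x. (max 0 (m - f x))\<^sup>2) x = (- 2 * max 0 (m - f x)) *\<^sub>R cgrad f x"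
    by (simp add: cgrad_def vec_eq_iff C1_compose(2)[OF g(1) d2 c2] g(2))
  show "cgrad (\<lambda>x. (max 0 (m - f x))^3 / 3) x = (- (max 0 (m - f x))\<^sup>2) *\<^sub>R cgrad f x"
    by (simp add: cgrad_def vec_eq_iff C1_compose(2)[OF g(1) d3 c3] g(2))
qed

text \<open>Transport drops out because \<open>(max 0 (m - f))^2 \<nabla>f\<close> is a gradient, and the diffusion term has a sign.\<close>

lemma truncation_bound:
  assumes f: "f \<in> C1_torus" and R: "continuous_on UNIV R" and b0: "\<And>x. b x \<ge> 0"
    and eq: "\<And>z. z \<in> C1_torus \<Longrightarrow> l2_inner df z = - (LINT x|torus_measure. (v x \<bullet> cgrad f x) * z x + (b x / \<omega> x) * (cgrad f x \<bullet> cgrad z x) + R x * z x)"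
    and le: "\<And>x. f x < m \<Longrightarrow> R x \<le> \<kappa>"
  shows "- l2_inner df (\<lambda>x. (max 0 (m - f x))\<^sup>2) \<le> \<kappa> * (LINT x|torus_measure. (max 0 (m - f x))\<^sup>2)"
proof -
  let ?z = "\<lambda>x. (max 0 (m - f x))\<^sup>2"
  note z = truncation_C1(1)[OF f, of m]
  have "- l2_inner df ?z = (LINT x|torus_measure. ((v x \<bullet> cgrad f x) * ?z x + (b x / \<omega> x) * (cgrad f x \<bullet> cgrad ?z x)) + R x * ?z x) 
      + (LINT x|torus_measure. v x \<bullet> cgrad (\<lambda>x. (max 0 (m - f x))^3 / 3) x)"
    using eq[OF z] transport_cgrad[OF v div truncation_C1(3)[OF f, of m]] by simp
  also have "\<dots> = (LINT x|torus_measure. (((v x \<bullet> cgrad f x) * ?z x + (b x / \<omega> x) * (cgrad f x \<bullet> cgrad ?z x)) + R x * ?z x) + v x \<bullet> cgrad (\<lambda>x. (max 0 (m - f x))^3 / 3) x)"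
    by (intro integral_continuous_add continuous_on_add[OF continuous_scalar_terms[OF f z]] continuous_on_mult R C1_torusD(4)[OF z]
        continuous_on_inner continuous_v continuous_cgrad truncation_C1(3)[OF f])
  also have "\<dots> \<le> (LINT x|torus_measure. \<kappa> * ?z x)"
  proof (rule integral_mono)
    show "integrable torus_measure (\<lambda>x. (((v x \<bullet> cgrad f x) * ?z x + (b x / \<omega> x) * (cgrad f x \<bullet> cgrad ?z x)) + R x * ?z x) + v x \<bullet> cgrad (\<lambda>x. (max 0 (m - f x))^3 / 3) x)"
      by (intro integrable_continuous_torus continuous_on_add[OF continuous_on_add[OF continuous_scalar_terms[OF f z]]] continuous_on_mult R C1_torusD(4)[OF z]
        continuous_on_inner continuous_v continuous_cgrad truncation_C1(3)[OF f])
    show "integrable torus_measure (\<lambda>x. \<kappa> * ?z x)"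
      by (intro integrable_continuous_torus continuous_on_mult continuous_on_const C1_torusD(4)[OF z])
    fix x
    have 1: "(b x / \<omega> x) * (cgrad f x \<bullet> cgrad ?z x) \<le> 0"
      unfolding truncation_C1(2)[OF f] inner_scaleR_right
    proof (rule mult_nonneg_nonpos)
      show "0 \<le> b x / \<omega> x" using b0[of x] \<omega>_pos[of x] by simp
      show "(- 2 * max 0 (m - f x)) * (cgrad f x \<bullet> cgrad f x) \<le> 0" by (rule mult_nonpos_nonneg) simp_all
    qed
    have 2: "R x * ?z x \<le> \<kappa> * ?z x"
    proof (cases "f x < m")
      case True
      then show ?thesis using le[OF True] by (intro mult_right_mono) auto
    next
      case False
      then show ?thesis by simp
    qed
    have 3: "(v x \<bullet> cgrad f x) * ?z x + v x \<bullet> cgrad (\<lambda>x. (max 0 (m - f x))^3 / 3) x = 0"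
      unfolding truncation_C1(4)[OF f] by simp
    show "(((v x \<bullet> cgrad f x) * ?z x + (b x / \<omega> x) * (cgrad f x \<bullet> cgrad ?z x)) + R x * ?z x) + v x \<bullet> cgrad (\<lambda>x. (max 0 (m - f x))^3 / 3) x \<le> \<kappa> * ?z x"
      using 1 2 3 by linarith
  qed
  also have "\<dots> = \<kappa> * (LINT x|torus_measure. ?z x)" by simp
  finally show ?thesis .
qed

end

section \<open>The energy inequality for two solutions at a fixed time\<close>

text \<open>The right side is the maximum of the left side over \<open>p\<close>.\<close>

lemma quadratic_absorb:
  fixes c a p :: real
  assumes "c > 0"
  shows "a * p - c * p\<^sup>2 \<le> a\<^sup>2 / (4 * c)"
proof -
  have "0 \<le> (2 * c * p - a)\<^sup>2" by simp
  then have "(a * p - c * p\<^sup>2) * (4 * c) \<le> a\<^sup>2" by (simp add: power2_eq_square algebra_simps)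
  then show ?thesis using assms by (simp add: pos_le_divide_eq)
qed

text \<open>Here n is the dimension, c and N are the lower and upper bounds of the viscosity, and A
  is the Lipschitz constant of b/\<omega>. In order, the summands come from: transport of the
  velocity, transport of \<omega> and b, the reaction term b \<omega>, the viscosity difference in
  the production term, the viscosity differences absorbed by dissipation, and the remaining part of
  the production term.\<close>

definition energy_const :: "real \<Rightarrow> real \<Rightarrow> real \<Rightarrow> real \<Rightarrow> real \<Rightarrow> real" where
  "energy_const n c A N M = n + 1 + M + 2 * A + 2 * A\<^sup>2 / c + 2 * N\<^sup>2 / c"

text \<open>The letters stand for pointwise sizes: x, y, z of the differences of v, \<omega>, b and
  p, g, k of the corresponding gradient differences. Terms linear in p, g, k are absorbed by the
  negative squares.\<close>

lemma energy_polynomial_bound: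
  fixes n c A N M L x y z p g k :: real
  assumes c: "c > 0" and nn: "n \<ge> 0" "A \<ge> 0" "N \<ge> 0" "M \<ge> 0" "L \<ge> 1" "x \<ge> 0" "y \<ge> 0" "z \<ge> 0" "p \<ge> 0" "g \<ge> 0" "k \<ge> 0"
  shows "n * L * x\<^sup>2 + A * (y + z) * L * p + L * x * y + A * (y + z) * L * g + L * x * z + A * (y + z) * L * k
     + M * y * z + A * (y + z) * L\<^sup>2 * z + 2 * N * L * z * p - c * p\<^sup>2 - c * g\<^sup>2 - c * k\<^sup>2 
     \<le> energy_const n c A N M * L\<^sup>2 * (x\<^sup>2 + y\<^sup>2 + z\<^sup>2)"
proof -
  have L: "L \<le> L\<^sup>2" "1 \<le> L\<^sup>2" using nn(5) by (auto simp: power2_eq_square intro: order_trans[of 1 L])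
  \<comment> \<open>The symmetric gradient occurs in two linear terms, in the viscosity difference
    and in the production term, so its dissipation is divided into halves.\<close>
  have p1: "(A * (y + z) * L) * p - (c / 2) * p\<^sup>2 \<le> (A * (y + z) * L)\<^sup>2 / (4 * (c / 2))" by (rule quadratic_absorb) (use c in simp)
  have p2: "(2 * N * L * z) * p - (c / 2) * p\<^sup>2 \<le> (2 * N * L * z)\<^sup>2 / (4 * (c / 2))" by (rule quadratic_absorb) (use c in simp)
  have p3: "(A * (y + z) * L) * g - c * g\<^sup>2 \<le> (A * (y + z) * L)\<^sup>2 / (4 * c)" by (rule quadratic_absorb[OF c])
  have p4: "(A * (y + z) * L) * k - c * k\<^sup>2 \<le> (A * (y + z) * L)\<^sup>2 / (4 * c)" by (rule quadratic_absorb[OF c])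
  \<comment> \<open>1/(2c) + 1/(4c) + 1/(4c) = 1/c.\<close>
  have q: "(A * (y + z) * L)\<^sup>2 / (4 * (c / 2)) + (A * (y + z) * L)\<^sup>2 / (4 * c) + (A * (y + z) * L)\<^sup>2 / (4 * c) = (A * (y + z) * L)\<^sup>2 / c"
    using c by (simp add: field_simps)
  have yz: "2 * (y * z) \<le> y\<^sup>2 + z\<^sup>2" "2 * (x * y) \<le> x\<^sup>2 + y\<^sup>2" "2 * (x * z) \<le> x\<^sup>2 + z\<^sup>2"
    using sum_squares_bound[of y z] sum_squares_bound[of x y] sum_squares_bound[of x z] by simp_all
  have x0: "0 \<le> x\<^sup>2" "0 \<le> y\<^sup>2" "0 \<le> z\<^sup>2" by simp_all
  have "(A * (y + z) * L)\<^sup>2 / c \<le> (2 * A\<^sup>2 / c) * L\<^sup>2 * (x\<^sup>2 + y\<^sup>2 + z\<^sup>2)"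
  proof -
    have "(y + z)\<^sup>2 \<le> 2 * (x\<^sup>2 + y\<^sup>2 + z\<^sup>2)" 
    proof -
      have "(y + z)\<^sup>2 = y\<^sup>2 + z\<^sup>2 + 2 * (y * z)" by (simp add: power2_eq_square algebra_simps)
      then show ?thesis using yz(1) x0 by argo
    qed
    then have "A\<^sup>2 / c * L\<^sup>2 * (y + z)\<^sup>2 \<le> A\<^sup>2 / c * L\<^sup>2 * (2 * (x\<^sup>2 + y\<^sup>2 + z\<^sup>2))" using c by (intro mult_left_mono) auto
    moreover have "(A * (y + z) * L)\<^sup>2 / c = A\<^sup>2 / c * L\<^sup>2 * (y + z)\<^sup>2" by (simp add: power_mult_distrib)
    moreover have "A\<^sup>2 / c * L\<^sup>2 * (2 * q) = (2 * A\<^sup>2 / c) * L\<^sup>2 * q" for q by simp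
    ultimately show ?thesis by (simp only:)
  qed
  moreover have "(2 * N * L * z)\<^sup>2 / (4 * (c / 2)) \<le> (2 * N\<^sup>2 / c) * L\<^sup>2 * (x\<^sup>2 + y\<^sup>2 + z\<^sup>2)"
  proof -
    have "2 * N\<^sup>2 / c * L\<^sup>2 * z\<^sup>2 \<le> 2 * N\<^sup>2 / c * L\<^sup>2 * (x\<^sup>2 + y\<^sup>2 + z\<^sup>2)" using c by (intro mult_left_mono) auto
    then show ?thesis by (simp add: power_mult_distrib mult_ac)
  qed
  moreover have "n * L * x\<^sup>2 \<le> n * L\<^sup>2 * (x\<^sup>2 + y\<^sup>2 + z\<^sup>2)"
    using nn L by (intro mult_mono) auto
  moreover have "L * x * y + L * x * z \<le> 1 * L\<^sup>2 * (x\<^sup>2 + y\<^sup>2 + z\<^sup>2)"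
  proof -
    have "x * y + x * z \<le> x\<^sup>2 + y\<^sup>2 + z\<^sup>2" using yz x0 by linarith
    then have "L * (x * y + x * z) \<le> L\<^sup>2 * (x\<^sup>2 + y\<^sup>2 + z\<^sup>2)" using nn L by (intro mult_mono) auto
    then show ?thesis by (simp add: distrib_left mult.assoc)
  qed
  moreover have "M * y * z \<le> M * L\<^sup>2 * (x\<^sup>2 + y\<^sup>2 + z\<^sup>2)"
  proof -
    have "y * z \<le> x\<^sup>2 + y\<^sup>2 + z\<^sup>2" using yz x0 by linarith
    then have "1 * (y * z) \<le> L\<^sup>2 * (x\<^sup>2 + y\<^sup>2 + z\<^sup>2)" using nn L by (intro mult_mono) auto
    then have "M * (1 * (y * z)) \<le> M * (L\<^sup>2 * (x\<^sup>2 + y\<^sup>2 + z\<^sup>2))" by (rule mult_left_mono) (rule nn)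
    then show ?thesis by (simp add: mult.assoc)
  qed
  moreover have "A * (y + z) * L\<^sup>2 * z \<le> 2 * A * L\<^sup>2 * (x\<^sup>2 + y\<^sup>2 + z\<^sup>2)"
  proof -
    have "(y + z) * z \<le> 2 * (x\<^sup>2 + y\<^sup>2 + z\<^sup>2)" 
    proof -
      have "(y + z) * z = y * z + z\<^sup>2" by (simp add: power2_eq_square algebra_simps)
      then show ?thesis using yz(1) x0 by argo
    qed
    then have "A * L\<^sup>2 * ((y + z) * z) \<le> A * L\<^sup>2 * (2 * (x\<^sup>2 + y\<^sup>2 + z\<^sup>2))" using nn by (intro mult_left_mono) auto
    moreover have "A * (y + z) * L\<^sup>2 * z = A * L\<^sup>2 * ((y + z) * z)" by (simp only: mult_ac)
    moreover have "A * L\<^sup>2 * (2 * q) = 2 * A * L\<^sup>2 * q" for q by simp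
    ultimately show ?thesis by (simp only:)
  qed
  moreover have "energy_const n c A N M * L\<^sup>2 * (x\<^sup>2 + y\<^sup>2 + z\<^sup>2) = n * L\<^sup>2 * (x\<^sup>2 + y\<^sup>2 + z\<^sup>2) + 1 * L\<^sup>2 * (x\<^sup>2 + y\<^sup>2 + z\<^sup>2) + M * L\<^sup>2 * (x\<^sup>2 + y\<^sup>2 + z\<^sup>2)
     + 2 * A * L\<^sup>2 * (x\<^sup>2 + y\<^sup>2 + z\<^sup>2) + (2 * A\<^sup>2 / c) * L\<^sup>2 * (x\<^sup>2 + y\<^sup>2 + z\<^sup>2) + (2 * N\<^sup>2 / c) * L\<^sup>2 * (x\<^sup>2 + y\<^sup>2 + z\<^sup>2)"
    unfolding energy_const_def by (simp only: distrib_right)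
  ultimately show ?thesis using p1 p2 p3 p4 q by linarith
qed

text \<open>At one point, G, D, g, k stand for the gradients of the velocity components, the
  symmetric gradient, and the gradients of \<omega> and b. The last summands on the left integrate
  to zero; they turn each transport difference into transport of the first solution by the
  difference V. Viscous terms are split as \<nu>1 (X1 - X2) + (\<nu>1 - \<nu>2) X2.\<close>

lemma pointwise_energy_bound:
  fixes u1 u2 :: "real^'n" and G1 G2 :: "'n \<Rightarrow> real^'n" and D1 D2 :: "'c::real_inner" and g1 g2 k1 k2 :: "real^'n"
    and \<omega>1 \<omega>2 b1 b2 \<alpha> m M L :: real
  assumes \<alpha>: "\<alpha> > 0" and m: "0 < m" and \<omega>: "m \<le> \<omega>1" "\<omega>1 \<le> M" "m \<le> \<omega>2" "\<omega>2 \<le> M" and b: "m \<le> b1" "b1 \<le> M" "m \<le> b2" "b2 \<le> M"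
    and L: "L \<ge> 1" and G: "\<And>i. norm (G1 i) \<le> L" and D: "norm D1 \<le> L" "norm D2 \<le> L"
    and g: "norm g1 \<le> L" "norm g2 \<le> L" and k: "norm k1 \<le> L" "norm k2 \<le> L"
  defines "V \<equiv> u1 - u2" and "W \<equiv> \<omega>1 - \<omega>2" and "B \<equiv> b1 - b2" and "\<nu>1 \<equiv> b1 / \<omega>1" and "\<nu>2 \<equiv> b2 / \<omega>2"
  shows "- (((\<Sum>i\<in>UNIV. (u1 \<bullet> G1 i) * V $ i) + \<nu>1 * (D1 \<bullet> (D1 - D2))) - ((\<Sum>i\<in>UNIV. (u2 \<bullet> G2 i) * V $ i) + \<nu>2 * (D2 \<bullet> (D1 - D2))))
    - (((u1 \<bullet> g1) * W + \<nu>1 * (g1 \<bullet> (g1 - g2)) + \<alpha> * \<omega>1\<^sup>2 * W) - ((u2 \<bullet> g2) * W + \<nu>2 * (g2 \<bullet> (g1 - g2)) + \<alpha> * \<omega>2\<^sup>2 * W))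
    - (((u1 \<bullet> k1) * B + \<nu>1 * (k1 \<bullet> (k1 - k2)) + (b1 * \<omega>1 - \<nu>1 * (norm D1)\<^sup>2) * B) - ((u2 \<bullet> k2) * B + \<nu>2 * (k2 \<bullet> (k1 - k2)) + (b2 * \<omega>2 - \<nu>2 * (norm D2)\<^sup>2) * B))
    + ((\<Sum>i\<in>UNIV. (u2 \<bullet> (G1 i - G2 i)) * V $ i) + (u2 \<bullet> (g1 - g2)) * W + (u2 \<bullet> (k1 - k2)) * B)
    \<le> energy_const (real CARD('n)) (m / M) (M / m\<^sup>2) (M / m) M * L\<^sup>2 * ((norm V)\<^sup>2 + W\<^sup>2 + B\<^sup>2)"
proof -
  define x where "x = norm V" define y where "y = \<bar>W\<bar>" define z where "z = \<bar>B\<bar>"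
  define p where "p = norm (D1 - D2)" define g' where "g' = norm (g1 - g2)" define k' where "k' = norm (k1 - k2)"
  define A where "A = M / m\<^sup>2"
  have nn: "0 \<le> x" "0 \<le> y" "0 \<le> z" "0 \<le> p" "0 \<le> g'" "0 \<le> k'" by (simp_all add: x_def y_def z_def p_def g'_def k'_def)
  have M: "M > 0" using m \<omega> by linarith
  have pos: "\<omega>1 > 0" "\<omega>2 > 0" "b1 > 0" "b2 > 0" using m \<omega> b by linarith+
  have A0: "0 \<le> A" using M by (simp add: A_def)
  have \<nu>1: "m / M \<le> \<nu>1" unfolding \<nu>1_def using m M \<omega> b pos by (intro frac_le) auto
  have \<nu>2: "\<nu>2 \<le> M / m" "0 \<le> \<nu>2" unfolding \<nu>2_def using m M \<omega> b pos by (auto intro!: frac_le)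
  \<comment> \<open>The difference of the two quotients is (B \<omega>2 - b2 W) / (\<omega>1
    \<omega>2), whence the constant A = M / m^2.\<close>
  have d\<nu>: "\<bar>\<nu>1 - \<nu>2\<bar> \<le> A * (y + z)"
  proof -
    have "\<nu>1 - \<nu>2 = (B * \<omega>2 - b2 * W) / (\<omega>1 * \<omega>2)"
      unfolding \<nu>1_def \<nu>2_def B_def W_def using pos by (simp add: field_simps)
    then have "\<bar>\<nu>1 - \<nu>2\<bar> = \<bar>B * \<omega>2 - b2 * W\<bar> / (\<omega>1 * \<omega>2)" using pos by (simp add: abs_divide abs_mult)
    also have "\<dots> \<le> (M * (y + z)) / m\<^sup>2"
    proof (rule frac_le)
      have "\<bar>B * \<omega>2 - b2 * W\<bar> \<le> \<bar>B * \<omega>2\<bar> + \<bar>b2 * W\<bar>" by (rule abs_triangle_ineq4)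
      also have "\<dots> = z * \<omega>2 + b2 * y" using pos by (simp add: abs_mult y_def z_def)
      also have "\<dots> \<le> z * M + M * y" using \<omega> b nn by (intro add_mono mult_left_mono mult_right_mono) auto
      finally show "\<bar>B * \<omega>2 - b2 * W\<bar> \<le> M * (y + z)" by (simp add: algebra_simps)
      show "m\<^sup>2 \<le> \<omega>1 * \<omega>2" unfolding power2_eq_square using m \<omega> by (intro mult_mono) auto
    qed (use m M nn in auto)
    finally show ?thesis by (simp add: A_def)
  qed
  have cs: "- (\<nu>1 - \<nu>2) * (X \<bullet> Y) \<le> A * (y + z) * L * norm Y" if "norm X \<le> L" for X Y :: "'d::real_inner"
  proof -
    have "- (\<nu>1 - \<nu>2) * (X \<bullet> Y) \<le> \<bar>\<nu>1 - \<nu>2\<bar> * \<bar>X \<bullet> Y\<bar>" by (metis abs_ge_self abs_minus_cancel abs_mult)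
    also have "\<dots> \<le> (A * (y + z)) * (L * norm Y)"
    proof (rule mult_mono[OF d\<nu>])
      have "\<bar>X \<bullet> Y\<bar> \<le> norm X * norm Y" by (rule Cauchy_Schwarz_ineq2)
      also have "\<dots> \<le> L * norm Y" using that by (rule mult_right_mono) simp
      finally show "\<bar>X \<bullet> Y\<bar> \<le> L * norm Y" .
    qed (use A0 nn in auto)
    finally show ?thesis by (simp add: mult.assoc)
  qed
  have c2: "- (V \<bullet> X) * s \<le> L * x * \<bar>s\<bar>" if "norm X \<le> L" for X s
  proof -
    have "- (V \<bullet> X) * s \<le> \<bar>V \<bullet> X\<bar> * \<bar>s\<bar>" by (metis abs_ge_self abs_minus_cancel abs_mult)
    also have "\<dots> \<le> (x * L) * \<bar>s\<bar>"
    proof (rule mult_right_mono)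
      have "\<bar>V \<bullet> X\<bar> \<le> norm V * norm X" by (rule Cauchy_Schwarz_ineq2)
      also have "\<dots> \<le> x * L" unfolding x_def using that by (intro mult_left_mono) auto
      finally show "\<bar>V \<bullet> X\<bar> \<le> x * L" .
    qed simp
    finally show ?thesis by (simp add: mult_ac)
  qed
  have s: "- \<nu>1 * (X \<bullet> X) \<le> - (m / M) * (norm X)\<^sup>2" for X :: "'d::real_inner"
    using mult_right_mono[OF \<nu>1, of "(norm X)\<^sup>2"] by (simp add: power2_norm_eq_inner)
  have t1: "(\<Sum>i\<in>UNIV. - (V \<bullet> G1 i) * V $ i) \<le> real CARD('n) * L * x\<^sup>2"
  proof -
    have "(\<Sum>i\<in>UNIV. - (V \<bullet> G1 i) * V $ i) \<le> (\<Sum>i\<in>(UNIV::'n set). L * x * x)"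
    proof (rule sum_mono)
      fix i
      have "- (V \<bullet> G1 i) * V $ i \<le> L * x * \<bar>V $ i\<bar>" by (rule c2[OF G])
      also have "\<dots> \<le> L * x * x" unfolding x_def using L component_le_norm_cart[of V i] by (intro mult_left_mono) auto
      finally show "- (V \<bullet> G1 i) * V $ i \<le> L * x * x" .
    qed
    then show ?thesis by (simp add: power2_eq_square mult_ac)
  qed
  have t2: "- \<nu>1 * ((D1 - D2) \<bullet> (D1 - D2)) \<le> - (m / M) * p\<^sup>2" unfolding p_def by (rule s)
  have t3: "- (\<nu>1 - \<nu>2) * (D2 \<bullet> (D1 - D2)) \<le> A * (y + z) * L * p" unfolding p_def by (rule cs[OF D(2)])
  have t4: "- (V \<bullet> g1) * W \<le> L * x * y" unfolding y_def by (rule c2[OF g(1)])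
  have t5: "- \<nu>1 * ((g1 - g2) \<bullet> (g1 - g2)) \<le> - (m / M) * g'\<^sup>2" unfolding g'_def by (rule s)
  have t6: "- (\<nu>1 - \<nu>2) * (g2 \<bullet> (g1 - g2)) \<le> A * (y + z) * L * g'" unfolding g'_def by (rule cs[OF g(2)])
  \<comment> \<open>The square is increasing on positive values, so the damping of \<omega> has a
    favourable sign.\<close>
  have t7: "- \<alpha> * (\<omega>1\<^sup>2 - \<omega>2\<^sup>2) * W \<le> 0"
  proof -
    have "0 \<le> \<alpha> * (\<omega>1 + \<omega>2) * W\<^sup>2" using \<alpha> pos by simp
    then show ?thesis by (simp add: W_def power2_eq_square algebra_simps)
  qed
  have t8: "- (V \<bullet> k1) * B \<le> L * x * z" unfolding z_def by (rule c2[OF k(1)])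
  have t9: "- \<nu>1 * ((k1 - k2) \<bullet> (k1 - k2)) \<le> - (m / M) * k'\<^sup>2" unfolding k'_def by (rule s)
  have t10: "- (\<nu>1 - \<nu>2) * (k2 \<bullet> (k1 - k2)) \<le> A * (y + z) * L * k'" unfolding k'_def by (rule cs[OF k(2)])
  \<comment> \<open>b1 \<omega>1 - b2 \<omega>2 = \<omega>1 B + b2 W: the first part gives a term of
    good sign, the second is a product of two differences.\<close>
  have t11: "- (b1 * \<omega>1 - b2 * \<omega>2) * B \<le> M * y * z"
  proof -
    have "- (b1 * \<omega>1 - b2 * \<omega>2) * B = - \<omega>1 * B\<^sup>2 + b2 * (- W * B)"
      by (simp add: W_def B_def power2_eq_square algebra_simps)
    also have "\<dots> \<le> 0 + M * (y * z)"
    proof (rule add_mono)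
      show "- \<omega>1 * B\<^sup>2 \<le> 0" using pos by simp
      have "b2 * (- W * B) \<le> b2 * (y * z)" unfolding y_def z_def using pos
        by (intro mult_left_mono) (metis abs_ge_self abs_minus_cancel abs_mult, simp)
      also have "\<dots> \<le> M * (y * z)" using b nn by (intro mult_right_mono) auto
      finally show "b2 * (- W * B) \<le> M * (y * z)" .
    qed
    finally show ?thesis by simp
  qed
  have t12: "(\<nu>1 - \<nu>2) * (norm D1)\<^sup>2 * B \<le> A * (y + z) * L\<^sup>2 * z"
  proof -
    have "(\<nu>1 - \<nu>2) * (norm D1)\<^sup>2 * B \<le> \<bar>\<nu>1 - \<nu>2\<bar> * (norm D1)\<^sup>2 * z"
      unfolding z_def by (rule order_trans[OF abs_ge_self]) (simp add: abs_mult)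
    also have "\<dots> \<le> (A * (y + z)) * L\<^sup>2 * z"
      using d\<nu> D(1) nn A0 by (intro mult_mono power_mono mult_nonneg_nonneg) auto
    finally show ?thesis .
  qed
  have t13: "\<nu>2 * ((D1 - D2) \<bullet> (D1 + D2)) * B \<le> 2 * (M / m) * L * z * p"
  proof -
    have "\<nu>2 * ((D1 - D2) \<bullet> (D1 + D2)) * B \<le> \<nu>2 * \<bar>(D1 - D2) \<bullet> (D1 + D2)\<bar> * z"
      unfolding z_def by (rule order_trans[OF abs_ge_self]) (simp add: abs_mult \<nu>2)
    also have "\<dots> \<le> (M / m) * (p * (2 * L)) * z"
    proof (intro mult_mono \<nu>2 order_refl)
      have "\<bar>(D1 - D2) \<bullet> (D1 + D2)\<bar> \<le> p * norm (D1 + D2)" unfolding p_def by (rule Cauchy_Schwarz_ineq2)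
      also have "\<dots> \<le> p * (2 * L)" using norm_triangle_ineq[of D1 D2] D nn by (intro mult_left_mono) auto
      finally show "\<bar>(D1 - D2) \<bullet> (D1 + D2)\<bar> \<le> p * (2 * L)" .
    qed (use nn m M L in auto)
    finally show ?thesis by (simp add: mult_ac)
  qed
  have bound: "real CARD('n) * L * x\<^sup>2 + A * (y + z) * L * p + L * x * y + A * (y + z) * L * g' + L * x * z + A * (y + z) * L * k'
     + M * y * z + A * (y + z) * L\<^sup>2 * z + 2 * (M / m) * L * z * p - (m / M) * p\<^sup>2 - (m / M) * g'\<^sup>2 - (m / M) * k'\<^sup>2 
     \<le> energy_const (real CARD('n)) (m / M) A (M / m) M * L\<^sup>2 * (x\<^sup>2 + y\<^sup>2 + z\<^sup>2)"
    by (rule energy_polynomial_bound) (use m M A0 L nn in auto)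
  have S: "(\<Sum>i\<in>UNIV. (u2 \<bullet> (G1 i - G2 i)) * V $ i) - ((\<Sum>i\<in>UNIV. (u1 \<bullet> G1 i) * V $ i) - (\<Sum>i\<in>UNIV. (u2 \<bullet> G2 i) * V $ i)) = (\<Sum>i\<in>UNIV. - (V \<bullet> G1 i) * V $ i)"
    by (simp add: sum_subtractf[symmetric] V_def inner_diff_left inner_diff_right algebra_simps)
  \<comment> \<open>The difference of squares exposes the factor \<open>D1 - D2\<close>, which the
    dissipation can absorb.\<close>
  have Dn: "\<nu>1 * (norm D1)\<^sup>2 - \<nu>2 * (norm D2)\<^sup>2 = (\<nu>1 - \<nu>2) * (norm D1)\<^sup>2 + \<nu>2 * ((D1 - D2) \<bullet> (D1 + D2))"
    by (simp add: power2_norm_eq_inner inner_diff_left inner_add_right inner_commute algebra_simps)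
  have Dd: "\<nu>1 * (X1 \<bullet> (X1 - X2)) - \<nu>2 * (X2 \<bullet> (X1 - X2)) = \<nu>1 * ((X1 - X2) \<bullet> (X1 - X2)) + (\<nu>1 - \<nu>2) * (X2 \<bullet> (X1 - X2))" for X1 X2 :: "'d::real_inner"
    by (simp add: inner_diff_left algebra_simps)
  have Tr: "(u1 \<bullet> X1) - (u2 \<bullet> X2) - u2 \<bullet> (X1 - X2) = V \<bullet> X1" for X1 X2
    by (simp add: V_def inner_diff_left inner_diff_right)
  \<comment> \<open>An algebraic regrouping of the left side into exactly the thirteen quantities
    estimated above.\<close>
  have "?thesis \<longleftrightarrow> (\<Sum>i\<in>UNIV. - (V \<bullet> G1 i) * V $ i) - \<nu>1 * ((D1 - D2) \<bullet> (D1 - D2)) - (\<nu>1 - \<nu>2) * (D2 \<bullet> (D1 - D2))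
     - (V \<bullet> g1) * W - \<nu>1 * ((g1 - g2) \<bullet> (g1 - g2)) - (\<nu>1 - \<nu>2) * (g2 \<bullet> (g1 - g2)) - \<alpha> * (\<omega>1\<^sup>2 - \<omega>2\<^sup>2) * W
     - (V \<bullet> k1) * B - \<nu>1 * ((k1 - k2) \<bullet> (k1 - k2)) - (\<nu>1 - \<nu>2) * (k2 \<bullet> (k1 - k2)) - (b1 * \<omega>1 - b2 * \<omega>2) * B
     + (\<nu>1 - \<nu>2) * (norm D1)\<^sup>2 * B + \<nu>2 * ((D1 - D2) \<bullet> (D1 + D2)) * B
     \<le> energy_const (real CARD('n)) (m / M) (M / m\<^sup>2) (M / m) M * L\<^sup>2 * ((norm V)\<^sup>2 + W\<^sup>2 + B\<^sup>2)"
  proof (rule arg_cong[where f="\<lambda>t. t \<le> _"])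
    have e1: "(u1 \<bullet> g1) * W - (u2 \<bullet> g2) * W - (u2 \<bullet> (g1 - g2)) * W = (V \<bullet> g1) * W"
      using arg_cong[OF Tr[of g1 g2], of "\<lambda>t. t * W"] by (simp only: left_diff_distrib)
    have e2: "(u1 \<bullet> k1) * B - (u2 \<bullet> k2) * B - (u2 \<bullet> (k1 - k2)) * B = (V \<bullet> k1) * B"
      using arg_cong[OF Tr[of k1 k2], of "\<lambda>t. t * B"] by (simp only: left_diff_distrib)
    have e3: "\<nu>1 * (norm D1)\<^sup>2 * B - \<nu>2 * (norm D2)\<^sup>2 * B = (\<nu>1 - \<nu>2) * (norm D1)\<^sup>2 * B + \<nu>2 * ((D1 - D2) \<bullet> (D1 + D2)) * B"
      using arg_cong[OF Dn, of "\<lambda>t. t * B"] by (simp only: left_diff_distrib distrib_right)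
    have e4: "\<alpha> * (\<omega>1\<^sup>2 - \<omega>2\<^sup>2) * W = \<alpha> * \<omega>1\<^sup>2 * W - \<alpha> * \<omega>2\<^sup>2 * W" by (simp add: algebra_simps)
    have e5: "(b1 * \<omega>1 - b2 * \<omega>2) * B = b1 * \<omega>1 * B - b2 * \<omega>2 * B" "(b1 * \<omega>1 - \<nu>1 * (norm D1)\<^sup>2) * B = b1 * \<omega>1 * B - \<nu>1 * (norm D1)\<^sup>2 * B"
      "(b2 * \<omega>2 - \<nu>2 * (norm D2)\<^sup>2) * B = b2 * \<omega>2 * B - \<nu>2 * (norm D2)\<^sup>2 * B" by (simp_all add: left_diff_distrib)
    show "- (((\<Sum>i\<in>UNIV. (u1 \<bullet> G1 i) * V $ i) + \<nu>1 * (D1 \<bullet> (D1 - D2))) - ((\<Sum>i\<in>UNIV. (u2 \<bullet> G2 i) * V $ i) + \<nu>2 * (D2 \<bullet> (D1 - D2))))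
      - (((u1 \<bullet> g1) * W + \<nu>1 * (g1 \<bullet> (g1 - g2)) + \<alpha> * \<omega>1\<^sup>2 * W) - ((u2 \<bullet> g2) * W + \<nu>2 * (g2 \<bullet> (g1 - g2)) + \<alpha> * \<omega>2\<^sup>2 * W))
      - (((u1 \<bullet> k1) * B + \<nu>1 * (k1 \<bullet> (k1 - k2)) + (b1 * \<omega>1 - \<nu>1 * (norm D1)\<^sup>2) * B) - ((u2 \<bullet> k2) * B + \<nu>2 * (k2 \<bullet> (k1 - k2)) + (b2 * \<omega>2 - \<nu>2 * (norm D2)\<^sup>2) * B))
      + ((\<Sum>i\<in>UNIV. (u2 \<bullet> (G1 i - G2 i)) * V $ i) + (u2 \<bullet> (g1 - g2)) * W + (u2 \<bullet> (k1 - k2)) * B) = 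
     (\<Sum>i\<in>UNIV. - (V \<bullet> G1 i) * V $ i) - \<nu>1 * ((D1 - D2) \<bullet> (D1 - D2)) - (\<nu>1 - \<nu>2) * (D2 \<bullet> (D1 - D2))
     - (V \<bullet> g1) * W - \<nu>1 * ((g1 - g2) \<bullet> (g1 - g2)) - (\<nu>1 - \<nu>2) * (g2 \<bullet> (g1 - g2)) - \<alpha> * (\<omega>1\<^sup>2 - \<omega>2\<^sup>2) * W
     - (V \<bullet> k1) * B - \<nu>1 * ((k1 - k2) \<bullet> (k1 - k2)) - (\<nu>1 - \<nu>2) * (k2 \<bullet> (k1 - k2)) - (b1 * \<omega>1 - b2 * \<omega>2) * B
     + (\<nu>1 - \<nu>2) * (norm D1)\<^sup>2 * B + \<nu>2 * ((D1 - D2) \<bullet> (D1 + D2)) * B"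
      using S Dd[of D1 D2] Dd[of g1 g2] Dd[of k1 k2] e1 e2 e3 unfolding e4 e5 by linarith
  qed
  moreover have "x\<^sup>2 + y\<^sup>2 + z\<^sup>2 = (norm V)\<^sup>2 + W\<^sup>2 + B\<^sup>2" by (simp add: x_def y_def z_def)
  ultimately show ?thesis
    using t1 t2 t3 t4 t5 t6 t7 t8 t9 t10 t11 t12 t13 bound unfolding A_def by (simp only: mult_minus_left)
qed

lemma cgrad_diff:
  "f \<in> C1_torus \<Longrightarrow> g \<in> C1_torus \<Longrightarrow> cgrad (\<lambda>x. f x - g x) x = cgrad f x - cgrad g x"
  by (simp add: cgrad_def vec_eq_iff C1_diff(2))

lemma csym_diff:
  assumes "\<And>i. (\<lambda>x. v x $ i) \<in> C1_torus" "\<And>i. (\<lambda>x. w x $ i) \<in> C1_torus"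
  shows "csym (\<lambda>x. v x - w x) x = csym v x - csym w x"
  by (simp add: csym_def vec_eq_iff C1_diff(2)[OF assms] field_simps)

text \<open>The integrand is half the transport of \<open>f^2\<close>.\<close>

lemma transport_self:
  assumes "\<And>i. (\<lambda>x. v x $ i) \<in> C1_torus" "div_free v" "f \<in> C1_torus"
  shows "(LINT x|torus_measure. (v x \<bullet> cgrad f x) * f x) = 0"
proof -
  have "cgrad (\<lambda>x. f x * f x) x = (2 * f x) *\<^sub>R cgrad f x" for x
    by (simp add: cgrad_def vec_eq_iff C1_mult(2)[OF assms(3,3)])
  then have "(LINT x|torus_measure. 2 * ((v x \<bullet> cgrad f x) * f x)) = 0"
    using transport_cgrad[OF assms(1,2) C1_mult(1)[OF assms(3,3)]] by (simp add: mult_ac)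
  then show ?thesis by simp
qed

text \<open>Both systems are tested with the differences of the unknowns; the velocity difference is
  C1 and divergence-free, hence admissible. The estimate is then pointwise under one
  integral.\<close>

lemma energy_inequality:
  fixes v1 v2 dv1 dv2 :: "real^'n \<Rightarrow> real^'n" and \<omega>1 \<omega>2 b1 b2 d\<omega>1 d\<omega>2 db1 db2 :: "real^'n \<Rightarrow> real"
  assumes S1: "slice \<alpha> v1 dv1 \<omega>1 d\<omega>1 b1 db1" and S2: "slice \<alpha> v2 dv2 \<omega>2 d\<omega>2 b2 db2"
    and \<alpha>: "\<alpha> > 0" and m: "0 < m" and M: "\<And>x. m \<le> \<omega>1 x \<and> \<omega>1 x \<le> M \<and> m \<le> \<omega>2 x \<and> \<omega>2 x \<le> M \<and> m \<le> b1 x \<and> b1 x \<le> M \<and> m \<le> b2 x \<and> b2 x \<le> M"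
    and L: "L \<ge> 1" "\<And>i x. norm (cgrad (\<lambda>y. v1 y $ i) x) \<le> L" "\<And>x. norm (csym v1 x) \<le> L" "\<And>x. norm (csym v2 x) \<le> L"
      "\<And>x. norm (cgrad \<omega>1 x) \<le> L" "\<And>x. norm (cgrad \<omega>2 x) \<le> L" "\<And>x. norm (cgrad b1 x) \<le> L" "\<And>x. norm (cgrad b2 x) \<le> L"
    and dL: "\<And>i. (\<lambda>x. dv1 x $ i) \<in> L2_torus" "\<And>i. (\<lambda>x. dv2 x $ i) \<in> L2_torus" "d\<omega>1 \<in> L2_torus" "d\<omega>2 \<in> L2_torus" "db1 \<in> L2_torus" "db2 \<in> L2_torus"
  shows "(\<Sum>i\<in>UNIV. l2_inner (\<lambda>x. dv1 x $ i - dv2 x $ i) (\<lambda>x. v1 x $ i - v2 x $ i)) + l2_inner (\<lambda>x. d\<omega>1 x - d\<omega>2 x) (\<lambda>x. \<omega>1 x - \<omega>2 x)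
      + l2_inner (\<lambda>x. db1 x - db2 x) (\<lambda>x. b1 x - b2 x)
     \<le> energy_const (real CARD('n)) (m / M) (M / m\<^sup>2) (M / m) M * L\<^sup>2 * 
        ((\<Sum>i\<in>UNIV. l2_inner (\<lambda>x. v1 x $ i - v2 x $ i) (\<lambda>x. v1 x $ i - v2 x $ i)) + l2_inner (\<lambda>x. \<omega>1 x - \<omega>2 x) (\<lambda>x. \<omega>1 x - \<omega>2 x)
          + l2_inner (\<lambda>x. b1 x - b2 x) (\<lambda>x. b1 x - b2 x))"
proof -
  interpret S1: slice \<alpha> v1 dv1 \<omega>1 d\<omega>1 b1 db1 by (rule S1)
  interpret S2: slice \<alpha> v2 dv2 \<omega>2 d\<omega>2 b2 db2 by (rule S2)
  let ?V = "\<lambda>x. v1 x - v2 x" and ?W = "\<lambda>x. \<omega>1 x - \<omega>2 x" and ?B = "\<lambda>x. b1 x - b2 x"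
  let ?K = "energy_const (real CARD('n)) (m / M) (M / m\<^sup>2) (M / m) M * L\<^sup>2"
  have VC: "(\<lambda>x. ?V x $ i) \<in> C1_torus" for i using C1_diff(1)[OF S1.v S2.v] by simp
  have VC': "(\<lambda>x. v1 x $ i - v2 x $ i) \<in> C1_torus" for i by (rule C1_diff(1)[OF S1.v S2.v])
  have WC: "?W \<in> C1_torus" by (rule C1_diff(1)[OF S1.\<omega> S2.\<omega>])
  have BC: "?B \<in> C1_torus" by (rule C1_diff(1)[OF S1.b S2.b])
  have Vdiv: "div_free ?V" by (rule div_free_diff[OF C1_L2[OF S1.v] C1_L2[OF S2.v] S1.div S2.div])
  have Vc: "continuous_on UNIV ?V" by (intro continuous_on_diff S1.continuous_v S2.continuous_v)
  define Pv1 where "Pv1 x = (\<Sum>i\<in>UNIV. (v1 x \<bullet> cgrad (\<lambda>y. v1 y $ i) x) * ?V x $ i) + (b1 x / \<omega>1 x) * (csym v1 x \<bullet> csym ?V x)" for x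
  define Pv2 where "Pv2 x = (\<Sum>i\<in>UNIV. (v2 x \<bullet> cgrad (\<lambda>y. v2 y $ i) x) * ?V x $ i) + (b2 x / \<omega>2 x) * (csym v2 x \<bullet> csym ?V x)" for x
  define Pw1 where "Pw1 x = (v1 x \<bullet> cgrad \<omega>1 x) * ?W x + (b1 x / \<omega>1 x) * (cgrad \<omega>1 x \<bullet> cgrad ?W x) + \<alpha> * (\<omega>1 x)\<^sup>2 * ?W x" for x
  define Pw2 where "Pw2 x = (v2 x \<bullet> cgrad \<omega>2 x) * ?W x + (b2 x / \<omega>2 x) * (cgrad \<omega>2 x \<bullet> cgrad ?W x) + \<alpha> * (\<omega>2 x)\<^sup>2 * ?W x" for x
  define Pb1 where "Pb1 x = (v1 x \<bullet> cgrad b1 x) * ?B x + (b1 x / \<omega>1 x) * (cgrad b1 x \<bullet> cgrad ?B x) + (b1 x * \<omega>1 x - b1 x / \<omega>1 x * (norm (csym v1 x))\<^sup>2) * ?B x" for x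
  define Pb2 where "Pb2 x = (v2 x \<bullet> cgrad b2 x) * ?B x + (b2 x / \<omega>2 x) * (cgrad b2 x \<bullet> cgrad ?B x) + (b2 x * \<omega>2 x - b2 x / \<omega>2 x * (norm (csym v2 x))\<^sup>2) * ?B x" for x
  \<comment> \<open>Transport of the differences by the second velocity. Its integral is zero by
    \<open>transport_self\<close>, and adding it removes the gradients of the differences from the
    convective terms, which would otherwise carry the factor \<open>v2\<close>.\<close>
  define R where "R x = (\<Sum>i\<in>UNIV. (v2 x \<bullet> cgrad (\<lambda>y. ?V y $ i) x) * ?V x $ i) + (v2 x \<bullet> cgrad ?W x) * ?W x + (v2 x \<bullet> cgrad ?B x) * ?B x" for x
  define E where "E x = (norm (?V x))\<^sup>2 + (?W x)\<^sup>2 + (?B x)\<^sup>2" for x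
  note cc = continuous_on_sum continuous_on_mult continuous_on_add continuous_on_diff continuous_on_inner continuous_on_power continuous_on_norm
    S1.continuous_v S2.continuous_v continuous_cgrad continuous_csym S1.continuous_ratio S2.continuous_ratio continuous_on_const
    S1.v S2.v VC VC' WC BC S1.\<omega> S2.\<omega> S1.b S2.b C1_torusD(4)[OF VC] C1_torusD(4)[OF WC] C1_torusD(4)[OF BC]
    C1_torusD(4)[OF S1.\<omega>] C1_torusD(4)[OF S2.\<omega>] C1_torusD(4)[OF S1.b] C1_torusD(4)[OF S2.b]
  have c: "continuous_on UNIV Pv1" "continuous_on UNIV Pv2" "continuous_on UNIV Pw1" "continuous_on UNIV Pw2" "continuous_on UNIV Pb1" "continuous_on UNIV Pb2"
    "continuous_on UNIV R"
    unfolding Pv1_def[abs_def] Pv2_def[abs_def] Pw1_def[abs_def] Pw2_def[abs_def] Pb1_def[abs_def] Pb2_def[abs_def] R_def[abs_def]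
    by (intro cc)+
  have cE: "continuous_on UNIV E" unfolding E_def[abs_def] by (intro cc Vc)
  note i = c[THEN integrable_continuous_torus]
  have Ldv: "l2_inner dv1 ?V - l2_inner dv2 ?V = (\<Sum>i\<in>UNIV. l2_inner (\<lambda>x. dv1 x $ i - dv2 x $ i) (\<lambda>x. v1 x $ i - v2 x $ i))"
    unfolding l2_inner_vec[OF dL(1) C1_L2[OF VC]] l2_inner_vec[OF dL(2) C1_L2[OF VC]] sum_subtractf[symmetric]
    using l2_inner_diff[OF dL(1,2) C1_L2[OF VC']] by simp
  have Rint: "(LINT x|torus_measure. R x) = 0"
  proof -
    have s: "(LINT x|torus_measure. (\<Sum>i\<in>UNIV. (v2 x \<bullet> cgrad (\<lambda>y. ?V y $ i) x) * ?V x $ i)) = 0"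
      by (subst Bochner_Integration.integral_sum) (simp_all only: transport_self[OF S2.v S2.div VC] sum.neutral_const, intro integrable_continuous_torus cc)
    have c1: "continuous_on UNIV (\<lambda>x. \<Sum>i\<in>UNIV. (v2 x \<bullet> cgrad (\<lambda>y. ?V y $ i) x) * ?V x $ i)" by (intro cc)
    have c2: "continuous_on UNIV (\<lambda>x. (v2 x \<bullet> cgrad ?W x) * ?W x)" by (intro cc)
    have c3: "continuous_on UNIV (\<lambda>x. (v2 x \<bullet> cgrad ?B x) * ?B x)" by (intro cc)
    have "(LINT x|torus_measure. R x) = 0 + 0 + 0"
      unfolding R_def integral_continuous_add[OF continuous_on_add[OF c1 c2] c3, symmetric] integral_continuous_add[OF c1 c2, symmetric]
      by (simp only: s transport_self[OF S2.v S2.div WC] transport_self[OF S2.v S2.div BC])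
    then show ?thesis by simp
  qed
  have "(\<Sum>i\<in>UNIV. l2_inner (\<lambda>x. dv1 x $ i - dv2 x $ i) (\<lambda>x. v1 x $ i - v2 x $ i)) + l2_inner (\<lambda>x. d\<omega>1 x - d\<omega>2 x) ?W + l2_inner (\<lambda>x. db1 x - db2 x) ?B
     = (l2_inner dv1 ?V - l2_inner dv2 ?V) + (l2_inner d\<omega>1 ?W - l2_inner d\<omega>2 ?W) + (l2_inner db1 ?B - l2_inner db2 ?B)"
    unfolding Ldv using l2_inner_diff[OF dL(3,4) C1_L2[OF WC]] l2_inner_diff[OF dL(5,6) C1_L2[OF BC]] by simp
  also have "\<dots> = - ((LINT x|torus_measure. Pv1 x) - (LINT x|torus_measure. Pv2 x)) - ((LINT x|torus_measure. Pw1 x) - (LINT x|torus_measure. Pw2 x))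
      - ((LINT x|torus_measure. Pb1 x) - (LINT x|torus_measure. Pb2 x)) + (LINT x|torus_measure. R x)"
    unfolding S1.velocity_equation[OF VC Vdiv] S2.velocity_equation[OF VC Vdiv] S1.omega_equation[OF WC] S2.omega_equation[OF WC]
      S1.b_equation[OF BC] S2.b_equation[OF BC] Rint Pv1_def Pv2_def Pw1_def Pw2_def Pb1_def Pb2_def by linarith
  also have "\<dots> = (LINT x|torus_measure. - (Pv1 x - Pv2 x) - (Pw1 x - Pw2 x) - (Pb1 x - Pb2 x) + R x)"
    by (simp add: i)
  also have "\<dots> \<le> (LINT x|torus_measure. ?K * E x)"
  proof (rule integral_mono)
    show "integrable torus_measure (\<lambda>x. - (Pv1 x - Pv2 x) - (Pw1 x - Pw2 x) - (Pb1 x - Pb2 x) + R x)" by (simp add: i)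
    show "integrable torus_measure (\<lambda>x. ?K * E x)" by (intro integrable_mult_right integrable_continuous_torus cE)
    fix x
    have VCi: "cgrad (\<lambda>y. ?V y $ i) x = cgrad (\<lambda>y. v1 y $ i) x - cgrad (\<lambda>y. v2 y $ i) x" for i
      using cgrad_diff[OF S1.v S2.v] by simp
    show "- (Pv1 x - Pv2 x) - (Pw1 x - Pw2 x) - (Pb1 x - Pb2 x) + R x \<le> ?K * E x"
      unfolding Pv1_def Pv2_def Pw1_def Pw2_def Pb1_def Pb2_def R_def E_def VCi csym_diff[OF S1.v S2.v] cgrad_diff[OF S1.\<omega> S2.\<omega>] cgrad_diff[OF S1.b S2.b]
      using M[of x] by (intro pointwise_energy_bound \<alpha> m L) auto
  qed
  also have "\<dots> = ?K * (LINT x|torus_measure. E x)" by simp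
  also have "(LINT x|torus_measure. E x) = (\<Sum>i\<in>UNIV. l2_inner (\<lambda>x. v1 x $ i - v2 x $ i) (\<lambda>x. v1 x $ i - v2 x $ i)) + l2_inner ?W ?W + l2_inner ?B ?B"
  proof -
    have n: "(norm (?V x))\<^sup>2 = (\<Sum>i\<in>UNIV. (v1 x $ i - v2 x $ i) * (v1 x $ i - v2 x $ i))" for x
      by (simp add: power2_norm_eq_inner inner_vec_def)
    have q: "continuous_on UNIV (\<lambda>x. (v1 x $ i - v2 x $ i) * (v1 x $ i - v2 x $ i))" for i by (intro continuous_on_mult C1_torusD(4)[OF VC'])
    have "(LINT x|torus_measure. E x) = (LINT x|torus_measure. (norm (?V x))\<^sup>2) + (LINT x|torus_measure. (?W x)\<^sup>2) + (LINT x|torus_measure. (?B x)\<^sup>2)"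
      unfolding E_def by (subst integral_continuous_add, intro cc Vc, intro cc Vc, subst integral_continuous_add, (intro cc Vc)+, rule refl)
    also have "(LINT x|torus_measure. (norm (?V x))\<^sup>2) = (\<Sum>i\<in>UNIV. l2_inner (\<lambda>x. v1 x $ i - v2 x $ i) (\<lambda>x. v1 x $ i - v2 x $ i))"
      unfolding n l2_inner_eq by (rule Bochner_Integration.integral_sum) (intro integrable_continuous_torus q)
    finally show ?thesis by (simp add: l2_inner_self)
  qed
  finally show ?thesis .
qed

lemma norm_cgrad_le:
  fixes x :: "real^'n"
  assumes "\<And>i. \<bar>classical_partial i f x\<bar> \<le> a"
  shows "norm (cgrad f x) \<le> real CARD('n) * a"
proof -
  have "norm (cgrad f x) \<le> (\<Sum>i\<in>UNIV. \<bar>cgrad f x $ i\<bar>)" by (rule norm_le_l1_cart)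
  also have "\<dots> \<le> (\<Sum>i\<in>(UNIV::'n set). a)" by (rule sum_mono) (simp add: cgrad_def assms)
  finally show ?thesis by simp
qed

text \<open>Bounding Euclidean norms by sums of absolute values, first over rows and then within
  them, accounts for the squared dimension.\<close>

lemma norm_csym_le:
  fixes x :: "real^'n"
  assumes "\<And>i j. \<bar>classical_partial i (\<lambda>y. v y $ j) x\<bar> \<le> a"
  shows "norm (csym v x) \<le> (real CARD('n))\<^sup>2 * a"
proof -
  have a: "norm (csym v x $ i) \<le> real CARD('n) * a" for i
  proof -
    have "norm (csym v x $ i) \<le> (\<Sum>j\<in>UNIV. \<bar>csym v x $ i $ j\<bar>)" by (rule norm_le_l1_cart)
    also have "\<dots> \<le> (\<Sum>j\<in>(UNIV::'n set). a)"
    proof (rule sum_mono)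
      fix j
      show "\<bar>csym v x $ i $ j\<bar> \<le> a" using assms[of j i] assms[of i j] unfolding csym_def by simp
    qed
    finally show ?thesis by simp
  qed
  have "norm (csym v x) \<le> (\<Sum>i\<in>UNIV. norm (csym v x $ i))"
    unfolding norm_vec_def by (rule L2_set_le_sum) simp
  also have "\<dots> \<le> (\<Sum>i\<in>(UNIV::'n set). real CARD('n) * a)" by (rule sum_mono) (rule a)
  finally show ?thesis by (simp add: power2_eq_square)
qed

section \<open>Lower bounds by the minimum principle\<close>

text \<open>The convexity inequality that \<open>l2_path_energy\<close> requires of
  \<open>(max 0 r)^3 / 3\<close>.\<close>

lemma positive_part_cube:
  fixes a b :: real
  shows "(max 0 a)^3 / 3 - (max 0 b)^3 / 3 \<le> (max 0 a)\<^sup>2 * (a - b)"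
proof -
  define p where "p = max 0 a" define q where "q = max 0 b"
  have pq: "0 \<le> p" "0 \<le> q" "b \<le> q" by (simp_all add: p_def q_def)
  \<comment> \<open>One third of this product is the defect
    \<open>p^2 * (p - q) - (p^3 - q^3) / 3\<close>.\<close>
  have "0 \<le> (p - q)\<^sup>2 * (2 * p + q)" using pq by simp
  then have 1: "p^3 / 3 - q^3 / 3 \<le> p\<^sup>2 * (p - q)" by (simp add: power2_eq_square power3_eq_cube algebra_simps)
  have "p\<^sup>2 * (p - q) \<le> p\<^sup>2 * (a - b)"
  proof (cases "a > 0")
    case True
    then show ?thesis using pq by (intro mult_left_mono) (auto simp: p_def)
  qed (simp add: p_def)
  with 1 show ?thesis unfolding p_def q_def by linarith
qed

text \<open>The square of the positive part is Lipschitz only below a bound; this is why the energy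
  lemma carries a range \<open>R\<close> for the values.\<close>

lemma positive_part_square_lipschitz:
  fixes a b C :: real
  assumes "a \<le> C" "b \<le> C" "0 \<le> C"
  shows "\<bar>(max 0 a)\<^sup>2 - (max 0 b)\<^sup>2\<bar> \<le> 2 * C * \<bar>a - b\<bar>"
proof -
  have "\<bar>(max 0 a)\<^sup>2 - (max 0 b)\<^sup>2\<bar> = \<bar>max 0 a + max 0 b\<bar> * \<bar>max 0 a - max 0 b\<bar>"
    unfolding abs_mult[symmetric] by (simp add: power2_eq_square algebra_simps)
  also have "\<dots> \<le> (2 * C) * \<bar>a - b\<bar>"
    using assms by (intro mult_mono) auto
  finally show ?thesis by simp
qed

context sobolev_path
begin

text \<open>Comparison with the barrier m(t) = \<open>m0 * exp (- l * t)\<close>, a solution of m' =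
  - l m. The energy of \<open>(max 0 (m - u))^3 / 3\<close> is zero initially, and the premise
  \<open>le\<close> says that \<open>du\<close> cannot make it grow faster than the decay of the
  barrier makes it shrink.\<close>

lemma lower_bound:
  assumes t1: "0 \<le> t1" "t1 < T" and lam: "0 \<le> l" and u0: "\<And>x. m0 \<le> u 0 x" and m0: "0 < m0"
    and H: "negligible H"
    and le: "\<And>t. t \<in> {0..t1} - H \<Longrightarrow> - l2_inner (du t) (\<lambda>x. (max 0 (m0 * exp (- l * t) - u t x))\<^sup>2)
        \<le> l * (m0 * exp (- l * t)) * (LINT x|torus_measure. (max 0 (m0 * exp (- l * t) - u t x))\<^sup>2)"
    and t: "t \<in> {0..t1}"
  shows "m0 * exp (- l * t) \<le> u t x"
proof -
  let ?m = "\<lambda>t. m0 * exp (- l * t)" and ?m' = "\<lambda>t. - l * (m0 * exp (- l * t))"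
  let ?z = "\<lambda>t x. ?m t - u t x" and ?dz = "\<lambda>t x. ?m' t - du t x"
  obtain M where M: "M > 0" "\<And>t x. t \<in> {0..t1} \<Longrightarrow> \<bar>u t x\<bar> \<le> M" using locally_bounded[OF t1] by blast
  obtain E where E: "negligible E" "\<And>t. t \<in> {0..T} - E \<Longrightarrow> du t \<in> sobolev (s - 1)" using regular_times by metis
  have "(?m has_real_derivative ?m' t) (at t)" for t by (auto intro!: derivative_eq_intros)
  then have pm: "l2_path t1 (\<lambda>t. (?m' t)\<^sup>2) (\<lambda>t x::real^'n. ?m t) (\<lambda>t x. ?m' t)"
    by (rule l2_path_const) (intro continuous_intros)
  note pz = l2_path_diff[OF pm path[OF t1]]
  \<comment> \<open>An upper bound for barrier minus solution, which delimits the range where the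
    Lipschitz estimate holds.\<close>
  let ?C = "m0 + M"
  have zC: "?z t x \<le> ?C" if "t \<in> {0..t1}" for t x
  proof -
    have "?m t \<le> m0" using lam m0 that by simp
    then show ?thesis using M(2)[OF that, of x] by linarith
  qed
  have tT: "t \<in> {0..<T}" if "t \<in> {0..t1}" for t using that t1 by auto
  have zc: "continuous_on UNIV (?z t)" if "t \<in> {0..t1}" for t
    by (intro continuous_on_diff continuous_on_const space_continuous tT that)
  have zp: "periodic (?z t)" if "t \<in> {0..t1}" for t using space_periodic[OF tT[OF that]] by (simp add: periodic_def)
  have c2: "continuous_on UNIV (\<lambda>x. (max 0 (?z t x))\<^sup>2)" if "t \<in> {0..t1}" for t
    by (intro continuous_on_power continuous_on_max continuous_on_const zc that)
  have c3: "continuous_on UNIV (\<lambda>x. (max 0 (?z t x))^3 / 3)" if "t \<in> {0..t1}" for t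
    by (intro continuous_on_divide continuous_on_power continuous_on_max continuous_on_const zc that) auto
  have g2: "(\<lambda>x. (max 0 (?z t x))\<^sup>2) \<in> L2_torus" if "t \<in> {0..t1}" for t
    by (rule continuous_periodic_L2[OF _ c2[OF that]]) (use zp[OF that] in \<open>simp add: periodic_def\<close>)
  have lip: "\<bar>(max 0 a)\<^sup>2 - (max 0 b)\<^sup>2\<bar> \<le> (2 * m0 + 2 * M) * \<bar>a - b\<bar>" if "a \<le> m0 + M" "b \<le> m0 + M" for a b :: real
    using positive_part_square_lipschitz[OF that] m0 M by simp
  \<comment> \<open>A one-element index set specializes the energy lemma to a single path; the
    derivative of the barrier exactly offsets the right side of \<open>le\<close>, so the bound is
    the zero function.\<close>
  have "(\<Sum>i\<in>{()}. LINT x|torus_measure. (max 0 (?z t x))^3 / 3) - (\<Sum>i\<in>{()}. LINT x|torus_measure. (max 0 (?z 0 x))^3 / 3) \<le> integral {0..t} (\<lambda>_. 0)"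
  proof (rule l2_path_energy[where R="{..?C}" and L="2 * ?C" and G'="\<lambda>r. (max 0 r)\<^sup>2" and z="\<lambda>_. ?z" and dz="\<lambda>_. ?dz", OF _ pz])
    show "negligible (E \<union> H)" using E(1) H by (rule negligible_Un)
    fix \<tau> assume \<tau>: "\<tau> \<in> {0..t} - (E \<union> H)"
    then have \<tau>1: "\<tau> \<in> {0..t1} - H" "\<tau> \<in> {0..t1}" "\<tau> \<in> {0..T} - E" using t t1 by auto
    have dL: "du \<tau> \<in> L2_torus" by (rule sobolevD(1)[OF E(2)[OF \<tau>1(3)]])
    have "l2_inner (?dz \<tau>) (\<lambda>x. (max 0 (?z \<tau> x))\<^sup>2) = ?m' \<tau> * (LINT x|torus_measure. (max 0 (?z \<tau> x))\<^sup>2) - l2_inner (du \<tau>) (\<lambda>x. (max 0 (?z \<tau> x))\<^sup>2)"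
      using l2_inner_diff[OF L2_const dL g2[OF \<tau>1(2)]] by (simp add: l2_inner_const)
    then show "(\<Sum>i\<in>{()}. l2_inner (?dz \<tau>) (\<lambda>x. (max 0 (?z \<tau> x))\<^sup>2)) \<le> 0" using le[OF \<tau>1(1)] by simp
  qed (use t t1 zC c3 g2 m0 M lip in \<open>auto intro: positive_part_cube integrable_continuous_torus\<close>)
  moreover have "(max 0 (?z 0 x))^3 / 3 = 0" for x using u0[of x] by simp
  ultimately have "(LINT x|torus_measure. (max 0 (?z t x))^3 / 3) \<le> 0" by simp
  moreover have "0 \<le> (LINT x|torus_measure. (max 0 (?z t x))^3 / 3)" by simp
  ultimately have z0: "(LINT x|torus_measure. (max 0 (?z t x))^3 / 3) = 0" by linarith
  obtain y where y: "y \<in> torus" "?z t y = ?z t x" using periodic_torus[OF zp[OF t], of x] by blast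
  have "(max 0 (?z t y))^3 / 3 = 0"
    by (rule continuous_eq_0_of_integral_eq_0[OF c3[OF t] _ z0 y(1)]) simp
  then show ?thesis using y(2) by (simp add: max_def split: if_splits)
qed

end

section \<open>Strict positivity of \<omega> and b on compact time intervals\<close>

locale kolmogorov =
  fixes \<alpha> T s :: real and v dv :: "real \<Rightarrow> real^'n \<Rightarrow> real^'n" and \<omega> d\<omega> b db :: "real \<Rightarrow> real^'n \<Rightarrow> real"
    and h :: "real \<Rightarrow> real" and m0 :: real
  assumes \<alpha>: "\<alpha> > 0"
    and Pv: "\<And>i. sobolev_path T s (\<lambda>t x. v t x $ i) (\<lambda>t x. dv t x $ i) h"
    and P\<omega>: "sobolev_path T s \<omega> d\<omega> h" and Pb: "sobolev_path T s b db h"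
    and h_nonneg: "\<And>t. 0 \<le> h t"
    and sol: "kolmogorov_weak_solution \<alpha> T v dv \<omega> d\<omega> b db"
    and m0: "m0 > 0" and \<omega>0: "\<And>x. m0 \<le> \<omega> 0 x" and b0: "\<And>x. m0 \<le> b 0 x"
begin

sublocale om: sobolev_path T s \<omega> d\<omega> h by (rule P\<omega>)
sublocale en: sobolev_path T s b db h by (rule Pb)

text \<open>The H^(s+1) bound by \<open>h\<close> makes almost every time regular, with gradients of
  order \<open>sqrt (h t)\<close>. Positivity of \<omega> stays a premise, because the minimum
  principle that will prove it already works on slices.\<close>

lemma regular_slices:
  obtains E where "negligible E"
    "\<And>t. t \<in> {0..T} - E \<Longrightarrow> (\<And>x. \<omega> t x > 0) \<Longrightarrow> slice \<alpha> (v t) (dv t) (\<omega> t) (d\<omega> t) (b t) (db t)"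
    "\<And>t i j x. t \<in> {0..T} - E \<Longrightarrow> \<bar>classical_partial i (\<lambda>y. v t y $ j) x\<bar> \<le> (emb TYPE('n) s * sqrt (h t))"
    "\<And>t i x. t \<in> {0..T} - E \<Longrightarrow> \<bar>classical_partial i (\<omega> t) x\<bar> \<le> (emb TYPE('n) s * sqrt (h t))"
    "\<And>t i x. t \<in> {0..T} - E \<Longrightarrow> \<bar>classical_partial i (b t) x\<bar> \<le> (emb TYPE('n) s * sqrt (h t))"
    "\<And>t i. t \<in> {0..T} - E \<Longrightarrow> (\<lambda>x. dv t x $ i) \<in> L2_torus"
    "\<And>t. t \<in> {0..T} - E \<Longrightarrow> d\<omega> t \<in> L2_torus" "\<And>t. t \<in> {0..T} - E \<Longrightarrow> db t \<in> L2_torus"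
proof -
  have bnd: "u \<in> C1_torus \<and> (\<forall>i x. \<bar>classical_partial i u x\<bar> \<le> (emb TYPE('n) s * sqrt (h t)))" if "u \<in> sobolev (s + 1)" "(sobolev_norm (s + 1) u)\<^sup>2 \<le> h t" for u :: "real^'n \<Rightarrow> real" and t
  proof (intro conjI allI)
    show "u \<in> C1_torus" by (rule sobolev_C1(1)[OF om.s that(1)])
    fix i x
    have "\<bar>classical_partial i u x\<bar> \<le> emb TYPE('n) s * sobolev_norm (s + 1) u" by (rule sobolev_C1(2)[OF om.s that(1)])
    also have "\<dots> \<le> (emb TYPE('n) s * sqrt (h t))"
      using real_sqrt_le_mono[OF that(2)] by (intro mult_left_mono emb_nonneg) (simp add: sobolev_norm_nonneg)
    finally show "\<bar>classical_partial i u x\<bar> \<le> (emb TYPE('n) s * sqrt (h t))" .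
  qed
  have "\<forall>i. \<exists>E. negligible E \<and> (\<forall>t\<in>{0..T} - E. (\<lambda>x. v t x $ i) \<in> sobolev (s + 1) \<and> (sobolev_norm (s + 1) (\<lambda>x. v t x $ i))\<^sup>2 \<le> h t \<and> (\<lambda>x. dv t x $ i) \<in> sobolev (s - 1))"
  proof
    fix i
    show "\<exists>E. negligible E \<and> (\<forall>t\<in>{0..T} - E. (\<lambda>x. v t x $ i) \<in> sobolev (s + 1) \<and> (sobolev_norm (s + 1) (\<lambda>x. v t x $ i))\<^sup>2 \<le> h t \<and> (\<lambda>x. dv t x $ i) \<in> sobolev (s - 1))"
      by (rule sobolev_path.regular_times[OF Pv[of i]]) blast
  qed
  then obtain Ev where Ev: "\<And>i. negligible (Ev i)" "\<And>i t. t \<in> {0..T} - Ev i \<Longrightarrow> (\<lambda>x. v t x $ i) \<in> sobolev (s + 1) \<and> (sobolev_norm (s + 1) (\<lambda>x. v t x $ i))\<^sup>2 \<le> h t \<and> (\<lambda>x. dv t x $ i) \<in> sobolev (s - 1)"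
    by metis
  obtain E1 where E1: "negligible E1" "\<And>t. t \<in> {0..T} - E1 \<Longrightarrow> t \<in> {0<..<T}"
    "\<And>t. t \<in> {0..T} - E1 \<Longrightarrow> \<omega> t \<in> sobolev (s + 1)" "\<And>t. t \<in> {0..T} - E1 \<Longrightarrow> (sobolev_norm (s + 1) (\<omega> t))\<^sup>2 \<le> h t" "\<And>t. t \<in> {0..T} - E1 \<Longrightarrow> d\<omega> t \<in> sobolev (s - 1)"
    by (rule om.regular_times) blast
  obtain E2 where E2: "negligible E2"
    "\<And>t. t \<in> {0..T} - E2 \<Longrightarrow> b t \<in> sobolev (s + 1)" "\<And>t. t \<in> {0..T} - E2 \<Longrightarrow> (sobolev_norm (s + 1) (b t))\<^sup>2 \<le> h t" "\<And>t. t \<in> {0..T} - E2 \<Longrightarrow> db t \<in> sobolev (s - 1)"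
    by (rule en.regular_times) blast
  have S: "{0<..<T} \<in> sets lebesgue" by simp
  note sd = sol[unfolded kolmogorov_weak_solution_def]
  obtain E3 where E3: "negligible E3" "\<And>t. t \<in> {0<..<T} \<Longrightarrow> t \<notin> E3 \<Longrightarrow> 
       (\<forall>w\<in>sobolev_div 1.
          l2_inner (dv t) w
          + l2_inner (\<lambda>x. \<chi> i. convect (v t) (\<lambda>y. v t y $ i) x) w
          + l2_inner (\<lambda>x. (b t x / \<omega> t x) *\<^sub>R sym_grad (v t) x) (sym_grad w) = 0) \<and>
       (\<forall>z\<in>sobolev 1.
          l2_inner (d\<omega> t) z
          + l2_inner (convect (v t) (\<omega> t)) z
          + l2_inner (\<lambda>x. (b t x / \<omega> t x) *\<^sub>R grad (\<omega> t) x) (grad z)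
          = - \<alpha> * l2_inner (\<lambda>x. (\<omega> t x)\<^sup>2) z) \<and>
       (\<forall>q\<in>sobolev 1.
          l2_inner (db t) q
          + l2_inner (convect (v t) (b t)) q
          + l2_inner (\<lambda>x. (b t x / \<omega> t x) *\<^sub>R grad (b t) x) (grad q)
          = - l2_inner (\<lambda>x. b t x * \<omega> t x) q
            + l2_inner (\<lambda>x. b t x / \<omega> t x * (norm (sym_grad (v t) x))\<^sup>2) q)"
    by (rule AE_lebesgue_onE[OF sd[THEN conjunct2] S]) blast
  define E where "E = (\<Union>i. Ev i) \<union> E1 \<union> E2 \<union> E3"
  have nE: "negligible E"
  proof -
    have "negligible (\<Union>i. Ev i)" using negligible_Union[of "range Ev"] Ev(1) by auto
    then show ?thesis unfolding E_def using E1(1) E2(1) E3(1) by (intro negligible_Un)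
  qed
  have sub: "t \<in> {0..T} - Ev i" "t \<in> {0..T} - E1" "t \<in> {0..T} - E2" "t \<notin> E3" if "t \<in> {0..T} - E" for t i
    using that by (auto simp: E_def)
  have vC: "(\<lambda>x. v t x $ i) \<in> C1_torus" "\<bar>classical_partial j (\<lambda>x. v t x $ i) x\<bar> \<le> (emb TYPE('n) s * sqrt (h t))" if "t \<in> {0..T} - E" for t i j x
    using bnd[of "\<lambda>x. v t x $ i" t] Ev(2)[OF sub(1)[OF that]] by blast+
  have wC: "\<omega> t \<in> C1_torus" "\<bar>classical_partial j (\<omega> t) x\<bar> \<le> (emb TYPE('n) s * sqrt (h t))" if "t \<in> {0..T} - E" for t j x
    using bnd[OF E1(3,4)[OF sub(2)[OF that]]] by blast+
  have bC: "b t \<in> C1_torus" "\<bar>classical_partial j (b t) x\<bar> \<le> (emb TYPE('n) s * sqrt (h t))" if "t \<in> {0..T} - E" for t j x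
    using bnd[OF E2(2,3)[OF sub(3)[OF that]]] by blast+
  show ?thesis
  proof (rule that[OF nE])
    fix t assume t: "t \<in> {0..T} - E" and pos: "\<And>x. \<omega> t x > 0"
    have t0: "t \<in> {0<..<T}" by (rule E1(2)[OF sub(2)[OF t]])
    note eqs = E3(2)[OF t0 sub(4)[OF t]]
    show "slice \<alpha> (v t) (dv t) (\<omega> t) (d\<omega> t) (b t) (db t)"
    proof
      show "CARD('n) \<ge> 2" by (rule om.dim)
      show "(\<lambda>x. v t x $ i) \<in> C1_torus" for i by (rule vC(1)[OF t])
      show "\<omega> t \<in> C1_torus" by (rule wC(1)[OF t])
      show "b t \<in> C1_torus" by (rule bC(1)[OF t])
      show "div_free (v t)" using sd[THEN conjunct1] t0 by blast
      show "\<omega> t x > 0" for x by (rule pos)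
    qed (use eqs in blast)+
  next
    fix t i assume t: "t \<in> {0..T} - E"
    show "(\<lambda>x. dv t x $ i) \<in> L2_torus" using Ev(2)[OF sub(1)[OF t]] sobolevD(1) by blast
  next
    fix t assume t: "t \<in> {0..T} - E"
    show "d\<omega> t \<in> L2_torus" by (rule sobolevD(1)[OF E1(5)[OF sub(2)[OF t]]])
    show "db t \<in> L2_torus" by (rule sobolevD(1)[OF E2(4)[OF sub(3)[OF t]]])
  qed (use vC(2) wC(2) bC(2) in blast)+
qed

text \<open>The conditional half of the bootstrap: mere positivity up to \<open>t1\<close> gives the
  diffusion term its sign, and the barrier then yields a quantitative bound.\<close>

lemma positivity_step:
  assumes t1: "0 \<le> t1" "t1 < T" and M: "M > 0" "\<And>t x. t \<in> {0..t1} \<Longrightarrow> \<bar>\<omega> t x\<bar> \<le> M"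
    and pos: "\<And>t x. t \<in> {0..t1} \<Longrightarrow> 0 < \<omega> t x \<and> 0 < b t x" and t: "t \<in> {0..t1}"
  shows "m0 * exp (- ((\<alpha> + 1) * M) * t) \<le> \<omega> t x" "m0 * exp (- ((\<alpha> + 1) * M) * t) \<le> b t x"
proof -
  \<comment> \<open>The rate dominates both \<alpha> M, which controls \<alpha> \<omega>^2 below the
    barrier, and M, which controls b \<omega> there; the production term in the equation for b only
    helps.\<close>
  let ?l = "(\<alpha> + 1) * M"
  let ?m = "\<lambda>t. m0 * exp (- ?l * t)"
  have l0: "0 \<le> ?l" using \<alpha> M by simp
  have la: "\<alpha> * M \<le> ?l" "M \<le> ?l" using \<alpha> M by (auto simp: distrib_right)
  obtain E where E: "negligible E"
    "\<And>t. t \<in> {0..T} - E \<Longrightarrow> (\<And>x. \<omega> t x > 0) \<Longrightarrow> slice \<alpha> (v t) (dv t) (\<omega> t) (d\<omega> t) (b t) (db t)"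
    by (rule regular_slices) blast
  have m: "0 < ?m t" for t using m0 by simp
  have sl: "slice \<alpha> (v \<tau>) (dv \<tau>) (\<omega> \<tau>) (d\<omega> \<tau>) (b \<tau>) (db \<tau>)" if "\<tau> \<in> {0..t1} - E" for \<tau>
    using that pos t1 by (intro E(2)) auto
  show "?m t \<le> \<omega> t x"
  proof (rule om.lower_bound[OF t1 l0 \<omega>0 m0 E(1) _ t])
    fix \<tau> assume \<tau>: "\<tau> \<in> {0..t1} - E"
    then interpret S: slice \<alpha> "v \<tau>" "dv \<tau>" "\<omega> \<tau>" "d\<omega> \<tau>" "b \<tau>" "db \<tau>" by (rule sl)
    have \<tau>1: "\<tau> \<in> {0..t1}" using \<tau> by simp
    show "- l2_inner (d\<omega> \<tau>) (\<lambda>x. (max 0 (?m \<tau> - \<omega> \<tau> x))\<^sup>2) \<le> ?l * ?m \<tau> * (LINT x|torus_measure. (max 0 (?m \<tau> - \<omega> \<tau> x))\<^sup>2)"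
    proof (rule S.truncation_bound[OF S.\<omega> _ _ S.omega_equation])
      show "continuous_on UNIV (\<lambda>x. \<alpha> * (\<omega> \<tau> x)\<^sup>2)" by (intro continuous_intros C1_torusD(4) S.\<omega>)
      show "0 \<le> b \<tau> x" for x using pos[OF \<tau>1, of x] by simp
      fix x assume x: "\<omega> \<tau> x < ?m \<tau>"
      have w: "0 < \<omega> \<tau> x" "\<omega> \<tau> x \<le> M" using pos[OF \<tau>1, of x] M(2)[OF \<tau>1, of x] by auto
      have "\<alpha> * (\<omega> \<tau> x)\<^sup>2 = (\<alpha> * \<omega> \<tau> x) * \<omega> \<tau> x" by (simp add: power2_eq_square)
      also have "\<dots> \<le> (\<alpha> * M) * ?m \<tau>" using w x \<alpha> by (intro mult_mono) auto
      also have "\<dots> \<le> ?l * ?m \<tau>" using la m[of \<tau>] M(1) by (intro mult_right_mono) auto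
      finally show "\<alpha> * (\<omega> \<tau> x)\<^sup>2 \<le> ?l * ?m \<tau>" .
    qed
  qed
  show "?m t \<le> b t x"
  proof (rule en.lower_bound[OF t1 l0 b0 m0 E(1) _ t])
    fix \<tau> assume \<tau>: "\<tau> \<in> {0..t1} - E"
    then interpret S: slice \<alpha> "v \<tau>" "dv \<tau>" "\<omega> \<tau>" "d\<omega> \<tau>" "b \<tau>" "db \<tau>" by (rule sl)
    have \<tau>1: "\<tau> \<in> {0..t1}" using \<tau> by simp
    show "- l2_inner (db \<tau>) (\<lambda>x. (max 0 (?m \<tau> - b \<tau> x))\<^sup>2) \<le> ?l * ?m \<tau> * (LINT x|torus_measure. (max 0 (?m \<tau> - b \<tau> x))\<^sup>2)"
    proof (rule S.truncation_bound[OF S.b _ _ S.b_equation])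
      show "continuous_on UNIV (\<lambda>x. b \<tau> x * \<omega> \<tau> x - b \<tau> x / \<omega> \<tau> x * (norm (csym (v \<tau>) x))\<^sup>2)"
        by (intro continuous_on_diff continuous_on_mult S.continuous_ratio continuous_on_power continuous_on_norm continuous_csym S.v C1_torusD(4) S.\<omega> S.b)
      show "0 \<le> b \<tau> x" for x using pos[OF \<tau>1, of x] by simp
      fix x assume x: "b \<tau> x < ?m \<tau>"
      have w: "0 < \<omega> \<tau> x" "\<omega> \<tau> x \<le> M" "0 < b \<tau> x" using pos[OF \<tau>1, of x] M(2)[OF \<tau>1, of x] by auto
      have "b \<tau> x * \<omega> \<tau> x \<le> ?m \<tau> * M" using w x by (intro mult_mono) auto
      also have "\<dots> = M * ?m \<tau>" by (rule mult.commute)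
      also have "\<dots> \<le> ?l * ?m \<tau>" by (intro mult_right_mono la(2) less_imp_le[OF m])
      finally have "b \<tau> x * \<omega> \<tau> x \<le> ?l * ?m \<tau>" .
      moreover have "0 \<le> b \<tau> x / \<omega> \<tau> x * (norm (csym (v \<tau>) x))\<^sup>2" using w by simp
      ultimately show "b \<tau> x * \<omega> \<tau> x - b \<tau> x / \<omega> \<tau> x * (norm (csym (v \<tau>) x))\<^sup>2 \<le> ?l * ?m \<tau>" by linarith
    qed
  qed
qed

text \<open>If \<omega> or b ever fell to c/2 there would be a first such time. Before it the values
  are positive, so \<open>positivity_step\<close> keeps them above c, and continuity in time forbids
  the sudden drop.\<close>

lemma positivity:
  assumes t1: "0 \<le> t1" "t1 < T"
  obtains c where "c > 0" "\<And>t x. t \<in> {0..t1} \<Longrightarrow> c \<le> \<omega> t x \<and> c \<le> b t x"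
proof -
  obtain M where M: "M > 0" "\<And>t x. t \<in> {0..t1} \<Longrightarrow> \<bar>\<omega> t x\<bar> \<le> M" using om.locally_bounded[OF t1] by blast
  let ?l = "(\<alpha> + 1) * M"
  \<comment> \<open>The value of the barrier at the end, its smallest value on the interval.\<close>
  define c where "c = m0 * exp (- ?l * t1)"
  have l0: "0 \<le> ?l" using \<alpha> M by simp
  have c: "c > 0" using m0 by (simp add: c_def)
  have cm: "c \<le> m0 * exp (- ?l * t)" if "t \<le> t1" for t
    unfolding c_def using l0 m0 that by (intro mult_left_mono) (auto intro: mult_left_mono)
  let ?Q = "{0..t1} \<times> cbox 0 (1::real^'n)"
  have Q: "?Q \<subseteq> {0..<T} \<times> UNIV" using t1 by auto
  \<comment> \<open>The threshold c/2 lies strictly below the bound c that the barrier gives. Points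
    range over the closed cube, which makes the set compact, so that a first bad time
    exists.\<close>
  define K where "K = {p \<in> ?Q. \<omega> (fst p) (snd p) \<le> c / 2} \<union> {p \<in> ?Q. b (fst p) (snd p) \<le> c / 2}"
  have "closed K"
    unfolding K_def
    by (intro closed_Un continuous_on_closed_Collect_le continuous_on_subset[OF om.joint_continuous Q] continuous_on_subset[OF en.joint_continuous Q]
       continuous_on_const compact_imp_closed compact_Times compact_cbox compact_Icc)
  moreover have "bounded K"
  proof (rule bounded_subset)
    show "bounded ?Q" by (intro bounded_Times bounded_cbox compact_imp_bounded compact_Icc)
  qed (auto simp: K_def)
  ultimately have cK: "compact (fst ` K)" by (intro compact_continuous_image continuous_intros) (simp add: compact_eq_bounded_closed)
  have out: "c / 2 < \<omega> t x \<and> c / 2 < b t x" if t: "t \<in> {0..t1}" "t \<notin> fst ` K" for t x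
  proof -
    have "t \<in> {0..<T}" using t t1 by auto
    then have "periodic (\<lambda>x. (\<omega> t x, b t x))" using om.space_periodic en.space_periodic by (auto simp: periodic_def)
    from periodic_torus[OF this, of x] obtain y where y: "y \<in> torus" "\<omega> t y = \<omega> t x" "b t y = b t x" by auto
    then have "(t, y) \<in> ?Q" using t torus_subset_cbox by blast
    moreover have "(t, y) \<notin> K" using t(2) by (metis fst_conv imageI)
    ultimately show ?thesis using y by (auto simp: K_def not_le)
  qed
  have "fst ` K = {}"
  proof (rule ccontr)
    assume ne: "fst ` K \<noteq> {}"
    obtain t' where t': "t' \<in> fst ` K" "\<And>t. t \<in> fst ` K \<Longrightarrow> t' \<le> t" using compact_attains_inf[OF cK ne] by blast
    obtain p where p: "p \<in> K" "t' = fst p" using t'(1) by blast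
    have "t' \<in> {0..t1} \<and> (\<omega> t' (snd p) \<le> c / 2 \<or> b t' (snd p) \<le> c / 2)" using p by (auto simp: K_def)
    then obtain x where x: "t' \<in> {0..t1}" "\<omega> t' x \<le> c / 2 \<or> b t' x \<le> c / 2" by blast
    \<comment> \<open>No time before t' is bad, so the functions are positive on [0, t] and the
      conditional bound applies there.\<close>
    have lowe: "c \<le> \<omega> t y \<and> c \<le> b t y" if "0 \<le> t" "t < t'" for t y
    proof -
      have tt: "0 \<le> t" "t < T" "t \<in> {0..t}" using that x t1 by auto
      have "0 < \<omega> r z \<and> 0 < b r z" if "r \<in> {0..t}" for r z
      proof -
        have "r \<notin> fst ` K" using t'(2)[of r] that \<open>t < t'\<close> by auto
        moreover have "r \<in> {0..t1}" using that \<open>t < t'\<close> x by auto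
        ultimately show ?thesis using out[of r z] c by auto
      qed
      moreover have "\<bar>\<omega> r z\<bar> \<le> M" if "r \<in> {0..t}" for r z using M(2) that \<open>t < t'\<close> x by auto
      ultimately have "m0 * exp (- ?l * t) \<le> \<omega> t y" "m0 * exp (- ?l * t) \<le> b t y"
        using positivity_step[OF tt(1,2) M(1) _ _ tt(3)] by blast+
      then show ?thesis using cm[of t] that x by auto
    qed
    have t'T: "t' \<in> {0..<T}" using x t1 by auto
    show False
    proof (cases "t' = 0")
      case True
      then have "c \<le> \<omega> t' x" "c \<le> b t' x" using cm[of 0] \<omega>0[of x] b0[of x] t1 by auto
      then show False using x c by auto
    next
      case False
      \<comment> \<open>Just before t' the values are at least c, and they change by less than c/4,
        so at t' they still exceed c/2.\<close>
      have q: "c / 4 > 0" using c by simp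
      obtain d1 where d1: "d1 > 0" "\<And>r x. r \<in> {0..<T} \<Longrightarrow> \<bar>r - t'\<bar> < d1 \<Longrightarrow> \<bar>\<omega> r x - \<omega> t' x\<bar> < c / 4" using om.time_uniform_continuity[OF t'T q] by blast
      obtain d2 where d2: "d2 > 0" "\<And>r x. r \<in> {0..<T} \<Longrightarrow> \<bar>r - t'\<bar> < d2 \<Longrightarrow> \<bar>b r x - b t' x\<bar> < c / 4" using en.time_uniform_continuity[OF t'T q] by blast
      define r where "r = max 0 (t' - min d1 d2 / 2)"
      have r: "0 \<le> r" "r < t'" "\<bar>r - t'\<bar> < d1" "\<bar>r - t'\<bar> < d2" using d1(1) d2(1) False t'T by (auto simp: r_def max_def min_def)
      have rT: "r \<in> {0..<T}" using r t'T by auto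
      show False using lowe[OF r(1,2), of x] d1(2)[OF rT r(3), of x] d2(2)[OF rT r(4), of x] x(2) c by argo
    qed
  qed
  then have "c / 2 \<le> \<omega> t x \<and> c / 2 \<le> b t x" if "t \<in> {0..t1}" for t x using out[OF that, of x] by auto
  then show ?thesis using that[of "c / 2"] c by auto
qed

end

section \<open>Uniqueness\<close>

lemma continuous_l2_energy:
  fixes z :: "real \<Rightarrow> real^'n \<Rightarrow> real"
  assumes B: "0 \<le> B" "\<And>t x. t \<in> I \<Longrightarrow> \<bar>z t x\<bar> \<le> B"
    and uc: "\<And>t e. t \<in> I \<Longrightarrow> e > 0 \<Longrightarrow> \<exists>\<delta>>0. \<forall>r\<in>I. \<bar>r - t\<bar> < \<delta> \<longrightarrow> (\<forall>x. \<bar>z r x - z t x\<bar> < e)"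
    and sc: "\<And>t. t \<in> I \<Longrightarrow> continuous_on UNIV (z t)"
  shows "continuous_on I (\<lambda>t. LINT x|torus_measure. (z t x)\<^sup>2 / 2)"
  unfolding continuous_on_iff
proof (intro ballI allI impI)
  fix t and e :: real assume t: "t \<in> I" and e: "e > 0"
  \<comment> \<open>Half the difference of squares is at most \<open>d * B\<close>; the summand 1
    makes this strictly smaller than e and covers B = 0.\<close>
  define d where "d = e / (B + 1)"
  have d: "d > 0" using e B by (simp add: d_def)
  have Bd: "d * B < e" using e B by (simp add: d_def field_simps)
  obtain \<delta> where \<delta>: "\<delta> > 0" "\<And>r x. r \<in> I \<Longrightarrow> \<bar>r - t\<bar> < \<delta> \<Longrightarrow> \<bar>z r x - z t x\<bar> < d" using uc[OF t d] by blast
  have i: "integrable torus_measure (\<lambda>x. (z r x)\<^sup>2 / 2)" if "r \<in> I" for r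
    by (intro integrable_continuous_torus continuous_on_divide continuous_on_power continuous_on_const sc that) auto
  show "\<exists>\<delta>>0. \<forall>r\<in>I. dist r t < \<delta> \<longrightarrow> dist (LINT x|torus_measure. (z r x)\<^sup>2 / 2) (LINT x|torus_measure. (z t x)\<^sup>2 / 2) < e"
  proof (intro exI[of _ \<delta>] conjI ballI impI \<delta>(1))
    fix r assume r: "r \<in> I" "dist r t < \<delta>"
    have "norm (LINT x|torus_measure. (z r x)\<^sup>2 / 2 - (z t x)\<^sup>2 / 2) \<le> (LINT x|torus_measure. norm ((z r x)\<^sup>2 / 2 - (z t x)\<^sup>2 / 2))"
      by (rule integral_norm_bound)
    also have "\<dots> \<le> (LINT x|(torus_measure :: (real^'n) measure). d * B)"
    proof (rule integral_mono)
      show "integrable torus_measure (\<lambda>x. norm ((z r x)\<^sup>2 / 2 - (z t x)\<^sup>2 / 2))"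
        by (rule integrable_norm[OF Bochner_Integration.integrable_diff[OF i[OF r(1)] i[OF t]]])
      show "integrable (torus_measure :: (real^'n) measure) (\<lambda>x. d * B)" by (rule L2_integrable[OF L2_const])
      fix x
      have "\<bar>z r x - z t x\<bar> \<le> d" using \<delta>(2)[OF r(1), of x] r(2) by (simp add: dist_real_def)
      moreover have "\<bar>z r x + z t x\<bar> \<le> 2 * B" using B(2)[OF r(1), of x] B(2)[OF t, of x] by linarith
      ultimately have "\<bar>z r x - z t x\<bar> * \<bar>z r x + z t x\<bar> \<le> d * (2 * B)" using d by (intro mult_mono) auto
      moreover have "(z r x)\<^sup>2 / 2 - (z t x)\<^sup>2 / 2 = (z r x - z t x) * (z r x + z t x) / 2"
        by (simp add: power2_eq_square algebra_simps)
      ultimately show "norm ((z r x)\<^sup>2 / 2 - (z t x)\<^sup>2 / 2) \<le> d * B" by (simp only: real_norm_def abs_divide abs_mult)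
    qed
    also have "\<dots> = d * B" by (rule integral_const_torus)
    finally show "dist (LINT x|torus_measure. (z r x)\<^sup>2 / 2) (LINT x|torus_measure. (z t x)\<^sup>2 / 2) < e"
      using Bd Bochner_Integration.integral_diff[OF i[OF r(1)] i[OF t]] by (simp add: dist_norm)
  qed
qed

lemma sum_UNIV_Inl_Inr_bool:
  fixes f :: "'n::finite + bool \<Rightarrow> real"
  shows "(\<Sum>j\<in>UNIV. f j) = (\<Sum>i\<in>UNIV. f (Inl i)) + f (Inr False) + f (Inr True)"
proof -
  have "(\<Sum>j\<in>UNIV. f j) = (\<Sum>j\<in>(UNIV::'n set) <+> (UNIV::bool set). f j)" by (simp only: UNIV_Plus_UNIV)
  also have "\<dots> = (\<Sum>i\<in>UNIV. f (Inl i)) + (\<Sum>c\<in>UNIV. f (Inr c))" by (subst sum.Plus) (auto simp: comp_def)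
  finally show ?thesis by (simp add: UNIV_bool)
qed

lemma energy_const_nonneg: "n \<ge> 0 \<Longrightarrow> c > 0 \<Longrightarrow> A \<ge> 0 \<Longrightarrow> M \<ge> 0 \<Longrightarrow> 0 \<le> energy_const n c A N M"
  unfolding energy_const_def by (intro add_nonneg_nonneg divide_nonneg_pos) auto

text \<open>A fixed time \<open>t1 < T\<close> is considered because the positive lower bound and
  the supremum bounds, hence the Gronwall constant, are tied to [0, t1].\<close>

lemma kolmogorov_unique:
  fixes v1 v2 dv1 dv2 :: "real \<Rightarrow> real^'n \<Rightarrow> real^'n" and \<omega>1 \<omega>2 d\<omega>1 d\<omega>2 b1 b2 db1 db2 :: "real \<Rightarrow> real^'n \<Rightarrow> real"
  assumes K1: "kolmogorov \<alpha> T s v1 dv1 \<omega>1 d\<omega>1 b1 db1 h1 m1" and K2: "kolmogorov \<alpha> T s v2 dv2 \<omega>2 d\<omega>2 b2 db2 h2 m2"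
    and init: "v1 0 = v2 0" "\<omega>1 0 = \<omega>2 0" "b1 0 = b2 0" and t1: "0 \<le> t1" "t1 < T"
  shows "v1 t1 = v2 t1" "\<omega>1 t1 = \<omega>2 t1" "b1 t1 = b2 t1"
proof -
  interpret K1: kolmogorov \<alpha> T s v1 dv1 \<omega>1 d\<omega>1 b1 db1 h1 m1 by (rule K1)
  interpret K2: kolmogorov \<alpha> T s v2 dv2 \<omega>2 d\<omega>2 b2 db2 h2 m2 by (rule K2)
  \<comment> \<open>All unknowns in one family: \<open>Inl i\<close> for the velocity components,
    \<open>Inr False\<close> for \<omega> and \<open>Inr True\<close> for b. A single application of
    the energy lemma then treats the coupled system.\<close>
  define u1 :: "'n + bool \<Rightarrow> real \<Rightarrow> real^'n \<Rightarrow> real" where "u1 j = (case j of Inl i \<Rightarrow> (\<lambda>t x. v1 t x $ i) | Inr c \<Rightarrow> if c then b1 else \<omega>1)" for j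
  define u2 :: "'n + bool \<Rightarrow> real \<Rightarrow> real^'n \<Rightarrow> real" where "u2 j = (case j of Inl i \<Rightarrow> (\<lambda>t x. v2 t x $ i) | Inr c \<Rightarrow> if c then b2 else \<omega>2)" for j
  define d1 :: "'n + bool \<Rightarrow> real \<Rightarrow> real^'n \<Rightarrow> real" where "d1 j = (case j of Inl i \<Rightarrow> (\<lambda>t x. dv1 t x $ i) | Inr c \<Rightarrow> if c then db1 else d\<omega>1)" for j
  define d2 :: "'n + bool \<Rightarrow> real \<Rightarrow> real^'n \<Rightarrow> real" where "d2 j = (case j of Inl i \<Rightarrow> (\<lambda>t x. dv2 t x $ i) | Inr c \<Rightarrow> if c then db2 else d\<omega>2)" for j
  have P1: "sobolev_path T s (u1 j) (d1 j) h1" for j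
    using K1.Pv K1.P\<omega> K1.Pb by (cases j) (auto simp: u1_def d1_def)
  have P2: "sobolev_path T s (u2 j) (d2 j) h2" for j
    using K2.Pv K2.P\<omega> K2.Pb by (cases j) (auto simp: u2_def d2_def)
  define z where "z j t x = u1 j t x - u2 j t x" for j t x
  define dz where "dz j t x = d1 j t x - d2 j t x" for j t x
  have tT: "t \<in> {0..<T}" if "t \<in> {0..t1}" for t using that t1 by auto
  have path: "l2_path t1 (\<lambda>t. 2 * h1 t + 2 * h2 t) (z j) (dz j)" for j
    unfolding z_def[abs_def] dz_def[abs_def]
    by (rule l2_path_diff[OF sobolev_path.path[OF P1 t1] sobolev_path.path[OF P2 t1]])
  have zc: "continuous_on UNIV (z j t)" if "t \<in> {0..t1}" for j t
    unfolding z_def[abs_def] by (intro continuous_on_diff sobolev_path.space_continuous[OF P1 tT[OF that]] sobolev_path.space_continuous[OF P2 tT[OF that]])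
  have zp: "periodic (z j t)" if "t \<in> {0..t1}" for j t
    using sobolev_path.space_periodic[OF P1 tT[OF that]] sobolev_path.space_periodic[OF P2 tT[OF that]]
    by (simp add: periodic_def z_def)
  have zL: "z j t \<in> L2_torus" if "t \<in> {0..t1}" for j t by (rule continuous_periodic_L2[OF zp[OF that] zc[OF that]])
  define F where "F t = (\<Sum>j\<in>UNIV. LINT x|torus_measure. (z j t x)\<^sup>2 / 2)" for t
  have Fc: "continuous_on {0..t1} F"
    unfolding F_def[abs_def]
  proof (intro continuous_on_sum)
    fix j :: "'n + bool"
    obtain A1 where A1: "A1 > 0" "\<And>t x. t \<in> {0..t1} \<Longrightarrow> \<bar>u1 j t x\<bar> \<le> A1" using sobolev_path.locally_bounded[OF P1 t1] by blast
    obtain A2 where A2: "A2 > 0" "\<And>t x. t \<in> {0..t1} \<Longrightarrow> \<bar>u2 j t x\<bar> \<le> A2" using sobolev_path.locally_bounded[OF P2 t1] by blast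
    show "continuous_on {0..t1} (\<lambda>t. LINT x|torus_measure. (z j t x)\<^sup>2 / 2)"
    proof (rule continuous_l2_energy[OF _ _ _ zc])
      show "0 \<le> A1 + A2" using A1 A2 by simp
      show "\<bar>z j t x\<bar> \<le> A1 + A2" if "t \<in> {0..t1}" for t x
        using A1(2)[OF that, of x] A2(2)[OF that, of x] unfolding z_def by linarith
      fix t e :: real assume t: "t \<in> {0..t1}" and e: "e > 0"
      then have e2: "e / 2 > 0" by simp
      obtain a1 where a1: "a1 > 0" "\<And>r x. r \<in> {0..<T} \<Longrightarrow> \<bar>r - t\<bar> < a1 \<Longrightarrow> \<bar>u1 j r x - u1 j t x\<bar> < e / 2"
        using sobolev_path.time_uniform_continuity[OF P1 tT[OF t] e2] by blast
      obtain a2 where a2: "a2 > 0" "\<And>r x. r \<in> {0..<T} \<Longrightarrow> \<bar>r - t\<bar> < a2 \<Longrightarrow> \<bar>u2 j r x - u2 j t x\<bar> < e / 2"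
        using sobolev_path.time_uniform_continuity[OF P2 tT[OF t] e2] by blast
      show "\<exists>\<delta>>0. \<forall>r\<in>{0..t1}. \<bar>r - t\<bar> < \<delta> \<longrightarrow> (\<forall>x. \<bar>z j r x - z j t x\<bar> < e)"
      proof (intro exI[of _ "min a1 a2"] conjI ballI impI allI)
        show "min a1 a2 > 0" using a1 a2 by simp
        fix r x assume r: "r \<in> {0..t1}" "\<bar>r - t\<bar> < min a1 a2"
        have "\<bar>u1 j r x - u1 j t x\<bar> < e / 2" using r by (intro a1(2) tT) auto
        moreover have "\<bar>u2 j r x - u2 j t x\<bar> < e / 2" using r by (intro a2(2) tT) auto
        ultimately show "\<bar>z j r x - z j t x\<bar> < e" unfolding z_def by argo
      qed
    qed
  qed
  have F0: "F 0 = 0"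
  proof -
    have "z j 0 x = 0" for j x using init by (cases j) (auto simp: z_def u1_def u2_def)
    then show ?thesis by (simp add: F_def)
  qed
  have F_eq: "F t = (\<Sum>j\<in>UNIV. l2_inner (z j t) (z j t)) / 2" for t
    by (simp add: F_def l2_inner_self sum_divide_distrib)
  have Fn: "0 \<le> F t" for t unfolding F_def by (intro sum_nonneg) simp
  obtain c1 where c1: "c1 > 0" "\<And>t x. t \<in> {0..t1} \<Longrightarrow> c1 \<le> \<omega>1 t x \<and> c1 \<le> b1 t x" using K1.positivity[OF t1] by blast
  obtain c2 where c2: "c2 > 0" "\<And>t x. t \<in> {0..t1} \<Longrightarrow> c2 \<le> \<omega>2 t x \<and> c2 \<le> b2 t x" using K2.positivity[OF t1] by blast
  obtain M1 where M1: "M1 > 0" "\<And>t x. t \<in> {0..t1} \<Longrightarrow> \<bar>\<omega>1 t x\<bar> \<le> M1" using K1.om.locally_bounded[OF t1] by blast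
  obtain M2 where M2: "M2 > 0" "\<And>t x. t \<in> {0..t1} \<Longrightarrow> \<bar>\<omega>2 t x\<bar> \<le> M2" using K2.om.locally_bounded[OF t1] by blast
  obtain M3 where M3: "M3 > 0" "\<And>t x. t \<in> {0..t1} \<Longrightarrow> \<bar>b1 t x\<bar> \<le> M3" using K1.en.locally_bounded[OF t1] by blast
  obtain M4 where M4: "M4 > 0" "\<And>t x. t \<in> {0..t1} \<Longrightarrow> \<bar>b2 t x\<bar> \<le> M4" using K2.en.locally_bounded[OF t1] by blast
  define m where "m = min c1 c2"
  define M where "M = M1 + M2 + M3 + M4"
  have m: "m > 0" using c1 c2 by (simp add: m_def)
  have Mp: "M > 0" using M1 M2 M3 M4 by (simp add: M_def)
  have bounds: "m \<le> \<omega>1 t x \<and> \<omega>1 t x \<le> M \<and> m \<le> \<omega>2 t x \<and> \<omega>2 t x \<le> M \<and> m \<le> b1 t x \<and> b1 t x \<le> M \<and> m \<le> b2 t x \<and> b2 t x \<le> M"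
    if "t \<in> {0..t1}" for t x
    using c1(2)[OF that, of x] c2(2)[OF that, of x] M1(2)[OF that, of x] M2(2)[OF that, of x] M3(2)[OF that, of x] M4(2)[OF that, of x]
      M1(1) M2(1) M3(1) M4(1) unfolding m_def M_def by (auto simp: abs_le_iff)
  obtain E1 where E1: "negligible E1"
    "\<And>t. t \<in> {0..T} - E1 \<Longrightarrow> (\<And>x. \<omega>1 t x > 0) \<Longrightarrow> slice \<alpha> (v1 t) (dv1 t) (\<omega>1 t) (d\<omega>1 t) (b1 t) (db1 t)"
    "\<And>t i j x. t \<in> {0..T} - E1 \<Longrightarrow> \<bar>classical_partial i (\<lambda>y. v1 t y $ j) x\<bar> \<le> (emb TYPE('n) s * sqrt (h1 t))"
    "\<And>t i x. t \<in> {0..T} - E1 \<Longrightarrow> \<bar>classical_partial i (\<omega>1 t) x\<bar> \<le> (emb TYPE('n) s * sqrt (h1 t))"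
    "\<And>t i x. t \<in> {0..T} - E1 \<Longrightarrow> \<bar>classical_partial i (b1 t) x\<bar> \<le> (emb TYPE('n) s * sqrt (h1 t))"
    "\<And>t i. t \<in> {0..T} - E1 \<Longrightarrow> (\<lambda>x. dv1 t x $ i) \<in> L2_torus"
    "\<And>t. t \<in> {0..T} - E1 \<Longrightarrow> d\<omega>1 t \<in> L2_torus" "\<And>t. t \<in> {0..T} - E1 \<Longrightarrow> db1 t \<in> L2_torus"
    by (rule K1.regular_slices) blast
  obtain E2 where E2: "negligible E2"
    "\<And>t. t \<in> {0..T} - E2 \<Longrightarrow> (\<And>x. \<omega>2 t x > 0) \<Longrightarrow> slice \<alpha> (v2 t) (dv2 t) (\<omega>2 t) (d\<omega>2 t) (b2 t) (db2 t)"
    "\<And>t i j x. t \<in> {0..T} - E2 \<Longrightarrow> \<bar>classical_partial i (\<lambda>y. v2 t y $ j) x\<bar> \<le> (emb TYPE('n) s * sqrt (h2 t))"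
    "\<And>t i x. t \<in> {0..T} - E2 \<Longrightarrow> \<bar>classical_partial i (\<omega>2 t) x\<bar> \<le> (emb TYPE('n) s * sqrt (h2 t))"
    "\<And>t i x. t \<in> {0..T} - E2 \<Longrightarrow> \<bar>classical_partial i (b2 t) x\<bar> \<le> (emb TYPE('n) s * sqrt (h2 t))"
    "\<And>t i. t \<in> {0..T} - E2 \<Longrightarrow> (\<lambda>x. dv2 t x $ i) \<in> L2_torus"
    "\<And>t. t \<in> {0..T} - E2 \<Longrightarrow> d\<omega>2 t \<in> L2_torus" "\<And>t. t \<in> {0..T} - E2 \<Longrightarrow> db2 t \<in> L2_torus"
    by (rule K2.regular_slices) blast
  define n where "n = real CARD('n)"
  \<comment> \<open>The factor for the symmetric gradient; as \<open>n \<le> n^2\<close> it also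
    covers the plain gradients.\<close>
  define A where "A = n\<^sup>2 * emb TYPE('n) s"
  have n1: "n \<ge> 1" using K1.om.dim by (simp add: n_def)
  have nn: "n \<le> n\<^sup>2" using n1 by (simp add: power2_eq_square)
  define K where "K = energy_const n (m / M) (M / m\<^sup>2) (M / m) M"
  have K0: "0 \<le> K" unfolding K_def using n1 m Mp by (intro energy_const_nonneg) auto
  \<comment> \<open>Its root serves as the bound \<open>L\<close> on all gradients: the summand 1
    ensures L \<ge> 1, and \<open>L^2 = Q t\<close> is integrable because \<open>h1\<close> and
    \<open>h2\<close> are.\<close>
  define Q where "Q t = 1 + A\<^sup>2 * (h1 t + h2 t)" for t
  have Q1: "1 \<le> Q t" for t using K1.h_nonneg[of t] K2.h_nonneg[of t] by (simp add: Q_def)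
  have gb: "n\<^sup>2 * (emb TYPE('n) s * sqrt (h1 t)) \<le> sqrt (Q t)" "n\<^sup>2 * (emb TYPE('n) s * sqrt (h2 t)) \<le> sqrt (Q t)" "n * (emb TYPE('n) s * sqrt (h1 t)) \<le> sqrt (Q t)" "n * (emb TYPE('n) s * sqrt (h2 t)) \<le> sqrt (Q t)" for t
  proof -
    have A0: "0 \<le> A" using emb_nonneg[where 'n='n, of s] by (simp add: A_def)
    have h0: "0 \<le> h1 t" "0 \<le> h2 t" by (rule K1.h_nonneg, rule K2.h_nonneg)
    have g0: "0 \<le> (emb TYPE('n) s * sqrt (h1 t))" "0 \<le> (emb TYPE('n) s * sqrt (h2 t))" using emb_nonneg[where 'n='n, of s] h0 by simp_all
    have "n\<^sup>2 * (emb TYPE('n) s * sqrt (h1 t)) = sqrt (A\<^sup>2 * h1 t)" "n\<^sup>2 * (emb TYPE('n) s * sqrt (h2 t)) = sqrt (A\<^sup>2 * h2 t)"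
      using A0 by (simp_all add: real_sqrt_mult A_def)
    moreover have "A\<^sup>2 * h1 t \<le> Q t" "A\<^sup>2 * h2 t \<le> Q t"
      using h0 mult_nonneg_nonneg[OF zero_le_power2[of A] h0(1)] mult_nonneg_nonneg[OF zero_le_power2[of A] h0(2)] by (auto simp: Q_def distrib_left)
    ultimately show a: "n\<^sup>2 * (emb TYPE('n) s * sqrt (h1 t)) \<le> sqrt (Q t)" "n\<^sup>2 * (emb TYPE('n) s * sqrt (h2 t)) \<le> sqrt (Q t)" by (simp_all only: real_sqrt_le_iff)
    show "n * (emb TYPE('n) s * sqrt (h1 t)) \<le> sqrt (Q t)" "n * (emb TYPE('n) s * sqrt (h2 t)) \<le> sqrt (Q t)"
      using mult_right_mono[OF nn g0(1)] mult_right_mono[OF nn g0(2)] a by linarith+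
  qed
  \<comment> \<open>The factor 2 compensates the halves in the definition of
    \<open>F\<close>.\<close>
  define h where "h t = 2 * K * Q t" for t
  have hn: "0 \<le> h t" for t using K0 Q1[of t] by (simp add: h_def)
  have hi: "h integrable_on {0..t1}"
  proof -
    have "h1 integrable_on {0..t1}" "h2 integrable_on {0..t1}"
      using K1.om.h_int K2.om.h_int t1 by (auto intro: time_integrable)
    then show ?thesis unfolding h_def[abs_def] Q_def by (intro integrable_on_mult_right integrable_add) auto
  qed
  have key: "(\<Sum>j\<in>UNIV. l2_inner (dz j t) (z j t)) \<le> h t * F t" if t: "t \<in> {0..t1} - (E1 \<union> E2)" for t
  proof -
    have tt: "t \<in> {0..t1}" "t \<in> {0..T} - E1" "t \<in> {0..T} - E2" using t t1 by auto
    have S1: "slice \<alpha> (v1 t) (dv1 t) (\<omega>1 t) (d\<omega>1 t) (b1 t) (db1 t)" by (rule E1(2)[OF tt(2)]) (use bounds[OF tt(1)] m in \<open>meson less_le_trans\<close>)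
    have S2: "slice \<alpha> (v2 t) (dv2 t) (\<omega>2 t) (d\<omega>2 t) (b2 t) (db2 t)" by (rule E2(2)[OF tt(3)]) (use bounds[OF tt(1)] m in \<open>meson less_le_trans\<close>)
    have cg: "norm (cgrad f x) \<le> sqrt (Q t)" if "\<And>i. \<bar>classical_partial i f x\<bar> \<le> (emb TYPE('n) s * sqrt (h1 t))" for f :: "real^'n \<Rightarrow> real" and x
      using norm_cgrad_le[OF that] gb(3)[of t] unfolding n_def by linarith
    have cg2: "norm (cgrad f x) \<le> sqrt (Q t)" if "\<And>i. \<bar>classical_partial i f x\<bar> \<le> (emb TYPE('n) s * sqrt (h2 t))" for f :: "real^'n \<Rightarrow> real" and x
      using norm_cgrad_le[OF that] gb(4)[of t] unfolding n_def by linarith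
    have cs1: "norm (csym (v1 t) x) \<le> sqrt (Q t)" for x using norm_csym_le[OF E1(3)[OF tt(2)], of x] gb(1)[of t] unfolding n_def by linarith
    have cs2: "norm (csym (v2 t) x) \<le> sqrt (Q t)" for x using norm_csym_le[OF E2(3)[OF tt(3)], of x] gb(2)[of t] unfolding n_def by linarith
    have sq: "(sqrt (Q t))\<^sup>2 = Q t" "1 \<le> sqrt (Q t)" using Q1[of t] by simp_all
    have zz: "z (Inl i) t = (\<lambda>x. v1 t x $ i - v2 t x $ i)" "z (Inr False) t = (\<lambda>x. \<omega>1 t x - \<omega>2 t x)" "z (Inr True) t = (\<lambda>x. b1 t x - b2 t x)"
      "dz (Inl i) t = (\<lambda>x. dv1 t x $ i - dv2 t x $ i)" "dz (Inr False) t = (\<lambda>x. d\<omega>1 t x - d\<omega>2 t x)" "dz (Inr True) t = (\<lambda>x. db1 t x - db2 t x)" for i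
      by (simp_all add: fun_eq_iff z_def dz_def u1_def u2_def d1_def d2_def)
    have "(\<Sum>j\<in>UNIV. l2_inner (dz j t) (z j t)) \<le> energy_const (real CARD('n)) (m / M) (M / m\<^sup>2) (M / m) M * (sqrt (Q t))\<^sup>2 * (\<Sum>j\<in>UNIV. l2_inner (z j t) (z j t))"
      unfolding sum_UNIV_Inl_Inr_bool zz
      by (rule energy_inequality[OF S1 S2 K1.\<alpha> m bounds[OF tt(1)] sq(2) cg[OF E1(3)[OF tt(2)]] cs1 cs2 cg[OF E1(4)[OF tt(2)]] cg2[OF E2(4)[OF tt(3)]]
            cg[OF E1(5)[OF tt(2)]] cg2[OF E2(5)[OF tt(3)]] E1(6)[OF tt(2)] E2(6)[OF tt(3)] E1(7)[OF tt(2)] E2(7)[OF tt(3)] E1(8)[OF tt(2)] E2(8)[OF tt(3)]])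
    then show ?thesis unfolding F_eq h_def K_def n_def sq(1) by simp
  qed
  have "F t1 = 0"
  proof (rule gronwall_zero[OF Fc F0 Fn hi hn])
    show "t1 \<in> {0..t1}" using t1 by simp
    fix a c S assume ac: "0 \<le> a" "a \<le> c" "c \<le> t1" and S: "\<And>t. t \<in> {a..c} \<Longrightarrow> F t \<le> S"
    have hac: "h integrable_on {a..c}" by (rule integrable_subinterval_real[OF hi]) (use ac in auto)
    have "(\<Sum>j\<in>UNIV. LINT x|torus_measure. (z j c x)\<^sup>2 / 2) - (\<Sum>j\<in>UNIV. LINT x|torus_measure. (z j a x)\<^sup>2 / 2) \<le> integral {a..c} (\<lambda>t. S * h t)"
    proof (rule l2_path_energy[where R=UNIV and G'="\<lambda>r. r" and L=1, OF _ path])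
      show "negligible (E1 \<union> E2)" using E1(1) E2(1) by (rule negligible_Un)
      show "(\<lambda>t. S * h t) integrable_on {a..c}" by (rule integrable_on_mult_right[OF hac])
      show "integrable torus_measure (\<lambda>x. (z i t x)\<^sup>2 / 2)" if "t \<in> {0..t1}" for i t
        by (intro integrable_continuous_torus continuous_on_divide continuous_on_power continuous_on_const zc that) auto
      show "(\<lambda>x. z i t x) \<in> L2_torus" if "t \<in> {0..t1}" for i t using zL[OF that] by simp
      show "p\<^sup>2 / 2 - q\<^sup>2 / 2 \<le> p * (p - q)" for p q :: real
        using sum_squares_bound[of p q] by (simp add: power2_eq_square algebra_simps)
      fix t assume t: "t \<in> {a..c} - (E1 \<union> E2)"
      then have "t \<in> {0..t1} - (E1 \<union> E2)" using ac by auto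
      then have "(\<Sum>j\<in>UNIV. l2_inner (dz j t) (z j t)) \<le> h t * F t" by (rule key)
      also have "\<dots> \<le> h t * S" using t by (intro mult_left_mono S hn) auto
      finally show "(\<Sum>i\<in>UNIV. l2_inner (dz i t) (\<lambda>x. z i t x)) \<le> S * h t" by (simp add: mult.commute)
    qed (use ac in auto)
    then show "F c - F a \<le> S * integral {a..c} h" by (simp add: F_def)
  qed
  then have "(LINT x|torus_measure. (z j t1 x)\<^sup>2 / 2) = 0" for j
    unfolding F_def by (subst (asm) sum_nonneg_eq_0_iff) auto
  then have z0: "z j t1 x = 0" for j x
  proof -
    have t: "t1 \<in> {0..t1}" using t1 by simp
    obtain y where y: "y \<in> torus" "z j t1 y = z j t1 x" using periodic_torus[OF zp[OF t]] by blast
    have c: "continuous_on UNIV (\<lambda>x. (z j t1 x)\<^sup>2 / 2)" by (intro continuous_on_divide continuous_on_power continuous_on_const zc[OF t]) auto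
    have "(z j t1 y)\<^sup>2 / 2 = 0"
      by (rule continuous_eq_0_of_integral_eq_0[OF c _ \<open>(LINT x|torus_measure. (z j t1 x)\<^sup>2 / 2) = 0\<close> y(1)]) simp
    then show ?thesis using y(2) by simp
  qed
  show "v1 t1 = v2 t1" using z0[of "Inl _"] by (simp add: fun_eq_iff vec_eq_iff z_def u1_def u2_def)
  show "\<omega>1 t1 = \<omega>2 t1" using z0[of "Inr False"] by (simp add: fun_eq_iff z_def u1_def u2_def)
  show "b1 t1 = b2 t1" using z0[of "Inr True"] by (simp add: fun_eq_iff z_def u1_def u2_def)
qed

section \<open>From the function-space hypotheses to abstract paths, and the conclusion\<close>

section \<open>Spaces of solutions\<close>

lemma sobolev_periodic: "u \<in> sobolev s \<Longrightarrow> periodic u"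
  using sobolevD(1) by (auto simp: L2_torus_def)

lemma periodic_eqI:
  assumes "periodic f" "periodic g" "\<And>x. x \<in> torus \<Longrightarrow> f x = g x"
  shows "f = g"
proof
  fix x
  have "periodic (\<lambda>x. (f x, g x))" using assms(1,2) by (simp add: periodic_def)
  from periodic_torus[OF this, of x] obtain y where "y \<in> torus" "f y = f x" "g y = g x" by auto
  then show "f x = g x" using assms(3)[of y] by simp
qed

text \<open>The Sobolev embedding makes the range bounded below, without which the infimum of reals
  would carry no information.\<close>

lemma sobolev_INF_le:
  fixes f :: "real^'n \<Rightarrow> real"
  assumes "s > real CARD('n) / 2" "f \<in> sobolev s"
  shows "(INF y\<in>torus. f y) \<le> f x"
proof -
  obtain y where y: "y \<in> torus" "f y = f x" using periodic_torus[OF sobolev_periodic[OF assms(2)]] by blast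
  have "- (emb TYPE('n) s * sobolev_norm s f) \<le> f z" for z using sobolev_sup_bound[OF assms, of z] by linarith
  then have "bdd_below (f ` torus)" by (intro bdd_belowI2) auto
  then have "(INF y\<in>torus. f y) \<le> f y" using y(1) by (rule cINF_lower)
  with y show ?thesis by simp
qed

lemma sobolev_norm_component_le: "sobolev_norm s (\<lambda>x. f x $ i) \<le> sobolev_vec_norm s f"
  unfolding sobolev_vec_norm_def
  using member_le_sum[of i UNIV "\<lambda>i. (sobolev_norm s (\<lambda>x. f x $ i))\<^sup>2"] by (auto intro: real_le_rsqrt)

lemma sobolev_norm_component_sq_le: "(sobolev_norm s (\<lambda>x. f x $ i))\<^sup>2 \<le> (sobolev_vec_norm s f)\<^sup>2"
  by (rule power_mono[OF sobolev_norm_component_le sobolev_norm_nonneg])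

lemma sobolev_div_component: "f \<in> sobolev_div s \<Longrightarrow> (\<lambda>x. f x $ i) \<in> sobolev s"
  by (simp add: sobolev_div_def sobolev_vec_def)

lemma div_free_scale: "div_free v \<Longrightarrow> div_free (\<lambda>x. c *\<^sub>R v x)"
  by (simp add: div_free_def l2_inner_def)

lemma sobolev_div_zero: "(\<lambda>x. 0) \<in> sobolev_div s"
  by (simp add: sobolev_div_def sobolev_vec_def sobolev_zero div_free_def l2_inner_def)

lemma sobolev_div_scale: "f \<in> sobolev_div s \<Longrightarrow> (\<lambda>x. c *\<^sub>R f x) \<in> sobolev_div s"
  by (simp add: sobolev_div_def sobolev_vec_def sobolev_scale div_free_scale)

lemma sobolev_div_add:
  assumes "f \<in> sobolev_div s" "g \<in> sobolev_div s"
  shows "(\<lambda>x. f x + g x) \<in> sobolev_div s"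
proof -
  have g: "(\<lambda>x. (-1) *\<^sub>R g x) \<in> sobolev_div s" by (rule sobolev_div_scale[OF assms(2)])
  have "div_free (\<lambda>x. f x - (-1) *\<^sub>R g x)"
    by (rule div_free_diff[OF sobolevD(1)[OF sobolev_div_component[OF assms(1)]] sobolevD(1)[OF sobolev_div_component[OF g]]])
      (use assms g in \<open>auto simp: sobolev_div_def\<close>)
  then show ?thesis using assms by (simp add: sobolev_div_def sobolev_vec_def sobolev_add)
qed

text \<open>The summand 1 keeps the constant positive even for a vanishing \<open>w\<close>, as
  \<open>bounded_functional\<close> demands.\<close>

lemma abs_l2_inner_le:
  assumes "0 \<le> s" "f \<in> sobolev s" "w \<in> L2_torus"
  shows "\<bar>l2_inner f w\<bar> \<le> (sqrt (l2_inner w w) + 1) * sobolev_norm s f"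
proof -
  have "\<bar>l2_inner f w\<bar> \<le> sqrt (l2_inner f f) * sqrt (l2_inner w w)" by (rule l2_cauchy_schwarz[OF sobolevD(1)[OF assms(2)] assms(3)])
  also have "\<dots> \<le> sobolev_norm s f * (sqrt (l2_inner w w) + 1)"
    using real_sqrt_le_mono[OF l2_le_sobolev_norm[OF assms(1,2)]] by (intro mult_mono) (auto simp: sobolev_norm_nonneg l2_inner_self_nonneg)
  finally show ?thesis by (simp add: mult.commute)
qed

lemma l2_functional_pos: "sqrt (l2_inner w w) + 1 > 0" for w :: "real^'n \<Rightarrow> real"
  using real_sqrt_ge_zero[OF l2_inner_self_nonneg[of w]] by linarith

lemma l2_functional:
  fixes w :: "real^'n \<Rightarrow> real"
  assumes "0 \<le> s" "w \<in> L2_torus"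
  shows "bounded_functional (sobolev s) (sobolev_norm s) (\<lambda>f. l2_inner f w) (sqrt (l2_inner w w) + 1)"
proof
  fix f g :: "real^'n \<Rightarrow> real" and c :: real
  assume f: "f \<in> sobolev s"
  show "(\<lambda>x. c *\<^sub>R f x) \<in> sobolev s" using sobolev_scale[OF f] by simp
  show "l2_inner (\<lambda>x. c *\<^sub>R f x) w = c * l2_inner f w" by (simp add: l2_inner_scale)
  show "\<bar>l2_inner f w\<bar> \<le> (sqrt (l2_inner w w) + 1) * sobolev_norm s f" by (rule abs_l2_inner_le[OF assms(1) f assms(2)])
  assume g: "g \<in> sobolev s"
  show "(\<lambda>x. f x + g x) \<in> sobolev s" by (rule sobolev_add[OF f g])
  show "l2_inner (\<lambda>x. f x + g x) w = l2_inner f w + l2_inner g w" by (rule l2_inner_add[OF sobolevD(1)[OF f] sobolevD(1)[OF g] assms(2)])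
qed (simp_all add: sobolev_zero l2_functional_pos)

lemma l2_component_functional:
  fixes w :: "real^'n \<Rightarrow> real"
  assumes "0 \<le> s" "w \<in> L2_torus"
  shows "bounded_functional (sobolev_div s) (sobolev_vec_norm s) (\<lambda>f. l2_inner (\<lambda>x. f x $ i) w) (sqrt (l2_inner w w) + 1)"
proof
  fix f g :: "real^'n \<Rightarrow> real^'n" and c :: real
  assume f: "f \<in> sobolev_div s"
  note fi = sobolev_div_component[OF f, of i]
  show "(\<lambda>x. c *\<^sub>R f x) \<in> sobolev_div s" by (rule sobolev_div_scale[OF f])
  show "l2_inner (\<lambda>x. (c *\<^sub>R f x) $ i) w = c * l2_inner (\<lambda>x. f x $ i) w" by (simp add: l2_inner_scale)
  have "\<bar>l2_inner (\<lambda>x. f x $ i) w\<bar> \<le> (sqrt (l2_inner w w) + 1) * sobolev_norm s (\<lambda>x. f x $ i)" by (rule abs_l2_inner_le[OF assms(1) fi assms(2)])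
  also have "\<dots> \<le> (sqrt (l2_inner w w) + 1) * sobolev_vec_norm s f"
    by (intro mult_left_mono sobolev_norm_component_le less_imp_le l2_functional_pos)
  finally show "\<bar>l2_inner (\<lambda>x. f x $ i) w\<bar> \<le> (sqrt (l2_inner w w) + 1) * sobolev_vec_norm s f" .
  assume g: "g \<in> sobolev_div s"
  show "(\<lambda>x. f x + g x) \<in> sobolev_div s" by (rule sobolev_div_add[OF f g])
  show "l2_inner (\<lambda>x. (f x + g x) $ i) w = l2_inner (\<lambda>x. f x $ i) w + l2_inner (\<lambda>x. g x $ i) w"
    using l2_inner_add[OF sobolevD(1)[OF fi] sobolevD(1)[OF sobolev_div_component[OF g, of i]] assms(2)] by simp
qed (simp_all add: sobolev_div_zero l2_functional_pos)

lemma (in bounded_functional) C_time_continuous: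
  assumes u: "u \<in> C_time I X N"
  shows "continuous_on I (\<lambda>t. \<Phi> (u t))"
  unfolding continuous_on_def
proof
  fix t assume t: "t \<in> I"
  have uX: "u r \<in> X" if "r \<in> I" for r using u that by (auto simp: C_time_def)
  have "((\<lambda>r. N (\<lambda>x. u r x - u t x)) \<longlongrightarrow> 0) (at t within I)" using u t by (simp add: C_time_def)
  then have "((\<lambda>r. C * N (\<lambda>x. u r x - u t x)) \<longlongrightarrow> 0) (at t within I)" by (rule tendsto_mult_right_zero)
  moreover have "\<forall>\<^sub>F r in at t within I. norm (\<Phi> (u r) - \<Phi> (u t)) \<le> C * N (\<lambda>x. u r x - u t x)"
    unfolding eventually_at_filter
  proof (rule always_eventually, intro allI impI)
    fix r assume "r \<in> I"
    then show "norm (\<Phi> (u r) - \<Phi> (u t)) \<le> C * N (\<lambda>x. u r x - u t x)"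
      using bound[OF X_diff[OF uX uX[OF t], of r]] diff[OF uX uX[OF t], of r] by simp
  qed
  ultimately have "((\<lambda>r. \<Phi> (u r) - \<Phi> (u t)) \<longlongrightarrow> 0) (at t within I)" by (rule Lim_null_comparison[rotated])
  then show "((\<lambda>r. \<Phi> (u r)) \<longlongrightarrow> \<Phi> (u t)) (at t within I)" by (rule LIM_zero_cancel)
qed

text \<open>Pairing with a fixed L^2 function is bounded on H^s and, as s - 1 \<ge> 0, also on
  H^(s-1). Continuity in time is read off in the first space, the weak derivative in the
  second.\<close>

lemma sobolev_path_scalar:
  fixes u :: "real \<Rightarrow> real^'n \<Rightarrow> real"
  assumes T: "T > 0" and dim: "CARD('n) \<ge> 2" and s: "s > real CARD('n) / 2"
    and u: "u \<in> C_time {0..<T} (sobolev s) (sobolev_norm s)" "u \<in> L2_time T (sobolev (s + 1)) (sobolev_norm (s + 1))"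
    and W: "W12_time T (sobolev (s - 1)) (sobolev_norm (s - 1)) u du"
    and h: "integrable (lebesgue_on {0<..<T}) h" "\<And>t. (sobolev_norm (s + 1) (u t))\<^sup>2 \<le> h t" "\<And>t. (sobolev_norm (s - 1) (du t))\<^sup>2 \<le> h t"
  shows "sobolev_path T s u du h"
proof
  have s0: "0 \<le> s" "0 \<le> s - 1" using s dim by linarith+
  show "T > 0" "CARD('n) \<ge> 2" "s > real CARD('n) / 2" "integrable (lebesgue_on {0<..<T}) h" by (fact T dim s h)+
  show "u t \<in> sobolev s" if "t \<in> {0..<T}" for t using u(1) that by (simp add: C_time_def)
  show "((\<lambda>r. sobolev_norm s (\<lambda>x. u r x - u t x)) \<longlongrightarrow> 0) (at t within {0..<T})" if "t \<in> {0..<T}" for t using u(1) that by (simp add: C_time_def)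
  have "AE t in lebesgue_on {0<..<T}. u t \<in> sobolev (s + 1)" using u(2) by (simp add: L2_time_def strongly_measurable_def)
  then show "AE t in lebesgue_on {0<..<T}. u t \<in> sobolev (s + 1) \<and> (sobolev_norm (s + 1) (u t))\<^sup>2 \<le> h t"
    by eventually_elim (simp add: h(2))
  have "AE t in lebesgue_on {0<..<T}. du t \<in> sobolev (s - 1)" using W by (simp add: W12_time_def L2_time_def strongly_measurable_def)
  then show "AE t in lebesgue_on {0<..<T}. du t \<in> sobolev (s - 1) \<and> (sobolev_norm (s - 1) (du t))\<^sup>2 \<le> h t"
    by eventually_elim (simp add: h(3))
  fix w :: "real^'n \<Rightarrow> real" assume w: "w \<in> L2_torus"
  note c = bounded_functional.C_time_continuous[OF l2_functional[OF s0(1) w] u(1)]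
  note inc = bounded_functional.W12_functional_increment[OF l2_functional[OF s0(2) w] W c]
  show "integrable (lebesgue_on {0<..<T}) (\<lambda>t. l2_inner (du t) w)" by (rule inc(1))
  fix r t assume "0 \<le> r" "r \<le> t" "t < T"
  then show "l2_inner (u t) w - l2_inner (u r) w = integral {r..t} (\<lambda>t. l2_inner (du t) w)" by (rule inc(2))
qed

lemma sobolev_path_component:
  fixes v :: "real \<Rightarrow> real^'n \<Rightarrow> real^'n"
  assumes T: "T > 0" and dim: "CARD('n) \<ge> 2" and s: "s > real CARD('n) / 2"
    and v: "v \<in> C_time {0..<T} (sobolev_div s) (sobolev_vec_norm s)" "v \<in> L2_time T (sobolev_div (s + 1)) (sobolev_vec_norm (s + 1))"
    and W: "W12_time T (sobolev_div (s - 1)) (sobolev_vec_norm (s - 1)) v dv"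
    and h: "integrable (lebesgue_on {0<..<T}) h" "\<And>t. (sobolev_vec_norm (s + 1) (v t))\<^sup>2 \<le> h t" "\<And>t. (sobolev_vec_norm (s - 1) (dv t))\<^sup>2 \<le> h t"
  shows "sobolev_path T s (\<lambda>t x. v t x $ i) (\<lambda>t x. dv t x $ i) h"
proof
  have s0: "0 \<le> s" "0 \<le> s - 1" using s dim by linarith+
  show "T > 0" "CARD('n) \<ge> 2" "s > real CARD('n) / 2" "integrable (lebesgue_on {0<..<T}) h" by (fact T dim s h)+
  show "(\<lambda>x. v t x $ i) \<in> sobolev s" if "t \<in> {0..<T}" for t using v(1) that by (simp add: C_time_def sobolev_div_component)
  show "((\<lambda>r. sobolev_norm s (\<lambda>x. v r x $ i - v t x $ i)) \<longlongrightarrow> 0) (at t within {0..<T})" if "t \<in> {0..<T}" for t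
  proof (rule Lim_null_comparison)
    show "((\<lambda>r. sobolev_vec_norm s (\<lambda>x. v r x - v t x)) \<longlongrightarrow> 0) (at t within {0..<T})" using v(1) that by (simp add: C_time_def)
    show "\<forall>\<^sub>F r in at t within {0..<T}. norm (sobolev_norm s (\<lambda>x. v r x $ i - v t x $ i)) \<le> sobolev_vec_norm s (\<lambda>x. v r x - v t x)"
    proof (rule always_eventually, rule allI)
      fix r
      show "norm (sobolev_norm s (\<lambda>x. v r x $ i - v t x $ i)) \<le> sobolev_vec_norm s (\<lambda>x. v r x - v t x)"
        using sobolev_norm_component_le[of s "\<lambda>x. v r x - v t x" i] by (simp add: sobolev_norm_nonneg)
    qed
  qed
  have "AE t in lebesgue_on {0<..<T}. v t \<in> sobolev_div (s + 1)" using v(2) by (simp add: L2_time_def strongly_measurable_def)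
  then show "AE t in lebesgue_on {0<..<T}. (\<lambda>x. v t x $ i) \<in> sobolev (s + 1) \<and> (sobolev_norm (s + 1) (\<lambda>x. v t x $ i))\<^sup>2 \<le> h t"
    by eventually_elim (blast intro: sobolev_div_component order_trans[OF sobolev_norm_component_sq_le h(2)])
  have "AE t in lebesgue_on {0<..<T}. dv t \<in> sobolev_div (s - 1)" using W by (simp add: W12_time_def L2_time_def strongly_measurable_def)
  then show "AE t in lebesgue_on {0<..<T}. (\<lambda>x. dv t x $ i) \<in> sobolev (s - 1) \<and> (sobolev_norm (s - 1) (\<lambda>x. dv t x $ i))\<^sup>2 \<le> h t"
    by eventually_elim (blast intro: sobolev_div_component order_trans[OF sobolev_norm_component_sq_le h(3)])
  fix w :: "real^'n \<Rightarrow> real" assume w: "w \<in> L2_torus"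
  note c = bounded_functional.C_time_continuous[OF l2_component_functional[OF s0(1) w] v(1)]
  note inc = bounded_functional.W12_functional_increment[OF l2_component_functional[OF s0(2) w] W c]
  show "integrable (lebesgue_on {0<..<T}) (\<lambda>t. l2_inner (\<lambda>x. dv t x $ i) w)" by (rule inc(1))
  fix r t assume "0 \<le> r" "r \<le> t" "t < T"
  then show "l2_inner (\<lambda>x. v t x $ i) w - l2_inner (\<lambda>x. v r x $ i) w = integral {r..t} (\<lambda>t. l2_inner (\<lambda>x. dv t x $ i) w)" by (rule inc(2))
qed

lemma kolmogorovI:
  fixes v dv :: "real \<Rightarrow> real^'n \<Rightarrow> real^'n" and \<omega> d\<omega> b db :: "real \<Rightarrow> real^'n \<Rightarrow> real"
  assumes dim: "CARD('n) \<ge> 2" and \<alpha>: "\<alpha> > 0" and s: "s > real CARD('n) / 2" and T: "T > 0"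
    and v: "v \<in> C_time {0..<T} (sobolev_div s) (sobolev_vec_norm s) \<inter> L2_time T (sobolev_div (s + 1)) (sobolev_vec_norm (s + 1))"
    and dv: "W12_time T (sobolev_div (s - 1)) (sobolev_vec_norm (s - 1)) v dv"
    and \<omega>: "\<omega> \<in> C_time {0..<T} (sobolev s) (sobolev_norm s) \<inter> L2_time T (sobolev (s + 1)) (sobolev_norm (s + 1))"
    and d\<omega>: "W12_time T (sobolev (s - 1)) (sobolev_norm (s - 1)) \<omega> d\<omega>"
    and b: "b \<in> C_time {0..<T} (sobolev s) (sobolev_norm s) \<inter> L2_time T (sobolev (s + 1)) (sobolev_norm (s + 1))"
    and db: "W12_time T (sobolev (s - 1)) (sobolev_norm (s - 1)) b db"
    and sol: "kolmogorov_weak_solution \<alpha> T v dv \<omega> d\<omega> b db"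
    and pos: "(INF x\<in>torus. \<omega> 0 x) > 0" "(INF x\<in>torus. b 0 x) > 0"
  obtains h m where "kolmogorov \<alpha> T s v dv \<omega> d\<omega> b db h m"
proof -
  \<comment> \<open>The sum of all squared norms in play serves as the one majorant shared by every
    component.\<close>
  define h where "h t = (sobolev_vec_norm (s + 1) (v t))\<^sup>2 + (sobolev_vec_norm (s - 1) (dv t))\<^sup>2
    + (sobolev_norm (s + 1) (\<omega> t))\<^sup>2 + (sobolev_norm (s - 1) (d\<omega> t))\<^sup>2
    + (sobolev_norm (s + 1) (b t))\<^sup>2 + (sobolev_norm (s - 1) (db t))\<^sup>2" for t
  have hi: "integrable (lebesgue_on {0<..<T}) h"
    unfolding h_def using v dv \<omega> d\<omega> b db
    by (intro Bochner_Integration.integrable_add) (auto simp: W12_time_def L2_time_def)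
  have hb: "(sobolev_vec_norm (s + 1) (v t))\<^sup>2 \<le> h t" "(sobolev_vec_norm (s - 1) (dv t))\<^sup>2 \<le> h t"
    "(sobolev_norm (s + 1) (\<omega> t))\<^sup>2 \<le> h t" "(sobolev_norm (s - 1) (d\<omega> t))\<^sup>2 \<le> h t"
    "(sobolev_norm (s + 1) (b t))\<^sup>2 \<le> h t" "(sobolev_norm (s - 1) (db t))\<^sup>2 \<le> h t" "0 \<le> h t" for t
    by (simp_all add: h_def)
  have z: "\<omega> 0 \<in> sobolev s" "b 0 \<in> sobolev s" using \<omega> b T by (auto simp: C_time_def)
  have "kolmogorov \<alpha> T s v dv \<omega> d\<omega> b db h (min (INF x\<in>torus. \<omega> 0 x) (INF x\<in>torus. b 0 x))"
  proof (rule kolmogorov.intro)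
    show "\<alpha> > 0" by (rule \<alpha>)
    show "sobolev_path T s (\<lambda>t x. v t x $ i) (\<lambda>t x. dv t x $ i) h" for i
      by (rule sobolev_path_component[OF T dim s IntD1[OF v] IntD2[OF v] dv hi hb(1,2)])
    show "sobolev_path T s \<omega> d\<omega> h" by (rule sobolev_path_scalar[OF T dim s IntD1[OF \<omega>] IntD2[OF \<omega>] d\<omega> hi hb(3,4)])
    show "sobolev_path T s b db h" by (rule sobolev_path_scalar[OF T dim s IntD1[OF b] IntD2[OF b] db hi hb(5,6)])
    show "0 \<le> h t" for t by (rule hb(7))
    show "kolmogorov_weak_solution \<alpha> T v dv \<omega> d\<omega> b db" by (rule sol)
    show "0 < min (INF x\<in>torus. \<omega> 0 x) (INF x\<in>torus. b 0 x)" using pos by simp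
    show "min (INF x\<in>torus. \<omega> 0 x) (INF x\<in>torus. b 0 x) \<le> \<omega> 0 x" for x using sobolev_INF_le[OF s z(1), of x] by linarith
    show "min (INF x\<in>torus. \<omega> 0 x) (INF x\<in>torus. b 0 x) \<le> b 0 x" for x using sobolev_INF_le[OF s z(2), of x] by linarith
  qed
  then show ?thesis by (rule that)
qed

text \<open>Limits are taken componentwise. The divergence constraint is a family of L^2 pairings,
  each continuous along the path, so it survives the limit.\<close>

lemma sobolev_div_end_limit:
  fixes v :: "real \<Rightarrow> real^'n \<Rightarrow> real^'n"
  assumes v: "v \<in> C_time {0..<T} (sobolev_div s) (sobolev_vec_norm s)"
    and P: "\<And>i. sobolev_path T s (\<lambda>t x. v t x $ i) (\<lambda>t x. dv t x $ i) h"
  obtains V where "V \<in> sobolev_div s" "((\<lambda>t. sobolev_vec_norm s (\<lambda>x. v t x - V x)) \<longlongrightarrow> 0) (at T within {0..<T})"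
proof -
  have T: "T > 0" by (rule sobolev_path.T[OF P])
  have s0: "0 \<le> s" using sobolev_path.s1[OF P] by simp
  \<comment> \<open>T is a limit point of the interval, so limits there are unique.\<close>
  have "{0..<T} - {T} = {0..<T}" by auto
  then have not_bot: "at T within {0..<T} \<noteq> bot" using T by (simp add: at_within_eq_bot_iff closure_atLeastLessThan)
  have vd: "v t \<in> sobolev_div s" if "t \<in> {0..<T}" for t using v that by (simp add: C_time_def)
  have "\<forall>i. \<exists>U. U \<in> sobolev s \<and> ((\<lambda>t. sobolev_norm s (\<lambda>x. v t x $ i - U x)) \<longlongrightarrow> 0) (at T within {0..<T})"
  proof
    fix i
    obtain U where "U \<in> sobolev s" "((\<lambda>t. sobolev_norm s (\<lambda>x. v t x $ i - U x)) \<longlongrightarrow> 0) (at T within {0..<T})"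
      by (rule sobolev_path.end_limit[OF P])
    then show "\<exists>U. U \<in> sobolev s \<and> ((\<lambda>t. sobolev_norm s (\<lambda>x. v t x $ i - U x)) \<longlongrightarrow> 0) (at T within {0..<T})" by blast
  qed
  from choice[OF this] obtain U where U: "\<And>i. U i \<in> sobolev s"
    "\<And>i. ((\<lambda>t. sobolev_norm s (\<lambda>x. v t x $ i - U i x)) \<longlongrightarrow> 0) (at T within {0..<T})" by blast
  define V where "V x = (\<chi> i. U i x)" for x
  have "((\<lambda>t. sqrt (\<Sum>i\<in>UNIV. (sobolev_norm s (\<lambda>x. v t x $ i - U i x))\<^sup>2)) \<longlongrightarrow> sqrt (\<Sum>i\<in>(UNIV::'n set). 0\<^sup>2)) (at T within {0..<T})"
    by (intro tendsto_intros U(2))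
  then have lim: "((\<lambda>t. sobolev_vec_norm s (\<lambda>x. v t x - V x)) \<longlongrightarrow> 0) (at T within {0..<T})"
    by (simp add: sobolev_vec_norm_def V_def)
  have "l2_inner V (\<lambda>x. \<chi> i. classical_partial i \<phi> x) = 0" if \<phi>: "test_function \<phi>" for \<phi>
  proof -
    have g: "classical_partial i \<phi> \<in> L2_torus" for i by (rule C1_partial_L2[OF test_function_C1[OF \<phi>]])
    have "((\<lambda>t. l2_inner (\<lambda>x. v t x $ i) (classical_partial i \<phi>)) \<longlongrightarrow> l2_inner (U i) (classical_partial i \<phi>)) (at T within {0..<T})" for i
    proof (rule LIM_zero_cancel, rule Lim_null_comparison)
      let ?g = "classical_partial i \<phi>"
      let ?C = "sqrt (l2_inner ?g ?g) + 1"
      show "((\<lambda>t. ?C * sobolev_norm s (\<lambda>x. v t x $ i - U i x)) \<longlongrightarrow> 0) (at T within {0..<T})"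
        by (rule tendsto_mult_right_zero[OF U(2)])
      show "\<forall>\<^sub>F t in at T within {0..<T}. norm (l2_inner (\<lambda>x. v t x $ i) ?g - l2_inner (U i) ?g) \<le> ?C * sobolev_norm s (\<lambda>x. v t x $ i - U i x)"
        unfolding eventually_at_filter
      proof (rule always_eventually, intro allI impI)
        fix t assume t: "t \<in> {0..<T}"
        note vi = sobolev_div_component[OF vd[OF t], of i]
        show "norm (l2_inner (\<lambda>x. v t x $ i) ?g - l2_inner (U i) ?g) \<le> ?C * sobolev_norm s (\<lambda>x. v t x $ i - U i x)"
          using abs_l2_inner_le[OF s0 sobolev_diff[OF vi U(1)[of i]] g[of i]] l2_inner_diff[OF sobolevD(1)[OF vi] sobolevD(1)[OF U(1)[of i]] g[of i]] by simp
      qed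
    qed
    then have "((\<lambda>t. \<Sum>i\<in>UNIV. l2_inner (\<lambda>x. v t x $ i) (classical_partial i \<phi>)) \<longlongrightarrow> (\<Sum>i\<in>UNIV. l2_inner (U i) (classical_partial i \<phi>))) (at T within {0..<T})"
      by (intro tendsto_sum)
    moreover have "((\<lambda>t. \<Sum>i\<in>UNIV. l2_inner (\<lambda>x. v t x $ i) (classical_partial i \<phi>)) \<longlongrightarrow> 0) (at T within {0..<T})"
    proof (rule tendsto_eventually)
      show "\<forall>\<^sub>F t in at T within {0..<T}. (\<Sum>i\<in>UNIV. l2_inner (\<lambda>x. v t x $ i) (classical_partial i \<phi>)) = 0"
        unfolding eventually_at_filter
      proof (rule always_eventually, intro allI impI)
        fix t assume t: "t \<in> {0..<T}"
        have "l2_inner (v t) (\<lambda>x. \<chi> i. classical_partial i \<phi> x) = 0" using vd[OF t] \<phi> by (simp add: sobolev_div_def div_free_def)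
        then show "(\<Sum>i\<in>UNIV. l2_inner (\<lambda>x. v t x $ i) (classical_partial i \<phi>)) = 0"
          using l2_inner_vec[of "v t" "\<lambda>x. \<chi> i. classical_partial i \<phi> x"] sobolevD(1)[OF sobolev_div_component[OF vd[OF t]]] g by simp
      qed
    qed
    ultimately have "(\<Sum>i\<in>UNIV. l2_inner (U i) (classical_partial i \<phi>)) = 0"
      using not_bot by (intro tendsto_unique[of "at T within {0..<T}"])
    then show ?thesis using l2_inner_vec[of V "\<lambda>x. \<chi> i. classical_partial i \<phi> x"] sobolevD(1)[OF U(1)] g by (simp add: V_def)
  qed
  then have "V \<in> sobolev_div s" using U(1) by (simp add: sobolev_div_def sobolev_vec_def div_free_def V_def)
  from that[OF this lim] show ?thesis .
qed

lemma continuous_extension_cong: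
  "continuous_extension T X N u U \<Longrightarrow> (\<And>t. t \<in> {0..<T} \<Longrightarrow> u t = u' t) \<Longrightarrow> continuous_extension T X N u' U"
  by (auto simp: continuous_extension_def)

theorem theorem2:
  fixes \<alpha> s T :: real
    and v0 :: "real^'n \<Rightarrow> real^'n" and \<omega>0 b0 :: "real^'n \<Rightarrow> real"
    and v1 v2 dv1 dv2 :: "real \<Rightarrow> real^'n \<Rightarrow> real^'n"
    and \<omega>1 \<omega>2 d\<omega>1 d\<omega>2 b1 b2 db1 db2 :: "real \<Rightarrow> real^'n \<Rightarrow> real"
  assumes "CARD('n) \<ge> 2" and "\<alpha> > 0" and "s > real CARD('n) / 2"
    and "v0 \<in> sobolev_div s" and "\<omega>0 \<in> sobolev s" and "b0 \<in> sobolev s"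
    and "(INF x\<in>torus. b0 x) > 0" and "(INF x\<in>torus. \<omega>0 x) > 0"
    and "T > 0"
    and "v1 \<in> C_time {0..<T} (sobolev_div s) (sobolev_vec_norm s)
             \<inter> L2_time T (sobolev_div (s + 1)) (sobolev_vec_norm (s + 1))"
    and "W12_time T (sobolev_div (s - 1)) (sobolev_vec_norm (s - 1)) v1 dv1"
    and "\<omega>1 \<in> C_time {0..<T} (sobolev s) (sobolev_norm s)
             \<inter> L2_time T (sobolev (s + 1)) (sobolev_norm (s + 1))"
    and "W12_time T (sobolev (s - 1)) (sobolev_norm (s - 1)) \<omega>1 d\<omega>1"
    and "b1 \<in> C_time {0..<T} (sobolev s) (sobolev_norm s)
             \<inter> L2_time T (sobolev (s + 1)) (sobolev_norm (s + 1))"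
    and "W12_time T (sobolev (s - 1)) (sobolev_norm (s - 1)) b1 db1"
    and "v2 \<in> C_time {0..<T} (sobolev_div s) (sobolev_vec_norm s)
             \<inter> L2_time T (sobolev_div (s + 1)) (sobolev_vec_norm (s + 1))"
    and "W12_time T (sobolev_div (s - 1)) (sobolev_vec_norm (s - 1)) v2 dv2"
    and "\<omega>2 \<in> C_time {0..<T} (sobolev s) (sobolev_norm s)
             \<inter> L2_time T (sobolev (s + 1)) (sobolev_norm (s + 1))"
    and "W12_time T (sobolev (s - 1)) (sobolev_norm (s - 1)) \<omega>2 d\<omega>2"
    and "b2 \<in> C_time {0..<T} (sobolev s) (sobolev_norm s)
             \<inter> L2_time T (sobolev (s + 1)) (sobolev_norm (s + 1))"
    and "W12_time T (sobolev (s - 1)) (sobolev_norm (s - 1)) b2 db2"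
    and "kolmogorov_weak_solution \<alpha> T v1 dv1 \<omega>1 d\<omega>1 b1 db1"
    and "kolmogorov_weak_solution \<alpha> T v2 dv2 \<omega>2 d\<omega>2 b2 db2"
    and "\<forall>x\<in>torus. v1 0 x = v0 x \<and> \<omega>1 0 x = \<omega>0 x \<and> b1 0 x = b0 x"
    and "\<forall>x\<in>torus. v2 0 x = v0 x \<and> \<omega>2 0 x = \<omega>0 x \<and> b2 0 x = b0 x"
  shows "\<exists>V1 \<Omega>1 B1 V2 \<Omega>2 B2.
      continuous_extension T (sobolev_div s) (sobolev_vec_norm s) v1 V1 \<and>
      continuous_extension T (sobolev s) (sobolev_norm s) \<omega>1 \<Omega>1 \<and>
      continuous_extension T (sobolev s) (sobolev_norm s) b1 B1 \<and>
      continuous_extension T (sobolev_div s) (sobolev_vec_norm s) v2 V2 \<and>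
      continuous_extension T (sobolev s) (sobolev_norm s) \<omega>2 \<Omega>2 \<and>
      continuous_extension T (sobolev s) (sobolev_norm s) b2 B2 \<and>
      (\<forall>t\<in>{0..T}. \<forall>x\<in>torus. V1 t x = V2 t x \<and> \<Omega>1 t x = \<Omega>2 t x \<and> B1 t x = B2 t x)"
proof -
  note [simp] = assms(24,25)
  have z: "(INF x\<in>torus. \<omega>1 0 x) > 0" "(INF x\<in>torus. b1 0 x) > 0" "(INF x\<in>torus. \<omega>2 0 x) > 0" "(INF x\<in>torus. b2 0 x) > 0"
    using assms(7,8) assms(24,25) by (simp_all cong: INF_cong)
  obtain h1 m1 where K1: "kolmogorov \<alpha> T s v1 dv1 \<omega>1 d\<omega>1 b1 db1 h1 m1"
    by (rule kolmogorovI[OF assms(1-3,9) assms(10-15,22) z(1,2)])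
  obtain h2 m2 where K2: "kolmogorov \<alpha> T s v2 dv2 \<omega>2 d\<omega>2 b2 db2 h2 m2"
    by (rule kolmogorovI[OF assms(1-3,9) assms(16-21,23) z(3,4)])
  have zero: "0 \<in> {0..<T}" using assms(9) by simp
  have v0: "periodic (v1 0)" "periodic (v2 0)"
  proof -
    have "v1 0 \<in> sobolev_div s" "v2 0 \<in> sobolev_div s" using assms(10,16) zero by (auto simp: C_time_def)
    then have "periodic (\<lambda>x. v1 0 x $ i)" "periodic (\<lambda>x. v2 0 x $ i)" for i
      by (auto intro: sobolev_periodic sobolev_div_component)
    then show "periodic (v1 0)" "periodic (v2 0)" by (simp_all add: periodic_def vec_eq_iff)
  qed
  have s0: "periodic (\<omega>1 0)" "periodic (b1 0)" "periodic (\<omega>2 0)" "periodic (b2 0)"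
    using assms(12,14,18,20) zero by (auto simp: C_time_def intro: sobolev_periodic)
  \<comment> \<open>The initial data are prescribed on the cell only; periodicity extends the
    agreement to all points.\<close>
  have init: "v1 0 = v2 0" "\<omega>1 0 = \<omega>2 0" "b1 0 = b2 0"
    by (rule periodic_eqI[OF v0], simp, rule periodic_eqI[OF s0(1,3)], simp, rule periodic_eqI[OF s0(2,4)], simp)
  have eq: "v1 t = v2 t" "\<omega>1 t = \<omega>2 t" "b1 t = b2 t" if "t \<in> {0..<T}" for t
    using kolmogorov_unique[OF K1 K2 init, of t] that by simp_all
  interpret K1: kolmogorov \<alpha> T s v1 dv1 \<omega>1 d\<omega>1 b1 db1 h1 m1 by (rule K1)
  obtain V where V: "V \<in> sobolev_div s" "((\<lambda>t. sobolev_vec_norm s (\<lambda>x. v1 t x - V x)) \<longlongrightarrow> 0) (at T within {0..<T})"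
    by (rule sobolev_div_end_limit[OF IntD1[OF assms(10)] K1.Pv])
  obtain W where W: "W \<in> sobolev s" "((\<lambda>t. sobolev_norm s (\<lambda>x. \<omega>1 t x - W x)) \<longlongrightarrow> 0) (at T within {0..<T})"
    by (rule K1.om.end_limit)
  obtain B where B: "B \<in> sobolev s" "((\<lambda>t. sobolev_norm s (\<lambda>x. b1 t x - B x)) \<longlongrightarrow> 0) (at T within {0..<T})"
    by (rule K1.en.end_limit)
  have e: "continuous_extension T (sobolev_div s) (sobolev_vec_norm s) v1 (\<lambda>t. if t < T then v1 t else V)"
    "continuous_extension T (sobolev s) (sobolev_norm s) \<omega>1 (\<lambda>t. if t < T then \<omega>1 t else W)"
    "continuous_extension T (sobolev s) (sobolev_norm s) b1 (\<lambda>t. if t < T then b1 t else B)"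
    using continuous_extensionI[OF assms(9) IntD1[OF assms(10)] V] continuous_extensionI[OF assms(9) IntD1[OF assms(12)] W]
      continuous_extensionI[OF assms(9) IntD1[OF assms(14)] B] by blast+
  \<comment> \<open>The solutions agree on [0, T), so the extensions built for the first one also
    extend the second, and the required equality holds by reflexivity, including at time T.\<close>
  show ?thesis
    using e continuous_extension_cong[OF e(1) eq(1)] continuous_extension_cong[OF e(2) eq(2)] continuous_extension_cong[OF e(3) eq(3)]
    by blast
qed

end
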